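(* Suppose that $V$ satisfies Hypotheses A and B and that $W=g^2\omega^{-1}v^2$ satisfies Hypothesis C (all stated in the context). Then, with $V,\omega,v$ fixed, as $g\to0$, $$\min_{(u,f)\in\mathcal{U}\times\mathcal{Z}_\omega}\mathcal{E}(u,f)=\mu_V-g^2\int_{\mathbb{R}^3}\big(\bar{\mathcal{F}}(\omega^{-1}v^2)*|u_V|^2\big)(x)\,|u_V(x)|^2\,dx+\mathcal{O}(g^4).$$
   Context: Weak Lebesgue space: $L^{3,\infty}=L^{3,\infty}(\mathbb{R}^3)$ is the set of measurable $f$ with $\|f\|_{L^{3,\infty}}=\sup_{t>0}t\,\lambda(\{|f|>t\})^{1/3}<\infty$, $\lambda$ being Lebesgue measure. Fourier transform: $\mathcal{F}(f)(x)=\int e^{-ix\cdot\xi}f(\xi)d\xi$, $\bar{\mathcal{F}}(f)(x)=\int e^{ix\cdot\xi}f(\xi)d\xi$ (extended to tempered distributions). Convention: $\bar{\mathcal{F}}(G)*\rho:=\bar{\mathcal{F}}(G\,\mathcal{F}(\rho))$. Particle. $V:\mathbb{R}^3\to\mathbb{R}$ is a measurable potential, $V_+=\max(V,0)$, $V_-=\max(-V,0)$. $H_V=-\Delta+V$ on $L^2(\mathbb{R}^3)$ is defined through its quadratic form, and $\mu_V=\inf\sigma(H_V)$ (similarly $H_U,\mu_U$ for other potentials $U$). Hypothesis A on $V$: there are $0\le a<1$ and $b\in\mathbb{R}$ with $V_-\le -a\Delta+b$ as quadratic forms on $H^1(\mathbb{R}^3)$, and $V=V_1+V_2$ with (i)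 $V_1\in L^1_{\mathrm{loc}}(\mathbb{R}^3;\mathbb{R}^+)$; (ii) $V_2\in L^{3/2}_{\mathrm{loc}}(\mathbb{R}^3;\mathbb{R})$ and $\lim_{|x|\to\infty}V_2(x)=0$; (iii) $\mu_V<\mu_{V_1}$. Under Hypothesis A, $H_V$ is a semibounded self-adjoint operator with form domain $\mathcal{Q}_V=\{u\in H^1(\mathbb{R}^3): \int V_+|u|^2<\infty\}$. Set $\mathcal{U}=\{u\in\mathcal{Q}_V:\|u\|_{L^2}=1\}$. Hypothesis B: $\mu_V$ is a simple isolated eigenvalue of $H_V$ associated to a unique positive ground state $u_V\in L^2(\mathbb{R}^3;\mathbb{R}_+)$ with $\|u_V\|_{L^2}=1$. Field. $\omega:\mathbb{R}^3\to[0,\infty)$ is measurable with $\omega>0$ almost everywhere, $v:\mathbb{R}^3\to\mathbb{R}$ is measurable, $g\in\mathbb{R}$ is the coupling constant, and $W=g^2\omega^{-1}v^2$. $\mathcal{Z}_\omega=\{f:\mathbb{R}^3\to\mathbb{C}\text{ measurable}:\omega^{1/2}f\in L^2(\mathbb{R}^3)\}$. Hypothesis C on $W$: $W=W_1+W_2$ with $W_1\in L^1(\mathbb{R}^3)$ and $W_2\in L^{3,\infty}(\mathbb{R}^3)$ (here, $\omega^{-1}v^2\in L^1+L^{3,\infty}$). Energy. For $(u,f)\in\mathcal{U}\times\mathcal{Z}_\omega$, $$\mathcal{E}(u,f)=\int|\nabla u|^2dx+\int V|u|^2dx+\int\omega|f|^2dk+2g\,\mathrm{Re}\int_{\mathbb{R}^6}e^{ik\cdot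 x}v(k)f(k)|u(x)|^2dx\,dk,$$ where the last integral is understood as $\int v(k)f(k)\big(\int e^{ik\cdot x}|u(x)|^2dx\big)dk$. *)

theory Defs
  imports "HOL-Analysis.Analysis" "HOL-Library.Landau_Symbols"
begin

text \<open>
  Elements of function spaces are represented by functions rather than by almost-everywhere
  classes. All notions below are invariant under modification on null sets, and equality of
  classes is written with \<open>AE\<close>. Measurability is Lebesgue measurability.
\<close>

type_synonym R3 = "real ^ 3"

section \<open>Function spaces\<close>

definition L2 :: "(R3 \<Rightarrow> 'b::real_normed_vector) set" where
  "L2 = {f. f \<in> borel_measurable lebesgue \<and> integrable lebesgue (\<lambda>x. (norm (f x))\<^sup>2)}"

definition L2_norm :: "(R3 \<Rightarrow> 'b::real_normed_vector) \<Rightarrow> real" where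
  "L2_norm f = sqrt (\<integral>x. (norm (f x))\<^sup>2 \<partial>lebesgue)"

definition L2_inner :: "(R3 \<Rightarrow> complex) \<Rightarrow> (R3 \<Rightarrow> complex) \<Rightarrow> complex" where
  "L2_inner f h = (\<integral>x. cnj (f x) * h x \<partial>lebesgue)"

definition Lp_loc :: "real \<Rightarrow> (R3 \<Rightarrow> real) set" where
  "Lp_loc p = {f. f \<in> borel_measurable lebesgue \<and>
     (\<forall>K. compact K \<longrightarrow> set_integrable lebesgue K (\<lambda>x. \<bar>f x\<bar> powr p))}"

definition weak_L3 :: "(R3 \<Rightarrow> real) set" where
  "weak_L3 = {f. f \<in> borel_measurable lebesgue \<and>
     (\<forall>t>0. emeasure lebesgue {x. t < \<bar>f x\<bar>} < \<infinity>) \<and>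
     bdd_above ((\<lambda>t. t * measure lebesgue {x. t < \<bar>f x\<bar>} powr (1/3)) ` {0<..})}"

definition partial_deriv :: "3 \<Rightarrow> (R3 \<Rightarrow> real) \<Rightarrow> R3 \<Rightarrow> real" where
  "partial_deriv i f x = frechet_derivative f (at x) (axis i 1)"

primrec C_k :: "nat \<Rightarrow> (R3 \<Rightarrow> real) \<Rightarrow> bool" where
  "C_k 0 f \<longleftrightarrow> continuous_on UNIV f"
| "C_k (Suc k) f \<longleftrightarrow> (\<forall>x. f differentiable (at x)) \<and> (\<forall>i. C_k k (partial_deriv i f))"

definition test_functions :: "(R3 \<Rightarrow> real) set" where
  "test_functions = {\<phi>. (\<forall>k. C_k k \<phi>) \<and> compact (closure {x. \<phi> x \<noteq> 0})}"

definition is_weak_grad :: "(R3 \<Rightarrow> complex) \<Rightarrow> (R3 \<Rightarrow> complex ^ 3) \<Rightarrow> bool" where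
  "is_weak_grad u G \<longleftrightarrow> (\<forall>\<phi>\<in>test_functions. \<forall>i.
     (\<integral>x. u x * of_real (partial_deriv i \<phi> x) \<partial>lebesgue) =
     - (\<integral>x. G x $ i * of_real (\<phi> x) \<partial>lebesgue))"

definition H1 :: "(R3 \<Rightarrow> complex) set" where
  "H1 = {u \<in> L2. \<exists>G\<in>L2. is_weak_grad u G}"

text \<open>For \<open>u\<close> in \<open>H1\<close>, the square-integrable weak gradient is unique up to null sets.\<close>

definition weak_grad :: "(R3 \<Rightarrow> complex) \<Rightarrow> R3 \<Rightarrow> complex ^ 3" where
  "weak_grad u = (SOME G. G \<in> L2 \<and> is_weak_grad u G)"

definition dirichlet :: "(R3 \<Rightarrow> complex) \<Rightarrow> real" where
  "dirichlet u = (\<integral>x. (norm (weak_grad u x))\<^sup>2 \<partial>lebesgue)"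

section \<open>The Schroedinger operator\<close>

definition form_domain :: "(R3 \<Rightarrow> real) \<Rightarrow> (R3 \<Rightarrow> complex) set" where
  "form_domain V = {u \<in> H1. integrable lebesgue (\<lambda>x. max (V x) 0 * (cmod (u x))\<^sup>2)}"

definition form :: "(R3 \<Rightarrow> real) \<Rightarrow> (R3 \<Rightarrow> complex) \<Rightarrow> (R3 \<Rightarrow> complex) \<Rightarrow> complex" where
  "form V \<phi> u =
     (\<integral>x. (\<Sum>i\<in>UNIV. cnj (weak_grad \<phi> x $ i) * weak_grad u x $ i) \<partial>lebesgue) +
     (\<integral>x. of_real (V x) * cnj (\<phi> x) * u x \<partial>lebesgue)"

text \<open>
  Graph of the operator associated with the closed form \<open>form V\<close> by the representation theorem:
  \<open>(u, w)\<close> is in the graph iff \<open>u\<close> is in the operator domain and \<open>w\<close> represents \<open>H_V u\<close>.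
\<close>

definition H_op :: "(R3 \<Rightarrow> real) \<Rightarrow> ((R3 \<Rightarrow> complex) \<times> (R3 \<Rightarrow> complex)) set" where
  "H_op V = {(u, w). u \<in> form_domain V \<and> w \<in> L2 \<and>
     (\<forall>\<phi>\<in>form_domain V. form V \<phi> u = L2_inner \<phi> w)}"

definition resolvent_set :: "((R3 \<Rightarrow> complex) \<times> (R3 \<Rightarrow> complex)) set \<Rightarrow> complex set" where
  "resolvent_set T = {z.
     (\<forall>(u, w)\<in>T. (AE x in lebesgue. w x = z * u x) \<longrightarrow> (AE x in lebesgue. u x = 0)) \<and>
     (\<exists>C. \<forall>h\<in>L2. \<exists>(u, w)\<in>T.
        (AE x in lebesgue. w x - z * u x = h x) \<and> L2_norm u \<le> C * L2_norm h)}"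

definition spectrum :: "((R3 \<Rightarrow> complex) \<times> (R3 \<Rightarrow> complex)) set \<Rightarrow> complex set" where
  "spectrum T = - resolvent_set T"

text \<open>The spectrum of the self-adjoint operator \<open>H_V\<close> is real, so \<open>Re\<close> is only a coercion.\<close>

definition mu :: "(R3 \<Rightarrow> real) \<Rightarrow> real" where
  "mu V = Inf (Re ` spectrum (H_op V))"

definition eigenfunction ::
    "((R3 \<Rightarrow> complex) \<times> (R3 \<Rightarrow> complex)) set \<Rightarrow> complex \<Rightarrow> (R3 \<Rightarrow> complex) \<Rightarrow> bool" where
  "eigenfunction T z u \<longleftrightarrow> (u, \<lambda>x. z * u x) \<in> T \<and> \<not> (AE x in lebesgue. u x = 0)"

definition simple_eigenvalue ::
    "((R3 \<Rightarrow> complex) \<times> (R3 \<Rightarrow> complex)) set \<Rightarrow> complex \<Rightarrow> bool" where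
  "simple_eigenvalue T z \<longleftrightarrow> (\<exists>u. eigenfunction T z u) \<and>
     (\<forall>u u'. eigenfunction T z u \<longrightarrow> eigenfunction T z u' \<longrightarrow>
        (\<exists>c. AE x in lebesgue. u' x = c * u x))"

definition positive_ground_state :: "(R3 \<Rightarrow> real) \<Rightarrow> (R3 \<Rightarrow> real) \<Rightarrow> bool" where
  "positive_ground_state V u \<longleftrightarrow>
     eigenfunction (H_op V) (of_real (mu V)) (\<lambda>x. of_real (u x)) \<and>
     (AE x in lebesgue. 0 \<le> u x) \<and> L2_norm u = 1"

definition hypothesis_A :: "(R3 \<Rightarrow> real) \<Rightarrow> bool" where
  "hypothesis_A V \<longleftrightarrow>
     (\<exists>a b. 0 \<le> a \<and> a < 1 \<and> (\<forall>u\<in>H1.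
        integrable lebesgue (\<lambda>x. max (- V x) 0 * (cmod (u x))\<^sup>2) \<and>
        (\<integral>x. max (- V x) 0 * (cmod (u x))\<^sup>2 \<partial>lebesgue) \<le> a * dirichlet u + b * (L2_norm u)\<^sup>2)) \<and>
     (\<exists>V\<^sub>1 V\<^sub>2. (AE x in lebesgue. V x = V\<^sub>1 x + V\<^sub>2 x) \<and>
        V\<^sub>1 \<in> Lp_loc 1 \<and> (AE x in lebesgue. 0 \<le> V\<^sub>1 x) \<and>
        V\<^sub>2 \<in> Lp_loc (3/2) \<and> (V\<^sub>2 \<longlongrightarrow> 0) at_infinity \<and>
        mu V < mu V\<^sub>1)"

definition hypothesis_B :: "(R3 \<Rightarrow> real) \<Rightarrow> (R3 \<Rightarrow> real) \<Rightarrow> bool" where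
  "hypothesis_B V u\<^sub>V \<longleftrightarrow>
     simple_eigenvalue (H_op V) (of_real (mu V)) \<and>
     complex_of_real (mu V) isolated_in spectrum (H_op V) \<and>
     positive_ground_state V u\<^sub>V \<and>
     (\<forall>u. positive_ground_state V u \<longrightarrow> (AE x in lebesgue. u x = u\<^sub>V x))"

definition hypothesis_C :: "(R3 \<Rightarrow> real) \<Rightarrow> bool" where
  "hypothesis_C W \<longleftrightarrow> (\<exists>W\<^sub>1 W\<^sub>2. (AE k in lebesgue. W k = W\<^sub>1 k + W\<^sub>2 k) \<and>
     integrable lebesgue W\<^sub>1 \<and> W\<^sub>2 \<in> weak_L3)"

section \<open>Fourier transform and energy\<close>

definition fourier :: "(R3 \<Rightarrow> complex) \<Rightarrow> R3 \<Rightarrow> complex" where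
  "fourier f x = (\<integral>\<xi>. exp (- \<i> * of_real (x \<bullet> \<xi>)) * f \<xi> \<partial>lebesgue)"

definition fourier_bar :: "(R3 \<Rightarrow> complex) \<Rightarrow> R3 \<Rightarrow> complex" where
  "fourier_bar f x = (\<integral>\<xi>. exp (\<i> * of_real (x \<bullet> \<xi>)) * f \<xi> \<partial>lebesgue)"

text \<open>
  The convolution of \<open>fourier_bar G\<close> with \<open>\<rho>\<close>, by the convention that defines it as
  \<open>fourier_bar (G * fourier \<rho>)\<close>. For \<open>\<rho> = |u|^2\<close> with \<open>u\<close> in \<open>H1\<close>, the function \<open>fourier \<rho>\<close> is
  bounded and lies in the Lorentz space with exponents 3/2 and 1. Hence \<open>G * fourier \<rho>\<close> is
  integrable for every \<open>G\<close> satisfying \<open>hypothesis_C\<close>, and the transform on tempered distributions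
  agrees with the absolutely convergent integral.
\<close>

definition fourier_bar_conv :: "(R3 \<Rightarrow> real) \<Rightarrow> (R3 \<Rightarrow> real) \<Rightarrow> R3 \<Rightarrow> complex" where
  "fourier_bar_conv G \<rho> =
     fourier_bar (\<lambda>\<xi>. of_real (G \<xi>) * fourier (\<lambda>x. of_real (\<rho> x)) \<xi>)"

definition unit_sphere :: "(R3 \<Rightarrow> real) \<Rightarrow> (R3 \<Rightarrow> complex) set" where
  "unit_sphere V = {u \<in> form_domain V. L2_norm u = 1}"

definition Z_space :: "(R3 \<Rightarrow> real) \<Rightarrow> (R3 \<Rightarrow> complex) set" where
  "Z_space \<omega> = {f. f \<in> borel_measurable lebesgue \<and> (\<lambda>k. of_real (sqrt (\<omega> k)) * f k) \<in> L2}"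

definition energy :: "(R3 \<Rightarrow> real) \<Rightarrow> (R3 \<Rightarrow> real) \<Rightarrow> (R3 \<Rightarrow> real) \<Rightarrow> real
    \<Rightarrow> (R3 \<Rightarrow> complex) \<times> (R3 \<Rightarrow> complex) \<Rightarrow> real" where
  "energy V \<omega> v g = (\<lambda>(u, f).
     dirichlet u +
     (\<integral>x. V x * (cmod (u x))\<^sup>2 \<partial>lebesgue) +
     (\<integral>k. \<omega> k * (cmod (f k))\<^sup>2 \<partial>lebesgue) +
     2 * g * Re (\<integral>k. of_real (v k) * f k *
       (\<integral>x. exp (\<i> * of_real (k \<bullet> x)) * of_real ((cmod (u x))\<^sup>2) \<partial>lebesgue) \<partial>lebesgue))"

end

theory Submission
  imports Defs "HOL-Probability.Probability"
begin

text \<open>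
  For fixed \<open>u\<close> the energy is a quadratic polynomial in the field \<open>f\<close>. Completing the square leaves
  \<open>q(u) - g\<^sup>2 \<integral> w |F(|u|\<^sup>2)|\<^sup>2\<close> with \<open>q\<close> the form of \<open>H_V\<close> and \<open>w = v\<^sup>2 / \<omega>\<close>, so at \<open>u_V\<close> the energy is exactly
  \<open>\<mu>_V\<close> minus the second-order term. Since \<open>\<mu>_V\<close> is simple and isolated, \<open>q - \<mu>_V\<close> is bounded below by a
  multiple of the squared form norm on the orthogonal complement of \<open>u_V\<close>, while the quartic term, applied to
  \<open>u_V + z\<close>, is \<open>O(g\<^sup>2 |z|)\<close> away from its value at \<open>u_V\<close>; this costs at most \<open>O(g\<^sup>4)\<close>. The same coercivity and the
  parallelogram identity make minimizing sequences, rotated to have the same phase, Cauchy in the form norm.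

  The quartic term is controlled by \<open>\<integral> w |F(|u|\<^sup>2)| \<le> C (|u|\<^sup>2 + |\<nabla>u|\<^sup>2)\<close>. For \<open>w\<close> in weak \<open>L\<^sup>3\<close> one writes \<open>F(|u|\<^sup>2)\<close>
  as the autocorrelation of \<open>F u\<close> and uses that \<open>w\<^sup>2\<close> has linearly growing mass on balls.
\<close>

section \<open>Closed forms\<close>

text \<open>\<open>mu\<close> is defined through the spectrum, that is, through solvability of
  \<open>(H - z) u = h\<close>, while the expansion rests on inequalities for the form. Resolvents
  are the bridge: solvability in a half plane puts the spectrum to the right of the infimum of the
  form, a resolvent at that infimum would contradict nearly minimizing vectors, and a spectrum-free
  interval above it bounds the resolvent at its midpoint, hence the form from below off the
  eigenspace. The obstacle in the field term is that weak \<open>L^3\<close> does not pair with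
  \<open>L^(3/2)\<close>: the transform of \<open>|u|^2\<close> must be slightly better than that,
  and the autocorrelation of \<open>F u\<close> is, because \<open>(1 + |\<xi>|) F u\<close> lies in
  \<open>L^2\<close>. Writing powers of \<open>bracket\<close> as integrals over thresholds reduces
  this to estimates on balls. Every Fourier estimate is an upper bound obtained by Gaussian damping
  and a limit, and the factor \<open>(2 pi)^3\<close> appears on both sides of the last one and
  cancels.\<close>

locale sym_form =
  fixes Q :: "'h::real_inner set" and t :: "'h \<Rightarrow> 'h \<Rightarrow> real"
  assumes sub: "subspace Q"
    and add_right: "\<And>x y z. x \<in> Q \<Longrightarrow> y \<in> Q \<Longrightarrow> z \<in> Q \<Longrightarrow> t x (y + z) = t x y + t x z"
    and scale_right: "\<And>x y c. x \<in> Q \<Longrightarrow> y \<in> Q \<Longrightarrow> t x (c *\<^sub>R y) = c * t x y"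
    and sym: "\<And>x y. x \<in> Q \<Longrightarrow> y \<in> Q \<Longrightarrow> t x y = t y x"
begin

lemma Q_zero [simp]: "0 \<in> Q"
  and Q_add [simp]: "x \<in> Q \<Longrightarrow> y \<in> Q \<Longrightarrow> x + y \<in> Q"
  and Q_diff [simp]: "x \<in> Q \<Longrightarrow> y \<in> Q \<Longrightarrow> x - y \<in> Q"
  and Q_scale [simp]: "x \<in> Q \<Longrightarrow> c *\<^sub>R x \<in> Q"
  and Q_minus [simp]: "x \<in> Q \<Longrightarrow> - x \<in> Q"
  using sub by (auto simp: subspace_0 subspace_add subspace_diff subspace_scale subspace_neg)

lemma add_left: "x \<in> Q \<Longrightarrow> y \<in> Q \<Longrightarrow> z \<in> Q \<Longrightarrow> t (x + y) z = t x z + t y z"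
  by (metis Q_add add_right sym)

lemma scale_left: "x \<in> Q \<Longrightarrow> y \<in> Q \<Longrightarrow> t (c *\<^sub>R x) y = c * t x y"
  by (metis Q_scale scale_right sym)

lemma minus_right: "x \<in> Q \<Longrightarrow> y \<in> Q \<Longrightarrow> t x (- y) = - t x y"
  using scale_right[of x y "-1"] by simp

lemma minus_left: "x \<in> Q \<Longrightarrow> y \<in> Q \<Longrightarrow> t (- x) y = - t x y"
  using scale_left[of x y "-1"] by simp

lemma diff_right: "x \<in> Q \<Longrightarrow> y \<in> Q \<Longrightarrow> z \<in> Q \<Longrightarrow> t x (y - z) = t x y - t x z"
  using add_right[of x y "- z"] minus_right[of x z] by simp

lemma diff_left: "x \<in> Q \<Longrightarrow> y \<in> Q \<Longrightarrow> z \<in> Q \<Longrightarrow> t (x - y) z = t x z - t y z"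
  using add_left[of x "- y" z] minus_left[of y z] by simp

lemmas bilinear_simps = add_left add_right diff_left diff_right scale_left scale_right
  minus_left minus_right

lemma sq_add_scale:
  assumes "x \<in> Q" "y \<in> Q"
  shows "t (x + c *\<^sub>R y) (x + c *\<^sub>R y) = t x x + 2 * c * t x y + c\<^sup>2 * t y y"
  using assms sym[of y x] by (simp add: bilinear_simps algebra_simps power2_eq_square)

lemma parallelogram:
  assumes "x \<in> Q" "y \<in> Q"
  shows "t (x + y) (x + y) + t (x - y) (x - y) = 2 * t x x + 2 * t y y"
  using assms by (simp add: bilinear_simps)

end

text \<open>Near \<open>c = 0\<close> the linear term dominates, so it must vanish;
  \<open>c = - a / (b + 1)\<close> is already small enough to make the expression negative. This is
  how the Euler equation of a minimizer is read off in \<open>Riesz\<close>.\<close>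

lemma quadratic_nonneg_imp_zero:
  fixes a b :: real
  assumes "\<And>c. 0 \<le> 2 * c * a + c\<^sup>2 * b" "0 \<le> b"
  shows "a = 0"
proof (rule ccontr)
  assume "a \<noteq> 0"
  define k where "k = b + 1"
  have k: "k > 0" "k > b" using assms(2) by (auto simp: k_def)
  have "0 \<le> k\<^sup>2 * (2 * (- a / k) * a + (- a / k)\<^sup>2 * b)" by (intro mult_nonneg_nonneg assms(1)) simp
  also have "\<dots> = - (a\<^sup>2 * (2 * k - b))"
    using k by (simp add: field_simps power2_eq_square)
  also have "\<dots> < 0" using \<open>a \<noteq> 0\<close> k by simp
  finally show False by simp
qed

locale pos_form = sym_form +
  assumes nonneg: "\<And>x. x \<in> Q \<Longrightarrow> 0 \<le> t x x"
begin

text \<open>The form is only semidefinite, so a vector with \<open>t y y = 0\<close> is treated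
  apart: there the quadratic is affine in the coefficient, and the coefficient chosen gives it the
  value -1.\<close>

lemma Cauchy_Schwarz:
  assumes xy: "x \<in> Q" "y \<in> Q"
  shows "(t x y)\<^sup>2 \<le> t x x * t y y"
proof (cases "t y y = 0")
  case True
  have "t x y = 0"
  proof (rule ccontr)
    assume ne: "t x y \<noteq> 0"
    have "0 \<le> t x x + 2 * (- (t x x + 1) / (2 * t x y)) * t x y
        + (- (t x x + 1) / (2 * t x y))\<^sup>2 * t y y"
      using nonneg[of "x + (- (t x x + 1) / (2 * t x y)) *\<^sub>R y"] xy
      by (simp only: sq_add_scale Q_add Q_scale)
    then show False using ne True by (simp add: field_simps)
  qed
  then show ?thesis using True by simp
next
  case False
  then have pos: "t y y > 0" using nonneg[OF xy(2)] by simp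
  have "0 \<le> t x x + 2 * (- t x y / t y y) * t x y + (- t x y / t y y)\<^sup>2 * t y y"
    using nonneg[of "x + (- t x y / t y y) *\<^sub>R y"] xy by (simp only: sq_add_scale Q_add Q_scale)
  also have "\<dots> = t x x - (t x y)\<^sup>2 / t y y"
    using pos by (simp add: field_simps power2_eq_square)
  finally show ?thesis using pos by (simp add: field_simps)
qed

lemma abs_le_sqrt:
  assumes "x \<in> Q" "y \<in> Q"
  shows "\<bar>t x y\<bar> \<le> sqrt (t x x) * sqrt (t y y)"
proof -
  have "sqrt ((t x y)\<^sup>2) \<le> sqrt (t x x * t y y)"
    using Cauchy_Schwarz[OF assms] by (rule real_sqrt_le_mono)
  then show ?thesis by (simp add: real_sqrt_mult)
qed

lemma tendsto_right:
  assumes "\<And>n. X n \<in> Q" "x \<in> Q" "y \<in> Q" "(\<lambda>n. t (X n - x) (X n - x)) \<longlonglongrightarrow> 0"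
  shows "(\<lambda>n. t y (X n)) \<longlonglongrightarrow> t y x"
proof -
  have "(\<lambda>n. sqrt (t y y) * sqrt (t (X n - x) (X n - x))) \<longlonglongrightarrow> sqrt (t y y) * sqrt 0"
    by (intro tendsto_intros assms)
  then have "(\<lambda>n. sqrt (t y y) * sqrt (t (X n - x) (X n - x))) \<longlonglongrightarrow> 0" by simp
  then have "(\<lambda>n. t y (X n) - t y x) \<longlonglongrightarrow> 0"
  proof (rule Lim_null_comparison[rotated], intro always_eventually allI)
    fix n show "norm (t y (X n) - t y x) \<le> sqrt (t y y) * sqrt (t (X n - x) (X n - x))"
      using abs_le_sqrt[of y "X n - x"] assms by (simp add: diff_right)
  qed
  then show ?thesis by (simp add: LIM_zero_iff)
qed

end

locale complete_form = pos_form +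
  assumes complete: "\<And>X. (\<And>n::nat. X n \<in> Q) \<Longrightarrow>
    (\<And>e. e > 0 \<Longrightarrow> \<exists>N. \<forall>m\<ge>N. \<forall>n\<ge>N. t (X m - X n) (X m - X n) < e) \<Longrightarrow>
    \<exists>x\<in>Q. (\<lambda>n. t (X n - x) (X n - x)) \<longlonglongrightarrow> 0"
begin

text \<open>The direct method applied to \<open>t x x - 2 * l x\<close>: the bound on
  \<open>l\<close> keeps it bounded below, the parallelogram identity makes a minimizing sequence
  Cauchy, and the first variation at the limit is the claim.\<close>

lemma Riesz:
  assumes ladd: "\<And>x y. x \<in> Q \<Longrightarrow> y \<in> Q \<Longrightarrow> l (x + y) = l x + l y"
    and lscale: "\<And>c x. x \<in> Q \<Longrightarrow> l (c *\<^sub>R x) = c * l x"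
    and bound: "\<And>x. x \<in> Q \<Longrightarrow> (l x)\<^sup>2 \<le> C * t x x"
  shows "\<exists>u\<in>Q. \<forall>x\<in>Q. t x u = l x"
proof -
  define F where "F x = t x x - 2 * l x" for x
  have Fbound: "- \<bar>C\<bar> \<le> F x" if "x \<in> Q" for x
  proof -
    have n: "0 \<le> t x x" using nonneg that .
    have "(l x)\<^sup>2 \<le> \<bar>C\<bar> * t x x"
      using bound[OF that] n by (meson abs_ge_self mult_right_mono order_trans)
    then have "(2 * l x)\<^sup>2 \<le> 4 * (\<bar>C\<bar> * t x x)" by (simp add: power_mult_distrib)
    also have "\<dots> \<le> (\<bar>C\<bar> + t x x)\<^sup>2"
      using zero_le_power2[of "\<bar>C\<bar> - t x x"] by (simp add: power2_eq_square algebra_simps)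
    finally have "2 * l x \<le> \<bar>C\<bar> + t x x"
      using n by (intro power2_le_imp_le[of "2 * l x"]) auto
    then show ?thesis by (simp add: F_def)
  qed
  define m where "m = Inf (F ` Q)"
  have bdd: "bdd_below (F ` Q)" using Fbound by (rule bdd_belowI2)
  have m_le: "m \<le> F x" if "x \<in> Q" for x
    unfolding m_def using bdd that by (auto intro: cINF_lower)
  have "\<exists>x\<in>Q. F x < m + inverse (real (Suc n))" for n
  proof -
    have "Inf (F ` Q) < m + inverse (real (Suc n))" by (simp add: m_def)
    then show ?thesis using cInf_lessD[of "F ` Q"] Q_zero by blast
  qed
  then obtain X where X: "\<And>n. X n \<in> Q" "\<And>n. F (X n) < m + inverse (real (Suc n))" by metis
  have inv0: "(\<lambda>n. inverse (real (Suc n))) \<longlonglongrightarrow> 0" by (rule LIMSEQ_inverse_real_of_nat)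
  have "\<exists>x\<in>Q. (\<lambda>n. t (X n - x) (X n - x)) \<longlonglongrightarrow> 0"
  proof (rule complete)
    fix e :: real assume "e > 0"
    then have "\<forall>\<^sub>F n in sequentially. inverse (real (Suc n)) < e / 4"
      using order_tendstoD(2)[OF inv0, of "e/4"] by simp
    then obtain N where N: "\<And>n. n \<ge> N \<Longrightarrow> inverse (real (Suc n)) < e / 4"
      by (auto simp: eventually_sequentially)
    have "t (X i - X j) (X i - X j) < e" if "i \<ge> N" "j \<ge> N" for i j
    proof -
      have mid: "m \<le> F ((1/2) *\<^sub>R (X i + X j))" by (intro m_le) (simp add: X)
      have "F ((1/2) *\<^sub>R (X i + X j)) = t (X i + X j) (X i + X j) / 4 - (l (X i) + l (X j))"
        by (simp add: F_def X lscale ladd scale_left scale_right) (simp add: field_simps)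
      then have "t (X i - X j) (X i - X j) = 2 * (F (X i) + F (X j)) - 4 * F ((1/2) *\<^sub>R (X i + X j))"
        using parallelogram[of "X i" "X j"] X by (simp add: F_def)
      also have "\<dots> < 2 * (inverse (real (Suc i)) + inverse (real (Suc j)))"
      proof -
        have "2 * (x + y) - 4 * f < 2 * (a + b)" if "m \<le> f" "x < m + a" "y < m + b" for x y f a b :: real
          using that by simp
        then show ?thesis using mid X(2)[of i] X(2)[of j] by blast
      qed
      also have "\<dots> < e" using N[OF that(1)] N[OF that(2)] by argo
      finally show ?thesis .
    qed
    then show "\<exists>N. \<forall>m\<ge>N. \<forall>n\<ge>N. t (X m - X n) (X m - X n) < e" by blast
  qed (rule X)
  then obtain u where u: "u \<in> Q" "(\<lambda>n. t (X n - u) (X n - u)) \<longlonglongrightarrow> 0" by blast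
  have "t x u = l x" if x: "x \<in> Q" for x
  proof -
    have "t x u - l x = 0"
    proof (rule quadratic_nonneg_imp_zero)
      fix c :: real
      \<comment> \<open>The variation is carried out at \<open>X n\<close> and only then passed to
        the limit, so that continuity is used only for the linear map \<open>t x\<close>.\<close>
      have "0 \<le> inverse (real (Suc n)) + (2 * c * (t x (X n) - l x) + c\<^sup>2 * t x x)" for n
      proof -
        have "m \<le> F (X n + c *\<^sub>R x)" using m_le x X by simp
        also have "\<dots> = F (X n) + 2 * c * (t x (X n) - l x) + c\<^sup>2 * t x x"
          using x X(1)[of n] sym[of x "X n"]
          by (simp add: F_def sq_add_scale ladd lscale algebra_simps)
        finally show ?thesis using X(2)[of n] by linarith
      qed
      moreover have "(\<lambda>n. inverse (real (Suc n)) + (2 * c * (t x (X n) - l x) + c\<^sup>2 * t x x))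
        \<longlonglongrightarrow> 0 + (2 * c * (t x u - l x) + c\<^sup>2 * t x x)"
        by (intro tendsto_intros inv0 tendsto_right X u x)
      ultimately show "0 \<le> 2 * c * (t x u - l x) + c\<^sup>2 * t x x"
        by (metis (no_types, lifting) LIMSEQ_le_const add_0)
    qed (use nonneg x in auto)
    then show ?thesis by simp
  qed
  then show ?thesis using u by blast
qed

text \<open>Two-sided estimates transport Cauchy sequences one way and limits the other way. Changes
  of the shift and the addition of a bounded term to the form are both handled by it.\<close>

lemma complete_equiv:
  assumes "sym_form Q t'" "c > 0"
    and lo: "\<And>x. x \<in> Q \<Longrightarrow> c * t x x \<le> t' x x"
    and up: "\<And>x. x \<in> Q \<Longrightarrow> t' x x \<le> M * t x x"
  shows "complete_form Q t'"
proof -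
  interpret t': sym_form Q t' by fact
  show ?thesis
  proof
    fix x assume x: "x \<in> Q"
    then show "0 \<le> t' x x"
      using lo[of x] nonneg[of x] \<open>c > 0\<close> by (meson less_imp_le mult_nonneg_nonneg order_trans)
  next
    fix X :: "nat \<Rightarrow> 'a"
    assume X: "\<And>n. X n \<in> Q"
      and C: "\<And>e. e > 0 \<Longrightarrow> \<exists>N. \<forall>m\<ge>N. \<forall>n\<ge>N. t' (X m - X n) (X m - X n) < e"
    have "\<exists>x\<in>Q. (\<lambda>n. t (X n - x) (X n - x)) \<longlonglongrightarrow> 0"
    proof (rule complete[OF X])
      fix e :: real assume "e > 0"
      then obtain N where N: "\<forall>m\<ge>N. \<forall>n\<ge>N. t' (X m - X n) (X m - X n) < c * e"
        using C[of "c * e"] \<open>c > 0\<close> by auto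
      have "t (X m - X n) (X m - X n) < e" if "m \<ge> N" "n \<ge> N" for m n
      proof -
        have "c * t (X m - X n) (X m - X n) < c * e"
          using N that lo[of "X m - X n"] X by (meson Q_diff order_le_less_trans)
        then show ?thesis using \<open>c > 0\<close> by simp
      qed
      then show "\<exists>N. \<forall>m\<ge>N. \<forall>n\<ge>N. t (X m - X n) (X m - X n) < e" by blast
    qed
    then obtain x where x: "x \<in> Q" "(\<lambda>n. t (X n - x) (X n - x)) \<longlonglongrightarrow> 0" by blast
    have "(\<lambda>n. t' (X n - x) (X n - x)) \<longlonglongrightarrow> 0"
    proof (rule tendsto_sandwich[OF _ _ tendsto_const])
      show "(\<lambda>n. M * t (X n - x) (X n - x)) \<longlonglongrightarrow> 0"
        using tendsto_mult_right_zero[OF x(2)] .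
      show "\<forall>\<^sub>F n in sequentially. 0 \<le> t' (X n - x) (X n - x)"
      proof (intro always_eventually allI)
        fix n
        have "0 \<le> c * t (X n - x) (X n - x)"
          using nonneg[of "X n - x"] X x \<open>c > 0\<close> by auto
        also have "\<dots> \<le> t' (X n - x) (X n - x)" using lo[of "X n - x"] X x by auto
        finally show "0 \<le> t' (X n - x) (X n - x)" .
      qed
      show "\<forall>\<^sub>F n in sequentially. t' (X n - x) (X n - x) \<le> M * t (X n - x) (X n - x)"
        using up X x by (intro always_eventually allI) simp
    qed
    then show "\<exists>x\<in>Q. (\<lambda>n. t' (X n - x) (X n - x)) \<longlonglongrightarrow> 0" using x by blast
  qed
qed

end

text \<open>
  A complex Hilbert space is encoded as a real one, with \<open>J\<close> the multiplication by the imaginary unit;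
  the real part of a complex form is enough to recover the form.
\<close>
locale closed_form = s: sym_form Q s for Q :: "'h::real_inner set" and s +
  fixes \<kappa> :: real and J :: "'h \<Rightarrow> 'h"
  assumes coercive: "\<And>u. u \<in> Q \<Longrightarrow> u \<bullet> u \<le> s u u + \<kappa> * (u \<bullet> u)"
    and closed: "complete_form Q (\<lambda>x y. s x y + \<kappa> * (x \<bullet> y))"
    and J_linear: "linear J"
    and J_J: "\<And>x. J (J x) = - x"
    and J_inner: "\<And>x y. J x \<bullet> J y = x \<bullet> y"
    and J_Q: "\<And>x. x \<in> Q \<Longrightarrow> J x \<in> Q"
    and J_form: "\<And>x y. x \<in> Q \<Longrightarrow> y \<in> Q \<Longrightarrow> s (J x) (J y) = s x y"
begin

section \<open>The operator of a closed form\<close>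

lemma J_inner_left: "J x \<bullet> y = - (x \<bullet> J y)"
  by (metis J_J J_inner inner_minus_right minus_equation_iff)

lemma J_inner_self: "x \<bullet> J x = 0"
  by (metis J_inner_left inner_commute neg_equal_zero)

lemma J_form_left: "x \<in> Q \<Longrightarrow> y \<in> Q \<Longrightarrow> s (J x) y = - s x (J y)"
  by (metis J_J J_Q J_form minus_equation_iff s.minus_right)

lemma J_form_self: "x \<in> Q \<Longrightarrow> s x (J x) = 0"
  using J_form_left[of x x] s.sym[of x "J x"] J_Q[of x] by simp

definition oper :: "('h \<times> 'h) set" where
  "oper = {(u, w). u \<in> Q \<and> (\<forall>x\<in>Q. s x u = x \<bullet> w)}"

text \<open>Membership of a real number in the resolvent set. The bound is asked of some solution
  for each \<open>h\<close>; by the injectivity in the first conjunct it is a bound on the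
  inverse.\<close>

definition regular :: "real \<Rightarrow> bool" where
  "regular z \<longleftrightarrow> (\<forall>u w. (u, w) \<in> oper \<longrightarrow> w = z *\<^sub>R u \<longrightarrow> u = 0) \<and>
     (\<exists>C. \<forall>h. \<exists>u w. (u, w) \<in> oper \<and> w - z *\<^sub>R u = h \<and> norm u \<le> C * norm h)"

lemma operD: "(u, w) \<in> oper \<Longrightarrow> u \<in> Q" "(u, w) \<in> oper \<Longrightarrow> x \<in> Q \<Longrightarrow> s x u = x \<bullet> w"
  by (auto simp: oper_def)

lemma oper_add: "(u, w) \<in> oper \<Longrightarrow> (u', w') \<in> oper \<Longrightarrow> (u + u', w + w') \<in> oper"
  by (auto simp: oper_def s.bilinear_simps inner_right_distrib)

lemma oper_scale: "(u, w) \<in> oper \<Longrightarrow> (c *\<^sub>R u, c *\<^sub>R w) \<in> oper"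
  by (auto simp: oper_def s.bilinear_simps)

lemma oper_diff: "(u, w) \<in> oper \<Longrightarrow> (u', w') \<in> oper \<Longrightarrow> (u - u', w - w') \<in> oper"
  by (auto simp: oper_def s.bilinear_simps inner_diff_right)

lemma oper_J: "(u, w) \<in> oper \<Longrightarrow> (J u, J w) \<in> oper"
  unfolding oper_def using J_form_left J_inner_left J_Q
  by clarsimp (metis J_Q minus_equation_iff)

lemma sym_form_shift: "sym_form Q (\<lambda>x y. s x y - a * (x \<bullet> y))"
  by unfold_locales (auto simp: s.sub s.bilinear_simps inner_right_distrib s.sym algebra_simps inner_commute)

section \<open>Lower bounds of the form, resolvents and the spectral gap\<close>

definition lower_bound :: "real \<Rightarrow> bool" where
  "lower_bound l \<longleftrightarrow> (\<forall>u\<in>Q. l * (u \<bullet> u) \<le> s u u)"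

lemma complete_shift:
  assumes l: "lower_bound l" and "a < l"
  shows "complete_form Q (\<lambda>x y. s x y - a * (x \<bullet> y))"
proof -
  interpret k: complete_form Q "\<lambda>x y. s x y + \<kappa> * (x \<bullet> y)" by (rule closed)
  \<comment> \<open>A number in the interval from 0 to 1 with
    \<open>c * (l + \<kappa>) \<le> l - a\<close>: the part \<open>(1 - c) * s\<close> is estimated
    below by \<open>l\<close>, and this pays for replacing the shift \<open>\<kappa>\<close> by
    \<open>- a\<close>.\<close>
  define c where "c = (l - a) / (\<bar>l + \<kappa>\<bar> + (l - a) + 1)"
  have D: "\<bar>l + \<kappa>\<bar> + (l - a) + 1 > 0" using \<open>a < l\<close> by simp
  have c: "0 < c" "c \<le> 1" "c * (l + \<kappa>) \<le> l - a"
  proof -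
    show "0 < c" "c \<le> 1" using \<open>a < l\<close> D by (auto simp: c_def)
    have "c * (l + \<kappa>) \<le> c * (\<bar>l + \<kappa>\<bar> + (l - a) + 1)"
      using \<open>0 < c\<close> \<open>a < l\<close> by (intro mult_left_mono) auto
    also have "\<dots> = l - a" using D by (simp add: c_def)
    finally show "c * (l + \<kappa>) \<le> l - a" .
  qed
  show ?thesis
  proof (rule k.complete_equiv[OF sym_form_shift \<open>0 < c\<close>])
    fix x assume x: "x \<in> Q"
    have "(1 - c) * (l * (x \<bullet> x)) \<le> (1 - c) * s x x"
      using l x c by (intro mult_left_mono) (auto simp: lower_bound_def)
    moreover have "c * (l + \<kappa>) * (x \<bullet> x) \<le> (l - a) * (x \<bullet> x)"
      using c by (intro mult_right_mono) auto
    ultimately show "c * (s x x + \<kappa> * (x \<bullet> x)) \<le> s x x - a * (x \<bullet> x)"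
      by (simp add: algebra_simps)
    have "- (a + \<kappa>) * (x \<bullet> x) \<le> \<bar>a + \<kappa>\<bar> * (s x x + \<kappa> * (x \<bullet> x))"
      using coercive[OF x] by (intro mult_mono) auto
    then show "s x x - a * (x \<bullet> x) \<le> (1 + \<bar>a + \<kappa>\<bar>) * (s x x + \<kappa> * (x \<bullet> x))"
      by (simp add: algebra_simps)
  qed
qed

text \<open>In the inner product with \<open>u\<close> the term \<open>b *\<^sub>R J u\<close> drops
  out by \<open>J_inner_self\<close>, so only the distance from the real part of the spectral
  parameter to \<open>l\<close> is seen.\<close>

lemma oper_lower:
  assumes l: "lower_bound l" and uw: "(u, w) \<in> oper"
  shows "(l - a) * norm u \<le> norm (w - a *\<^sub>R u - b *\<^sub>R J u)"
proof (cases "u = 0")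
  case False
  have u: "u \<in> Q" using operD[OF uw] by simp
  have "(l - a) * (u \<bullet> u) \<le> s u u - a * (u \<bullet> u)"
    using l u by (simp add: lower_bound_def algebra_simps)
  also have "\<dots> = u \<bullet> (w - a *\<^sub>R u - b *\<^sub>R J u)"
    using operD(2)[OF uw u] by (simp add: inner_diff_right J_inner_self)
  also have "\<dots> \<le> norm u * norm (w - a *\<^sub>R u - b *\<^sub>R J u)" by (rule norm_cauchy_schwarz)
  finally have "norm u * ((l - a) * norm u) \<le> norm u * norm (w - a *\<^sub>R u - b *\<^sub>R J u)"
    by (simp add: power2_norm_eq_inner[symmetric] power2_eq_square mult_ac)
  then show ?thesis using False by simp
qed simp

text \<open>
  With \<open>A\<close> the inverse of \<open>H - a\<close>, the solution of \<open>(H - a - b J) u = h\<close> is \<open>u = p + b J y\<close>,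
  where \<open>(H - a) y = p = A (h - b\<^sup>2 y)\<close>; the form \<open>s - a + b\<^sup>2 \<langle>\<cdot>, A \<cdot>\<rangle>\<close> that determines \<open>y\<close> is symmetric.
\<close>
lemma half_plane_solvable:
  assumes l: "lower_bound l" and "a < l"
  shows "\<exists>u w. (u, w) \<in> oper \<and> w - a *\<^sub>R u - b *\<^sub>R J u = h"
proof -
  let ?t = "\<lambda>x y. s x y - a * (x \<bullet> y)"
  interpret a: complete_form Q ?t by (rule complete_shift[OF l \<open>a < l\<close>])
  have low: "(l - a) * (x \<bullet> x) \<le> ?t x x" if "x \<in> Q" for x
    using l that by (simp add: lower_bound_def algebra_simps)
  have "\<exists>u\<in>Q. \<forall>x\<in>Q. ?t x u = x \<bullet> h" for h
  proof (rule a.Riesz)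
    show "(x \<bullet> h)\<^sup>2 \<le> ((h \<bullet> h) / (l - a)) * ?t x x" if "x \<in> Q" for x
    proof -
      have "(x \<bullet> h)\<^sup>2 \<le> (x \<bullet> x) * (h \<bullet> h)" by (rule Cauchy_Schwarz_ineq)
      also have "\<dots> \<le> (?t x x / (l - a)) * (h \<bullet> h)"
        using low[OF that] \<open>a < l\<close> by (intro mult_right_mono) (auto simp: field_simps)
      finally show ?thesis by (simp add: mult.commute)
    qed
  qed (auto simp: inner_left_distrib)
  then obtain A where A: "\<And>h. A h \<in> Q" "\<And>h x. x \<in> Q \<Longrightarrow> ?t x (A h) = x \<bullet> h" by metis
  have uniq: "u = A h" if "u \<in> Q" "\<And>x. x \<in> Q \<Longrightarrow> ?t x u = x \<bullet> h" for u h
  proof -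
    have "?t (u - A h) (u - A h) = 0"
      using that A by (subst a.diff_right) auto
    moreover have "(l - a) * ((u - A h) \<bullet> (u - A h)) \<le> ?t (u - A h) (u - A h)"
      using that A by (intro low) auto
    ultimately have "(u - A h) \<bullet> (u - A h) \<le> 0" using \<open>a < l\<close> by (simp add: mult_le_0_iff)
    then show ?thesis by (metis antisym eq_iff_diff_eq_0 inner_eq_zero_iff inner_ge_zero)
  qed
  have A_add: "A (x + y) = A x + A y" for x y
    by (rule uniq[symmetric]) (auto simp: A a.add_right[OF _ A(1) A(1)] inner_right_distrib[of _ x y]
      simp del: inner_add_right)
  have A_scale: "A (c *\<^sub>R x) = c *\<^sub>R A x" for c x
    by (rule uniq[symmetric]) (auto simp: A a.scale_right[OF _ A(1)] simp del: inner_scaleR_right,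
      simp)
  have A_sym: "x \<bullet> A y = A x \<bullet> y" for x y
    by (metis A a.sym inner_commute)
  have A_pos: "0 \<le> x \<bullet> A x" for x
    by (metis A a.nonneg inner_commute)
  have A_bd: "x \<bullet> A x \<le> (1 / (l - a)) * (x \<bullet> x)" for x
  proof -
    have "norm (A x) * ((l - a) * norm (A x)) \<le> norm (A x) * norm x"
      using low[of "A x"] A(2)[of "A x" x] A(1)[of x] norm_cauchy_schwarz[of "A x" x]
      by (simp add: power2_norm_eq_inner[symmetric] power2_eq_square mult_ac)
    then have "(l - a) * norm (A x) \<le> norm x" by (cases "A x = 0") auto
    then have "norm x * norm (A x) \<le> norm x * (norm x / (l - a))"
      using \<open>a < l\<close> by (intro mult_left_mono) (auto simp: field_simps)
    then show ?thesis
      using norm_cauchy_schwarz[of x "A x"]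
      by (simp add: power2_norm_eq_inner[symmetric] power2_eq_square mult_ac)
  qed
  let ?t' = "\<lambda>x y. ?t x y + b\<^sup>2 * (x \<bullet> A y)"
  have "complete_form Q ?t'"
  proof (rule a.complete_equiv[of _ 1])
    show "sym_form Q ?t'"
    proof
      fix x y assume xy: "x \<in> Q" "y \<in> Q"
      show "?t' x y = ?t' y x"
        using a.sym[OF xy] A_sym[of x y] by (simp add: inner_commute)
    qed (auto simp: s.sub s.bilinear_simps A_add A_scale inner_right_distrib algebra_simps)
    fix x assume x: "x \<in> Q"
    show "1 * ?t x x \<le> ?t' x x" using A_pos[of x] by simp
    have "x \<bullet> A x \<le> (1 / (l - a)) * ((1 / (l - a)) * ?t x x)"
    proof (rule order_trans[OF A_bd mult_left_mono])
      show "x \<bullet> x \<le> (1 / (l - a)) * ?t x x" using low[OF x] \<open>a < l\<close> by (simp add: field_simps)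
    qed (use \<open>a < l\<close> in simp)
    then have "b\<^sup>2 * (x \<bullet> A x) \<le> b\<^sup>2 * ((1 / (l - a)) * ((1 / (l - a)) * ?t x x))"
      by (intro mult_left_mono) auto
    then show "?t' x x \<le> (1 + b\<^sup>2 * (1 / (l - a)) * (1 / (l - a))) * ?t x x"
      by (simp only: distrib_right mult_1_left mult.assoc)
  qed simp
  then interpret b: complete_form Q ?t' .
  have "\<exists>y\<in>Q. \<forall>x\<in>Q. ?t' x y = x \<bullet> A h"
  proof (rule b.Riesz)
    show "(x \<bullet> A h)\<^sup>2 \<le> ((A h \<bullet> A h) / (l - a)) * ?t' x x" if "x \<in> Q" for x
    proof -
      have "(x \<bullet> A h)\<^sup>2 \<le> (x \<bullet> x) * (A h \<bullet> A h)" by (rule Cauchy_Schwarz_ineq)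
      also have "\<dots> \<le> (?t' x x / (l - a)) * (A h \<bullet> A h)"
        using low[OF that] \<open>a < l\<close> A_pos[of x]
        by (intro mult_right_mono) (auto simp: field_simps intro: order_trans)
      finally show ?thesis by (simp add: mult.commute)
    qed
  qed (auto simp: inner_left_distrib)
  then obtain y where y: "y \<in> Q" "\<And>x. x \<in> Q \<Longrightarrow> ?t' x y = x \<bullet> A h" by blast
  define p where "p = A h - b\<^sup>2 *\<^sub>R A y"
  have p_eq: "p = A (h - b\<^sup>2 *\<^sub>R y)"
    using A_add[of "h - b\<^sup>2 *\<^sub>R y" "b\<^sup>2 *\<^sub>R y"] A_scale[of "b\<^sup>2" y] by (simp add: p_def)
  have 1: "(y, p + a *\<^sub>R y) \<in> oper"
    using y by (auto simp: oper_def p_def inner_right_distrib inner_diff_right algebra_simps)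
  have 2: "(p, h - b\<^sup>2 *\<^sub>R y + a *\<^sub>R p) \<in> oper"
    unfolding oper_def
  proof (clarsimp, intro conjI ballI)
    show "p \<in> Q" by (simp add: p_eq A)
    fix x assume "x \<in> Q"
    then show "s x p = x \<bullet> (h - b\<^sup>2 *\<^sub>R y + a *\<^sub>R p)"
      using A(2)[of x "h - b\<^sup>2 *\<^sub>R y"] by (simp add: p_eq[symmetric] inner_right_distrib)
  qed
  have "(p + b *\<^sub>R J y, h - b\<^sup>2 *\<^sub>R y + a *\<^sub>R p + b *\<^sub>R J (p + a *\<^sub>R y)) \<in> oper"
    by (intro oper_add oper_scale oper_J 1 2)
  moreover have "h - b\<^sup>2 *\<^sub>R y + a *\<^sub>R p + b *\<^sub>R J (p + a *\<^sub>R y) - a *\<^sub>R (p + b *\<^sub>R J y)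
      - b *\<^sub>R J (p + b *\<^sub>R J y) = h"
    using J_linear by (simp add: linear_add linear_scale J_J algebra_simps power2_eq_square)
  ultimately show ?thesis by blast
qed

text \<open>
  If \<open>(H - l) y = u\<close>, the Cauchy-Schwarz inequality for \<open>s - l\<close> gives \<open>1 \<le> (s - l)(u, u) \<cdot> (s - l)(y, y)\<close>,
  and the second factor is bounded by the resolvent.
\<close>
lemma bottom_not_regular:
  assumes l: "lower_bound l"
    and inf: "\<And>e. e > 0 \<Longrightarrow> \<exists>u\<in>Q. norm u = 1 \<and> s u u < l + e"
  shows "\<not> regular l"
proof
  assume "regular l"
  then obtain C where C: "\<And>h. \<exists>u w. (u, w) \<in> oper \<and> w - l *\<^sub>R u = h \<and> norm u \<le> C * norm h"
    by (auto simp: regular_def)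
  let ?b = "\<lambda>x y. s x y - l * (x \<bullet> y)"
  interpret b: pos_form Q ?b
    using l by (intro pos_form.intro sym_form_shift pos_form_axioms.intro) (auto simp: lower_bound_def)
  have *: "1 \<le> e * C" if "e > 0" for e :: real
  proof -
    obtain u where u: "u \<in> Q" "norm u = 1" "s u u < l + e" using inf[OF \<open>e > 0\<close>] by blast
    obtain y w where y: "(y, w) \<in> oper" "w - l *\<^sub>R y = u" "norm y \<le> C"
      using C[of u] u by auto
    have yQ: "y \<in> Q" using operD[OF y(1)] by simp
    have uu: "u \<bullet> u = 1" using u by (simp add: norm_eq_1)
    have form: "?b x y = x \<bullet> u" if "x \<in> Q" for x
      using operD(2)[OF y(1) that] y(2) by (metis inner_diff_right inner_scaleR_right)
    have "1 \<le> ?b u u * ?b y y" using b.Cauchy_Schwarz[OF u(1) yQ] form[OF u(1)] uu by simp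
    also have "?b y y \<le> C"
      using form[OF yQ] norm_cauchy_schwarz[of y u] u y by simp
    then have "?b u u * ?b y y \<le> e * C"
      using b.nonneg[OF u(1)] b.nonneg[OF yQ] u uu by (intro mult_mono) auto
    finally show ?thesis .
  qed
  have "C > 0" using *[of 1] by simp
  then show False using *[of "1 / (2 * C)"] by simp
qed

text \<open>
  The resolvent \<open>R\<close> at \<open>c\<close> is symmetric. If its norm \<open>M\<close> exceeded \<open>1 / r\<close>, both points
  \<open>c \<plusminus> 1 / M\<close> would be regular, hence \<open>R\<^sup>2 - M\<^sup>2\<close> bounded below, and
  \<open>|R\<^sup>2 x - M\<^sup>2 x|\<^sup>2 \<le> M\<^sup>2 (M\<^sup>2 |x|\<^sup>2 - |R x|\<^sup>2)\<close> would contradict \<open>|R| = M\<close>.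
\<close>
lemma regular_ball_bound:
  assumes reg: "\<And>z. \<bar>z - c\<bar> < r \<Longrightarrow> regular z" and "r > 0" and uw: "(u, w) \<in> oper"
  shows "r * norm u \<le> norm (w - c *\<^sub>R u)"
proof -
  have inj: "u = v" if "regular z" "(u, w) \<in> oper" "(v, w') \<in> oper" "w - z *\<^sub>R u = w' - z *\<^sub>R v"
    for z u v w w'
  proof -
    have "(u - v, w - w') \<in> oper" by (rule oper_diff[OF that(2,3)])
    moreover have "w - w' = z *\<^sub>R (u - v)" using that(4) by (simp add: algebra_simps)
    ultimately have "u - v = 0" using that(1) unfolding regular_def by blast
    then show ?thesis by simp
  qed
  have bnd: "\<exists>C>0. \<forall>u w. (u, w) \<in> oper \<longrightarrow> norm u \<le> C * norm (w - z *\<^sub>R u)" if z: "regular z" for z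
  proof -
    obtain C where C: "\<And>h. \<exists>u w. (u, w) \<in> oper \<and> w - z *\<^sub>R u = h \<and> norm u \<le> C * norm h"
      using z by (auto simp: regular_def)
    have "norm u \<le> (\<bar>C\<bar> + 1) * norm (w - z *\<^sub>R u)" if uw: "(u, w) \<in> oper" for u w
    proof -
      obtain u' w' where u': "(u', w') \<in> oper" "w' - z *\<^sub>R u' = w - z *\<^sub>R u"
          "norm u' \<le> C * norm (w - z *\<^sub>R u)"
        using C by blast
      have "u = u'" using inj[OF z uw u'(1)] u'(2) by simp
      then have "norm u \<le> C * norm (w - z *\<^sub>R u)" using u' by simp
      also have "\<dots> \<le> (\<bar>C\<bar> + 1) * norm (w - z *\<^sub>R u)" by (intro mult_right_mono) auto
      finally show ?thesis .
    qed
    then show ?thesis by (intro exI[of _ "\<bar>C\<bar> + 1"]) auto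
  qed
  have regc: "regular c" using reg[of c] \<open>r > 0\<close> by simp
  obtain R where R: "\<And>h. (R h, h + c *\<^sub>R R h) \<in> oper"
  proof -
    have "\<exists>u. (u, h + c *\<^sub>R u) \<in> oper" for h
    proof -
      obtain u w where "(u, w) \<in> oper" "w - c *\<^sub>R u = h"
        using regc unfolding regular_def by blast
      then show ?thesis by (auto simp: algebra_simps)
    qed
    then show ?thesis using that by metis
  qed
  obtain C where C: "C > 0" "\<And>h. norm (R h) \<le> C * norm h"
  proof -
    obtain C where "C > 0" and C: "\<And>u w. (u, w) \<in> oper \<Longrightarrow> norm u \<le> C * norm (w - c *\<^sub>R u)"
      using bnd[OF regc] by blast
    moreover have "norm (R h) \<le> C * norm h" for h using C[OF R[of h]] by simp
    ultimately show ?thesis using that by blast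
  qed
  have R_eq: "R h = u" if "(u, h + c *\<^sub>R u) \<in> oper" for u h
    using inj[OF regc R that] by simp
  have R_lin: "bounded_linear R"
  proof (rule bounded_linear_intro)
    show "R (x + y) = R x + R y" for x y
      using oper_add[OF R R, of x y] by (intro R_eq) (simp add: algebra_simps)
    show "R (a *\<^sub>R x) = a *\<^sub>R R x" for a x
      using oper_scale[OF R, of a x] by (intro R_eq) (simp add: algebra_simps)
    show "norm (R x) \<le> norm x * C" for x using C(2)[of x] by (simp add: mult.commute)
  qed
  have R_sym: "R x \<bullet> y = x \<bullet> R y" for x y
  proof -
    have "R x \<in> Q" "R y \<in> Q" using operD[OF R] by auto
    then have "s (R x) (R y) = R x \<bullet> (y + c *\<^sub>R R y)" "s (R y) (R x) = R y \<bullet> (x + c *\<^sub>R R x)"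
      using operD(2)[OF R] by auto
    then show ?thesis using s.sym[of "R x" "R y"] \<open>R x \<in> Q\<close> \<open>R y \<in> Q\<close>
      by (simp add: inner_right_distrib inner_commute)
  qed
  define M where "M = onorm R"
  have M: "norm (R x) \<le> M * norm x" for x unfolding M_def by (rule onorm[OF R_lin])
  have "M \<le> 1 / r"
  proof (rule ccontr)
    assume "\<not> M \<le> 1 / r"
    then have Mr: "M > 1 / r" by simp
    then have "M > 0" using \<open>r > 0\<close> by (meson divide_pos_pos less_trans zero_less_one)
    define \<epsilon> where "\<epsilon> = 1 / M"
    have \<epsilon>: "0 < \<epsilon>" "\<epsilon> < r" "M * \<epsilon> = 1"
      using Mr \<open>M > 0\<close> \<open>r > 0\<close> by (auto simp: \<epsilon>_def field_simps)
    obtain C1 where C1: "C1 > 0" "\<And>u w. (u, w) \<in> oper \<Longrightarrow> norm u \<le> C1 * norm (w - (c + \<epsilon>) *\<^sub>R u)"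
      using bnd[of "c + \<epsilon>"] reg[of "c + \<epsilon>"] \<epsilon> by auto
    obtain C2 where C2: "C2 > 0" "\<And>u w. (u, w) \<in> oper \<Longrightarrow> norm u \<le> C2 * norm (w - (c - \<epsilon>) *\<^sub>R u)"
      using bnd[of "c - \<epsilon>"] reg[of "c - \<epsilon>"] \<epsilon> by auto
    define K where "K = \<epsilon>\<^sup>2 * (C2 * (C1 * \<epsilon>\<^sup>2) + 1)"
    have "K > 0" using C1 C2 \<epsilon> by (auto simp: K_def intro!: mult_pos_pos add_pos_pos)
    have K: "norm x \<le> K * norm (R (R x) - M\<^sup>2 *\<^sub>R x)" for x
    proof -
      define y where "y = R (R x) - M\<^sup>2 *\<^sub>R x"
      have eM: "\<epsilon>\<^sup>2 * M\<^sup>2 = 1" using \<epsilon> by (simp add: power_mult_distrib[symmetric] mult.commute)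
      have x: "x = \<epsilon>\<^sup>2 *\<^sub>R (R (R x) - y)" by (simp add: y_def eM scaleR_diff_right)
      \<comment> \<open>Applying \<open>H - c - \<epsilon>\<close> to this vector gives
        \<open>x - \<epsilon>^2 R (R x)\<close>, while \<open>H - c + \<epsilon>\<close> maps
        \<open>R (R x)\<close> to the vector itself. The two regular points
        \<open>c + \<epsilon>\<close> and \<open>c - \<epsilon>\<close> thus bound
        \<open>R (R x)\<close> by \<open>x - \<epsilon>^2 R (R x)\<close>, a multiple of
        \<open>y\<close>.\<close>
      have z: "(R x + \<epsilon> *\<^sub>R R (R x), x + c *\<^sub>R R x + \<epsilon> *\<^sub>R (R x + c *\<^sub>R R (R x))) \<in> oper"
        by (intro oper_add oper_scale R)
      have "norm (R (R x)) \<le> C2 * norm (R x + c *\<^sub>R R (R x) - (c - \<epsilon>) *\<^sub>R R (R x))"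
        by (rule C2(2)[OF R])
      also have "\<dots> = C2 * norm (R x + \<epsilon> *\<^sub>R R (R x))" by (simp add: algebra_simps)
      also have "norm (R x + \<epsilon> *\<^sub>R R (R x)) \<le> C1 * norm (x - \<epsilon>\<^sup>2 *\<^sub>R R (R x))"
        using C1(2)[OF z] by (simp add: algebra_simps power2_eq_square)
      also have "x - \<epsilon>\<^sup>2 *\<^sub>R R (R x) = - (\<epsilon>\<^sup>2 *\<^sub>R y)" using x by (simp add: algebra_simps)
      finally have r: "norm (R (R x)) \<le> C2 * (C1 * (\<epsilon>\<^sup>2 * norm y))" using C2 by simp
      have "norm x = \<epsilon>\<^sup>2 * norm (R (R x) - y)"
        using x by (metis abs_of_nonneg norm_scaleR zero_le_power2)
      also have "\<dots> \<le> \<epsilon>\<^sup>2 * (norm (R (R x)) + norm y)"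
        by (intro mult_left_mono norm_triangle_ineq4) auto
      also have "\<dots> \<le> \<epsilon>\<^sup>2 * (C2 * (C1 * (\<epsilon>\<^sup>2 * norm y)) + norm y)"
        using r by (intro mult_left_mono) auto
      also have "\<dots> = K * norm y" by (simp add: K_def algebra_simps)
      finally show ?thesis by (simp add: y_def)
    qed
    define M' where "M' = M\<^sup>2 - 1 / (K\<^sup>2 * M\<^sup>2)"
    have RM': "(norm (R x))\<^sup>2 \<le> M' * (norm x)\<^sup>2" for x
    proof -
      have "(norm x)\<^sup>2 \<le> (K * norm (R (R x) - M\<^sup>2 *\<^sub>R x))\<^sup>2" by (intro power_mono K) auto
      also have "\<dots> = K\<^sup>2 * ((norm (R (R x)))\<^sup>2 - 2 * M\<^sup>2 * (norm (R x))\<^sup>2 + M\<^sup>2 * M\<^sup>2 * (norm x)\<^sup>2)"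
        using R_sym[of "R x" x] unfolding power_mult_distrib power2_norm_eq_inner
        by (simp add: inner_diff_left inner_diff_right inner_commute algebra_simps)
      also have "\<dots> \<le> K\<^sup>2 * (M\<^sup>2 * (norm (R x))\<^sup>2 - 2 * M\<^sup>2 * (norm (R x))\<^sup>2 + M\<^sup>2 * M\<^sup>2 * (norm x)\<^sup>2)"
        using power_mono[OF M[of "R x"], of 2] by (intro mult_left_mono) (auto simp: power_mult_distrib)
      finally show ?thesis
        using \<open>K > 0\<close> \<open>M > 0\<close> by (simp add: M'_def field_simps)
    qed
    have "M \<le> sqrt \<bar>M'\<bar>" unfolding M_def
    proof (rule onorm_bound)
      fix x
      have "(norm (R x))\<^sup>2 \<le> (sqrt \<bar>M'\<bar> * norm x)\<^sup>2"
        using order_trans[OF RM'[of x] mult_right_mono[of M' "\<bar>M'\<bar>" "(norm x)\<^sup>2"]]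
        by (simp add: power_mult_distrib)
      then show "norm (R x) \<le> sqrt \<bar>M'\<bar> * norm x" by (rule power2_le_imp_le) simp
    qed simp
    \<comment> \<open>A negative \<open>M'\<close> would force \<open>R = 0\<close>, against
      \<open>M > 0\<close>; this removes the absolute value under the root.\<close>
    moreover have "M' \<ge> 0"
    proof (rule ccontr)
      assume "\<not> 0 \<le> M'"
      then have "R x = 0" for x
        using order_trans[OF RM'[of x] mult_nonpos_nonneg[of M' "(norm x)\<^sup>2"]] by simp
      then have "R = (\<lambda>x. 0)" by auto
      then show False using \<open>M > 0\<close> by (simp add: M_def onorm_zero)
    qed
    ultimately have "M\<^sup>2 \<le> M'" using \<open>M > 0\<close> power_mono[of M "sqrt \<bar>M'\<bar>" 2] by simp
    moreover have "1 / (K\<^sup>2 * M\<^sup>2) > 0" using \<open>K > 0\<close> \<open>M > 0\<close> by simp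
    ultimately show False by (simp add: M'_def)
  qed
  then have "norm u \<le> (1 / r) * norm (w - c *\<^sub>R u)"
    using M[of "w - c *\<^sub>R u"] R_eq[of u "w - c *\<^sub>R u"] uw mult_right_mono[OF \<open>M \<le> 1 / r\<close> norm_ge_zero, of "w - c *\<^sub>R u"]
    by simp
  then show ?thesis using \<open>r > 0\<close> by (simp add: field_simps)
qed

text \<open>
  Write \<open>T = H - \<mu>\<close>. The bound on the ball of radius \<open>d / 2\<close> around \<open>\<mu> + d / 2\<close> reads \<open>d \<langle>u, T u\<rangle> \<le> |T u|\<^sup>2\<close>, and
  interpolating moments turns it into \<open>d |x| \<le> |T x|\<close> on the range of \<open>T\<close>. Hence \<open>\<epsilon> (T + \<epsilon>)\<^bsup>-1\<^esup> z\<close> is Cauchy as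
  \<open>\<epsilon> \<rightarrow> 0\<close>; its limit lies in the kernel and is orthogonal to it, so it vanishes at the rate \<open>2 \<epsilon> |z| / d\<close>.
\<close>
lemma spectral_gap:
  assumes mu: "lower_bound \<mu>" and e: "(e, \<mu> *\<^sub>R e) \<in> oper"
    and ker: "\<And>u. (u, \<mu> *\<^sub>R u) \<in> oper \<Longrightarrow> \<exists>a b. u = a *\<^sub>R e + b *\<^sub>R J e"
    and "d > 0" and reg: "\<And>z. \<mu> < z \<Longrightarrow> z < \<mu> + d \<Longrightarrow> regular z"
    and z: "z \<in> Q" "e \<bullet> z = 0" "J e \<bullet> z = 0"
  shows "(\<mu> + d / 2) * (z \<bullet> z) \<le> s z z"
proof -
  let ?b = "\<lambda>x y. s x y - \<mu> * (x \<bullet> y)"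
  interpret b: pos_form Q ?b
    using mu by (intro pos_form.intro sym_form_shift pos_form_axioms.intro) (auto simp: lower_bound_def)
  interpret k: complete_form Q "\<lambda>x y. s x y + \<kappa> * (x \<bullet> y)" by (rule closed)
  have b_oper: "?b x u = x \<bullet> (w - \<mu> *\<^sub>R u)" if "(u, w) \<in> oper" "x \<in> Q" for x u w
    using operD[OF that(1)] that(2) by (simp add: inner_diff_right)
  have sq: "d * (u \<bullet> (w - \<mu> *\<^sub>R u)) \<le> (norm (w - \<mu> *\<^sub>R u))\<^sup>2" if uw: "(u, w) \<in> oper" for u w
  proof -
    have "(d / 2) * norm u \<le> norm (w - (\<mu> + d / 2) *\<^sub>R u)"
      by (rule regular_ball_bound[OF _ _ uw]) (use reg \<open>d > 0\<close> in \<open>auto simp: abs_if split: if_splits\<close>)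
    then have "((d / 2) * norm u)\<^sup>2 \<le> (norm (w - (\<mu> + d / 2) *\<^sub>R u))\<^sup>2"
      using \<open>d > 0\<close> by (intro power_mono) auto
    moreover have "w - (\<mu> + d / 2) *\<^sub>R u = (w - \<mu> *\<^sub>R u) - (d / 2) *\<^sub>R u" by (simp add: algebra_simps)
    ultimately show ?thesis
      unfolding power_mult_distrib power2_norm_eq_inner
      by (simp add: inner_diff_left inner_diff_right inner_commute power2_eq_square algebra_simps)
  qed
  have range: "d * norm x \<le> norm (w - \<mu> *\<^sub>R x)"
    if v: "(v, x + \<mu> *\<^sub>R v) \<in> oper" and x: "(x, w) \<in> oper" for v x w
  proof (cases "x = 0")
    case False
    have vQ: "v \<in> Q" and xQ: "x \<in> Q" using operD v x by auto
    \<comment> \<open>Since \<open>x = T v\<close>, these four numbers are the moments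
      \<open><v, T^j v>\<close> for j = 1, 2, 3, 4.\<close>
    define m1 where "m1 = v \<bullet> x"
    define m2 where "m2 = x \<bullet> x"
    define m3 where "m3 = x \<bullet> (w - \<mu> *\<^sub>R x)"
    define m4 where "m4 = (norm (w - \<mu> *\<^sub>R x))\<^sup>2"
    have m2: "m2 > 0" using False by (simp add: m2_def)
    have 1: "d * m1 \<le> m2" using sq[OF v] by (simp add: m1_def m2_def power2_norm_eq_inner)
    have 3: "d * m3 \<le> m4" using sq[OF x] by (simp add: m3_def m4_def)
    have "m2\<^sup>2 \<le> m1 * m3"
      using b.Cauchy_Schwarz[OF xQ vQ] b_oper[OF v xQ] b_oper[OF v vQ] b_oper[OF x xQ]
      by (simp add: m1_def m2_def m3_def mult.commute)
    moreover have "m1 \<ge> 0" "m3 \<ge> 0"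
      using b.nonneg[OF xQ] b.nonneg[OF vQ] b_oper[OF v vQ] b_oper[OF x xQ]
      by (auto simp: m1_def m3_def)
    ultimately have "d * d * m2\<^sup>2 \<le> (d * m1) * (d * m3)" using \<open>d > 0\<close> by simp
    also have "\<dots> \<le> m2 * m4" using 1 3 \<open>d > 0\<close> m2 \<open>m1 \<ge> 0\<close> \<open>m3 \<ge> 0\<close> by (intro mult_mono) auto
    finally have "d * d * m2 \<le> m4" using m2 by (simp add: power2_eq_square)
    then have "(d * norm x)\<^sup>2 \<le> (norm (w - \<mu> *\<^sub>R x))\<^sup>2"
      by (simp add: m2_def m4_def power_mult_distrib power2_norm_eq_inner[symmetric] power2_eq_square mult_ac)
    then show ?thesis by (rule power2_le_imp_le) simp
  qed simp
  have sol: "\<exists>u. (u, y + \<mu> *\<^sub>R u - \<epsilon> *\<^sub>R u) \<in> oper" if "\<epsilon> > 0" for y \<epsilon>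
  proof -
    obtain u w where "(u, w) \<in> oper" "w - (\<mu> - \<epsilon>) *\<^sub>R u - 0 *\<^sub>R J u = y"
      using half_plane_solvable[OF mu, of "\<mu> - \<epsilon>" 0 y] \<open>\<epsilon> > 0\<close>
      by (metis diff_less_eq less_add_same_cancel1)
    moreover from this have "w = y + \<mu> *\<^sub>R u - \<epsilon> *\<^sub>R u" by (auto simp: algebra_simps)
    ultimately show ?thesis by auto
  qed
  \<comment> \<open>\<open>U y \<epsilon>\<close> is \<open>(T + \<epsilon>)^-1 y\<close>, and
    \<open>p y \<epsilon>\<close>, which is \<open>\<epsilon>\<close> times it, approximates the
    projection of \<open>y\<close> onto the kernel of \<open>T\<close>.\<close>
  define p where "p y \<epsilon> = \<epsilon> *\<^sub>R (SOME u. (u, y + \<mu> *\<^sub>R u - \<epsilon> *\<^sub>R u) \<in> oper)" for y \<epsilon>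
  define U where "U y \<epsilon> = (SOME u. (u, y + \<mu> *\<^sub>R u - \<epsilon> *\<^sub>R u) \<in> oper)" for y \<epsilon>
  have U: "(U y \<epsilon>, y + \<mu> *\<^sub>R U y \<epsilon> - \<epsilon> *\<^sub>R U y \<epsilon>) \<in> oper" if "\<epsilon> > 0" for y \<epsilon>
    using someI_ex[OF sol[OF that]] by (simp add: U_def)
  have pU: "p y \<epsilon> = \<epsilon> *\<^sub>R U y \<epsilon>" for y \<epsilon> by (simp add: p_def U_def)
  have U_bd: "\<epsilon> * norm (U y \<epsilon>) \<le> norm y" if "\<epsilon> > 0" for y \<epsilon>
    using oper_lower[OF mu U[OF that, of y], where a = "\<mu> - \<epsilon>" and b = 0] by (simp add: algebra_simps)
  have p_oper: "(p y \<epsilon>, \<epsilon> *\<^sub>R (y - p y \<epsilon>) + \<mu> *\<^sub>R p y \<epsilon>) \<in> oper" if "\<epsilon> > 0" for y \<epsilon>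
    using oper_scale[OF U[OF that], of \<epsilon>] by (simp add: pU algebra_simps)
  have diff_bd: "norm (p y \<epsilon> - p y \<epsilon>') \<le> 2 * (\<epsilon> + \<epsilon>') * norm y / d" if "\<epsilon> > 0" "\<epsilon>' > 0" for y \<epsilon> \<epsilon>'
  proof -
    \<comment> \<open>The resolvent identity: the difference of two values of \<open>p\<close> is
      the image under \<open>T\<close> of a difference of values of \<open>U\<close>, so
      \<open>range\<close> applies to it.\<close>
    have 1: "(U y \<epsilon>' - U y \<epsilon>, (p y \<epsilon> - p y \<epsilon>') + \<mu> *\<^sub>R (U y \<epsilon>' - U y \<epsilon>)) \<in> oper"
      using oper_diff[OF U U, of \<epsilon>' \<epsilon> y y] that by (simp add: pU algebra_simps)
    have 2: "(p y \<epsilon> - p y \<epsilon>', (\<epsilon> *\<^sub>R (y - p y \<epsilon>) + \<mu> *\<^sub>R p y \<epsilon>) - (\<epsilon>' *\<^sub>R (y - p y \<epsilon>') + \<mu> *\<^sub>R p y \<epsilon>')) \<in> oper"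
      using oper_diff[OF p_oper p_oper, of \<epsilon> \<epsilon>'] that by simp
    have yp: "norm (y - p y \<epsilon>) \<le> 2 * norm y" if "\<epsilon> > 0" for \<epsilon>
      using norm_triangle_ineq4[of y "p y \<epsilon>"] U_bd[OF that, of y] that by (simp add: pU)
    have "d * norm (p y \<epsilon> - p y \<epsilon>') \<le> norm (\<epsilon> *\<^sub>R (y - p y \<epsilon>) - \<epsilon>' *\<^sub>R (y - p y \<epsilon>'))"
      using range[OF 1 2] by (simp add: algebra_simps)
    also have "\<dots> \<le> \<epsilon> * norm (y - p y \<epsilon>) + \<epsilon>' * norm (y - p y \<epsilon>')"
      using norm_triangle_ineq4[of "\<epsilon> *\<^sub>R (y - p y \<epsilon>)" "\<epsilon>' *\<^sub>R (y - p y \<epsilon>')"] that by simp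
    also have "\<dots> \<le> \<epsilon> * (2 * norm y) + \<epsilon>' * (2 * norm y)"
      using that by (intro add_mono mult_left_mono yp) auto
    finally show ?thesis using \<open>d > 0\<close> by (simp add: field_simps)
  qed
  have U_le: "norm (U z \<epsilon>) \<le> 2 * norm z / d" if "\<epsilon> > 0" for \<epsilon>
  proof -
    define P where "P n = p z (inverse (real (Suc n)))" for n
    have inv: "(\<lambda>n. inverse (real (Suc n))) \<longlonglongrightarrow> 0" by (rule LIMSEQ_inverse_real_of_nat)
    define w where "w n = inverse (real (Suc n)) *\<^sub>R (z - P n)" for n
    have P: "(P n, w n + \<mu> *\<^sub>R P n) \<in> oper" for n
      unfolding P_def w_def by (rule p_oper) simp
    have PQ: "P n \<in> Q" for n using operD[OF P] by simp
    define D where "D n = inverse (real (Suc n)) * (2 * norm z)" for n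
    have D0: "D \<longlonglongrightarrow> 0" unfolding D_def using tendsto_mult_left_zero[OF inv] .
    have wD: "norm (w n) \<le> D n" for n
    proof -
      have "norm (z - P n) \<le> 2 * norm z"
        using norm_triangle_ineq4[of z "P n"] U_bd[of "inverse (real (Suc n))" z]
        unfolding P_def by (simp add: pU del: of_nat_Suc)
      then show ?thesis unfolding w_def D_def by (simp add: mult_left_mono)
    qed
    have P_diff: "norm (P m - P n) \<le> (D m + D n) / d" for m n
      using diff_bd[of "inverse (real (Suc m))" "inverse (real (Suc n))" z]
      by (simp add: P_def D_def field_simps del: of_nat_Suc)
    have "\<exists>x\<in>Q. (\<lambda>n. s (P n - x) (P n - x) + \<kappa> * ((P n - x) \<bullet> (P n - x))) \<longlonglongrightarrow> 0"
    proof (rule k.complete[OF PQ])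
      fix \<eta> :: real assume "\<eta> > 0"
      \<comment> \<open>The summand \<open>1 / d\<close> accounts for the form
        \<open>s - \<mu>\<close> on the differences of \<open>P\<close>, the other summand for their
        norm; both are multiples of \<open>(2 * D N)^2\<close>.\<close>
      define c where "c = 1 / d + \<bar>\<mu> + \<kappa>\<bar> / d\<^sup>2"
      have "(\<lambda>n. c * (2 * D n)\<^sup>2) \<longlonglongrightarrow> c * (2 * 0)\<^sup>2" by (intro tendsto_intros D0)
      then have "\<forall>\<^sub>F n in sequentially. c * (2 * D n)\<^sup>2 < \<eta>"
        using \<open>\<eta> > 0\<close> order_tendstoD(2) by fastforce
      then obtain N where N: "c * (2 * D N)\<^sup>2 < \<eta>" by (auto simp: eventually_sequentially)
      have anti: "D n \<le> D N" if "n \<ge> N" for n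
        using that unfolding D_def by (intro mult_right_mono le_imp_inverse_le) auto
      have "s (P m - P n) (P m - P n) + \<kappa> * ((P m - P n) \<bullet> (P m - P n)) < \<eta>" if "m \<ge> N" "n \<ge> N" for m n
      proof -
        have nd: "norm (P m - P n) \<le> (2 * D N) / d"
        proof (rule order_trans[OF P_diff divide_right_mono])
          show "D m + D n \<le> 2 * D N" using anti[OF that(1)] anti[OF that(2)] by simp
        qed (use \<open>d > 0\<close> in simp)
        have dQ: "P m - P n \<in> Q" using PQ by simp
        have "?b (P m - P n) (P m - P n) = (P m - P n) \<bullet> (w m - w n)"
          using b_oper[OF oper_diff[OF P P] dQ] by (simp add: algebra_simps)
        also have "\<dots> \<le> norm (P m - P n) * norm (w m - w n)" by (rule norm_cauchy_schwarz)
        also have "\<dots> \<le> ((2 * D N) / d) * (2 * D N)"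
          using nd norm_triangle_ineq4[of "w m" "w n"] wD[of m] wD[of n] anti[OF that(1)] anti[OF that(2)]
          by (intro mult_mono order_trans[OF norm_ge_zero nd]) auto
        finally have 1: "?b (P m - P n) (P m - P n) \<le> (1 / d) * (2 * D N)\<^sup>2"
          by (simp add: power2_eq_square)
        have "(\<mu> + \<kappa>) * ((P m - P n) \<bullet> (P m - P n)) \<le> \<bar>\<mu> + \<kappa>\<bar> * ((2 * D N) / d)\<^sup>2"
          using power_mono[OF nd, of 2] by (intro mult_mono) (auto simp: power2_norm_eq_inner)
        then have "?b (P m - P n) (P m - P n) + (\<mu> + \<kappa>) * ((P m - P n) \<bullet> (P m - P n)) \<le> c * (2 * D N)\<^sup>2"
          using 1 by (simp add: c_def algebra_simps power_divide)
        then show ?thesis using N by (simp add: algebra_simps)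
      qed
      then show "\<exists>N. \<forall>m\<ge>N. \<forall>n\<ge>N. s (P m - P n) (P m - P n) + \<kappa> * ((P m - P n) \<bullet> (P m - P n)) < \<eta>"
        by blast
    qed
    then obtain x where x: "x \<in> Q"
      "(\<lambda>n. s (P n - x) (P n - x) + \<kappa> * ((P n - x) \<bullet> (P n - x))) \<longlonglongrightarrow> 0" by blast
    have "(\<lambda>n. (P n - x) \<bullet> (P n - x)) \<longlonglongrightarrow> 0"
      using coercive[of "P _ - x"] PQ x
      by (intro tendsto_sandwich[OF _ _ tendsto_const x(2)]) (auto intro!: always_eventually)
    then have "(\<lambda>n. (norm (P n - x))\<^sup>2) \<longlonglongrightarrow> 0" by (simp add: power2_norm_eq_inner)
    then have "(\<lambda>n. sqrt ((norm (P n - x))\<^sup>2)) \<longlonglongrightarrow> sqrt 0" by (intro tendsto_intros)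
    then have Px: "P \<longlonglongrightarrow> x" by (simp add: tendsto_norm_zero_iff LIM_zero_iff)
    have w0: "w \<longlonglongrightarrow> 0" by (rule Lim_null_comparison[OF _ D0]) (simp add: wD)
    have "(x, \<mu> *\<^sub>R x) \<in> oper"
      unfolding oper_def
    proof (clarsimp simp: x, rule LIMSEQ_unique)
      fix y assume y: "y \<in> Q"
      have "(\<lambda>n. s y (P n) + \<kappa> * (y \<bullet> P n)) \<longlonglongrightarrow> s y x + \<kappa> * (y \<bullet> x)"
        by (rule k.tendsto_right[OF PQ x(1) y x(2)])
      then have "(\<lambda>n. (s y (P n) + \<kappa> * (y \<bullet> P n)) - \<kappa> * (y \<bullet> P n)) \<longlonglongrightarrow> (s y x + \<kappa> * (y \<bullet> x)) - \<kappa> * (y \<bullet> x)"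
        by (rule tendsto_diff) (intro tendsto_intros Px)
      then show "(\<lambda>n. s y (P n)) \<longlonglongrightarrow> s y x" by simp
      have "(\<lambda>n. y \<bullet> (w n + \<mu> *\<^sub>R P n)) \<longlonglongrightarrow> y \<bullet> (0 + \<mu> *\<^sub>R x)" by (intro tendsto_intros w0 Px)
      then show "(\<lambda>n. s y (P n)) \<longlonglongrightarrow> \<mu> * (y \<bullet> x)" using operD(2)[OF P y] by simp
    qed
    then obtain a b where ab: "x = a *\<^sub>R e + b *\<^sub>R J e" using ker by blast
    have orth: "v \<bullet> U z \<epsilon> = 0" if v: "(v, \<mu> *\<^sub>R v) \<in> oper" "v \<bullet> z = 0" and "\<epsilon> > 0" for v \<epsilon>
    proof -
      have "v \<in> Q" "U z \<epsilon> \<in> Q" by (rule operD(1)[OF v(1)], rule operD(1)[OF U[OF \<open>\<epsilon> > 0\<close>]])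
      then have "v \<bullet> (z + \<mu> *\<^sub>R U z \<epsilon> - \<epsilon> *\<^sub>R U z \<epsilon>) = U z \<epsilon> \<bullet> (\<mu> *\<^sub>R v)"
        using operD(2)[OF U[OF \<open>\<epsilon> > 0\<close>, of z], of v] operD(2)[OF v(1), of "U z \<epsilon>"] s.sym by simp
      then have "\<epsilon> * (v \<bullet> U z \<epsilon>) = 0"
        using v by (simp add: inner_diff_right inner_right_distrib inner_commute)
      then show ?thesis using \<open>\<epsilon> > 0\<close> by simp
    qed
    have Je: "(J e, \<mu> *\<^sub>R J e) \<in> oper" using oper_J[OF e] J_linear by (simp add: linear_scale)
    have "v \<bullet> x = 0" if v: "(v, \<mu> *\<^sub>R v) \<in> oper" "v \<bullet> z = 0" for v
    proof (rule LIMSEQ_unique)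
      show "(\<lambda>n. v \<bullet> P n) \<longlonglongrightarrow> v \<bullet> x" by (intro tendsto_intros Px)
      show "(\<lambda>n. v \<bullet> P n) \<longlonglongrightarrow> 0" by (simp add: P_def pU orth[OF v])
    qed
    then have "x \<bullet> x = 0" using e Je z unfolding ab by (simp add: inner_left_distrib)
    then have "x = 0" by simp
    have "norm (p z \<epsilon>) \<le> 2 * \<epsilon> * norm z / d"
    proof (rule LIMSEQ_le)
      have "(\<lambda>n. norm (p z \<epsilon> - P n)) \<longlonglongrightarrow> norm (p z \<epsilon> - x)" by (intro tendsto_intros Px)
      then show "(\<lambda>n. norm (p z \<epsilon> - P n)) \<longlonglongrightarrow> norm (p z \<epsilon>)" by (simp add: \<open>x = 0\<close>)
      have "(\<lambda>n. 2 * (\<epsilon> + inverse (real (Suc n))) * norm z / d) \<longlonglongrightarrow> 2 * (\<epsilon> + 0) * norm z / d"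
        by (intro tendsto_intros inv) (use \<open>d > 0\<close> in auto)
      then show "(\<lambda>n. 2 * (\<epsilon> + inverse (real (Suc n))) * norm z / d) \<longlonglongrightarrow> 2 * \<epsilon> * norm z / d" by simp
      show "\<exists>N. \<forall>n\<ge>N. norm (p z \<epsilon> - P n) \<le> 2 * (\<epsilon> + inverse (real (Suc n))) * norm z / d"
        unfolding P_def using diff_bd \<open>\<epsilon> > 0\<close> by (intro exI[of _ 0] allI impI diff_bd) auto
    qed
    then have "\<epsilon> * norm (U z \<epsilon>) \<le> \<epsilon> * (2 * norm z / d)" using \<open>\<epsilon> > 0\<close> by (simp add: pU mult_ac)
    then show ?thesis using \<open>\<epsilon> > 0\<close> by (simp only: mult_le_cancel_left_pos)
  qed
  \<comment> \<open>The Cauchy-Schwarz inequality for the form of \<open>T + \<epsilon>\<close>,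
    applied to \<open>z\<close> and \<open>(T + \<epsilon>)^-1 z\<close>, turns the bound
    \<open>U_le\<close> on the resolvent into a lower bound on the form at \<open>z\<close>. The 2
    in \<open>U_le\<close>, which goes back to \<open>|y - p y \<epsilon>| \<le> 2 |y|\<close>, is
    what halves the gap.\<close>
  have low: "d / 2 * (z \<bullet> z) \<le> ?b z z + \<epsilon> * (z \<bullet> z)" if "\<epsilon> > 0" for \<epsilon>
  proof (cases "z = 0")
    case True then show ?thesis using z b.nonneg[of z] by simp
  next
    case False
    let ?be = "\<lambda>x y. s x y - (\<mu> - \<epsilon>) * (x \<bullet> y)"
    interpret be: pos_form Q ?be
    proof (intro pos_form.intro sym_form_shift pos_form_axioms.intro)
      fix x assume x: "x \<in> Q"
      have "0 \<le> ?b x x + \<epsilon> * (x \<bullet> x)" using b.nonneg[OF x] \<open>\<epsilon> > 0\<close> by (intro add_nonneg_nonneg) auto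
      then show "0 \<le> ?be x x" by (simp add: algebra_simps)
    qed
    define u where "u = U z \<epsilon>"
    have u: "u \<in> Q" unfolding u_def by (rule operD(1)[OF U[OF \<open>\<epsilon> > 0\<close>]])
    have form: "?be x u = x \<bullet> z" if "x \<in> Q" for x
      using operD(2)[OF U[OF \<open>\<epsilon> > 0\<close>, of z] that]
      by (simp add: u_def inner_diff_right inner_right_distrib algebra_simps)
    have "(z \<bullet> z)\<^sup>2 \<le> ?be z z * (u \<bullet> z)" using be.Cauchy_Schwarz[OF z(1) u] form z u by simp
    also have "\<dots> \<le> ?be z z * (2 * norm z / d * norm z)"
      using be.nonneg[OF z(1)]
        order_trans[OF norm_cauchy_schwarz[of u z] mult_right_mono[OF U_le[OF \<open>\<epsilon> > 0\<close>, folded u_def] norm_ge_zero]]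
      by (intro mult_left_mono) auto
    also have "\<dots> = (2 / d) * ?be z z * (z \<bullet> z)"
      by (simp add: power2_norm_eq_inner[symmetric] power2_eq_square)
    finally have "(z \<bullet> z) * (z \<bullet> z) \<le> ((2 / d) * ?be z z) * (z \<bullet> z)" by (simp only: power2_eq_square)
    then have "z \<bullet> z \<le> (2 / d) * ?be z z" by (rule mult_right_le_imp_le) (use False in simp)
    then show ?thesis using \<open>d > 0\<close> by (simp add: field_simps)
  qed
  have "d / 2 * (z \<bullet> z) \<le> ?b z z"
  proof (rule field_le_epsilon)
    fix \<eta> :: real assume "\<eta> > 0"
    define \<epsilon> where "\<epsilon> = \<eta> / (z \<bullet> z + 1)"
    have "z \<bullet> z + 1 > 0" by (simp add: add_nonneg_pos)
    then have "\<epsilon> > 0" "\<epsilon> * (z \<bullet> z) \<le> \<eta>" using \<open>\<eta> > 0\<close> by (auto simp: \<epsilon>_def field_simps)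
    then show "d / 2 * (z \<bullet> z) \<le> ?b z z + \<eta>" using low[OF \<open>\<epsilon> > 0\<close>] by linarith
  qed
  then show ?thesis by (simp add: algebra_simps)
qed

end

section \<open>Quartic perturbation of a form\<close>

context closed_form begin

definition fnorm :: "'h \<Rightarrow> real" where
  "fnorm x = sqrt (s x x + \<kappa> * (x \<bullet> x))"

lemma fnorm_sq: "x \<in> Q \<Longrightarrow> (fnorm x)\<^sup>2 = s x x + \<kappa> * (x \<bullet> x)"
  using order_trans[OF inner_ge_zero coercive[of x]] by (simp add: fnorm_def)

lemma norm_le_fnorm: "x \<in> Q \<Longrightarrow> norm x \<le> fnorm x"
  using coercive[of x] by (simp add: fnorm_def norm_eq_sqrt_inner)

lemma fnorm_nonneg: "x \<in> Q \<Longrightarrow> 0 \<le> fnorm x"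
  using norm_le_fnorm[of x] norm_ge_zero[of x] by linarith

lemma fnorm_scale: "x \<in> Q \<Longrightarrow> fnorm (c *\<^sub>R x) = \<bar>c\<bar> * fnorm x"
proof -
  assume "x \<in> Q"
  then have "s (c *\<^sub>R x) (c *\<^sub>R x) + \<kappa> * (c *\<^sub>R x \<bullet> c *\<^sub>R x) = c\<^sup>2 * (s x x + \<kappa> * (x \<bullet> x))"
    by (simp add: s.bilinear_simps power2_eq_square algebra_simps)
  then show ?thesis by (simp add: fnorm_def real_sqrt_mult)
qed

lemma fnorm_triangle:
  assumes "x \<in> Q" "y \<in> Q"
  shows "fnorm (x + y) \<le> fnorm x + fnorm y"
proof -
  interpret k: complete_form Q "\<lambda>x y. s x y + \<kappa> * (x \<bullet> y)" by (rule closed)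
  have "(fnorm (x + y))\<^sup>2 = (fnorm x)\<^sup>2 + 2 * (s x y + \<kappa> * (x \<bullet> y)) + (fnorm y)\<^sup>2"
    using assms k.sq_add_scale[of x y 1] by (simp add: fnorm_sq)
  also have "\<dots> \<le> (fnorm x)\<^sup>2 + 2 * (fnorm x * fnorm y) + (fnorm y)\<^sup>2"
    using k.abs_le_sqrt[OF assms] by (simp add: fnorm_def)
  also have "\<dots> = (fnorm x + fnorm y)\<^sup>2" by (simp add: power2_eq_square algebra_simps)
  finally show ?thesis
    by (rule power2_le_imp_le) (simp add: fnorm_nonneg assms)
qed

lemma fnorm_minus: "x \<in> Q \<Longrightarrow> fnorm (- x) = fnorm x"
  using fnorm_scale[of x "-1"] by simp

lemma fnorm_diff: "x \<in> Q \<Longrightarrow> y \<in> Q \<Longrightarrow> fnorm (x - y) \<le> fnorm x + fnorm y"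
  using fnorm_triangle[of x "- y"] fnorm_minus[of y] by simp

lemma fnorm_parallelogram:
  assumes "x \<in> Q" "y \<in> Q"
  shows "(fnorm (x + y))\<^sup>2 + (fnorm (x - y))\<^sup>2 = 2 * (fnorm x)\<^sup>2 + 2 * (fnorm y)\<^sup>2"
proof -
  interpret k: complete_form Q "\<lambda>x y. s x y + \<kappa> * (x \<bullet> y)" by (rule closed)
  show ?thesis using assms k.parallelogram[OF assms] by (simp add: fnorm_sq)
qed

end

text \<open>\<open>P x y\<close> stands for the weighted transform of \<open>Re (x * cnj y)\<close>,
  so \<open>P_J\<close> and \<open>P_J0\<close> say that \<open>|u|^2\<close> ignores the phase. The
  single factor \<open>norm x\<close> in \<open>P_bound\<close> makes \<open>P z z\<close> linear
  rather than quadratic in the form norm when \<open>norm z\<close> is at most 1.\<close>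

locale quartic_perturbation = closed_form Q s \<kappa> J
  for Q :: "'h::real_inner set" and s \<kappa> J +
  fixes P :: "'h \<Rightarrow> 'h \<Rightarrow> 'k::real_inner" and C \<mu> \<delta> :: real and e :: 'h
  assumes P_add: "\<And>x y z. x \<in> Q \<Longrightarrow> y \<in> Q \<Longrightarrow> z \<in> Q \<Longrightarrow> P x (y + z) = P x y + P x z"
    and P_scale: "\<And>x y c. x \<in> Q \<Longrightarrow> y \<in> Q \<Longrightarrow> P x (c *\<^sub>R y) = c *\<^sub>R P x y"
    and P_sym: "\<And>x y. x \<in> Q \<Longrightarrow> y \<in> Q \<Longrightarrow> P x y = P y x"
    and P_J: "\<And>x. x \<in> Q \<Longrightarrow> P (J x) (J x) = P x x"
    and P_J0: "\<And>x. x \<in> Q \<Longrightarrow> P x (J x) = 0"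
    and C0: "0 \<le> C"
    and P_bound: "\<And>x. x \<in> Q \<Longrightarrow> norm (P x x) \<le> C * (norm x * fnorm x)"
    and e: "(e, \<mu> *\<^sub>R e) \<in> oper" "norm e = 1"
    and \<delta>: "0 < \<delta>"
    and gap: "\<And>z. z \<in> Q \<Longrightarrow> e \<bullet> z = 0 \<Longrightarrow> J e \<bullet> z = 0 \<Longrightarrow> (\<mu> + \<delta>) * (z \<bullet> z) \<le> s z z"
begin

lemma P_add_left: "x \<in> Q \<Longrightarrow> y \<in> Q \<Longrightarrow> z \<in> Q \<Longrightarrow> P (x + y) z = P x z + P y z"
  by (metis s.Q_add P_add P_sym)

lemma P_scale_left: "x \<in> Q \<Longrightarrow> y \<in> Q \<Longrightarrow> P (c *\<^sub>R x) y = c *\<^sub>R P x y"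
  by (metis s.Q_scale P_scale P_sym)

lemma P_minus: "x \<in> Q \<Longrightarrow> y \<in> Q \<Longrightarrow> P x (- y) = - P x y"
  using P_scale[of x y "-1"] by simp

lemma P_minus_left: "x \<in> Q \<Longrightarrow> y \<in> Q \<Longrightarrow> P (- x) y = - P x y"
  using P_scale_left[of x y "-1"] by simp

lemma P_sq_add: "x \<in> Q \<Longrightarrow> y \<in> Q \<Longrightarrow> P (x + y) (x + y) = P x x + 2 *\<^sub>R P x y + P y y"
  using P_sym[of y x] by (simp add: P_add P_add_left scaleR_2)

lemma P_sq_diff: "x \<in> Q \<Longrightarrow> y \<in> Q \<Longrightarrow> P (x - y) (x - y) = P x x - 2 *\<^sub>R P x y + P y y"
  using P_sq_add[of x "- y"] by (simp add: P_minus P_minus_left)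

text \<open>Polarization gives a bound by the sum of the squared form norms; scaling both arguments
  to form norm 1 converts the sum into a product, with the same constant \<open>C\<close>.\<close>

lemma P_bound2:
  assumes x: "x \<in> Q" and y: "y \<in> Q"
  shows "norm (P x y) \<le> C * (fnorm x * fnorm y)"
proof -
  have diag: "norm (P z z) \<le> C * (fnorm z)\<^sup>2" if "z \<in> Q" for z
  proof -
    have "norm (P z z) \<le> C * (norm z * fnorm z)" by (rule P_bound[OF that])
    also have "\<dots> \<le> C * (fnorm z * fnorm z)"
      using norm_le_fnorm[OF that] fnorm_nonneg[OF that] C0 by (intro mult_left_mono mult_right_mono) auto
    finally show ?thesis by (simp add: power2_eq_square)
  qed
  have pol: "norm (P x y) \<le> C / 2 * ((fnorm x)\<^sup>2 + (fnorm y)\<^sup>2)" if "x \<in> Q" "y \<in> Q" for x y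
  proof -
    have "4 *\<^sub>R P x y = P (x + y) (x + y) - P (x - y) (x - y)"
    proof -
      have "4 *\<^sub>R P x y = 2 *\<^sub>R P x y + 2 *\<^sub>R P x y" by (simp flip: scaleR_left.add)
      then show ?thesis using that by (simp only: P_sq_add P_sq_diff) (simp add: algebra_simps)
    qed
    then have "norm (4 *\<^sub>R P x y) \<le> norm (P (x + y) (x + y)) + norm (P (x - y) (x - y))"
      by (simp only: norm_triangle_ineq4)
    also have "\<dots> \<le> C * (fnorm (x + y))\<^sup>2 + C * (fnorm (x - y))\<^sup>2"
      using that by (intro add_mono diag) auto
    also have "\<dots> = C * (2 * (fnorm x)\<^sup>2 + 2 * (fnorm y)\<^sup>2)"
      unfolding fnorm_parallelogram[OF that, symmetric] by (simp add: distrib_left)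
    finally show ?thesis by (simp add: algebra_simps)
  qed
  show ?thesis
  proof (cases "fnorm x = 0 \<or> fnorm y = 0")
    case True
    then have "x = 0 \<or> y = 0" using norm_le_fnorm x y by force
    moreover have "P x 0 = 0" "P 0 y = 0" using P_scale[of x y 0] P_scale_left[of x y 0] x y by auto
    ultimately show ?thesis using C0 fnorm_nonneg[OF x] fnorm_nonneg[OF y] by auto
  next
    case False
    then have pos: "fnorm x > 0" "fnorm y > 0" using fnorm_nonneg x y by force+
    let ?x = "(1 / fnorm x) *\<^sub>R x" and ?y = "(1 / fnorm y) *\<^sub>R y"
    have "norm (P ?x ?y) \<le> C / 2 * ((fnorm ?x)\<^sup>2 + (fnorm ?y)\<^sup>2)" using x y by (intro pol) auto
    also have "\<dots> = C" using x y pos by (simp add: fnorm_scale)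
    finally show ?thesis using x y pos by (simp add: P_scale P_scale_left field_simps)
  qed
qed

lemma eQ: "e \<in> Q" and ee: "e \<bullet> e = 1" and s_e: "x \<in> Q \<Longrightarrow> s x e = \<mu> * (x \<bullet> e)"
  using operD[OF e(1)] e(2) by (auto simp: norm_eq_1)

definition c1 :: real where "c1 = 1 / (1 + \<bar>\<kappa> + \<mu>\<bar> / \<delta>)"

lemma c1_pos: "c1 > 0"
  using \<delta> by (simp add: c1_def add_pos_nonneg)

text \<open>The squared form norm and the shifted form differ by
  \<open>(\<kappa> + \<mu>) * (z \<bullet> z)\<close>, and the gap bounds this difference by the
  shifted form divided by \<open>\<delta>\<close>. The constant \<open>c1\<close> collects the two
  contributions.\<close>

lemma c1_bound:
  assumes z: "z \<in> Q" "e \<bullet> z = 0" "J e \<bullet> z = 0"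
  shows "c1 * (fnorm z)\<^sup>2 \<le> s z z - \<mu> * (z \<bullet> z)"
proof -
  have g: "\<delta> * (z \<bullet> z) \<le> s z z - \<mu> * (z \<bullet> z)" using gap[OF z] by (simp add: algebra_simps)
  have "(fnorm z)\<^sup>2 = (s z z - \<mu> * (z \<bullet> z)) + (\<kappa> + \<mu>) * (z \<bullet> z)"
    using z by (simp add: fnorm_sq algebra_simps)
  also have "(\<kappa> + \<mu>) * (z \<bullet> z) \<le> \<bar>\<kappa> + \<mu>\<bar> * ((s z z - \<mu> * (z \<bullet> z)) / \<delta>)"
    using g \<delta> by (intro mult_mono) (auto simp: field_simps)
  finally have "(fnorm z)\<^sup>2 \<le> (1 + \<bar>\<kappa> + \<mu>\<bar> / \<delta>) * (s z z - \<mu> * (z \<bullet> z))"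
    by (simp add: distrib_right)
  then show ?thesis
    using \<delta> by (simp add: c1_def pos_divide_le_eq add_pos_nonneg mult.commute)
qed

text \<open>The eigenvector \<open>e\<close> lies in the kernel of the form
  \<open>s - \<mu>\<close>, so removing its component changes the norm but not that form.\<close>

lemma shift_e:
  assumes "w \<in> Q"
  defines "z \<equiv> w - (e \<bullet> w) *\<^sub>R e"
  shows "z \<in> Q" "e \<bullet> z = 0" "J e \<bullet> z = J e \<bullet> w"
    "s z z - \<mu> * (z \<bullet> z) = s w w - \<mu> * (w \<bullet> w)" "z \<bullet> z = w \<bullet> w - (e \<bullet> w)\<^sup>2"
proof -
  show "z \<in> Q" "e \<bullet> z = 0" using assms eQ by (auto simp: inner_diff_right ee)
  show "J e \<bullet> z = J e \<bullet> w" using J_inner_self[of e] by (simp add: z_def inner_diff_right inner_commute)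
  show zz: "z \<bullet> z = w \<bullet> w - (e \<bullet> w)\<^sup>2"
    by (simp add: z_def inner_diff_right inner_diff_left ee power2_eq_square inner_commute)
  have "s z z = s w w - \<mu> * (e \<bullet> w)\<^sup>2"
    using assms eQ s.sym[OF eQ assms(1)]
    by (simp add: s.bilinear_simps s_e ee inner_commute power2_eq_square algebra_simps)
  then show "s z z - \<mu> * (z \<bullet> z) = s w w - \<mu> * (w \<bullet> w)" by (simp add: zz algebra_simps)
qed

section \<open>The energy after elimination of the field, with \<open>t\<close> in the place of
  \<open>g^2\<close>\<close>

definition E :: "real \<Rightarrow> 'h \<Rightarrow> real" where
  "E t u = s u u - t * (norm (P u u))\<^sup>2"

definition normalized :: "'h \<Rightarrow> bool" where
  "normalized u \<longleftrightarrow> u \<in> Q \<and> norm u = 1 \<and> 0 \<le> e \<bullet> u \<and> J e \<bullet> u = 0"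

text \<open>Multiplication by the unit number \<open>a + b i\<close>, chosen to cancel the phase of
  the complex product with \<open>e\<close>, makes this product real and nonnegative. Neither
  \<open>s\<close> nor \<open>P\<close> changes under a phase.\<close>

lemma rotate:
  assumes u: "u \<in> Q" "norm u = 1"
  shows "\<exists>u'. normalized u' \<and> (\<forall>t. E t u' = E t u)"
proof (cases "(e \<bullet> u)\<^sup>2 + (J e \<bullet> u)\<^sup>2 = 0")
  case True
  then show ?thesis using u by (intro exI[of _ u]) (simp add: normalized_def sum_power2_eq_zero_iff)
next
  case False
  define r where "r = sqrt ((e \<bullet> u)\<^sup>2 + (J e \<bullet> u)\<^sup>2)"
  have r: "r > 0" "r\<^sup>2 = (e \<bullet> u)\<^sup>2 + (J e \<bullet> u)\<^sup>2"
    using False by (auto simp: r_def sum_power2_gt_zero_iff sum_power2_eq_zero_iff)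
  define a where "a = (e \<bullet> u) / r"
  define b where "b = - (J e \<bullet> u) / r"
  have "a\<^sup>2 + b\<^sup>2 = ((e \<bullet> u)\<^sup>2 + (J e \<bullet> u)\<^sup>2) / r\<^sup>2"
    by (simp add: a_def b_def power_divide add_divide_distrib)
  then have ab: "a\<^sup>2 + b\<^sup>2 = 1" using r(1) unfolding r(2)[symmetric] by simp
  define u' where "u' = a *\<^sub>R u + b *\<^sub>R J u"
  have uu: "u \<bullet> u = 1" using u by (simp add: norm_eq_1)
  have "u' \<bullet> u' = a\<^sup>2 + b\<^sup>2"
    using J_inner_self[of u]
    by (simp add: u'_def inner_left_distrib inner_right_distrib J_inner uu inner_commute power2_eq_square)
  then have n1: "norm u' = 1" using ab by (simp add: norm_eq_1)
  have "e \<bullet> u' = ((e \<bullet> u)\<^sup>2 + (J e \<bullet> u)\<^sup>2) / r"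
    using J_inner_left[of e u]
    by (simp add: u'_def a_def b_def inner_right_distrib power2_eq_square add_divide_distrib)
  then have n2: "e \<bullet> u' \<ge> 0" using r by simp
  have n3: "J e \<bullet> u' = 0"
    by (simp add: u'_def a_def b_def inner_simps J_inner)
  have Ju: "J u \<in> Q" using u J_Q by simp
  have "s u' u' = (a\<^sup>2 + b\<^sup>2) * s u u"
    using u Ju J_form_self[of u] s.sym[of u "J u"]
    by (simp add: u'_def s.bilinear_simps J_form power2_eq_square algebra_simps)
  moreover have "P u' u' = (a\<^sup>2 + b\<^sup>2) *\<^sub>R P u u"
    using u Ju P_J0[of u] P_sym[of u "J u"]
    by (simp add: u'_def P_add P_add_left P_scale P_scale_left P_J power2_eq_square scaleR_add_left)
  ultimately have "E t u' = E t u" for t by (simp add: E_def ab)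
  moreover have "normalized u'" using n1 n2 n3 u Ju by (simp add: normalized_def u'_def)
  ultimately show ?thesis by blast
qed

definition L :: real where "L = fnorm e"
definition A :: real where "A = norm (P e e)"
text \<open>\<open>B\<close> is the rate at which \<open>P u u\<close> can grow with the distance
  from \<open>e\<close>: \<open>2 * C * L\<close> from the cross term, \<open>C\<close> from
  \<open>P z z\<close>. \<open>K\<close> is the loss in completing the square in
  \<open>E_lower\<close>.\<close>

definition B :: real where "B = 2 * C * L + C"
definition K :: real where "K = 2 * A\<^sup>2 * B\<^sup>2 / c1"

lemma L0: "L \<ge> 0" and A0: "A \<ge> 0" and B0: "B \<ge> 0" and K0: "K \<ge> 0"
  using fnorm_nonneg[OF eQ] C0 c1_pos by (auto simp: L_def A_def B_def K_def)

text \<open>Coercivity provides \<open>c1 * n^2\<close> for the form norm \<open>n\<close> of the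
  part orthogonal to \<open>e\<close>. One quarter absorbs the term of second order in
  \<open>n\<close>, one half absorbs the linear term at the price \<open>K * t^2\<close>, and the
  remaining quarter later confines near-minimizers to a neighbourhood of the line through
  \<open>e\<close>.\<close>

lemma E_lower:
  assumes u: "normalized u" and t: "0 \<le> t" "t * B\<^sup>2 \<le> c1 / 4"
  shows "\<mu> - t * A\<^sup>2 + c1 / 4 * (fnorm (u - (e \<bullet> u) *\<^sub>R e))\<^sup>2 - K * t\<^sup>2 \<le> E t u"
proof -
  define z where "z = u - (e \<bullet> u) *\<^sub>R e"
  have uQ: "u \<in> Q" and uu: "u \<bullet> u = 1" and a: "0 \<le> e \<bullet> u" "J e \<bullet> u = 0"
    using u by (auto simp: normalized_def norm_eq_1)
  note z = shift_e[OF uQ, folded z_def]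
  define n where "n = fnorm z"
  have n: "n \<ge> 0" using z fnorm_nonneg by (simp add: n_def)
  have a1: "(e \<bullet> u)\<^sup>2 \<le> 1" using z(5) uu inner_ge_zero[of z] by simp
  then have a1': "e \<bullet> u \<le> 1" using power2_le_imp_le[of "e \<bullet> u" 1] by simp
  have z1: "norm z \<le> 1" using z(5) uu by (simp add: norm_eq_sqrt_inner)
  have "u = (e \<bullet> u) *\<^sub>R e + z" by (simp add: z_def)
  then have "P u u = (e \<bullet> u)\<^sup>2 *\<^sub>R P e e + (2 * (e \<bullet> u)) *\<^sub>R P e z + P z z"
    using P_sq_add[of "(e \<bullet> u) *\<^sub>R e" z] eQ z(1)
    by (simp add: P_scale P_scale_left power2_eq_square)
  then have "norm (P u u) \<le> norm ((e \<bullet> u)\<^sup>2 *\<^sub>R P e e) + norm ((2 * (e \<bullet> u)) *\<^sub>R P e z) + norm (P z z)"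
    by (simp add: norm_triangle_mono)
  also have "norm ((e \<bullet> u)\<^sup>2 *\<^sub>R P e e) \<le> A"
    using mult_right_mono[OF a1 A0] by (simp add: A_def)
  also have "norm ((2 * (e \<bullet> u)) *\<^sub>R P e z) \<le> 2 * (C * (L * n))"
    using mult_mono[OF a1' P_bound2[OF eQ z(1)]] a by (simp add: L_def n_def)
  also have "norm (P z z) \<le> C * n"
    using P_bound[OF z(1)] mult_right_mono[OF z1 n] C0
    by (simp add: n_def) (meson mult_left_mono order_trans)
  finally have "norm (P u u) \<le> A + B * n" by (simp add: B_def algebra_simps)
  then have "t * (norm (P u u))\<^sup>2 \<le> t * (A + B * n)\<^sup>2"
    using t by (intro mult_left_mono power_mono) auto
  also have "\<dots> = t * A\<^sup>2 + 2 * t * A * B * n + t * B\<^sup>2 * n\<^sup>2"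
    by (simp add: power2_eq_square algebra_simps)
  also have "t * B\<^sup>2 * n\<^sup>2 \<le> c1 / 4 * n\<^sup>2" using t by (intro mult_right_mono) auto
  finally have 1: "t * (norm (P u u))\<^sup>2 \<le> t * A\<^sup>2 + 2 * t * A * B * n + c1 / 4 * n\<^sup>2" by simp
  have "0 \<le> (c1 * n - 2 * t * A * B)\<^sup>2 / (2 * c1)" using c1_pos by simp
  also have "\<dots> = c1 / 2 * n\<^sup>2 - 2 * t * A * B * n + K * t\<^sup>2"
    using c1_pos by (simp add: K_def power2_eq_square field_simps)
  finally have 2: "2 * t * A * B * n \<le> c1 / 2 * n\<^sup>2 + K * t\<^sup>2" by simp
  have "c1 * n\<^sup>2 \<le> s u u - \<mu>"
    using c1_bound[of z] z a uu by (simp add: n_def)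
  then show ?thesis using 1 2 unfolding E_def n_def[symmetric] z_def[symmetric] by argo
qed

text \<open>The midpoint \<open>p\<close>, once normalized, cannot have energy below
  \<open>m\<close>. By the parallelogram identity this leaves only \<open>\<epsilon>\<close> and a
  quartic remainder of size \<open>t\<close> for the form at half the difference \<open>d\<close>,
  and smallness of \<open>t\<close> lets coercivity absorb the remainder.\<close>

lemma near_minimizers_close:
  assumes u: "normalized u" "fnorm (u - (e \<bullet> u) *\<^sub>R e) \<le> 1 / 2"
    and v: "normalized v" "fnorm (v - (e \<bullet> v) *\<^sub>R e) \<le> 1 / 2"
    and t: "0 \<le> t" "t * (7 * C\<^sup>2 * (L + 1)\<^sup>2) \<le> c1 / (2 * (L + 1)\<^sup>2)"
    and m: "\<And>x. x \<in> Q \<Longrightarrow> norm x = 1 \<Longrightarrow> m \<le> E t x" "m \<le> \<mu>"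
    and Em: "E t u \<le> m + \<epsilon>" "E t v \<le> m + \<epsilon>"
  shows "(fnorm (u - v))\<^sup>2 \<le> 8 * (L + 1)\<^sup>2 / c1 * \<epsilon>"
proof -
  define p where "p = (1/2) *\<^sub>R (u + v)"
  define d where "d = (1/2) *\<^sub>R (u - v)"
  have "p + d = (1/2) *\<^sub>R (u + u)" "p - d = (1/2) *\<^sub>R (v + v)"
    unfolding p_def d_def by (simp_all add: scaleR_add_right scaleR_diff_right)
  then have upd: "u = p + d" and vpd: "v = p - d" by simp_all
  have uQ: "u \<in> Q" "u \<bullet> u = 1" "0 \<le> e \<bullet> u" "J e \<bullet> u = 0" and vQ: "v \<in> Q" "v \<bullet> v = 1" "0 \<le> e \<bullet> v" "J e \<bullet> v = 0"
    using u v by (auto simp: normalized_def norm_eq_1)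
  have pQ: "p \<in> Q" and dQ: "d \<in> Q" using uQ vQ by (auto simp: p_def d_def)
  have facts: "1/2 \<le> e \<bullet> w \<and> fnorm w \<le> L + 1"
    if w: "w \<in> Q" "w \<bullet> w = 1" "0 \<le> e \<bullet> w" "fnorm (w - (e \<bullet> w) *\<^sub>R e) \<le> 1 / 2" for w
  proof -
    define z where "z = w - (e \<bullet> w) *\<^sub>R e"
    note z = shift_e[OF w(1), folded z_def]
    have "norm z \<le> 1/2" using norm_le_fnorm[OF z(1)] w(4) by (simp add: z_def)
    then have "(norm z)\<^sup>2 \<le> (1/2)\<^sup>2" by (intro power_mono) auto
    then have "(1/2)\<^sup>2 \<le> (e \<bullet> w)\<^sup>2"
      using z(5) w(2) unfolding power2_norm_eq_inner by (simp add: power2_eq_square)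
    then have 1: "1/2 \<le> e \<bullet> w" using w(3) by (rule power2_le_imp_le)
    have "(e \<bullet> w)\<^sup>2 \<le> 1" using z(5) w(2) inner_ge_zero[of z] by simp
    then have "\<bar>e \<bullet> w\<bar> \<le> 1" by (simp add: abs_square_le_1)
    then have "fnorm ((e \<bullet> w) *\<^sub>R e) \<le> L"
      using mult_right_mono[of "\<bar>e \<bullet> w\<bar>" 1 L] L0 by (simp add: fnorm_scale eQ L_def)
    then have "fnorm w \<le> L + 1"
      using fnorm_triangle[of "(e \<bullet> w) *\<^sub>R e" z] z(1) eQ w(4) by (simp add: z_def)
    then show ?thesis using 1 by simp
  qed
  have eu: "1/2 \<le> e \<bullet> u" "fnorm u \<le> L + 1" and ev: "1/2 \<le> e \<bullet> v" "fnorm v \<le> L + 1"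
    using facts uQ vQ u(2) v(2) by auto
  have np: "fnorm p \<le> L + 1"
    using fnorm_triangle[OF uQ(1) vQ(1)] eu ev uQ vQ by (simp add: p_def fnorm_scale)
  have nd: "fnorm d \<le> L + 1"
    using fnorm_diff[OF uQ(1) vQ(1)] eu ev uQ vQ by (simp add: d_def fnorm_scale)
  have np0: "0 \<le> fnorm p" and nd0: "0 \<le> fnorm d" using fnorm_nonneg pQ dQ by auto
  have "p \<bullet> p + 2 * (p \<bullet> d) + d \<bullet> d = 1" "p \<bullet> p - 2 * (p \<bullet> d) + d \<bullet> d = 1"
    using uQ(2) vQ(2) unfolding upd vpd by (simp_all add: inner_simps inner_commute)
  then have pp: "p \<bullet> p = 1 - d \<bullet> d" and pd: "p \<bullet> d = 0" by linarith+
  have ep: "1/2 \<le> e \<bullet> p" using eu ev by (simp add: p_def inner_right_distrib)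
  have p1: "p \<bullet> p \<le> 1" using pp by simp
  have "p \<noteq> 0" using ep by auto
  then have ppos: "p \<bullet> p > 0" by simp
  have mp: "m * (p \<bullet> p) \<le> s p p - t * (norm (P p p))\<^sup>2"
  proof -
    define q where "q = (1 / norm p) *\<^sub>R p"
    have np2: "(norm p)\<^sup>2 = p \<bullet> p" by (simp add: power2_norm_eq_inner)
    have "m \<le> E t q" using \<open>p \<noteq> 0\<close> pQ by (intro m) (auto simp: q_def)
    moreover have "s q q = s p p / (p \<bullet> p)"
      using pQ by (simp add: q_def s.bilinear_simps np2[symmetric] power2_eq_square)
    moreover have "norm (P q q) = norm (P p p) / (p \<bullet> p)"
      using pQ by (simp add: q_def P_scale P_scale_left np2[symmetric] power2_eq_square)
    ultimately have "m \<le> s p p / (p \<bullet> p) - t * (norm (P p p) / (p \<bullet> p))\<^sup>2" by (simp add: E_def)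
    then have "m * (p \<bullet> p) \<le> (s p p / (p \<bullet> p) - t * (norm (P p p) / (p \<bullet> p))\<^sup>2) * (p \<bullet> p)"
      using ppos by (intro mult_right_mono) auto
    also have "\<dots> = s p p - t * ((norm (P p p))\<^sup>2 / (p \<bullet> p))"
      using ppos by (simp add: power2_eq_square field_simps)
    also have "(norm (P p p))\<^sup>2 \<le> (norm (P p p))\<^sup>2 / (p \<bullet> p)"
      using ppos p1 by (simp add: pos_le_divide_eq mult_left_le)
    then have "s p p - t * ((norm (P p p))\<^sup>2 / (p \<bullet> p)) \<le> s p p - t * (norm (P p p))\<^sup>2"
      using t by (intro diff_left_mono mult_left_mono)
    finally show ?thesis .
  qed
  have spar: "s u u + s v v = 2 * s p p + 2 * s d d"
    unfolding upd vpd by (rule s.parallelogram[OF pQ dQ])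
  define X where "X = ((norm (P u u))\<^sup>2 + (norm (P v v))\<^sup>2) / 2 - (norm (P p p))\<^sup>2"
  \<comment> \<open>The factor 7 is 2 + 1 + 4, the coefficients in the expansion of \<open>X\<close>
    into products of \<open>P p p\<close>, \<open>P d d\<close> and \<open>P p d\<close>.\<close>
  have Xbd: "X \<le> 7 * C\<^sup>2 * (L + 1)\<^sup>2 * (fnorm d)\<^sup>2"
  proof -
    have "P u u = (P p p + P d d) + 2 *\<^sub>R P p d" "P v v = (P p p + P d d) - 2 *\<^sub>R P p d"
      unfolding upd vpd using pQ dQ by (auto simp: P_sq_add P_sq_diff)
    then have "X = 2 * (P p p \<bullet> P d d) + (norm (P d d))\<^sup>2 + 4 * (norm (P p d))\<^sup>2"
      unfolding X_def power2_norm_eq_inner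
      by (simp add: inner_simps inner_commute) (simp add: field_simps)
    also have "P p p \<bullet> P d d \<le> (C * (fnorm p * fnorm p)) * (C * (fnorm d * fnorm d))"
      using norm_cauchy_schwarz[of "P p p" "P d d"] P_bound2[OF pQ pQ] P_bound2[OF dQ dQ] C0
      by (meson mult_mono norm_ge_zero order_trans)
    also have "\<dots> \<le> (C * ((L + 1) * (L + 1))) * (C * (fnorm d * fnorm d))"
      using np np0 C0 nd0 L0 by (intro mult_right_mono mult_left_mono mult_mono) auto
    also have "(norm (P d d))\<^sup>2 \<le> (C * ((L + 1) * fnorm d))\<^sup>2"
      using P_bound2[OF dQ dQ] mult_left_mono[OF mult_right_mono[OF nd nd0] C0]
      by (intro power_mono) auto
    also have "(norm (P p d))\<^sup>2 \<le> (C * ((L + 1) * fnorm d))\<^sup>2"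
      using P_bound2[OF pQ dQ] mult_left_mono[OF mult_right_mono[OF np nd0] C0]
      by (intro power_mono) auto
    finally show ?thesis by (simp add: power2_eq_square algebra_simps)
  qed
  have sd: "s d d - m * (d \<bullet> d) \<le> \<epsilon> + t * X"
  proof -
    have "s u u + s v v \<le> 2 * m + 2 * \<epsilon> + t * ((norm (P u u))\<^sup>2 + (norm (P v v))\<^sup>2)"
      using Em by (simp add: E_def algebra_simps)
    moreover have "t * ((norm (P u u))\<^sup>2 + (norm (P v v))\<^sup>2) = 2 * (t * X) + 2 * (t * (norm (P p p))\<^sup>2)"
      by (simp add: X_def algebra_simps)
    moreover have "m * (p \<bullet> p) = m - m * (d \<bullet> d)" by (simp add: pp algebra_simps)
    ultimately show ?thesis using spar mp by argo
  qed
  define z where "z = d - (e \<bullet> d) *\<^sub>R e"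
  note z = shift_e[OF dQ, folded z_def]
  have Jd: "J e \<bullet> d = 0" using uQ vQ by (simp add: d_def inner_simps)
  have "c1 * (fnorm z)\<^sup>2 \<le> s d d - \<mu> * (d \<bullet> d)" using c1_bound[of z] z Jd by simp
  also have "\<dots> \<le> s d d - m * (d \<bullet> d)" using m(2) by (simp add: mult_right_mono)
  finally have zb: "c1 * (fnorm z)\<^sup>2 \<le> \<epsilon> + t * X" using sd by linarith
  \<comment> \<open>Coercivity says nothing about the component of \<open>d\<close> along
    \<open>e\<close>. But \<open>d\<close> is orthogonal to \<open>p\<close>, because
    \<open>u\<close> and \<open>v\<close> have equal norm; \<open>p\<close> has component at least
    1/2 along \<open>e\<close>, and its remaining part has norm at most 1/2. So the component along
    \<open>e\<close> is bounded by the rest of \<open>d\<close>.\<close>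
  have "\<bar>e \<bullet> d\<bar> \<le> fnorm z"
  proof -
    define y where "y = p - (e \<bullet> p) *\<^sub>R e"
    note y = shift_e[OF pQ, folded y_def]
    have "p \<bullet> d = (e \<bullet> p) * (e \<bullet> d) + y \<bullet> z"
      by (simp add: y_def z_def inner_simps ee inner_commute)
    then have "(e \<bullet> p) * (e \<bullet> d) = - (y \<bullet> z)" using pd by simp
    then have "\<bar>(e \<bullet> p) * (e \<bullet> d)\<bar> = \<bar>y \<bullet> z\<bar>" by simp
    then have "(e \<bullet> p) * \<bar>e \<bullet> d\<bar> = \<bar>y \<bullet> z\<bar>" using ep by (simp add: abs_mult)
    also have "\<dots> \<le> norm y * norm z" by (rule Cauchy_Schwarz_ineq2)
    also have "\<dots> \<le> (e \<bullet> p) * norm z"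
    proof (rule mult_right_mono)
      have "y = (1/2) *\<^sub>R (u - (e \<bullet> u) *\<^sub>R e) + (1/2) *\<^sub>R (v - (e \<bullet> v) *\<^sub>R e)"
        by (simp add: y_def p_def inner_right_distrib scaleR_add_right scaleR_add_left scaleR_diff_right add_divide_distrib)
      then have "norm y \<le> norm ((1/2) *\<^sub>R (u - (e \<bullet> u) *\<^sub>R e)) + norm ((1/2) *\<^sub>R (v - (e \<bullet> v) *\<^sub>R e))"
        by (metis norm_triangle_ineq)
      then have "norm y \<le> 1/2"
        using norm_le_fnorm[OF shift_e(1)[OF uQ(1)]] norm_le_fnorm[OF shift_e(1)[OF vQ(1)]] u(2) v(2) by simp
      then show "norm y \<le> e \<bullet> p" using ep by linarith
    qed simp
    finally have "\<bar>e \<bullet> d\<bar> \<le> norm z" using ep by simp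
    then show ?thesis using norm_le_fnorm[OF z(1)] by linarith
  qed
  then have "fnorm ((e \<bullet> d) *\<^sub>R e) \<le> fnorm z * L"
    using L0 mult_right_mono by (auto simp: fnorm_scale eQ L_def)
  then have "fnorm d \<le> (L + 1) * fnorm z"
    using fnorm_triangle[of "(e \<bullet> d) *\<^sub>R e" z] z(1) eQ by (simp add: z_def algebra_simps)
  then have "(fnorm d)\<^sup>2 \<le> ((L + 1) * fnorm z)\<^sup>2" using nd0 by (intro power_mono) auto
  then have "(fnorm d)\<^sup>2 \<le> (L + 1)\<^sup>2 * (fnorm z)\<^sup>2" by (simp only: power_mult_distrib)
  then have "c1 / (L + 1)\<^sup>2 * (fnorm d)\<^sup>2 \<le> c1 / (L + 1)\<^sup>2 * ((L + 1)\<^sup>2 * (fnorm z)\<^sup>2)"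
    using c1_pos by (intro mult_left_mono) auto
  also have "\<dots> = c1 * (fnorm z)\<^sup>2" using L0 by simp
  finally have d1: "c1 / (L + 1)\<^sup>2 * (fnorm d)\<^sup>2 \<le> c1 * (fnorm z)\<^sup>2" .
  have "t * X \<le> t * (7 * C\<^sup>2 * (L + 1)\<^sup>2) * (fnorm d)\<^sup>2"
    using mult_left_mono[OF Xbd t(1)] by (simp add: mult.assoc)
  also have "\<dots> \<le> c1 / (2 * (L + 1)\<^sup>2) * (fnorm d)\<^sup>2" using t(2) by (intro mult_right_mono) auto
  finally have "c1 / (L + 1)\<^sup>2 * (fnorm d)\<^sup>2 \<le> \<epsilon> + c1 / (2 * (L + 1)\<^sup>2) * (fnorm d)\<^sup>2"
    using zb d1 by linarith
  moreover have "c1 / (L + 1)\<^sup>2 = 2 * (c1 / (2 * (L + 1)\<^sup>2))" by simp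
  ultimately have "c1 / (2 * (L + 1)\<^sup>2) * (fnorm d)\<^sup>2 \<le> \<epsilon>" by (simp only: mult.assoc)
  moreover have "(fnorm d)\<^sup>2 = (fnorm (u - v))\<^sup>2 / 4"
    using uQ vQ by (simp add: d_def fnorm_scale power2_eq_square)
  ultimately have "c1 / (8 * (L + 1)\<^sup>2) * (fnorm (u - v))\<^sup>2 \<le> \<epsilon>" by simp
  then have "8 * (L + 1)\<^sup>2 / c1 * (c1 / (8 * (L + 1)\<^sup>2) * (fnorm (u - v))\<^sup>2) \<le> 8 * (L + 1)\<^sup>2 / c1 * \<epsilon>"
    using c1_pos by (intro mult_left_mono) auto
  then show ?thesis using c1_pos L0 by simp
qed

theorem minimizer:
  "\<exists>T>0. \<forall>t. 0 \<le> t \<longrightarrow> t < T \<longrightarrow> (\<exists>u\<in>Q. norm u = 1 \<and> (\<forall>x\<in>Q. norm x = 1 \<longrightarrow> E t u \<le> E t x) \<and>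
     \<mu> - t * A\<^sup>2 - K * t\<^sup>2 \<le> E t u)"
proof -
  \<comment> \<open>In this order: \<open>t \<le> 1\<close> for \<open>K * t^2 \<le> K * t\<close>,
    the hypothesis of \<open>E_lower\<close>, the confinement of near-minimizers, and the hypothesis
    of \<open>near_minimizers_close\<close>. The added 1 keeps the denominators positive.\<close>
  define T where "T = min 1 (min (c1 / (4 * (B\<^sup>2 + 1))) (min (c1 / (32 * (K + 1)))
     (c1 / (2 * (L + 1)\<^sup>2) / (7 * C\<^sup>2 * (L + 1)\<^sup>2 + 1))))"
  have L1: "(L + 1)\<^sup>2 > 0" using L0 by simp
  have "T > 0"
    using c1_pos K0 L1 by (auto simp: T_def intro!: divide_pos_pos mult_pos_pos add_nonneg_pos)
  have le_div: "t * a \<le> b" if "0 \<le> t" "t < b / (a + 1)" "0 \<le> a" for t a b :: real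
  proof -
    have "t * (a + 1) \<le> b" using that by (simp add: pos_less_divide_eq add_nonneg_pos)
    then show ?thesis using that by (simp add: algebra_simps)
  qed
  have "\<exists>u\<in>Q. norm u = 1 \<and> (\<forall>x\<in>Q. norm x = 1 \<longrightarrow> E t u \<le> E t x) \<and> \<mu> - t * A\<^sup>2 - K * t\<^sup>2 \<le> E t u"
    if t: "0 \<le> t" "t < T" for t
  proof -
    have t1: "t \<le> 1" using t by (simp add: T_def)
    have t2: "t * B\<^sup>2 \<le> c1 / 4"
      using t by (intro le_div) (auto simp: T_def)
    have t3: "K * t\<^sup>2 \<le> c1 / 32"
    proof -
      have "t * K \<le> c1 / 32" using t K0 by (intro le_div) (auto simp: T_def)
      moreover have "K * t\<^sup>2 \<le> t * K"
        using t1 t K0 mult_left_mono[of "t * t" t K] mult_left_mono[of t 1 t] by (simp add: power2_eq_square mult.commute)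
      ultimately show ?thesis by linarith
    qed
    have t4: "t * (7 * C\<^sup>2 * (L + 1)\<^sup>2) \<le> c1 / (2 * (L + 1)\<^sup>2)"
      using t by (intro le_div) (auto simp: T_def)
    have low: "\<mu> - t * A\<^sup>2 - K * t\<^sup>2 \<le> E t x" if x: "x \<in> Q" "norm x = 1" for x
    proof -
      obtain x' where x': "normalized x'" "E t x' = E t x" using rotate[OF x] by blast
      have "0 \<le> c1 / 4 * (fnorm (x' - (e \<bullet> x') *\<^sub>R e))\<^sup>2" using c1_pos by simp
      then show ?thesis using E_lower[OF x'(1) t(1) t2] x'(2) by linarith
    qed
    define m where "m = Inf (E t ` {x \<in> Q. norm x = 1})"
    have bdd: "bdd_below (E t ` {x \<in> Q. norm x = 1})" by (rule bdd_belowI2) (use low in auto)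
    have eS: "e \<in> {x \<in> Q. norm x = 1}" using eQ e by simp
    have m_le: "m \<le> E t x" if "x \<in> Q" "norm x = 1" for x
      unfolding m_def using that by (intro cINF_lower bdd) auto
    have Ee: "E t e = \<mu> - t * A\<^sup>2" by (simp add: E_def A_def s_e eQ ee)
    have m\<mu>: "m \<le> \<mu> - t * A\<^sup>2" using m_le[of e] eS Ee by simp
    then have m\<mu>': "m \<le> \<mu>" using mult_nonneg_nonneg[OF t(1) zero_le_power2[of A]] by linarith
    \<comment> \<open>With \<open>K * t^2\<close> and \<open>\<epsilon> 0\<close> both at most
      \<open>c1 / 32\<close>, \<open>E_lower\<close> leaves \<open>c1 / 16\<close>, which is
      \<open>c1 / 4\<close> times the square of the radius 1/2 in
      \<open>near_minimizers_close\<close>.\<close>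
    define \<epsilon> where "\<epsilon> n = c1 / 32 * inverse (real (Suc n))" for n
    have \<epsilon>pos: "\<epsilon> n > 0" for n using c1_pos by (simp add: \<epsilon>_def)
    have \<epsilon>0: "\<epsilon> \<longlonglongrightarrow> 0" unfolding \<epsilon>_def by (rule tendsto_mult_right_zero[OF LIMSEQ_inverse_real_of_nat])
    have \<epsilon>le: "\<epsilon> n \<le> \<epsilon> k" if "k \<le> n" for k n
      unfolding \<epsilon>_def using that c1_pos by (intro mult_left_mono le_imp_inverse_le) auto
    have "\<exists>x. normalized x \<and> E t x \<le> m + \<epsilon> n" for n
    proof -
      have "\<exists>y\<in>E t ` {x \<in> Q. norm x = 1}. y < m + \<epsilon> n"
        using eS \<epsilon>pos[of n] by (intro cInf_lessD) (auto simp: m_def)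
      then obtain x where x: "x \<in> Q" "norm x = 1" "E t x < m + \<epsilon> n" by auto
      then show ?thesis using rotate[OF x(1,2)] by (metis less_imp_le)
    qed
    then obtain X where X: "\<And>n. normalized (X n)" "\<And>n. E t (X n) \<le> m + \<epsilon> n" by metis
    have XQ: "X n \<in> Q" for n using X(1) by (simp add: normalized_def)
    have half: "fnorm (X n - (e \<bullet> X n) *\<^sub>R e) \<le> 1 / 2" for n
    proof -
      have "c1 / 4 * (fnorm (X n - (e \<bullet> X n) *\<^sub>R e))\<^sup>2 \<le> c1 / 32 + \<epsilon> n"
        using E_lower[OF X(1)[of n] t(1) t2] X(2)[of n] m\<mu> t3 by linarith
      also have "\<dots> \<le> c1 / 32 + \<epsilon> 0" using \<epsilon>le[of 0 n] by simp
      also have "\<dots> = c1 / 4 * (1/2)\<^sup>2" by (simp add: \<epsilon>_def power2_eq_square)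
      finally have "(fnorm (X n - (e \<bullet> X n) *\<^sub>R e))\<^sup>2 \<le> (1/2)\<^sup>2" using c1_pos by simp
      then show ?thesis by (rule power2_le_imp_le) simp
    qed
    interpret k: complete_form Q "\<lambda>x y. s x y + \<kappa> * (x \<bullet> y)" by (rule closed)
    define c where "c = 8 * (L + 1)\<^sup>2 / c1"
    have c: "c > 0" using c1_pos L1 by (simp add: c_def)
    have "\<exists>u\<in>Q. (\<lambda>n. s (X n - u) (X n - u) + \<kappa> * ((X n - u) \<bullet> (X n - u))) \<longlonglongrightarrow> 0"
    proof (rule k.complete[OF XQ])
      fix \<eta> :: real assume "\<eta> > 0"
      have "(\<lambda>n. c * \<epsilon> n) \<longlonglongrightarrow> c * 0" by (intro tendsto_intros \<epsilon>0)
      then have "\<forall>\<^sub>F n in sequentially. c * \<epsilon> n < \<eta>"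
        using \<open>\<eta> > 0\<close> order_tendstoD(2) by fastforce
      then obtain N where N: "c * \<epsilon> N < \<eta>" by (auto simp: eventually_sequentially)
      have "s (X i - X j) (X i - X j) + \<kappa> * ((X i - X j) \<bullet> (X i - X j)) < \<eta>" if "i \<ge> N" "j \<ge> N" for i j
      proof -
        have "(fnorm (X i - X j))\<^sup>2 \<le> 8 * (L + 1)\<^sup>2 / c1 * \<epsilon> N"
          using X(2)[of i] X(2)[of j] \<epsilon>le[OF that(1)] \<epsilon>le[OF that(2)]
          by (intro near_minimizers_close[OF X(1) half X(1) half t(1) t4 m_le m\<mu>']) auto
        then show ?thesis using N fnorm_sq[of "X i - X j"] XQ by (simp add: c_def)
      qed
      then show "\<exists>N. \<forall>m\<ge>N. \<forall>n\<ge>N. s (X m - X n) (X m - X n) + \<kappa> * ((X m - X n) \<bullet> (X m - X n)) < \<eta>"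
        by blast
    qed
    then obtain u where u: "u \<in> Q" "(\<lambda>n. (fnorm (X n - u))\<^sup>2) \<longlonglongrightarrow> 0"
      using XQ by (auto simp: fnorm_sq)
    have "(\<lambda>n. sqrt ((fnorm (X n - u))\<^sup>2)) \<longlonglongrightarrow> sqrt 0" using u(2) by (intro tendsto_intros)
    then have f0: "(\<lambda>n. fnorm (X n - u)) \<longlonglongrightarrow> 0" using XQ u by (simp add: fnorm_nonneg)
    have "(\<lambda>n. X n - u) \<longlonglongrightarrow> 0"
      by (rule Lim_null_comparison[OF _ f0]) (use norm_le_fnorm XQ u in auto)
    then have Xu: "X \<longlonglongrightarrow> u" by (simp add: LIM_zero_iff)
    have "(\<lambda>n. norm (X n)) \<longlonglongrightarrow> norm u" by (intro tendsto_intros Xu)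
    then have nu: "norm u = 1" using X(1) by (simp add: normalized_def LIMSEQ_const_iff)
    have Plim: "(\<lambda>n. P (X n) (X n)) \<longlonglongrightarrow> P u u"
    proof -
      have "(\<lambda>n. 2 * (C * (fnorm u * fnorm (X n - u))) + C * (fnorm (X n - u) * fnorm (X n - u)))
          \<longlonglongrightarrow> 2 * (C * (fnorm u * 0)) + C * (0 * 0)"
        by (intro tendsto_intros f0)
      then have "(\<lambda>n. 2 * (C * (fnorm u * fnorm (X n - u))) + C * (fnorm (X n - u) * fnorm (X n - u))) \<longlonglongrightarrow> 0"
        by simp
      then have "(\<lambda>n. P (X n) (X n) - P u u) \<longlonglongrightarrow> 0"
      proof (rule Lim_null_comparison[rotated], intro always_eventually allI)
        fix n
        define d where "d = X n - u"
        have d: "d \<in> Q" using XQ u by (simp add: d_def)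
        have "X n = u + d" by (simp add: d_def)
        then have "P (X n) (X n) - P u u = 2 *\<^sub>R P u d + P d d" using u d by (simp add: P_sq_add)
        then have "norm (P (X n) (X n) - P u u) \<le> 2 * norm (P u d) + norm (P d d)"
          using norm_triangle_ineq[of "2 *\<^sub>R P u d" "P d d"] by simp
        then show "norm (P (X n) (X n) - P u u)
          \<le> 2 * (C * (fnorm u * fnorm (X n - u))) + C * (fnorm (X n - u) * fnorm (X n - u))"
          using P_bound2[OF u(1) d] P_bound2[OF d d] by (simp add: d_def)
      qed
      then show ?thesis by (simp add: LIM_zero_iff)
    qed
    have slim: "(\<lambda>n. s (X n) (X n)) \<longlonglongrightarrow> s u u"
    proof -
      have "(\<lambda>n. (fnorm (X n))\<^sup>2 - \<kappa> * (X n \<bullet> X n)) \<longlonglongrightarrow> (fnorm u)\<^sup>2 - \<kappa> * (u \<bullet> u)"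
      proof (intro tendsto_intros Xu)
        have "(\<lambda>n. fnorm (X n) - fnorm u) \<longlonglongrightarrow> 0"
        proof (rule Lim_null_comparison[OF _ f0], intro always_eventually allI)
          fix n
          have "fnorm (X n) \<le> fnorm (X n - u) + fnorm u" "fnorm u \<le> fnorm (X n) + fnorm (X n - u)"
            using fnorm_triangle[of "X n - u" u] fnorm_diff[of "X n" "X n - u"] XQ u by auto
          then show "norm (fnorm (X n) - fnorm u) \<le> fnorm (X n - u)" by (simp add: abs_le_iff)
        qed
        then show "(\<lambda>n. fnorm (X n)) \<longlonglongrightarrow> fnorm u" by (simp add: LIM_zero_iff)
      qed
      then show ?thesis using XQ u by (simp add: fnorm_sq)
    qed
    have Elim: "(\<lambda>n. E t (X n)) \<longlonglongrightarrow> E t u"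
      unfolding E_def by (intro tendsto_intros slim Plim)
    have "(\<lambda>n. m + \<epsilon> n) \<longlonglongrightarrow> m + 0" by (intro tendsto_intros \<epsilon>0)
    then have "E t u \<le> m + 0" using Elim X(2) by (intro LIMSEQ_le[of _ _ "\<lambda>n. m + \<epsilon> n"]) auto
    then show ?thesis using u(1) nu m_le low by (intro bexI[of _ u]) (auto intro: order_trans)
  qed
  then show ?thesis using \<open>T > 0\<close> by blast
qed

end

section \<open>Fourier bound for a weakly integrable weight\<close>

lemma cnj_measurable [measurable (raw)]:
  "f \<in> borel_measurable M \<Longrightarrow> (\<lambda>x. cnj (f x)) \<in> borel_measurable M"
  by (rule borel_measurable_continuous_on[OF continuous_on_cnj[OF continuous_on_id]])

lemma borel_measurable_fst_snd [measurable (raw)]: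
  fixes f :: "'a \<Rightarrow> 'b::topological_space \<times> 'c::topological_space"
  assumes "f \<in> borel_measurable M"
  shows "(\<lambda>x. fst (f x)) \<in> borel_measurable M" "(\<lambda>x. snd (f x)) \<in> borel_measurable M"
  by (rule borel_measurable_continuous_on[OF continuous_on_fst[OF continuous_on_id] assms],
      rule borel_measurable_continuous_on[OF continuous_on_snd[OF continuous_on_id] assms])

lemma borel_measurable_pair_id [measurable]:
  "(\<lambda>x. x) \<in> borel_measurable (borel \<Otimes>\<^sub>M (borel :: 'b::second_countable_topology measure) :: ('a::second_countable_topology \<times> 'b) measure)"
  by (simp add: borel_prod)

lemma nn_integral_lborel_shift:
  fixes f :: "'a::euclidean_space \<Rightarrow> ennreal"
  assumes [measurable]: "f \<in> borel_measurable borel"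
  shows "(\<integral>\<^sup>+x. f (x + h) \<partial>lborel) = (\<integral>\<^sup>+x. f x \<partial>lborel)"
proof -
  have "(\<integral>\<^sup>+x. f x \<partial>lborel) = (\<integral>\<^sup>+x. f x \<partial>distr lborel borel ((+) h))"
    by (simp add: lborel_distr_plus)
  also have "\<dots> = (\<integral>\<^sup>+x. f (h + x) \<partial>lborel)" by (simp add: nn_integral_distr)
  finally show ?thesis by (simp add: add.commute)
qed

lemma integral_lborel_shift:
  fixes f :: "'a::euclidean_space \<Rightarrow> 'b::{banach, second_countable_topology}"
  assumes [measurable]: "f \<in> borel_measurable borel"
  shows "(\<integral>x. f (x + h) \<partial>lborel) = (\<integral>x. f x \<partial>lborel)"
proof -
  have "(\<integral>x. f x \<partial>lborel) = (\<integral>x. f x \<partial>distr lborel borel ((+) h))"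
    by (simp add: lborel_distr_plus)
  also have "\<dots> = (\<integral>x. f (h + x) \<partial>lborel)" by (subst integral_distr) auto
  finally show ?thesis by (simp add: add.commute)
qed

lemma integrable_lborel_shift:
  fixes f :: "'a::euclidean_space \<Rightarrow> 'b::{banach, second_countable_topology}"
  assumes "integrable lborel f"
  shows "integrable lborel (\<lambda>x. f (x + h))"
proof -
  have [measurable]: "f \<in> borel_measurable borel" using borel_measurable_integrable[OF assms] by simp
  show ?thesis using assms unfolding integrable_iff_bounded
    using nn_integral_lborel_shift[of "\<lambda>x. ennreal (norm (f x))" h] by simp
qed

lemma nn_integral_lborel_scale:
  fixes f :: "'a::euclidean_space \<Rightarrow> ennreal"
  assumes [measurable]: "f \<in> borel_measurable borel" and "c > 0"
  shows "(\<integral>\<^sup>+x. f x \<partial>lborel) = ennreal (c ^ DIM('a)) * (\<integral>\<^sup>+x. f (t + c *\<^sub>R x) \<partial>lborel)"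
proof -
  have "(\<integral>\<^sup>+x. f x \<partial>lborel)
      = (\<integral>\<^sup>+x. f x \<partial>density (distr lborel borel (\<lambda>x. t + c *\<^sub>R x)) (\<lambda>_. \<bar>c\<bar>^DIM('a)))"
    using lborel_affine[of c t] \<open>c > 0\<close> by simp
  also have "\<dots> = ennreal (c ^ DIM('a)) * (\<integral>\<^sup>+x. f (t + c *\<^sub>R x) \<partial>lborel)"
    using \<open>c > 0\<close> by (simp add: nn_integral_density nn_integral_distr nn_integral_cmult)
  finally show ?thesis .
qed

lemma integral_lborel_scale:
  fixes f :: "'a::euclidean_space \<Rightarrow> 'b::{banach, second_countable_topology}"
  assumes [measurable]: "f \<in> borel_measurable borel" and "c > 0"
  shows "(\<integral>x. f x \<partial>lborel) = c ^ DIM('a) *\<^sub>R (\<integral>x. f (t + c *\<^sub>R x) \<partial>lborel)"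
proof -
  have "(\<integral>x. f x \<partial>lborel)
      = (\<integral>x. f x \<partial>density (distr lborel borel (\<lambda>x. t + c *\<^sub>R x)) (\<lambda>_. \<bar>c\<bar>^DIM('a)))"
    using lborel_affine[of c t] \<open>c > 0\<close> by simp
  also have "\<dots> = c ^ DIM('a) *\<^sub>R (\<integral>x. f (t + c *\<^sub>R x) \<partial>lborel)"
    using \<open>c > 0\<close> by (subst integral_density) (auto simp: integral_distr)
  finally show ?thesis .
qed

lemma integrable_pair_mult:
  fixes f :: "'a::euclidean_space \<Rightarrow> complex" and g :: "'b::euclidean_space \<Rightarrow> complex"
  assumes f: "integrable lborel f" and g: "integrable lborel g"
  shows "integrable (lborel \<Otimes>\<^sub>M lborel) (\<lambda>p. f (fst p) * g (snd p))"
proof (rule lborel_pair.Fubini_integrable)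
  have [measurable]: "f \<in> borel_measurable borel" "g \<in> borel_measurable borel"
    using borel_measurable_integrable[OF f] borel_measurable_integrable[OF g] by auto
  show "(\<lambda>p. f (fst p) * g (snd p)) \<in> borel_measurable (lborel \<Otimes>\<^sub>M lborel)" by measurable
  show "integrable lborel (\<lambda>x. \<integral>y. norm (f (fst (x, y)) * g (snd (x, y))) \<partial>lborel)"
    using f by (simp add: norm_mult)
  show "AE x in lborel. integrable lborel (\<lambda>y. f (fst (x, y)) * g (snd (x, y)))"
    using g by simp
qed

section \<open>Products over coordinates and Gaussians\<close>

lemma
  fixes f :: "'a::euclidean_space \<Rightarrow> real \<Rightarrow> 'b::{real_normed_field, banach, second_countable_topology}"
  assumes f: "\<And>b. b \<in> Basis \<Longrightarrow> integrable lborel (f b)"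
  shows lborel_integral_prod_Basis:
      "(\<integral>x. (\<Prod>b\<in>Basis. f b (x \<bullet> b)) \<partial>lborel) = (\<Prod>b\<in>Basis. \<integral>t. f b t \<partial>lborel)" (is ?eq)
    and lborel_integrable_prod_Basis:
      "integrable lborel (\<lambda>x. \<Prod>b\<in>Basis. f b (x \<bullet> b))" (is ?int)
proof -
  interpret product_sigma_finite "\<lambda>_::'a. lborel :: real measure" ..
  have [measurable]: "f b \<in> borel_measurable borel" if "b \<in> Basis" for b
    using borel_measurable_integrable[OF f[OF that]] by simp
  have m: "(\<lambda>x. \<Prod>b\<in>Basis. f b (x \<bullet> b)) \<in> borel_measurable borel" by measurable
  have m2: "(\<lambda>f. \<Sum>b\<in>Basis. f b *\<^sub>R b) \<in> measurable (\<Pi>\<^sub>M b\<in>Basis. (lborel::real measure)) (borel :: 'a measure)"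
    by measurable
  have eq: "(\<Prod>b\<in>Basis. f b ((\<Sum>b\<in>Basis. y b *\<^sub>R b) \<bullet> b)) = (\<Prod>b\<in>Basis. f b (y b))" for y :: "'a \<Rightarrow> real"
    by (intro prod.cong refl) (simp add: inner_sum_left inner_Basis if_distrib sum.delta cong: if_cong)
  show ?eq
    by (subst lborel_eq, subst integral_distr[OF m2 m], subst eq, subst product_integral_prod) (auto simp: f)
  show ?int
    by (subst lborel_eq, subst integrable_distr_eq[OF m2 m], subst eq, intro product_integrable_prod) (auto simp: f)
qed

text \<open>The product form reduces integral and Fourier transform to the one-dimensional normal
  distribution and its characteristic function; \<open>gauss_eq\<close> is the closed
  formula.\<close>

definition gauss :: "'a::euclidean_space \<Rightarrow> real" where
  "gauss x = (\<Prod>b\<in>Basis. std_normal_density (x \<bullet> b))"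

lemma gauss_measurable [measurable]: "gauss \<in> borel_measurable borel"
  unfolding gauss_def by measurable

lemma gauss_pos: "0 < gauss x"
  unfolding gauss_def by (intro prod_pos) (simp add: normal_density_pos)

lemma gauss_eq: "gauss (x::'a::euclidean_space) = exp (- (x \<bullet> x) / 2) / sqrt (2 * pi) ^ DIM('a)"
proof -
  have "gauss x = (\<Prod>b\<in>Basis. exp (- (x \<bullet> b)\<^sup>2 / 2) * (1 / sqrt (2 * pi)))"
    unfolding gauss_def by (intro prod.cong refl) (simp add: std_normal_density_def)
  also have "\<dots> = exp (\<Sum>b\<in>Basis. - (x \<bullet> b)\<^sup>2 / 2) * (1 / sqrt (2 * pi)) ^ DIM('a)"
    unfolding prod.distrib by (simp add: exp_sum)
  also have "(\<Sum>b\<in>Basis. - (x \<bullet> b)\<^sup>2 / 2) = - (x \<bullet> x) / 2"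
    by (simp add: euclidean_inner[of x x] sum_negf sum_divide_distrib power2_eq_square)
  finally show ?thesis by (simp add: power_divide)
qed

lemma gauss_uminus: "gauss (- x) = gauss x"
  by (simp add: gauss_eq)

lemma gauss_integrable: "integrable lborel (gauss :: 'a::euclidean_space \<Rightarrow> real)"
  and gauss_integral: "(\<integral>x. gauss (x::'a) \<partial>lborel) = 1"
proof -
  have 1: "integrable lborel std_normal_density" "(\<integral>x. std_normal_density x \<partial>lborel) = 1"
    using integrable_normal_moment[of 1 0 0] integral_normal_density[of 1 0] by auto
  show "integrable lborel (gauss :: 'a \<Rightarrow> real)" "(\<integral>x. gauss (x::'a) \<partial>lborel) = 1"
    unfolding gauss_def using lborel_integrable_prod_Basis[of "\<lambda>_. std_normal_density"]
      lborel_integral_prod_Basis[of "\<lambda>_. std_normal_density"] 1 by auto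
qed

lemma gauss_fourier:
  fixes x :: "'a::euclidean_space"
  shows "(\<integral>\<xi>. exp (\<i> * of_real (x \<bullet> \<xi>)) * of_real (gauss \<xi>) \<partial>lborel)
    = of_real (sqrt (2 * pi) ^ DIM('a) * gauss x)"
proof -
  have int: "integrable lborel (\<lambda>s. exp (\<i> * of_real (t * s)) * complex_of_real (std_normal_density s))" for t
  proof (rule Bochner_Integration.integrable_bound)
    show "integrable lborel std_normal_density" using integrable_normal_moment[of 1 0 0] by simp
  qed (auto simp: norm_mult)
  have one: "(\<integral>s. exp (\<i> * of_real (t * s)) * complex_of_real (std_normal_density s) \<partial>lborel)
      = of_real (exp (- t\<^sup>2 / 2))" for t
  proof -
    have "of_real (exp (- t\<^sup>2 / 2)) = (CLINT s|std_normal_distribution. iexp (t * s))"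
      using fun_cong[OF char_std_normal_distribution, of t] unfolding char_def by simp
    also have "\<dots> = (CLINT s|lborel. std_normal_density s *\<^sub>R iexp (t * s))"
      by (subst integral_density) (auto simp: normal_density_nonneg)
    finally show ?thesis by (simp add: scaleR_conv_of_real mult_ac)
  qed
  have eq: "exp (\<i> * of_real (x \<bullet> \<xi>)) * of_real (gauss \<xi>) =
     (\<Prod>b\<in>Basis. exp (\<i> * of_real ((x \<bullet> b) * (\<xi> \<bullet> b))) * complex_of_real (std_normal_density (\<xi> \<bullet> b)))" for \<xi>
    unfolding prod.distrib gauss_def of_real_prod
    by (subst exp_sum[symmetric]) (auto simp: euclidean_inner[of x \<xi>] sum_distrib_left[symmetric] of_real_sum[symmetric])
  have "(\<integral>\<xi>. exp (\<i> * of_real (x \<bullet> \<xi>)) * of_real (gauss \<xi>) \<partial>lborel)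
     = (\<Prod>b\<in>Basis. \<integral>s. exp (\<i> * of_real ((x \<bullet> b) * s)) * complex_of_real (std_normal_density s) \<partial>lborel)"
    unfolding eq
    by (rule lborel_integral_prod_Basis[of "\<lambda>b s. exp (\<i> * of_real ((x \<bullet> b) * s)) * complex_of_real (std_normal_density s)"]) (rule int)
  also have "\<dots> = (\<Prod>b\<in>Basis. complex_of_real (exp (- (x \<bullet> b)\<^sup>2 / 2)))"
    by (intro prod.cong refl one)
  also have "\<dots> = of_real (exp (\<Sum>b\<in>Basis. - (x \<bullet> b)\<^sup>2 / 2))" by (simp add: exp_sum)
  also have "(\<Sum>b\<in>Basis. - (x \<bullet> b)\<^sup>2 / 2) = - (x \<bullet> x) / 2"
    by (simp add: euclidean_inner[of x x] sum_negf sum_divide_distrib power2_eq_square)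
  finally show ?thesis by (simp add: gauss_eq)
qed

section \<open>The Fourier transform over \<open>lborel\<close>, where Fubini's theorem applies to
  Borel functions\<close>

definition ft :: "('a::euclidean_space \<Rightarrow> complex) \<Rightarrow> 'a \<Rightarrow> complex" where
  "ft f \<xi> = (\<integral>x. exp (- \<i> * of_real (\<xi> \<bullet> x)) * f x \<partial>lborel)"

lemma norm_exp_i [simp]: "norm (exp (\<i> * complex_of_real t)) = 1" "norm (exp (- (\<i> * complex_of_real t))) = 1"
  using norm_exp_i_times[of t] norm_exp_i_times[of "-t"] by auto

lemma ft_measurable [measurable]:
  assumes [measurable]: "f \<in> borel_measurable borel"
  shows "ft f \<in> borel_measurable borel"
  unfolding ft_def by measurable

text \<open>
  Damping the integral of \<open>ft u \<cdot> cnj (ft u)\<close> by a Gaussian turns it into a Gaussian average of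
  translates of \<open>u\<close>; both the Bessel inequality and the convolution formula for \<open>ft (|u|\<^sup>2)\<close>
  are limits of this identity.
\<close>
lemma damped_product_identity:
  fixes u :: "'a::euclidean_space \<Rightarrow> complex"
  assumes u: "integrable lborel u" and "\<epsilon> > 0"
  shows "(\<integral>\<xi>. ft u \<xi> * cnj (ft u (\<xi> - k)) * of_real (gauss (\<epsilon> *\<^sub>R \<xi>)) \<partial>lborel) =
    of_real (sqrt (2 * pi) ^ DIM('a)) *
    (\<integral>z. of_real (gauss z) * (\<integral>y. u (y + \<epsilon> *\<^sub>R z) * cnj (u y) * exp (- \<i> * of_real (k \<bullet> y)) \<partial>lborel) \<partial>lborel)"
proof -
  have [measurable]: "u \<in> borel_measurable borel" using borel_measurable_integrable[OF u] by simp
  let ?c = "sqrt (2 * pi) ^ DIM('a)"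
  define V where "V p = u (fst p) * (cnj (u (snd p)) * exp (- \<i> * of_real (k \<bullet> snd p)))" for p
  have V_int: "integrable (lborel \<Otimes>\<^sub>M lborel) V"
    unfolding V_def
  proof (rule integrable_pair_mult[OF u])
    show "integrable lborel (\<lambda>y. cnj (u y) * exp (- \<i> * of_real (k \<bullet> y)))"
      by (rule Bochner_Integration.integrable_bound[OF u]) (auto simp: norm_mult)
  qed
  then have V_int': "integrable lborel V" by (simp add: lborel_prod)
  have [measurable]: "V \<in> borel_measurable borel" using borel_measurable_integrable[OF V_int'] by simp
  have g_int: "integrable lborel (\<lambda>\<xi>. complex_of_real (gauss (\<epsilon> *\<^sub>R \<xi> :: 'a)))"
  proof -
    have "integrable lborel (\<lambda>\<xi>. gauss (\<epsilon> *\<^sub>R \<xi> :: 'a))"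
      unfolding integrable_iff_bounded
    proof
      have "ennreal (\<epsilon> ^ DIM('a)) * (\<integral>\<^sup>+ x. ennreal (norm (gauss (\<epsilon> *\<^sub>R x :: 'a))) \<partial>lborel) < \<infinity>"
        using gauss_integrable[where 'a='a] nn_integral_lborel_scale[of "\<lambda>x. ennreal (norm (gauss (x::'a)))" \<epsilon> 0] \<open>\<epsilon> > 0\<close>
        by (simp add: integrable_iff_bounded)
      then show "(\<integral>\<^sup>+ x. ennreal (norm (gauss (\<epsilon> *\<^sub>R x :: 'a))) \<partial>lborel) < \<infinity>"
        using \<open>\<epsilon> > 0\<close> by (auto simp: ennreal_mult_less_top)
    qed simp
    then show ?thesis by simp
  qed
  \<comment> \<open>The integrand in all three variables. Integrating over \<open>p\<close> first
    gives the product of transforms, integrating over \<open>\<xi>\<close> first gives the Gaussian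
    kernel in \<open>fst p - snd p\<close>.\<close>
  define H where "H \<xi> p = exp (\<i> * of_real (\<xi> \<bullet> (snd p - fst p))) * (of_real (gauss (\<epsilon> *\<^sub>R \<xi>)) * V p)" for \<xi> p
  have H_int: "integrable (lborel \<Otimes>\<^sub>M lborel) (\<lambda>(\<xi>, p). H \<xi> p)"
    unfolding split_beta'
    by (rule Bochner_Integration.integrable_bound[OF integrable_pair_mult[OF g_int V_int']])
       (auto simp: H_def norm_mult)
  have "(\<integral>\<xi>. ft u \<xi> * cnj (ft u (\<xi> - k)) * of_real (gauss (\<epsilon> *\<^sub>R \<xi>)) \<partial>lborel) = (\<integral>\<xi>. (\<integral>p. H \<xi> p \<partial>lborel) \<partial>lborel)"
  proof (rule Bochner_Integration.integral_cong[OF refl])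
    fix \<xi> :: 'a
    have [measurable]: "V \<in> borel_measurable (lborel \<Otimes>\<^sub>M lborel)"
      using borel_measurable_integrable[OF V_int] .
    have [measurable]: "H \<xi> \<in> borel_measurable (lborel \<Otimes>\<^sub>M lborel)"
      unfolding H_def[abs_def] by measurable
    have Hp: "integrable (lborel \<Otimes>\<^sub>M lborel) (H \<xi>)"
      by (rule Bochner_Integration.integrable_bound[OF integrable_mult_right[OF V_int, of "of_real (gauss (\<epsilon> *\<^sub>R \<xi>))"]])
         (auto simp: H_def norm_mult)
    have "(\<integral>p. H \<xi> p \<partial>lborel) = (\<integral>x. (\<integral>y. H \<xi> (x, y) \<partial>lborel) \<partial>lborel)"
      using lborel_pair.integral_fst'[OF Hp] by (simp add: lborel_prod)
    also have "\<dots> = (\<integral>x. (\<integral>y. (exp (- \<i> * of_real (\<xi> \<bullet> x)) * u x * of_real (gauss (\<epsilon> *\<^sub>R \<xi>))) *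
         cnj (exp (- \<i> * of_real ((\<xi> - k) \<bullet> y)) * u y) \<partial>lborel) \<partial>lborel)"
    proof (intro Bochner_Integration.integral_cong refl)
      fix x y :: 'a
      have "exp (\<i> * of_real (\<xi> \<bullet> (y - x))) * exp (- \<i> * of_real (k \<bullet> y)) =
          exp (- \<i> * of_real (\<xi> \<bullet> x)) * exp (\<i> * of_real ((\<xi> - k) \<bullet> y))"
        unfolding exp_add[symmetric] by (simp add: inner_simps algebra_simps)
      then show "H \<xi> (x, y) = (exp (- \<i> * of_real (\<xi> \<bullet> x)) * u x * of_real (gauss (\<epsilon> *\<^sub>R \<xi>))) *
         cnj (exp (- \<i> * of_real ((\<xi> - k) \<bullet> y)) * u y)"
        unfolding H_def V_def by (simp add: exp_cnj)
    qed
    also have "\<dots> = (\<integral>x. exp (- \<i> * of_real (\<xi> \<bullet> x)) * u x * of_real (gauss (\<epsilon> *\<^sub>R \<xi>)) \<partial>lborel) *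
        (\<integral>y. cnj (exp (- \<i> * of_real ((\<xi> - k) \<bullet> y)) * u y) \<partial>lborel)"
      by (simp only: integral_mult_right_zero integral_mult_left_zero)
    also have "\<dots> = ft u \<xi> * cnj (ft u (\<xi> - k)) * of_real (gauss (\<epsilon> *\<^sub>R \<xi>))"
    proof -
      have cf: "(\<integral>y. cnj (exp (- \<i> * of_real ((\<xi> - k) \<bullet> y)) * u y) \<partial>lborel) = cnj (ft u (\<xi> - k))"
        unfolding ft_def by (rule Bochner_Integration.integral_cnj)
      show ?thesis
        unfolding cf integral_mult_left_zero ft_def[of u \<xi>, symmetric] by (simp only: mult_ac)
    qed
    finally show "ft u \<xi> * cnj (ft u (\<xi> - k)) * of_real (gauss (\<epsilon> *\<^sub>R \<xi>)) = (\<integral>p. H \<xi> p \<partial>lborel)" ..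
  qed
  also have "\<dots> = (\<integral>p. (\<integral>\<xi>. H \<xi> p \<partial>lborel) \<partial>lborel)"
    using lborel_pair.Fubini_integral[OF H_int] by simp
  also have "\<dots> = (\<integral>p. V p * of_real (?c * gauss ((1 / \<epsilon>) *\<^sub>R (fst p - snd p)) / \<epsilon> ^ DIM('a)) \<partial>lborel)"
  proof (rule Bochner_Integration.integral_cong[OF refl])
    fix p :: "'a \<times> 'a"
    let ?d = "snd p - fst p"
    have "(\<integral>\<xi>. exp (\<i> * of_real (((1 / \<epsilon>) *\<^sub>R ?d) \<bullet> \<xi>)) * of_real (gauss \<xi>) \<partial>lborel)
      = \<epsilon> ^ DIM('a) *\<^sub>R (\<integral>\<xi>. exp (\<i> * of_real (((1 / \<epsilon>) *\<^sub>R ?d) \<bullet> (0 + \<epsilon> *\<^sub>R \<xi>))) * of_real (gauss (0 + \<epsilon> *\<^sub>R \<xi>)) \<partial>lborel)"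
      by (rule integral_lborel_scale[OF _ \<open>\<epsilon> > 0\<close>]) measurable
    also have "\<dots> = \<epsilon> ^ DIM('a) *\<^sub>R (\<integral>\<xi>. exp (\<i> * of_real (\<xi> \<bullet> ?d)) * of_real (gauss (\<epsilon> *\<^sub>R \<xi>)) \<partial>lborel)"
      using \<open>\<epsilon> > 0\<close> by (simp add: inner_commute)
    finally have "(\<integral>\<xi>. exp (\<i> * of_real (\<xi> \<bullet> ?d)) * of_real (gauss (\<epsilon> *\<^sub>R \<xi>)) \<partial>lborel)
      = of_real (?c * gauss ((1 / \<epsilon>) *\<^sub>R ?d) / \<epsilon> ^ DIM('a))"
      using \<open>\<epsilon> > 0\<close> unfolding gauss_fourier by (simp add: scaleR_conv_of_real field_simps)
    moreover have "gauss ((1 / \<epsilon>) *\<^sub>R ?d) = gauss ((1 / \<epsilon>) *\<^sub>R (fst p - snd p))"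
      using gauss_uminus[of "(1 / \<epsilon>) *\<^sub>R ?d"] by (simp add: scaleR_diff_right)
    moreover have "(\<integral>\<xi>. H \<xi> p \<partial>lborel) = (\<integral>\<xi>. exp (\<i> * of_real (\<xi> \<bullet> ?d)) * of_real (gauss (\<epsilon> *\<^sub>R \<xi>)) \<partial>lborel) * V p"
      unfolding H_def mult.assoc[symmetric] by simp
    ultimately show "(\<integral>\<xi>. H \<xi> p \<partial>lborel) = V p * of_real (?c * gauss ((1 / \<epsilon>) *\<^sub>R (fst p - snd p)) / \<epsilon> ^ DIM('a))"
      by (simp add: mult.commute)
  qed
  also have "\<dots> = (\<integral>y. (\<integral>x. V (x, y) * of_real (?c * gauss ((1 / \<epsilon>) *\<^sub>R (x - y)) / \<epsilon> ^ DIM('a)) \<partial>lborel) \<partial>lborel)"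
  proof -
    have gb: "gauss (x::'a) \<le> 1 / ?c" for x by (auto simp: gauss_eq divide_le_cancel)
    have "integrable (lborel \<Otimes>\<^sub>M lborel) (\<lambda>p. V p * of_real (?c * gauss ((1 / \<epsilon>) *\<^sub>R (fst p - snd p)) / \<epsilon> ^ DIM('a)))"
    proof (rule Bochner_Integration.integrable_bound[OF integrable_mult_left[OF V_int, of "of_real (1 / \<epsilon> ^ DIM('a))"]])
      show "AE p in lborel \<Otimes>\<^sub>M lborel. norm (V p * of_real (?c * gauss ((1 / \<epsilon>) *\<^sub>R (fst p - snd p)) / \<epsilon> ^ DIM('a)))
        \<le> norm (V p * of_real (1 / \<epsilon> ^ DIM('a)))"
      proof (intro AE_I2)
        fix p :: "'a \<times> 'a"
        have "?c * gauss ((1 / \<epsilon>) *\<^sub>R (fst p - snd p)) \<le> 1"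
          using gb[of "(1 / \<epsilon>) *\<^sub>R (fst p - snd p)"] by (simp add: field_simps)
        then have "?c * gauss ((1 / \<epsilon>) *\<^sub>R (fst p - snd p)) / \<epsilon> ^ DIM('a) \<le> 1 / \<epsilon> ^ DIM('a)"
          using \<open>\<epsilon> > 0\<close> by (intro divide_right_mono) auto
        moreover have "0 \<le> ?c * gauss ((1 / \<epsilon>) *\<^sub>R (fst p - snd p)) / \<epsilon> ^ DIM('a)"
          using \<open>\<epsilon> > 0\<close> gauss_pos[of "(1 / \<epsilon>) *\<^sub>R (fst p - snd p)"] by simp
        ultimately show "norm (V p * of_real (?c * gauss ((1 / \<epsilon>) *\<^sub>R (fst p - snd p)) / \<epsilon> ^ DIM('a)))
          \<le> norm (V p * of_real (1 / \<epsilon> ^ DIM('a)))"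
          unfolding norm_mult norm_of_real
          by (intro mult_left_mono order_trans[OF eq_refl[OF abs_of_nonneg]] order_trans[OF _ abs_ge_self]) auto
      qed
    qed measurable
    with lborel_pair.integral_snd[of "\<lambda>x y. V (x, y) * of_real (?c * gauss ((1 / \<epsilon>) *\<^sub>R (x - y)) / \<epsilon> ^ DIM('a))"]
    have "(\<integral>y. (\<integral>x. V (x, y) * of_real (?c * gauss ((1 / \<epsilon>) *\<^sub>R (x - y)) / \<epsilon> ^ DIM('a)) \<partial>lborel) \<partial>lborel)
      = (\<integral>p. V p * of_real (?c * gauss ((1 / \<epsilon>) *\<^sub>R (fst p - snd p)) / \<epsilon> ^ DIM('a)) \<partial>lborel)"
      by (simp add: lborel_prod split_beta')
    then show ?thesis by (rule sym)
  qed
  \<comment> \<open>The substitution \<open>x = y + \<epsilon> z\<close> concentrates the kernel at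
    scale \<open>\<epsilon>\<close>, and its Jacobian cancels the power of \<open>\<epsilon>\<close>
    in the denominator.\<close>
  also have "\<dots> = (\<integral>y. (\<integral>z. of_real ?c * (of_real (gauss z) * (u (y + \<epsilon> *\<^sub>R z) * cnj (u y) * exp (- \<i> * of_real (k \<bullet> y)))) \<partial>lborel) \<partial>lborel)"
  proof (rule Bochner_Integration.integral_cong[OF refl])
    fix y :: 'a
    have "(\<integral>x. V (x, y) * of_real (?c * gauss ((1 / \<epsilon>) *\<^sub>R (x - y)) / \<epsilon> ^ DIM('a)) \<partial>lborel)
      = \<epsilon> ^ DIM('a) *\<^sub>R (\<integral>z. V (y + \<epsilon> *\<^sub>R z, y) * of_real (?c * gauss ((1 / \<epsilon>) *\<^sub>R ((y + \<epsilon> *\<^sub>R z) - y)) / \<epsilon> ^ DIM('a)) \<partial>lborel)"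
      by (rule integral_lborel_scale[OF _ \<open>\<epsilon> > 0\<close>]) measurable
    also have "\<dots> = (\<integral>z. \<epsilon> ^ DIM('a) *\<^sub>R (V (y + \<epsilon> *\<^sub>R z, y) * of_real (?c * gauss ((1 / \<epsilon>) *\<^sub>R ((y + \<epsilon> *\<^sub>R z) - y)) / \<epsilon> ^ DIM('a))) \<partial>lborel)"
      by simp
    also have "\<dots> = (\<integral>z. of_real ?c * (of_real (gauss z) * (u (y + \<epsilon> *\<^sub>R z) * cnj (u y) * exp (- \<i> * of_real (k \<bullet> y)))) \<partial>lborel)"
      using \<open>\<epsilon> > 0\<close> by (intro Bochner_Integration.integral_cong refl) (simp add: V_def scaleR_conv_of_real)
    finally show "(\<integral>x. V (x, y) * of_real (?c * gauss ((1 / \<epsilon>) *\<^sub>R (x - y)) / \<epsilon> ^ DIM('a)) \<partial>lborel) = \<dots>" .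
  qed
  also have "\<dots> = (\<integral>z. (\<integral>y. of_real ?c * (of_real (gauss z) * (u (y + \<epsilon> *\<^sub>R z) * cnj (u y) * exp (- \<i> * of_real (k \<bullet> y)))) \<partial>lborel) \<partial>lborel)"
  proof (rule lborel_pair.Fubini_integral)
    let ?F = "\<lambda>z y. of_real ?c * (of_real (gauss z) * (u (y + \<epsilon> *\<^sub>R z) * cnj (u y) * exp (- \<i> * of_real (k \<bullet> y))))"
    have "integrable (lborel \<Otimes>\<^sub>M lborel) (\<lambda>(y, z). ?F z y)"
    proof (rule lborel_pair.Fubini_integrable)
      have b: "gauss (x::'a) \<le> 1 / ?c" for x by (auto simp: gauss_eq divide_le_cancel)
      have sc: "integrable lborel (\<lambda>z. u (y + \<epsilon> *\<^sub>R z))"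
        and sc2: "(\<integral>z. norm (u (y + \<epsilon> *\<^sub>R z)) \<partial>lborel) = (\<integral>x. norm (u x) \<partial>lborel) / \<epsilon> ^ DIM('a)" for y
      proof -
        have "ennreal (\<epsilon> ^ DIM('a)) * (\<integral>\<^sup>+ x. ennreal (norm (u (y + \<epsilon> *\<^sub>R x))) \<partial>lborel) < \<infinity>"
          using u nn_integral_lborel_scale[of "\<lambda>x. ennreal (norm (u x))" \<epsilon> y] \<open>\<epsilon> > 0\<close>
          by (simp add: integrable_iff_bounded)
        then show "integrable lborel (\<lambda>z. u (y + \<epsilon> *\<^sub>R z))"
          using \<open>\<epsilon> > 0\<close> unfolding integrable_iff_bounded by (auto simp: ennreal_mult_less_top)
        show "(\<integral>z. norm (u (y + \<epsilon> *\<^sub>R z)) \<partial>lborel) = (\<integral>x. norm (u x) \<partial>lborel) / \<epsilon> ^ DIM('a)"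
          using integral_lborel_scale[of "\<lambda>x. norm (u x)" \<epsilon> y] \<open>\<epsilon> > 0\<close> by simp
      qed
      have F_le: "norm (?F z y) \<le> norm (u y) * norm (u (y + \<epsilon> *\<^sub>R z))" for z y
      proof -
        have "?c * gauss z \<le> 1" using b[of z] by (simp add: field_simps)
        then have "(?c * gauss z) * (norm (u y) * norm (u (y + \<epsilon> *\<^sub>R z))) \<le> 1 * (norm (u y) * norm (u (y + \<epsilon> *\<^sub>R z)))"
          by (rule mult_right_mono) simp
        moreover have "cmod (of_real ?c) = ?c" by (subst norm_of_real) simp
        ultimately show ?thesis
          using gauss_pos[of z] unfolding norm_mult by (simp add: mult_ac)
      qed
      have F_int: "integrable lborel (\<lambda>z. ?F z y)" for y
        by (rule Bochner_Integration.integrable_bound[of _ "\<lambda>z. norm (u y) * norm (u (y + \<epsilon> *\<^sub>R z))"])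
           (use sc[of y] F_le[of _ y] in \<open>auto simp: abs_mult\<close>)
      then show "AE y in lborel. integrable lborel (\<lambda>z. case (y, z) of (y, z) \<Rightarrow> ?F z y)" by simp
      show "integrable lborel (\<lambda>y. \<integral>z. norm (case (y, z) of (y, z) \<Rightarrow> ?F z y) \<partial>lborel)"
      proof (rule Bochner_Integration.integrable_bound[of _ "\<lambda>y. norm (u y) * ((\<integral>x. norm (u x) \<partial>lborel) / \<epsilon> ^ DIM('a))"])
        show "AE y in lborel. norm (\<integral>z. norm (case (y, z) of (y, z) \<Rightarrow> ?F z y) \<partial>lborel)
           \<le> norm (norm (u y) * ((\<integral>x. norm (u x) \<partial>lborel) / \<epsilon> ^ DIM('a)))"
        proof (intro AE_I2)
          fix y
          have "(\<integral>z. norm (?F z y) \<partial>lborel) \<le> (\<integral>z. norm (u y) * norm (u (y + \<epsilon> *\<^sub>R z)) \<partial>lborel)"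
            by (rule integral_mono) (use F_int[of y] sc[of y] F_le[of _ y] in auto)
          then show "norm (\<integral>z. norm (case (y, z) of (y, z) \<Rightarrow> ?F z y) \<partial>lborel)
             \<le> norm (norm (u y) * ((\<integral>x. norm (u x) \<partial>lborel) / \<epsilon> ^ DIM('a)))"
            using sc2[of y] \<open>\<epsilon> > 0\<close> by (simp add: abs_of_nonneg)
        qed
      qed (use u in \<open>auto\<close>)
    qed measurable
    show "integrable (lborel \<Otimes>\<^sub>M lborel) (\<lambda>(z, y). ?F z y)"
      using lborel_pair.integrable_product_swap[OF \<open>integrable (lborel \<Otimes>\<^sub>M lborel) (\<lambda>(y, z). ?F z y)\<close>]
      by (simp add: split_beta')
  qed
  also have "\<dots> = of_real ?c *
    (\<integral>z. of_real (gauss z) * (\<integral>y. u (y + \<epsilon> *\<^sub>R z) * cnj (u y) * exp (- \<i> * of_real (k \<bullet> y)) \<partial>lborel) \<partial>lborel)"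
    by simp
  finally show ?thesis .
qed

text \<open>Fatou's lemma, in the form in which Gaussian damping, difference quotients and cutoffs
  are removed from upper bounds below.\<close>

lemma nn_integral_le_of_tendsto:
  fixes f :: "nat \<Rightarrow> 'a \<Rightarrow> ennreal"
  assumes m: "\<And>n. f n \<in> borel_measurable M" and l: "\<And>x. x \<in> space M \<Longrightarrow> (\<lambda>n. f n x) \<longlonglongrightarrow> g x"
    and b: "\<And>n. (\<integral>\<^sup>+x. f n x \<partial>M) \<le> B"
  shows "(\<integral>\<^sup>+x. g x \<partial>M) \<le> B"
proof -
  have "(\<integral>\<^sup>+x. g x \<partial>M) = (\<integral>\<^sup>+x. liminf (\<lambda>n. f n x) \<partial>M)"
    by (intro nn_integral_cong lim_imp_Liminf[symmetric] l) auto
  also have "\<dots> \<le> liminf (\<lambda>n. \<integral>\<^sup>+x. f n x \<partial>M)" by (rule nn_integral_liminf[OF m])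
  also have "\<dots> \<le> liminf (\<lambda>n::nat. B)" by (intro Liminf_mono always_eventually allI b)
  finally show ?thesis by (simp add: Liminf_const)
qed

text \<open>The modulated autocorrelation of \<open>u\<close>, the inner integral of
  \<open>damped_product_identity\<close>. At \<open>h = 0\<close> it is the transform of
  \<open>|u|^2\<close>.\<close>

definition corr :: "('a::euclidean_space \<Rightarrow> complex) \<Rightarrow> 'a \<Rightarrow> 'a \<Rightarrow> complex" where
  "corr u k h = (\<integral>y. u (y + h) * cnj (u y) * exp (- \<i> * of_real (k \<bullet> y)) \<partial>lborel)"

section \<open>Autocorrelations and the Bessel inequality\<close>

lemma cmod_mult_le_squares: "cmod a * cmod b \<le> ((cmod a)\<^sup>2 + (cmod b)\<^sup>2) / 2"
  using zero_le_power2[of "cmod a - cmod b"] by (simp add: power2_eq_square algebra_simps)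

lemma cmod_mult_le_sum_squares: "cmod a * cmod b \<le> (cmod a)\<^sup>2 + (cmod b)\<^sup>2"
  by (rule order_trans[OF cmod_mult_le_squares]) simp

lemma gauss_le_1: "sqrt (2 * pi) ^ DIM('a) * gauss (x::'a::euclidean_space) \<le> 1"
  by (simp add: gauss_eq)

lemma gauss_dilation_tendsto: "(\<lambda>n. sqrt (2 * pi) ^ DIM('a) * gauss ((1 / real (Suc n)) *\<^sub>R (x::'a::euclidean_space))) \<longlonglongrightarrow> 1"
proof -
  have "(\<lambda>n. exp (- ((1 / real (Suc n))\<^sup>2 * (x \<bullet> x)) / 2)) \<longlonglongrightarrow> exp (- (0\<^sup>2 * (x \<bullet> x)) / 2)"
    by (intro tendsto_intros LIMSEQ_inverse_real_of_nat[unfolded inverse_eq_divide]) auto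
  then show ?thesis by (simp add: gauss_eq power2_eq_square mult.assoc del: of_nat_Suc)
qed

context
  fixes u :: "'a::euclidean_space \<Rightarrow> complex"
  assumes u_int: "integrable lborel u" and u_sq: "integrable lborel (\<lambda>x. (cmod (u x))\<^sup>2)"
begin

lemma u_measurable [measurable]: "u \<in> borel_measurable borel"
  using borel_measurable_integrable[OF u_int] by simp

lemma corr_integrable: "integrable lborel (\<lambda>y. u (y + h) * cnj (u y) * exp (- \<i> * of_real (k \<bullet> y)))"
proof (rule Bochner_Integration.integrable_bound)
  show "integrable lborel (\<lambda>y. ((cmod (u (y + h)))\<^sup>2 + (cmod (u y))\<^sup>2) / 2)"
    using integrable_lborel_shift[OF u_sq, of h] u_sq by simp
  show "AE y in lborel. norm (u (y + h) * cnj (u y) * exp (- \<i> * of_real (k \<bullet> y)))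
      \<le> norm (((cmod (u (y + h)))\<^sup>2 + (cmod (u y))\<^sup>2) / 2)"
  proof (intro AE_I2)
    fix y
    show "norm (u (y + h) * cnj (u y) * exp (- \<i> * of_real (k \<bullet> y)))
      \<le> norm (((cmod (u (y + h)))\<^sup>2 + (cmod (u y))\<^sup>2) / 2)"
      using cmod_mult_le_squares[of "u (y + h)" "u y"] by (simp add: norm_mult)
  qed
qed measurable

lemma corr_bound: "cmod (corr u k h) \<le> (\<integral>x. (cmod (u x))\<^sup>2 \<partial>lborel)"
proof -
  have "cmod (corr u k h) \<le> (\<integral>y. cmod (u (y + h) * cnj (u y) * exp (- \<i> * of_real (k \<bullet> y))) \<partial>lborel)"
    unfolding corr_def by (rule integral_norm_bound)
  also have "\<dots> \<le> (\<integral>y. ((cmod (u (y + h)))\<^sup>2 + (cmod (u y))\<^sup>2) / 2 \<partial>lborel)"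
  proof (rule integral_mono)
    show "integrable lborel (\<lambda>y. cmod (u (y + h) * cnj (u y) * exp (- \<i> * of_real (k \<bullet> y))))"
      by (rule integrable_norm[OF corr_integrable])
    show "integrable lborel (\<lambda>y. ((cmod (u (y + h)))\<^sup>2 + (cmod (u y))\<^sup>2) / 2)"
      using integrable_lborel_shift[OF u_sq, of h] u_sq by simp
    fix y
    show "cmod (u (y + h) * cnj (u y) * exp (- \<i> * of_real (k \<bullet> y))) \<le> ((cmod (u (y + h)))\<^sup>2 + (cmod (u y))\<^sup>2) / 2"
      using cmod_mult_le_squares[of "u (y + h)" "u y"] by (simp add: norm_mult)
  qed
  also have "\<dots> = (\<integral>x. (cmod (u x))\<^sup>2 \<partial>lborel)"
    using integrable_lborel_shift[OF u_sq, of h] u_sq integral_lborel_shift[of "\<lambda>x. (cmod (u x))\<^sup>2" h]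
    by simp
  finally show ?thesis .
qed

lemma corr_zero: "corr u k 0 = ft (\<lambda>x. of_real ((cmod (u x))\<^sup>2)) k"
  unfolding corr_def ft_def
  by (intro Bochner_Integration.integral_cong refl) (simp add: complex_norm_square[symmetric] mult.commute)

lemma corr_measurable [measurable]: "corr u k \<in> borel_measurable borel"
  unfolding corr_def[abs_def] by measurable

lemma ft_bounded: "cmod (ft u \<xi>) \<le> (\<integral>x. cmod (u x) \<partial>lborel)"
proof -
  have "cmod (ft u \<xi>) \<le> (\<integral>x. cmod (exp (- \<i> * of_real (\<xi> \<bullet> x)) * u x) \<partial>lborel)"
    unfolding ft_def by (rule integral_norm_bound)
  then show ?thesis by (simp add: norm_mult)
qed

lemma gauss_corr_bound:
  "cmod (\<integral>z. of_real (gauss z) * corr u k (\<epsilon> *\<^sub>R z) \<partial>lborel) \<le> (\<integral>x. (cmod (u x))\<^sup>2 \<partial>lborel)"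
proof -
  let ?U = "\<integral>x. (cmod (u x))\<^sup>2 \<partial>lborel"
  have "cmod (\<integral>z. of_real (gauss z) * corr u k (\<epsilon> *\<^sub>R z) \<partial>lborel)
      \<le> (\<integral>z. gauss (z::'a) * ?U \<partial>lborel)"
  proof (rule Bochner_Integration.integral_norm_bound_integral)
    show gU: "integrable lborel (\<lambda>z. gauss (z::'a) * ?U)"
      using gauss_integrable[where 'a='a] by simp
    show b: "cmod (of_real (gauss z) * corr u k (\<epsilon> *\<^sub>R z)) \<le> gauss z * ?U" for z
      using mult_left_mono[OF corr_bound[of k "\<epsilon> *\<^sub>R z"] less_imp_le[OF gauss_pos[of z]]] gauss_pos[of z]
      by (simp add: norm_mult)
    show "integrable lborel (\<lambda>z. of_real (gauss z) * corr u k (\<epsilon> *\<^sub>R z))"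
      by (rule Bochner_Integration.integrable_bound[OF gU]) (auto intro!: AE_I2 order_trans[OF b])
  qed
  then show ?thesis using gauss_integrable[where 'a='a] gauss_integral[where 'a='a] by simp
qed

lemma gauss_ft_integrable:
  assumes "\<epsilon> > 0"
  shows "integrable lborel (\<lambda>\<xi>. ft u \<xi> * cnj (ft u (\<xi> - k)) * of_real (gauss (\<epsilon> *\<^sub>R \<xi>)))"
proof -
  let ?B = "(\<integral>x. cmod (u x) \<partial>lborel)"
  have g: "integrable lborel (\<lambda>\<xi>::'a. gauss (\<epsilon> *\<^sub>R \<xi>))"
  proof (rule integrableI_bounded)
    have "ennreal (\<epsilon> ^ DIM('a)) * (\<integral>\<^sup>+ x. ennreal (norm (gauss (\<epsilon> *\<^sub>R x :: 'a))) \<partial>lborel) < \<infinity>"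
      using gauss_integrable[where 'a='a] nn_integral_lborel_scale[of "\<lambda>x. ennreal (norm (gauss (x::'a)))" \<epsilon> 0] \<open>\<epsilon> > 0\<close>
      by (simp add: integrable_iff_bounded)
    then show "(\<integral>\<^sup>+ x. ennreal (norm (gauss (\<epsilon> *\<^sub>R x :: 'a))) \<partial>lborel) < \<infinity>"
      using \<open>\<epsilon> > 0\<close> by (auto simp: ennreal_mult_less_top)
  qed simp
  show ?thesis
  proof (rule Bochner_Integration.integrable_bound)
    show "integrable lborel (\<lambda>\<xi>::'a. (?B * ?B) * gauss (\<epsilon> *\<^sub>R \<xi>))" using g by simp
    show "AE \<xi> in lborel. norm (ft u \<xi> * cnj (ft u (\<xi> - k)) * of_real (gauss (\<epsilon> *\<^sub>R \<xi>))) \<le> norm ((?B * ?B) * gauss (\<epsilon> *\<^sub>R \<xi>))"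
    proof (intro AE_I2)
      fix \<xi> :: 'a
      have "cmod (ft u \<xi>) * cmod (ft u (\<xi> - k)) * gauss (\<epsilon> *\<^sub>R \<xi>) \<le> (?B * ?B) * gauss (\<epsilon> *\<^sub>R \<xi>)"
        by (intro mult_right_mono mult_mono ft_bounded less_imp_le[OF gauss_pos]) auto
      then show "norm (ft u \<xi> * cnj (ft u (\<xi> - k)) * of_real (gauss (\<epsilon> *\<^sub>R \<xi>))) \<le> norm ((?B * ?B) * gauss (\<epsilon> *\<^sub>R \<xi>))"
        using gauss_pos[of "\<epsilon> *\<^sub>R \<xi>"] by (simp add: norm_mult abs_mult)
    qed
  qed measurable
qed

text \<open>The inequality half of Plancherel's theorem. For \<open>k = 0\<close> the damped
  integral of \<open>|ft u|^2\<close> is a Gaussian average of \<open>corr u 0\<close>, which never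
  exceeds the squared norm of \<open>u\<close>; then the damping is removed.\<close>

lemma Bessel:
  "(\<integral>\<^sup>+\<xi>. ennreal ((cmod (ft u \<xi>))\<^sup>2) \<partial>lborel) \<le> ennreal ((sqrt (2 * pi) ^ DIM('a))\<^sup>2 * (\<integral>x. (cmod (u x))\<^sup>2 \<partial>lborel))"
proof (rule nn_integral_le_of_tendsto)
  let ?f = "\<lambda>n \<xi>. (cmod (ft u \<xi>))\<^sup>2 * (sqrt (2 * pi) ^ DIM('a) * gauss ((1 / real (Suc n)) *\<^sub>R \<xi>))"
  show "(\<lambda>\<xi>. ennreal (?f n \<xi>)) \<in> borel_measurable lborel" for n by measurable
  show "(\<lambda>n. ennreal (?f n \<xi>)) \<longlonglongrightarrow> ennreal ((cmod (ft u \<xi>))\<^sup>2)" for \<xi>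
    using tendsto_mult[OF tendsto_const gauss_dilation_tendsto, of "(cmod (ft u \<xi>))\<^sup>2" \<xi>]
    by (intro tendsto_ennrealI) simp
  show "(\<integral>\<^sup>+\<xi>. ennreal (?f n \<xi>) \<partial>lborel) \<le> ennreal ((sqrt (2 * pi) ^ DIM('a))\<^sup>2 * (\<integral>x. (cmod (u x))\<^sup>2 \<partial>lborel))" for n
  proof -
    define \<epsilon> where "\<epsilon> = 1 / real (Suc n)"
    have "\<epsilon> > 0" by (simp add: \<epsilon>_def)
    have c_pos: "sqrt (2 * pi) ^ DIM('a) > 0" by simp
    have eq: "ft u \<xi> * cnj (ft u (\<xi> - 0)) * of_real (gauss (\<epsilon> *\<^sub>R \<xi>)) = complex_of_real ((cmod (ft u \<xi>))\<^sup>2 * gauss (\<epsilon> *\<^sub>R \<xi>))" for \<xi>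
      by (simp add: complex_norm_square[symmetric])
    have i: "integrable lborel (\<lambda>\<xi>. (cmod (ft u \<xi>))\<^sup>2 * gauss (\<epsilon> *\<^sub>R \<xi>))"
      using gauss_ft_integrable[OF \<open>\<epsilon> > 0\<close>, of 0] unfolding eq complex_of_real_integrable_eq .
    have "complex_of_real (\<integral>\<xi>. (cmod (ft u \<xi>))\<^sup>2 * gauss (\<epsilon> *\<^sub>R \<xi>) \<partial>lborel)
        = of_real (sqrt (2 * pi) ^ DIM('a)) * (\<integral>z. of_real (gauss z) * corr u 0 (\<epsilon> *\<^sub>R z) \<partial>lborel)"
      using damped_product_identity[OF u_int \<open>\<epsilon> > 0\<close>, of 0]
      unfolding eq corr_def integral_complex_of_real .
    then have "cmod (complex_of_real (\<integral>\<xi>. (cmod (ft u \<xi>))\<^sup>2 * gauss (\<epsilon> *\<^sub>R \<xi>) \<partial>lborel))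
        = cmod (of_real (sqrt (2 * pi) ^ DIM('a)) * (\<integral>z. of_real (gauss z) * corr u 0 (\<epsilon> *\<^sub>R z) \<partial>lborel))"
      by (rule arg_cong)
    then have "\<bar>\<integral>\<xi>. (cmod (ft u \<xi>))\<^sup>2 * gauss (\<epsilon> *\<^sub>R \<xi>) \<partial>lborel\<bar>
        = sqrt (2 * pi) ^ DIM('a) * cmod (\<integral>z. of_real (gauss z) * corr u 0 (\<epsilon> *\<^sub>R z) \<partial>lborel)"
      unfolding norm_mult norm_of_real abs_of_pos[OF c_pos] .
    also have "\<dots> \<le> sqrt (2 * pi) ^ DIM('a) * (\<integral>x. (cmod (u x))\<^sup>2 \<partial>lborel)"
      using gauss_corr_bound by (intro mult_left_mono) auto
    finally have le: "(\<integral>\<xi>. (cmod (ft u \<xi>))\<^sup>2 * gauss (\<epsilon> *\<^sub>R \<xi>) \<partial>lborel) \<le> sqrt (2 * pi) ^ DIM('a) * (\<integral>x. (cmod (u x))\<^sup>2 \<partial>lborel)" by simp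
    have "(\<integral>\<^sup>+\<xi>. ennreal (?f n \<xi>) \<partial>lborel) = (\<integral>\<^sup>+\<xi>. ennreal (sqrt (2 * pi) ^ DIM('a) * ((cmod (ft u \<xi>))\<^sup>2 * gauss (\<epsilon> *\<^sub>R \<xi>))) \<partial>lborel)"
      by (intro nn_integral_cong arg_cong[where f=ennreal]) (simp add: \<epsilon>_def)
    also have "\<dots> = ennreal (\<integral>\<xi>. sqrt (2 * pi) ^ DIM('a) * ((cmod (ft u \<xi>))\<^sup>2 * gauss (\<epsilon> *\<^sub>R \<xi>)) \<partial>lborel)"
      by (rule nn_integral_eq_integral)
         (use i in simp, intro AE_I2 mult_nonneg_nonneg less_imp_le[OF gauss_pos], auto)
    also have "\<dots> \<le> ennreal ((sqrt (2 * pi) ^ DIM('a))\<^sup>2 * (\<integral>x. (cmod (u x))\<^sup>2 \<partial>lborel))"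
      using mult_left_mono[OF le less_imp_le[OF c_pos]] by (intro ennreal_leI) (simp add: power2_eq_square mult.assoc)
    finally show ?thesis .
  qed
qed

section \<open>Functions with Lipschitz translations in the square norm\<close>

context
  fixes K :: real
  assumes lip: "\<And>h. (\<integral>\<^sup>+x. ennreal ((cmod (u (x + h) - u x))\<^sup>2) \<partial>lborel) \<le> ennreal (K * (norm h)\<^sup>2)"
    and K: "0 \<le> K"
begin

lemma diff_sq_integrable: "integrable lborel (\<lambda>x. (cmod (u (x + h) - u x))\<^sup>2)"
  and diff_sq_integral: "(\<integral>x. (cmod (u (x + h) - u x))\<^sup>2 \<partial>lborel) \<le> K * (norm h)\<^sup>2"
proof -
  show i: "integrable lborel (\<lambda>x. (cmod (u (x + h) - u x))\<^sup>2)"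
    using lip[of h] by (intro integrableI_bounded) (auto intro: le_less_trans)
  have "ennreal (\<integral>x. (cmod (u (x + h) - u x))\<^sup>2 \<partial>lborel) \<le> ennreal (K * (norm h)\<^sup>2)"
    using lip[of h] nn_integral_eq_integral[OF i] by simp
  then show "(\<integral>x. (cmod (u (x + h) - u x))\<^sup>2 \<partial>lborel) \<le> K * (norm h)\<^sup>2"
    using K by (subst (asm) ennreal_le_iff) auto
qed

text \<open>Pointwise AM-GM with weight \<open>norm h\<close> divides the translation bound
  \<open>K * (norm h)^2\<close> by \<open>norm h\<close> and multiplies the square integral of
  \<open>u\<close> by it, which produces a linear modulus of continuity.\<close>

lemma corr_continuous: "cmod (corr u k h - corr u k 0) \<le> (K + (\<integral>x. (cmod (u x))\<^sup>2 \<partial>lborel)) * norm h"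
proof (cases "h = 0")
  case False
  let ?U = "\<integral>x. (cmod (u x))\<^sup>2 \<partial>lborel"
  define r where "r = norm h"
  have r: "r > 0" using False by (simp add: r_def)
  let ?e = "\<lambda>y. exp (- \<i> * of_real (k \<bullet> y))"
  have "corr u k h - corr u k 0 = (\<integral>y. u (y + h) * cnj (u y) * ?e y - u (y + 0) * cnj (u y) * ?e y \<partial>lborel)"
    unfolding corr_def by (rule Bochner_Integration.integral_diff[symmetric, OF corr_integrable corr_integrable])
  also have "cmod \<dots> \<le> (\<integral>y. (1 / r) * (cmod (u (y + h) - u y))\<^sup>2 + r * (cmod (u y))\<^sup>2 \<partial>lborel)"
  proof (rule Bochner_Integration.integral_norm_bound_integral)
    show "integrable lborel (\<lambda>y. u (y + h) * cnj (u y) * ?e y - u (y + 0) * cnj (u y) * ?e y)"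
      by (intro Bochner_Integration.integrable_diff corr_integrable)
    show "integrable lborel (\<lambda>y. (1 / r) * (cmod (u (y + h) - u y))\<^sup>2 + r * (cmod (u y))\<^sup>2)"
      using u_sq diff_sq_integrable by simp
    fix y
    have "u (y + h) * cnj (u y) * ?e y - u (y + 0) * cnj (u y) * ?e y = (u (y + h) - u y) * cnj (u y) * ?e y"
      by (simp add: algebra_simps)
    then have "cmod (u (y + h) * cnj (u y) * ?e y - u (y + 0) * cnj (u y) * ?e y) = cmod (u (y + h) - u y) * cmod (u y)"
      by (simp add: norm_mult)
    also have "\<dots> \<le> (1 / r) * (cmod (u (y + h) - u y))\<^sup>2 + r * (cmod (u y))\<^sup>2"
    proof -
      have am: "a * b \<le> (1 / r) * a\<^sup>2 + r * b\<^sup>2" if "a \<ge> 0" "b \<ge> 0" for a b :: real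
      proof -
        have "0 \<le> (a - r * b)\<^sup>2 / r + a * b" using r that by simp
        also have "(a - r * b)\<^sup>2 / r + a * b = (1 / r) * a\<^sup>2 + r * b\<^sup>2 - a * b"
          using r by (simp add: power2_eq_square field_simps)
        finally show ?thesis by simp
      qed
      show ?thesis by (rule am) auto
    qed
    finally show "cmod (u (y + h) * cnj (u y) * ?e y - u (y + 0) * cnj (u y) * ?e y) \<le> (1 / r) * (cmod (u (y + h) - u y))\<^sup>2 + r * (cmod (u y))\<^sup>2" .
  qed
  also have "\<dots> = (1 / r) * (\<integral>y. (cmod (u (y + h) - u y))\<^sup>2 \<partial>lborel) + r * ?U"
    using u_sq diff_sq_integrable by simp
  also have "\<dots> \<le> (1 / r) * (K * r\<^sup>2) + r * ?U"
    using diff_sq_integral[of h] r by (intro add_mono mult_left_mono) (auto simp: r_def)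
  also have "\<dots> = (K + ?U) * norm h" using r by (simp add: r_def power2_eq_square field_simps)
  finally show ?thesis .
qed simp

text \<open>Let the damping in \<open>damped_product_identity\<close> tend to zero. On the side of
  \<open>corr\<close>, continuity at \<open>h = 0\<close> and dominated convergence give the
  transform of \<open>|u|^2\<close>; on the other side absolute values are taken and the Gaussian,
  at most 1 after normalization, is dropped.\<close>

lemma ft_square_le_convolution:
  "ennreal ((sqrt (2 * pi) ^ DIM('a))\<^sup>2 * cmod (ft (\<lambda>x. of_real ((cmod (u x))\<^sup>2)) k))
    \<le> (\<integral>\<^sup>+\<xi>. ennreal (cmod (ft u \<xi>) * cmod (ft u (\<xi> - k))) \<partial>lborel)"
proof -
  let ?U = "\<integral>x. (cmod (u x))\<^sup>2 \<partial>lborel"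
  let ?\<epsilon> = "\<lambda>n::nat. 1 / real (Suc n)"
  let ?G = "\<lambda>n. \<integral>z. of_real (gauss z) * corr u k (?\<epsilon> n *\<^sub>R z) \<partial>lborel"
  have e0: "?\<epsilon> \<longlonglongrightarrow> 0" using LIMSEQ_inverse_real_of_nat by (simp only: inverse_eq_divide)
  have lim: "?G \<longlonglongrightarrow> (\<integral>z. of_real (gauss (z::'a)) * corr u k 0 \<partial>lborel)"
  proof (rule integral_dominated_convergence)
    show "integrable lborel (\<lambda>z::'a. gauss z * ?U)" using gauss_integrable[where 'a='a] by simp
    show "AE z in lborel. (\<lambda>n. of_real (gauss (z::'a)) * corr u k (?\<epsilon> n *\<^sub>R z)) \<longlonglongrightarrow> of_real (gauss z) * corr u k 0"
    proof (intro AE_I2 tendsto_mult tendsto_const)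
      fix z :: 'a
      have "(\<lambda>n. (K + ?U) * norm (?\<epsilon> n *\<^sub>R z)) \<longlonglongrightarrow> (K + ?U) * norm (0 *\<^sub>R z)"
        by (intro tendsto_intros e0)
      then have "(\<lambda>n. (K + ?U) * norm (?\<epsilon> n *\<^sub>R z)) \<longlonglongrightarrow> 0" by simp
      then have "(\<lambda>n. corr u k (?\<epsilon> n *\<^sub>R z) - corr u k 0) \<longlonglongrightarrow> 0"
        by (rule Lim_null_comparison[rotated]) (intro always_eventually allI corr_continuous)
      then show "(\<lambda>n. corr u k (?\<epsilon> n *\<^sub>R z)) \<longlonglongrightarrow> corr u k 0" by (simp add: LIM_zero_iff)
    qed
    show "AE z in lborel. norm (of_real (gauss (z::'a)) * corr u k (?\<epsilon> n *\<^sub>R z)) \<le> gauss z * ?U" for n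
    proof (intro AE_I2)
      fix z :: 'a
      show "norm (of_real (gauss z) * corr u k (?\<epsilon> n *\<^sub>R z)) \<le> gauss z * ?U"
        using mult_left_mono[OF corr_bound[of k "?\<epsilon> n *\<^sub>R z"] less_imp_le[OF gauss_pos[of z]]] gauss_pos[of z]
        by (simp add: norm_mult del: of_nat_Suc)
    qed
  qed measurable
  have g1: "(\<integral>z. of_real (gauss (z::'a)) * corr u k 0 \<partial>lborel) = corr u k 0"
    unfolding integral_mult_left_zero integral_complex_of_real gauss_integral by simp
  have lim': "?G \<longlonglongrightarrow> ft (\<lambda>x. of_real ((cmod (u x))\<^sup>2)) k" using lim[unfolded g1] unfolding corr_zero .
  have le: "ennreal ((sqrt (2 * pi) ^ DIM('a))\<^sup>2 * cmod (?G n)) \<le> (\<integral>\<^sup>+\<xi>. ennreal (cmod (ft u \<xi>) * cmod (ft u (\<xi> - k))) \<partial>lborel)" for n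
  proof -
    define \<epsilon> where "\<epsilon> = ?\<epsilon> n"
    have "\<epsilon> > 0" by (simp add: \<epsilon>_def)
    let ?F = "\<lambda>\<xi>. ft u \<xi> * cnj (ft u (\<xi> - k)) * of_real (gauss (\<epsilon> *\<^sub>R \<xi>))"
    have "(sqrt (2 * pi) ^ DIM('a))\<^sup>2 * cmod (?G n) = sqrt (2 * pi) ^ DIM('a) * cmod (of_real (sqrt (2 * pi) ^ DIM('a)) * ?G n)"
      unfolding norm_mult norm_of_real by (simp add: power2_eq_square)
    also have "of_real (sqrt (2 * pi) ^ DIM('a)) * ?G n = (\<integral>\<xi>. ?F \<xi> \<partial>lborel)"
      using damped_product_identity[OF u_int \<open>\<epsilon> > 0\<close>, of k] unfolding corr_def \<epsilon>_def by simp
    finally have "ennreal ((sqrt (2 * pi) ^ DIM('a))\<^sup>2 * cmod (?G n)) = ennreal (sqrt (2 * pi) ^ DIM('a)) * ennreal (cmod (\<integral>\<xi>. ?F \<xi> \<partial>lborel))"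
      by (simp add: ennreal_mult)
    also have "\<dots> \<le> ennreal (sqrt (2 * pi) ^ DIM('a)) * (\<integral>\<^sup>+\<xi>. ennreal (cmod (?F \<xi>)) \<partial>lborel)"
      by (intro mult_left_mono integral_norm_bound_ennreal gauss_ft_integrable \<open>\<epsilon> > 0\<close>) simp
    also have "\<dots> = (\<integral>\<^sup>+\<xi>. ennreal (sqrt (2 * pi) ^ DIM('a)) * ennreal (cmod (?F \<xi>)) \<partial>lborel)"
      by (rule nn_integral_cmult[symmetric]) measurable
    also have "\<dots> \<le> (\<integral>\<^sup>+\<xi>. ennreal (cmod (ft u \<xi>) * cmod (ft u (\<xi> - k))) \<partial>lborel)"
    proof (intro nn_integral_mono)
      fix \<xi>
      have "(sqrt (2 * pi) ^ DIM('a) * gauss (\<epsilon> *\<^sub>R \<xi>)) * (cmod (ft u \<xi>) * cmod (ft u (\<xi> - k))) \<le> 1 * (cmod (ft u \<xi>) * cmod (ft u (\<xi> - k)))"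
        by (intro mult_right_mono gauss_le_1) simp
      then show "ennreal (sqrt (2 * pi) ^ DIM('a)) * ennreal (cmod (?F \<xi>)) \<le> ennreal (cmod (ft u \<xi>) * cmod (ft u (\<xi> - k)))"
        using gauss_pos[of "\<epsilon> *\<^sub>R \<xi>"]
        by (subst ennreal_mult[symmetric]) (auto simp: norm_mult abs_of_pos mult_ac intro!: ennreal_leI)
    qed
    finally show ?thesis .
  qed
  have "(\<lambda>n. ennreal ((sqrt (2 * pi) ^ DIM('a))\<^sup>2 * cmod (?G n))) \<longlonglongrightarrow> ennreal ((sqrt (2 * pi) ^ DIM('a))\<^sup>2 * cmod (ft (\<lambda>x. of_real ((cmod (u x))\<^sup>2)) k))"
    by (intro tendsto_ennrealI tendsto_intros lim')
  then show ?thesis by (rule LIMSEQ_le_const2) (use le in blast)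
qed

end

end

lemma ft_shift:
  assumes u: "integrable lborel u"
  shows "ft (\<lambda>x. u (x + h)) \<xi> = exp (\<i> * of_real (\<xi> \<bullet> h)) * ft u \<xi>"
proof -
  have [measurable]: "u \<in> borel_measurable borel" using borel_measurable_integrable[OF u] by simp
  have "ft u \<xi> = (\<integral>x. exp (- \<i> * of_real (\<xi> \<bullet> (x + h))) * u (x + h) \<partial>lborel)"
    unfolding ft_def by (rule integral_lborel_shift[symmetric]) measurable
  also have "\<dots> = (\<integral>x. exp (- \<i> * of_real (\<xi> \<bullet> h)) * (exp (- \<i> * of_real (\<xi> \<bullet> x)) * u (x + h)) \<partial>lborel)"
    by (intro Bochner_Integration.integral_cong refl)
       (simp add: inner_add_right algebra_simps exp_add[symmetric] exp_diff exp_minus divide_inverse)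
  also have "\<dots> = exp (- \<i> * of_real (\<xi> \<bullet> h)) * ft (\<lambda>x. u (x + h)) \<xi>"
    unfolding ft_def by simp
  finally show ?thesis by (simp add: exp_minus field_simps)
qed

lemma difference_quotient_exp:
  "(\<lambda>n. of_real (real (Suc n)) * (exp (\<i> * of_real (s / real (Suc n))) - 1)) \<longlonglongrightarrow> \<i> * of_real s"
proof -
  have "((\<lambda>z. exp (\<i> * of_real s * z)) has_field_derivative (\<i> * of_real s) * exp (\<i> * of_real s * 0)) (at 0)"
    by (auto intro!: derivative_eq_intros)
  then have d: "((\<lambda>h. (exp (\<i> * of_real s * h) - 1) / h) \<longlongrightarrow> \<i> * of_real s) (at 0)"
    by (simp add: has_field_derivative_iff)
  have "filterlim (\<lambda>n. complex_of_real (1 / real (Suc n))) (at 0) sequentially"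
    unfolding filterlim_at
  proof
    have "(\<lambda>n. complex_of_real (1 / real (Suc n))) \<longlonglongrightarrow> of_real 0"
      by (intro tendsto_of_real LIMSEQ_inverse_real_of_nat[unfolded inverse_eq_divide])
    then show "(\<lambda>n. complex_of_real (1 / real (Suc n))) \<longlonglongrightarrow> 0" by simp
  qed (simp add: always_eventually del: of_nat_Suc)
  from filterlim_compose[OF d this] show ?thesis
    by (simp add: mult.commute mult.left_commute divide_inverse del: of_nat_Suc)
qed

text \<open>The transform of a difference quotient in direction \<open>b\<close> tends pointwise to
  \<open>\<i>\<close> times \<open>\<xi> \<bullet> b\<close> times \<open>ft u\<close>, while the
  quotients have squared norm at most \<open>K\<close>. Bessel and Fatou give one such bound for
  each basis vector, hence the factor \<open>DIM('a)\<close>.\<close>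

lemma ft_weighted_bound:
  fixes u :: "'a::euclidean_space \<Rightarrow> complex" and K :: real
  assumes u: "integrable lborel u" and u2: "integrable lborel (\<lambda>x. (cmod (u x))\<^sup>2)"
    and K: "0 \<le> K"
    and lip: "\<And>h. (\<integral>\<^sup>+x. ennreal ((cmod (u (x + h) - u x))\<^sup>2) \<partial>lborel) \<le> ennreal (K * (norm h)\<^sup>2)"
  shows "(\<integral>\<^sup>+\<xi>. ennreal ((1 + \<xi> \<bullet> \<xi>) * (cmod (ft u \<xi>))\<^sup>2) \<partial>lborel)
    \<le> ennreal ((sqrt (2 * pi) ^ DIM('a))\<^sup>2 * ((\<integral>x. (cmod (u x))\<^sup>2 \<partial>lborel) + DIM('a) * K))"
proof -
  let ?c = "sqrt (2 * pi) ^ DIM('a)"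
  let ?U = "\<integral>x. (cmod (u x))\<^sup>2 \<partial>lborel"
  have [measurable]: "u \<in> borel_measurable borel" using borel_measurable_integrable[OF u] by simp
  have dir: "(\<integral>\<^sup>+\<xi>. ennreal ((\<xi> \<bullet> b)\<^sup>2 * (cmod (ft u \<xi>))\<^sup>2) \<partial>lborel) \<le> ennreal (?c\<^sup>2 * K)" if b: "b \<in> Basis" for b :: 'a
  proof (rule nn_integral_le_of_tendsto)
    let ?v = "\<lambda>n x. of_real (real (Suc n)) * (u (x + (1 / real (Suc n)) *\<^sub>R b) - u x)"
    have vi: "integrable lborel (?v n)" for n
      using u integrable_lborel_shift[OF u] by simp
    have v2: "integrable lborel (\<lambda>x. (cmod (?v n x))\<^sup>2)" for n
      using diff_sq_integrable[OF u u2 lip K] by (simp add: norm_mult power_mult_distrib del: of_nat_Suc)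
    have ftv: "ft (?v n) \<xi> = of_real (real (Suc n)) * (exp (\<i> * of_real ((\<xi> \<bullet> b) / real (Suc n))) - 1) * ft u \<xi>" for n \<xi>
    proof -
      have e1: "integrable lborel (\<lambda>x. exp (- \<i> * of_real (\<xi> \<bullet> x)) * f x)" if "integrable lborel f" for f :: "'a \<Rightarrow> complex"
      proof (rule Bochner_Integration.integrable_bound[OF that])
        have [measurable]: "f \<in> borel_measurable borel" using borel_measurable_integrable[OF that] by simp
        show "(\<lambda>x. exp (- \<i> * of_real (\<xi> \<bullet> x)) * f x) \<in> borel_measurable lborel" by measurable
      qed (simp add: norm_mult)
      let ?e = "\<lambda>x. exp (- \<i> * complex_of_real (\<xi> \<bullet> x))"
      have "ft (?v n) \<xi> = (\<integral>x. of_real (real (Suc n)) *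
          (?e x * u (x + (1 / real (Suc n)) *\<^sub>R b) - ?e x * u x) \<partial>lborel)"
        unfolding ft_def by (intro Bochner_Integration.integral_cong refl) (simp only: right_diff_distrib mult_ac)
      also have "\<dots> = of_real (real (Suc n)) *
          (\<integral>x. ?e x * u (x + (1 / real (Suc n)) *\<^sub>R b) - ?e x * u x \<partial>lborel)"
        by (rule integral_mult_right_zero)
      also have "\<dots> = of_real (real (Suc n)) * (ft (\<lambda>x. u (x + (1 / real (Suc n)) *\<^sub>R b)) \<xi> - ft u \<xi>)"
        unfolding ft_def
        by (subst Bochner_Integration.integral_diff) (rule e1 integrable_lborel_shift u refl)+
      finally have "ft (?v n) \<xi> = of_real (real (Suc n)) * (ft (\<lambda>x. u (x + (1 / real (Suc n)) *\<^sub>R b)) \<xi> - ft u \<xi>)" .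
      then show ?thesis unfolding ft_shift[OF u] by (simp add: algebra_simps del: of_nat_Suc)
    qed
    show "(\<lambda>\<xi>. ennreal ((cmod (ft (?v n) \<xi>))\<^sup>2)) \<in> borel_measurable lborel" for n by measurable
    show "(\<lambda>n. ennreal ((cmod (ft (?v n) \<xi>))\<^sup>2)) \<longlonglongrightarrow> ennreal ((\<xi> \<bullet> b)\<^sup>2 * (cmod (ft u \<xi>))\<^sup>2)" for \<xi>
    proof -
      have "(\<lambda>n. (cmod (ft (?v n) \<xi>))\<^sup>2) \<longlonglongrightarrow> (cmod (\<i> * of_real (\<xi> \<bullet> b) * ft u \<xi>))\<^sup>2"
        unfolding ftv by (intro tendsto_intros difference_quotient_exp)
      then show ?thesis by (intro tendsto_ennrealI) (simp add: norm_mult power_mult_distrib)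
    qed
    show "(\<integral>\<^sup>+\<xi>. ennreal ((cmod (ft (?v n) \<xi>))\<^sup>2) \<partial>lborel) \<le> ennreal (?c\<^sup>2 * K)" for n
    proof (rule order_trans[OF Bessel[OF vi v2]], intro ennreal_leI mult_left_mono)
      have "(\<integral>x. (cmod (?v n x))\<^sup>2 \<partial>lborel) = (real (Suc n))\<^sup>2 * (\<integral>x. (cmod (u (x + (1 / real (Suc n)) *\<^sub>R b) - u x))\<^sup>2 \<partial>lborel)"
        by (simp add: norm_mult power_mult_distrib del: of_nat_Suc)
      also have "\<dots> \<le> (real (Suc n))\<^sup>2 * (K * (norm ((1 / real (Suc n)) *\<^sub>R b))\<^sup>2)"
        by (intro mult_left_mono diff_sq_integral[OF u u2 lip K]) auto
      also have "\<dots> = K" using b by (simp add: power_divide del: of_nat_Suc)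
      finally show "(\<integral>x. (cmod (?v n x))\<^sup>2 \<partial>lborel) \<le> K" .
    qed simp
  qed
  have "(\<integral>\<^sup>+\<xi>. ennreal ((1 + \<xi> \<bullet> \<xi>) * (cmod (ft u \<xi>))\<^sup>2) \<partial>lborel)
     = (\<integral>\<^sup>+\<xi>. ennreal ((cmod (ft u \<xi>))\<^sup>2) + (\<Sum>b\<in>Basis. ennreal ((\<xi> \<bullet> b)\<^sup>2 * (cmod (ft u \<xi>))\<^sup>2)) \<partial>lborel)"
    by (intro nn_integral_cong, subst euclidean_inner)
       (simp add: sum_ennreal ennreal_plus[symmetric] sum_nonneg distrib_right sum_distrib_right power2_eq_square del: ennreal_plus)
  also have "\<dots> = (\<integral>\<^sup>+\<xi>. ennreal ((cmod (ft u \<xi>))\<^sup>2) \<partial>lborel) + (\<Sum>b\<in>Basis. \<integral>\<^sup>+\<xi>. ennreal ((\<xi> \<bullet> b)\<^sup>2 * (cmod (ft u \<xi>))\<^sup>2) \<partial>lborel)"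
    by (simp add: nn_integral_add nn_integral_sum del: sum_ennreal)
  also have "\<dots> \<le> ennreal (?c\<^sup>2 * ?U) + (\<Sum>b\<in>(Basis::'a set). ennreal (?c\<^sup>2 * K))"
    by (intro add_mono sum_mono Bessel[OF u u2] dir)
  also have "\<dots> = ennreal (?c\<^sup>2 * (?U + DIM('a) * K))"
    using K by (simp add: ennreal_plus[symmetric] ennreal_of_nat_eq_real_of_nat ennreal_mult[symmetric] algebra_simps del: ennreal_plus)
  finally show ?thesis .
qed

section \<open>Layer-cake integrals of the truncated norm\<close>

lemma measurable_indicator_interval [measurable (raw)]:
  fixes f g :: "'a \<Rightarrow> real"
  assumes [measurable]: "f \<in> borel_measurable M" "g \<in> borel_measurable M"
  shows "(\<lambda>x. indicator {f x..} (g x) :: ennreal) \<in> borel_measurable M"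
    and "(\<lambda>x. indicator {..f x} (g x) :: ennreal) \<in> borel_measurable M"
    and "(\<lambda>x. indicator {..<f x} (g x) :: ennreal) \<in> borel_measurable M"
proof -
  have "(\<lambda>x. indicator {f x..} (g x) :: ennreal) = (\<lambda>x. if f x \<le> g x then 1 else 0)"
    "(\<lambda>x. indicator {..f x} (g x) :: ennreal) = (\<lambda>x. if g x \<le> f x then 1 else 0)"
    "(\<lambda>x. indicator {..<f x} (g x) :: ennreal) = (\<lambda>x. if g x < f x then 1 else 0)"
    by (auto simp: indicator_def)
  then show "(\<lambda>x. indicator {f x..} (g x) :: ennreal) \<in> borel_measurable M"
    "(\<lambda>x. indicator {..f x} (g x) :: ennreal) \<in> borel_measurable M"
    "(\<lambda>x. indicator {..<f x} (g x) :: ennreal) \<in> borel_measurable M"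
    by simp_all
qed

text \<open>Truncating at \<open>1\<close> avoids the singularity of negative powers of the norm at the origin.\<close>
definition bracket :: "'a::real_normed_vector \<Rightarrow> real" where
  "bracket x = max 1 (norm x)"

lemma bracket_ge_1: "1 \<le> bracket x" and bracket_pos: "0 < bracket x"
  by (auto simp: bracket_def)

lemma bracket_measurable [measurable]: "bracket \<in> borel_measurable borel"
  unfolding bracket_def[abs_def] by measurable

lemma bracket_sq_le: "(bracket x)\<^sup>2 \<le> 1 + x \<bullet> x" for x :: "'a::real_inner"
  by (simp add: bracket_def max_def power2_norm_eq_inner)

text \<open>Read from right to left, this writes a negative power of \<open>a\<close> as an integral
  over thresholds above \<open>a\<close>. With \<open>a\<close> a value of \<open>bracket\<close>,
  Fubini then leaves only integrals over balls.\<close>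

lemma nn_integral_powr_tail:
  fixes a p :: real
  assumes "0 < a" "0 < p"
  shows "(\<integral>\<^sup>+t. ennreal (p * t powr (- p - 1)) * indicator {a..} t \<partial>lborel) = ennreal (a powr (- p))"
proof -
  have "(\<integral>\<^sup>+t. ennreal (p * t powr (- p - 1)) * indicator {a..} t \<partial>lborel) = ennreal (0 - (- (a powr (- p))))"
  proof (rule nn_integral_FTC_atLeast)
    show "((\<lambda>t. - (t powr (- p))) \<longlongrightarrow> 0) at_top"
      using tendsto_minus[OF tendsto_neg_powr[OF _ filterlim_ident, of "- p"]] assms by simp
    show "((\<lambda>t. - (t powr (- p))) has_real_derivative p * t powr (- p - 1)) (at t)" if "a \<le> t" for t
      using assms that by (auto intro!: derivative_eq_intros)
    show "0 \<le> p * t powr (- p - 1)" for t using assms by simp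
  qed measurable
  then show ?thesis by simp
qed

text \<open>Layer-cake form of an Abelian summation: linear growth of the mass of balls makes the mass
  weighted by the power \<open>-3/2\<close> of the distance converge at infinity.\<close>
lemma linear_growth_weighted_tail:
  fixes f :: "'a::euclidean_space \<Rightarrow> ennreal"
  assumes [measurable]: "f \<in> borel_measurable borel" and A: "0 \<le> A"
    and growth: "\<And>R. 1 \<le> R \<Longrightarrow> (\<integral>\<^sup>+x. f x * indicator {..R} (bracket x) \<partial>lborel) \<le> ennreal (A * R)"
    and r: "1 \<le> r"
  shows "(\<integral>\<^sup>+x. f x * indicator {r..} (bracket x) * ennreal (bracket x powr (- 3/2)) \<partial>lborel)
    \<le> ennreal (3 * A * r powr (- 1/2))"
proof -
  let ?g = "\<lambda>t::real. ennreal (3/2 * t powr (- 5/2))"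
  have tail: "ennreal (a powr (- 3/2)) = (\<integral>\<^sup>+t. ?g t * indicator {a..} t \<partial>lborel)" if "a > 0" for a
    using nn_integral_powr_tail[of a "3/2"] that by simp
  have "(\<integral>\<^sup>+x. f x * indicator {r..} (bracket x) * ennreal (bracket x powr (- 3/2)) \<partial>lborel)
     = (\<integral>\<^sup>+x. (\<integral>\<^sup>+t. f x * indicator {r..} (bracket x) * (?g t * indicator {bracket x..} t) \<partial>lborel) \<partial>lborel)"
    unfolding tail[OF bracket_pos] by (intro nn_integral_cong nn_integral_cmult[symmetric]) measurable
  also have "\<dots> = (\<integral>\<^sup>+t. (\<integral>\<^sup>+x. f x * indicator {r..} (bracket x) * (?g t * indicator {bracket x..} t) \<partial>lborel) \<partial>lborel)"
    by (rule lborel_pair.Fubini'[symmetric]) measurable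
  also have "\<dots> \<le> (\<integral>\<^sup>+t. ennreal (3 * A) * (ennreal (1/2 * t powr (- 1/2 - 1)) * indicator {r..} t) \<partial>lborel)"
  proof (intro nn_integral_mono)
    fix t :: real
    show "(\<integral>\<^sup>+x. f x * indicator {r..} (bracket x) * (?g t * indicator {bracket x..} t) \<partial>lborel)
      \<le> ennreal (3 * A) * (ennreal (1/2 * t powr (- 1/2 - 1)) * indicator {r..} t)"
    proof (cases "r \<le> t")
      case True
      have "(\<integral>\<^sup>+x. f x * indicator {r..} (bracket x) * (?g t * indicator {bracket x..} t) \<partial>lborel)
         \<le> (\<integral>\<^sup>+x. ?g t * (f x * indicator {..t} (bracket x)) \<partial>lborel)"
        by (intro nn_integral_mono) (auto simp: indicator_def mult.commute)
      also have "\<dots> = ?g t * (\<integral>\<^sup>+x. f x * indicator {..t} (bracket x) \<partial>lborel)"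
        by (rule nn_integral_cmult) measurable
      also have "\<dots> \<le> ?g t * ennreal (A * t)" using True r by (intro mult_left_mono growth) auto
      also have "\<dots> = ennreal (3 * A * (1/2 * (t powr (- 5/2) * t powr 1)))"
        using True r A by (simp add: ennreal_mult[symmetric])
      also have "t powr (- 5/2) * t powr 1 = t powr (- 1/2 - 1)" unfolding powr_add[symmetric] by simp
      finally show ?thesis using True A by (simp add: ennreal_mult[symmetric])
    next
      case False
      then have "(\<integral>\<^sup>+x. f x * indicator {r..} (bracket x) * (?g t * indicator {bracket x..} t) \<partial>lborel) = (\<integral>\<^sup>+x. 0 \<partial>(lborel :: 'a measure))"
        by (intro nn_integral_cong) (auto simp: indicator_def)
      then show ?thesis by simp
    qed
  qed
  also have "\<dots> = ennreal (3 * A) * ennreal (r powr (- 1/2))"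
    using nn_integral_powr_tail[of r "1/2"] r by (subst nn_integral_cmult) auto
  also have "\<dots> = ennreal (3 * A * r powr (- 1/2))" using A by (simp add: ennreal_mult)
  finally show ?thesis .
qed

definition ball_const :: real where "ball_const = unit_ball_vol 3"

lemma ball_const_nonneg: "0 \<le> ball_const"
  by (simp add: ball_const_def)

lemma emeasure_bracket_le:
  assumes "1 \<le> R"
  shows "emeasure lborel {x::real^3. bracket x \<le> R} \<le> ennreal (ball_const * R ^ 3)"
proof -
  have "{x::real^3. bracket x \<le> R} = cball 0 R" using assms by (auto simp: bracket_def)
  then show ?thesis using emeasure_cball[of R "0::real^3"] assms by (simp add: ball_const_def)
qed

text \<open>The exponent 1/2 is \<open>3 - 5/2\<close>. Thresholds between 1 and \<open>R\<close>
  see a ball of volume proportional to \<open>t^3\<close> and contribute 5; larger ones see the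
  whole ball of radius \<open>R\<close> and contribute 1. Together this gives the factor 6.\<close>

lemma bracket_powr_local_integral:
  assumes R: "1 \<le> R"
  shows "(\<integral>\<^sup>+x. indicator {..R} (bracket (x::real^3)) * ennreal (bracket x powr (- 5/2)) \<partial>lborel)
    \<le> ennreal (6 * ball_const * R powr (1/2))"
proof -
  let ?g = "\<lambda>t::real. ennreal (5/2 * t powr (- 7/2))"
  let ?c = ball_const
  note c = ball_const_nonneg
  have tail: "ennreal (a powr (- 5/2)) = (\<integral>\<^sup>+t. ?g t * indicator {a..} t \<partial>lborel)" if "a > 0" for a
    using nn_integral_powr_tail[of a "5/2"] that by simp
  have "(\<integral>\<^sup>+x. indicator {..R} (bracket (x::real^3)) * ennreal (bracket x powr (- 5/2)) \<partial>lborel)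
     = (\<integral>\<^sup>+x. (\<integral>\<^sup>+t. indicator {..R} (bracket (x::real^3)) * (?g t * indicator {bracket x..} t) \<partial>lborel) \<partial>lborel)"
    unfolding tail[OF bracket_pos] by (intro nn_integral_cong nn_integral_cmult[symmetric]) measurable
  also have "\<dots> = (\<integral>\<^sup>+t. (\<integral>\<^sup>+x. indicator {..R} (bracket (x::real^3)) * (?g t * indicator {bracket x..} t) \<partial>lborel) \<partial>lborel)"
    by (rule lborel_pair.Fubini'[symmetric]) measurable
  also have "\<dots> \<le> (\<integral>\<^sup>+t. ennreal ?c * (ennreal (5/2 * t powr (- 1/2)) * indicator {1..R} t) +
      ennreal (?c * R ^ 3) * (?g t * indicator {R..} t) \<partial>lborel)"
  proof (intro nn_integral_mono)
    fix t :: real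
    have le: "(\<integral>\<^sup>+x. indicator {..R} (bracket (x::real^3)) * (?g t * indicator {bracket x..} t) \<partial>lborel)
       \<le> ?g t * ennreal (?c * S ^ 3)" if "1 \<le> S" "\<And>x::real^3. bracket x \<le> R \<Longrightarrow> bracket x \<le> t \<Longrightarrow> bracket x \<le> S" for S
    proof -
      have "(\<integral>\<^sup>+x. indicator {..R} (bracket (x::real^3)) * (?g t * indicator {bracket x..} t) \<partial>lborel)
         \<le> (\<integral>\<^sup>+x. ?g t * indicator {x::real^3. bracket x \<le> S} x \<partial>lborel)"
        using that(2) by (intro nn_integral_mono) (auto simp: indicator_def)
      also have "\<dots> = ?g t * emeasure lborel {x::real^3. bracket x \<le> S}"
        by (rule nn_integral_cmult_indicator) measurable
      also have "\<dots> \<le> ?g t * ennreal (?c * S ^ 3)" by (intro mult_left_mono emeasure_bracket_le that) simp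
      finally show ?thesis .
    qed
    consider "t < 1" | "1 \<le> t" "t \<le> R" | "R < t" by linarith
    then show "(\<integral>\<^sup>+x. indicator {..R} (bracket (x::real^3)) * (?g t * indicator {bracket x..} t) \<partial>lborel)
      \<le> ennreal ?c * (ennreal (5/2 * t powr (- 1/2)) * indicator {1..R} t) + ennreal (?c * R ^ 3) * (?g t * indicator {R..} t)"
    proof cases
      case 1
      then have "\<not> bracket x \<le> t" for x :: "real^3" using bracket_ge_1[of x] by linarith
      then have "(\<integral>\<^sup>+x. indicator {..R} (bracket (x::real^3)) * (?g t * indicator {bracket x..} t) \<partial>lborel) = (\<integral>\<^sup>+x. 0 \<partial>(lborel :: (real^3) measure))"
        by (intro nn_integral_cong) (auto simp: indicator_def)
      then show ?thesis by simp
    next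
      case 2
      have "t powr (- 7/2) * t ^ 3 = t powr (- 7/2) * t powr 3" using 2 by (simp add: powr_numeral)
      also have "\<dots> = t powr (- 1/2)" unfolding powr_add[symmetric] by simp
      finally have p: "t powr (- 7/2) * t ^ 3 = t powr (- 1/2)" .
      have "(\<integral>\<^sup>+x. indicator {..R} (bracket (x::real^3)) * (?g t * indicator {bracket x..} t) \<partial>lborel) \<le> ?g t * ennreal (?c * t ^ 3)"
        by (rule le) (use 2 in auto)
      also have "\<dots> = ennreal (?c * (5/2 * (t powr (- 7/2) * t ^ 3)))"
        using 2 c by (subst ennreal_mult[symmetric]) (auto simp: mult_ac)
      also have "\<dots> = ennreal ?c * (ennreal (5/2 * t powr (- 1/2)) * indicator {1..R} t)"
        unfolding p using 2 c by (subst ennreal_mult) auto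
      finally show ?thesis by (rule order_trans) simp
    next
      case 3
      have "(\<integral>\<^sup>+x. indicator {..R} (bracket (x::real^3)) * (?g t * indicator {bracket x..} t) \<partial>lborel) \<le> ?g t * ennreal (?c * R ^ 3)"
        by (rule le) (use 3 R in auto)
      then show ?thesis using 3 by (auto simp: mult.commute intro: order_trans)
    qed
  qed
  also have "\<dots> = (\<integral>\<^sup>+t. ennreal ?c * (ennreal (5/2 * t powr (- 1/2)) * indicator {1..R} t) \<partial>lborel) +
      (\<integral>\<^sup>+t. ennreal (?c * R ^ 3) * (?g t * indicator {R..} t) \<partial>lborel)"
    by (rule nn_integral_add) measurable
  also have "(\<integral>\<^sup>+t. ennreal ?c * (ennreal (5/2 * t powr (- 1/2)) * indicator {1..R} t) \<partial>lborel)
      = ennreal ?c * (\<integral>\<^sup>+t. ennreal (5/2 * t powr (- 1/2)) * indicator {1..R} t \<partial>lborel)"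
    by (rule nn_integral_cmult) measurable
  also have "(\<integral>\<^sup>+t. ennreal (?c * R ^ 3) * (?g t * indicator {R..} t) \<partial>lborel)
      = ennreal (?c * R ^ 3) * (\<integral>\<^sup>+t. ?g t * indicator {R..} t \<partial>lborel)"
    by (rule nn_integral_cmult) measurable
  also have "(\<integral>\<^sup>+t. ennreal (5/2 * t powr (- 1/2)) * indicator {1..R} t \<partial>lborel) = ennreal (5 * R powr (1/2) - 5 * 1 powr (1/2))"
  proof (rule nn_integral_FTC_Icc)
    show "((\<lambda>t. 5 * t powr (1/2)) has_real_derivative 5/2 * t powr (- 1/2)) (at t)" if "t \<in> {1..R}" for t
      using that by (auto intro!: derivative_eq_intros)
  qed (use R in auto)
  also have "(\<integral>\<^sup>+t. ?g t * indicator {R..} t \<partial>lborel) = ennreal (R powr (- 5/2))" using tail[of R] R by simp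
  also have "ennreal ?c * ennreal (5 * R powr (1/2) - 5 * 1 powr (1/2)) + ennreal (?c * R ^ 3) * ennreal (R powr (- 5/2))
     \<le> ennreal ?c * ennreal (5 * R powr (1/2)) + ennreal (?c * R ^ 3) * ennreal (R powr (- 5/2))"
    by (intro add_right_mono mult_left_mono ennreal_leI) auto
  also have "\<dots> = ennreal (?c * (5 * R powr (1/2)) + ?c * (R ^ 3 * R powr (- 5/2)))"
    using c R by (simp add: ennreal_mult[symmetric] ennreal_plus[symmetric] mult.assoc del: ennreal_plus)
  also have "R ^ 3 * R powr (- 5/2) = R powr (1/2)"
  proof -
    have "R ^ 3 * R powr (- 5/2) = R powr 3 * R powr (- 5/2)" using R by (simp add: powr_numeral)
    also have "\<dots> = R powr (1/2)" unfolding powr_add[symmetric] by simp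
    finally show ?thesis .
  qed
  finally show ?thesis by (simp add: algebra_simps)
qed

text \<open>The part of \<open>w\<close> below height \<open>s\<close> contributes at most
  \<open>s^2\<close> times the measure of \<open>B\<close>, and the part above at most the integral
  of \<open>2 t * M / t^3\<close> from \<open>s\<close>, which is \<open>2 M / s\<close>. The choice
  \<open>s = 1 / R\<close> makes both linear in \<open>R\<close>.\<close>

lemma weak_L3_square_local:
  fixes w :: "'a::euclidean_space \<Rightarrow> real"
  assumes [measurable]: "w \<in> borel_measurable borel" and w0: "\<And>x. 0 \<le> w x" and M: "0 \<le> M" and c: "0 \<le> c"
    and weak: "\<And>t. t > 0 \<Longrightarrow> emeasure lborel {x. t < w x} \<le> ennreal (M / t ^ 3)"
    and [measurable]: "B \<in> sets borel" and B: "emeasure lborel B \<le> ennreal (c * R ^ 3)" and R: "1 \<le> R"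
  shows "(\<integral>\<^sup>+x. ennreal ((w x)\<^sup>2) * indicator B x \<partial>lborel) \<le> ennreal ((c + 2 * M) * R)"
proof -
  define s where "s = 1 / R"
  have s: "s > 0" using R by (simp add: s_def)
  let ?h = "\<lambda>x. \<integral>\<^sup>+t. ennreal (2 * t) * indicator {s..} t * indicator {..<w x} t \<partial>lborel"
  have pt: "ennreal ((w x)\<^sup>2) \<le> ennreal (s\<^sup>2) + ?h x" for x
  proof (cases "s \<le> w x")
    case True
    have "ennreal ((w x)\<^sup>2 - s\<^sup>2) = (\<integral>\<^sup>+t. ennreal (2 * t) * indicator {s..w x} t \<partial>lborel)"
      using s True by (intro nn_integral_FTC_Icc[symmetric]) (auto intro!: derivative_eq_intros)
    also have "\<dots> = ?h x"
    proof (rule nn_integral_cong_AE)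
      have "AE t in lborel. t \<noteq> w x" by (rule AE_lborel_singleton)
      then show "AE t in lborel. ennreal (2 * t) * indicator {s..w x} t = ennreal (2 * t) * indicator {s..} t * indicator {..<w x} t"
        by eventually_elim (auto simp: indicator_def)
    qed
    finally have "?h x = ennreal ((w x)\<^sup>2 - s\<^sup>2)" ..
    moreover have "s\<^sup>2 \<le> (w x)\<^sup>2" using True s by (intro power_mono) auto
    ultimately show ?thesis by (simp add: ennreal_plus[symmetric] del: ennreal_plus)
  next
    case False
    then have "(w x)\<^sup>2 \<le> s\<^sup>2" using w0 by (intro power_mono) auto
    then have "ennreal ((w x)\<^sup>2) \<le> ennreal (s\<^sup>2)" by (rule ennreal_leI)
    then show ?thesis by (rule add_increasing2[OF zero_le])
  qed
  have "(\<integral>\<^sup>+x. ennreal ((w x)\<^sup>2) * indicator B x \<partial>lborel) \<le> (\<integral>\<^sup>+x. ennreal (s\<^sup>2) * indicator B x + ?h x \<partial>lborel)"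
  proof (intro nn_integral_mono)
    fix x
    show "ennreal ((w x)\<^sup>2) * indicator B x \<le> ennreal (s\<^sup>2) * indicator B x + ?h x"
    proof (cases "x \<in> B")
      case True
      then show ?thesis using pt[of x] by (simp only: indicator_simps(1) mult_1_right)
    next
      case False
      show ?thesis by (simp only: indicator_simps(2)[OF False] mult_zero_right zero_le)
    qed
  qed
  also have "\<dots> = (\<integral>\<^sup>+x. ennreal (s\<^sup>2) * indicator B x \<partial>lborel) + (\<integral>\<^sup>+x. ?h x \<partial>lborel)"
    by (rule nn_integral_add) measurable
  also have "(\<integral>\<^sup>+x. ennreal (s\<^sup>2) * indicator B x \<partial>lborel) = ennreal (s\<^sup>2) * emeasure lborel B"
    by (rule nn_integral_cmult_indicator) simp
  also have "(\<integral>\<^sup>+x. ?h x \<partial>lborel) = (\<integral>\<^sup>+t. (\<integral>\<^sup>+x. ennreal (2 * t) * indicator {s..} t * indicator {..<w x} t \<partial>lborel) \<partial>lborel)"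
    by (rule lborel_pair.Fubini'[symmetric]) measurable
  also have "\<dots> \<le> (\<integral>\<^sup>+t. ennreal (2 * M) * (ennreal (1 * t powr (- 1 - 1)) * indicator {s..} t) \<partial>lborel)"
  proof (intro nn_integral_mono)
    fix t :: real
    show "(\<integral>\<^sup>+x. ennreal (2 * t) * indicator {s..} t * indicator {..<w x} t \<partial>lborel)
       \<le> ennreal (2 * M) * (ennreal (1 * t powr (- 1 - 1)) * indicator {s..} t)"
    proof (cases "s \<le> t")
      case True
      then have t: "t > 0" using s by simp
      have "(\<integral>\<^sup>+x. ennreal (2 * t) * indicator {s..} t * indicator {..<w x} t \<partial>lborel)
         = (\<integral>\<^sup>+x. ennreal (2 * t) * indicator {x. t < w x} x \<partial>lborel)"
        using True by (intro nn_integral_cong) (auto simp: indicator_def)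
      also have "\<dots> = ennreal (2 * t) * emeasure lborel {x. t < w x}"
        by (rule nn_integral_cmult_indicator) measurable
      also have "\<dots> \<le> ennreal (2 * t) * ennreal (M / t ^ 3)" by (intro mult_left_mono weak t) simp
      also have "\<dots> = ennreal (2 * M * (1 * t powr (- 1 - 1)))"
        using t M by (simp add: ennreal_mult[symmetric] powr_minus powr_numeral power2_eq_square power3_eq_cube field_simps)
      finally show ?thesis using True M by (simp add: ennreal_mult[symmetric])
    qed simp
  qed
  also have "\<dots> = ennreal (2 * M) * ennreal (s powr (- 1))"
    using nn_integral_powr_tail[of s 1] s by (subst nn_integral_cmult) auto
  also have "ennreal (s\<^sup>2) * emeasure lborel B + ennreal (2 * M) * ennreal (s powr (- 1))
     \<le> ennreal (s\<^sup>2) * ennreal (c * R ^ 3) + ennreal (2 * M) * ennreal (s powr (- 1))"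
    by (intro add_right_mono mult_left_mono B) simp
  also have "\<dots> = ennreal (s\<^sup>2 * (c * R ^ 3) + 2 * M * R)"
    using c M R by (simp add: s_def powr_minus ennreal_mult[symmetric] ennreal_plus[symmetric] del: ennreal_plus)
  also have "s\<^sup>2 * (c * R ^ 3) + 2 * M * R = (c + 2 * M) * R"
    using R by (simp add: s_def field_simps power2_eq_square power3_eq_cube)
  finally show ?thesis by simp
qed

section \<open>The bilinear estimate for weak weights\<close>

lemma nn_integral_lborel_reflect:
  fixes f :: "'a::euclidean_space \<Rightarrow> ennreal"
  assumes [measurable]: "f \<in> borel_measurable borel"
  shows "(\<integral>\<^sup>+x. f (h - x) \<partial>lborel) = (\<integral>\<^sup>+x. f x \<partial>lborel)"
proof -
  have "(\<integral>\<^sup>+x. f x \<partial>lborel)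
      = (\<integral>\<^sup>+x. f x \<partial>density (distr lborel borel (\<lambda>x. h + (- 1) *\<^sub>R x)) (\<lambda>_. 1))"
    using lborel_affine[of "- 1" h] by simp
  also have "\<dots> = (\<integral>\<^sup>+x. f (h - x) \<partial>lborel)"
    by (simp add: nn_integral_density nn_integral_distr)
  finally show ?thesis ..
qed

text \<open>
  A weak-\<open>L\<^sup>3\<close> kernel is locally square integrable with linearly growing mass on balls. On
  \<open>bracket \<xi> \<le> bracket \<eta>\<close> the product \<open>w \<phi>(\<xi>) \<phi>(\<eta>)\<close> is split by AM-GM with the weight
  \<open>bracket \<eta> powr (3/2) * bracket \<xi> powr (-5/2)\<close>, for which both resulting integrals gain a power.
\<close>
lemma ordered_bilinear_bound:
  fixes w \<phi> :: "real^3 \<Rightarrow> real"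
  assumes [measurable]: "w \<in> borel_measurable borel" "\<phi> \<in> borel_measurable borel" and A: "0 \<le> A"
    and growth: "\<And>\<xi> R. 1 \<le> R \<Longrightarrow> (\<integral>\<^sup>+\<eta>. ennreal ((w (\<xi> - \<eta>))\<^sup>2) * indicator {..R} (bracket \<eta>) \<partial>lborel) \<le> ennreal (A * R)"
  shows "(\<integral>\<^sup>+\<xi>. \<integral>\<^sup>+\<eta>. ennreal (\<bar>w (\<xi> - \<eta>)\<bar> * (\<bar>\<phi> \<xi>\<bar> * \<bar>\<phi> \<eta>\<bar>)) * indicator {bracket \<xi>..} (bracket \<eta>) \<partial>lborel \<partial>lborel)
    \<le> ennreal (6 * ball_const + 3 * A) * (\<integral>\<^sup>+\<xi>. ennreal ((bracket \<xi>)\<^sup>2 * (\<phi> \<xi>)\<^sup>2) \<partial>lborel)"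
proof -
  let ?I = "\<lambda>\<xi> \<eta>::real^3. indicator {bracket \<xi>..} (bracket \<eta>) :: ennreal"
  let ?S = "\<integral>\<^sup>+\<xi>. ennreal ((bracket \<xi>)\<^sup>2 * (\<phi> \<xi>)\<^sup>2) \<partial>lborel"
  let ?a1 = "\<lambda>(\<xi>::real^3) \<eta>. ennreal (bracket \<eta> powr (3/2) * (\<phi> \<eta>)\<^sup>2) * (indicator {..bracket \<eta>} (bracket \<xi>) * ennreal (bracket \<xi> powr (- 5/2)))"
  let ?a2 = "\<lambda>(\<xi>::real^3) \<eta>. ennreal (bracket \<xi> powr (5/2) * (\<phi> \<xi>)\<^sup>2) * (ennreal ((w (\<xi> - \<eta>))\<^sup>2) * indicator {bracket \<xi>..} (bracket \<eta>) * ennreal (bracket \<eta> powr (- 3/2)))"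
  have [measurable]: "case_prod ?I \<in> borel_measurable (lborel \<Otimes>\<^sub>M lborel)"
    "case_prod (\<lambda>\<xi> \<eta>::real^3. indicator {..bracket \<eta>} (bracket \<xi>) :: ennreal) \<in> borel_measurable (lborel \<Otimes>\<^sub>M lborel)"
    by measurable
  have am: "w' * (a * b) \<le> \<alpha> * b\<^sup>2 + a\<^sup>2 * w'\<^sup>2 * (1 / \<alpha>)" if "0 \<le> w'" "0 \<le> a" "0 \<le> b" "0 < \<alpha>" for w' a b \<alpha> :: real
  proof -
    have "0 \<le> (a * w' - \<alpha> * b)\<^sup>2 / \<alpha> + w' * (a * b)" using that by simp
    also have "(a * w' - \<alpha> * b)\<^sup>2 / \<alpha> + w' * (a * b) = \<alpha> * b\<^sup>2 + a\<^sup>2 * w'\<^sup>2 * (1 / \<alpha>) - w' * (a * b)"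
      using that by (simp add: power2_eq_square field_simps)
    finally show ?thesis by simp
  qed
  have pt: "ennreal (\<bar>w (\<xi> - \<eta>)\<bar> * (\<bar>\<phi> \<xi>\<bar> * \<bar>\<phi> \<eta>\<bar>)) * ?I \<xi> \<eta> \<le> ?a1 \<xi> \<eta> + ?a2 \<xi> \<eta>" for \<xi> \<eta>
  proof (cases "bracket \<xi> \<le> bracket \<eta>")
    case True
    let ?\<alpha> = "bracket \<eta> powr (3/2) * bracket \<xi> powr (- 5/2)"
    have pos: "0 < ?\<alpha>" using bracket_pos[of \<xi>] bracket_pos[of \<eta>] by simp
    have "bracket \<eta> powr (3/2) * bracket \<eta> powr (- 3/2) = 1" "bracket \<xi> powr (- 5/2) * bracket \<xi> powr (5/2) = 1"
      using bracket_pos[of \<xi>] bracket_pos[of \<eta>] unfolding powr_add[symmetric] by simp_all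
    then have "(bracket \<xi> powr (5/2) * bracket \<eta> powr (- 3/2)) * ?\<alpha> = 1" by (simp only: mult_ac)
    then have inv: "1 / ?\<alpha> = bracket \<xi> powr (5/2) * bracket \<eta> powr (- 3/2)"
      using pos by (subst nonzero_divide_eq_eq) auto
    have "\<bar>w (\<xi> - \<eta>)\<bar> * (\<bar>\<phi> \<xi>\<bar> * \<bar>\<phi> \<eta>\<bar>) \<le> ?\<alpha> * (\<phi> \<eta>)\<^sup>2 + (\<phi> \<xi>)\<^sup>2 * (w (\<xi> - \<eta>))\<^sup>2 * (1 / ?\<alpha>)"
      using am[of "\<bar>w (\<xi> - \<eta>)\<bar>" "\<bar>\<phi> \<xi>\<bar>" "\<bar>\<phi> \<eta>\<bar>", OF _ _ _ pos] by simp
    also have "\<dots> = (bracket \<eta> powr (3/2) * (\<phi> \<eta>)\<^sup>2) * bracket \<xi> powr (- 5/2)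
        + (bracket \<xi> powr (5/2) * (\<phi> \<xi>)\<^sup>2) * ((w (\<xi> - \<eta>))\<^sup>2 * bracket \<eta> powr (- 3/2))"
      unfolding inv by (simp add: mult_ac)
    finally show ?thesis
      using True by (simp add: ennreal_mult[symmetric] ennreal_plus[symmetric] ennreal_leI del: ennreal_plus)
  qed simp
  have "(\<integral>\<^sup>+\<xi>. \<integral>\<^sup>+\<eta>. ennreal (\<bar>w (\<xi> - \<eta>)\<bar> * (\<bar>\<phi> \<xi>\<bar> * \<bar>\<phi> \<eta>\<bar>)) * ?I \<xi> \<eta> \<partial>lborel \<partial>lborel)
    \<le> (\<integral>\<^sup>+\<xi>. \<integral>\<^sup>+\<eta>. ?a1 \<xi> \<eta> + ?a2 \<xi> \<eta> \<partial>lborel \<partial>lborel)"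
    by (intro nn_integral_mono pt)
  also have "\<dots> = (\<integral>\<^sup>+\<xi>. (\<integral>\<^sup>+\<eta>. ?a1 \<xi> \<eta> \<partial>lborel) + (\<integral>\<^sup>+\<eta>. ?a2 \<xi> \<eta> \<partial>lborel) \<partial>lborel)"
    by (intro nn_integral_cong nn_integral_add) measurable
  also have "\<dots> = (\<integral>\<^sup>+\<xi>. \<integral>\<^sup>+\<eta>. ?a1 \<xi> \<eta> \<partial>lborel \<partial>lborel) + (\<integral>\<^sup>+\<xi>. \<integral>\<^sup>+\<eta>. ?a2 \<xi> \<eta> \<partial>lborel \<partial>lborel)"
    by (rule nn_integral_add) measurable
  also have "(\<integral>\<^sup>+\<xi>. \<integral>\<^sup>+\<eta>. ?a1 \<xi> \<eta> \<partial>lborel \<partial>lborel) = (\<integral>\<^sup>+\<eta>. \<integral>\<^sup>+\<xi>. ?a1 \<xi> \<eta> \<partial>lborel \<partial>lborel)"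
    by (rule lborel_pair.Fubini'[symmetric]) measurable
  also have "\<dots> \<le> (\<integral>\<^sup>+\<eta>. ennreal (6 * ball_const) * ennreal ((bracket \<eta>)\<^sup>2 * (\<phi> \<eta>)\<^sup>2) \<partial>lborel)"
  proof (intro nn_integral_mono)
    fix \<eta> :: "real^3"
    have "(\<integral>\<^sup>+\<xi>. ?a1 \<xi> \<eta> \<partial>lborel) = ennreal (bracket \<eta> powr (3/2) * (\<phi> \<eta>)\<^sup>2) *
       (\<integral>\<^sup>+\<xi>. indicator {..bracket \<eta>} (bracket (\<xi>::real^3)) * ennreal (bracket \<xi> powr (- 5/2)) \<partial>lborel)"
      by (rule nn_integral_cmult) measurable
    also have "\<dots> \<le> ennreal (bracket \<eta> powr (3/2) * (\<phi> \<eta>)\<^sup>2) * ennreal (6 * ball_const * bracket \<eta> powr (1/2))"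
      by (intro mult_left_mono bracket_powr_local_integral bracket_ge_1) simp
    also have "\<dots> = ennreal (6 * ball_const * ((bracket \<eta> powr (3/2) * bracket \<eta> powr (1/2)) * (\<phi> \<eta>)\<^sup>2))"
      using ball_const_nonneg by (subst ennreal_mult[symmetric]) (auto simp: mult_ac)
    also have "bracket \<eta> powr (3/2) * bracket \<eta> powr (1/2) = (bracket \<eta>)\<^sup>2"
      using bracket_pos[of \<eta>] unfolding powr_add[symmetric] by (simp add: powr_numeral)
    finally show "(\<integral>\<^sup>+\<xi>. ?a1 \<xi> \<eta> \<partial>lborel) \<le> ennreal (6 * ball_const) * ennreal ((bracket \<eta>)\<^sup>2 * (\<phi> \<eta>)\<^sup>2)"
      using ball_const_nonneg by (simp add: ennreal_mult)
  qed
  also have "\<dots> = ennreal (6 * ball_const) * ?S" by (rule nn_integral_cmult) measurable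
  also have "(\<integral>\<^sup>+\<xi>. \<integral>\<^sup>+\<eta>. ?a2 \<xi> \<eta> \<partial>lborel \<partial>lborel) \<le> (\<integral>\<^sup>+\<xi>. ennreal (3 * A) * ennreal ((bracket \<xi>)\<^sup>2 * (\<phi> \<xi>)\<^sup>2) \<partial>lborel)"
  proof (intro nn_integral_mono)
    fix \<xi> :: "real^3"
    have "(\<integral>\<^sup>+\<eta>. ?a2 \<xi> \<eta> \<partial>lborel) = ennreal (bracket \<xi> powr (5/2) * (\<phi> \<xi>)\<^sup>2) *
       (\<integral>\<^sup>+\<eta>. ennreal ((w (\<xi> - \<eta>))\<^sup>2) * indicator {bracket \<xi>..} (bracket \<eta>) * ennreal (bracket \<eta> powr (- 3/2)) \<partial>lborel)"
      by (rule nn_integral_cmult) measurable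
    also have "\<dots> \<le> ennreal (bracket \<xi> powr (5/2) * (\<phi> \<xi>)\<^sup>2) * ennreal (3 * A * bracket \<xi> powr (- 1/2))"
      by (intro mult_left_mono linear_growth_weighted_tail growth bracket_ge_1 A) auto
    also have "\<dots> = ennreal (3 * A * ((bracket \<xi> powr (5/2) * bracket \<xi> powr (- 1/2)) * (\<phi> \<xi>)\<^sup>2))"
      using A by (subst ennreal_mult[symmetric]) (auto simp: mult_ac)
    also have "bracket \<xi> powr (5/2) * bracket \<xi> powr (- 1/2) = (bracket \<xi>)\<^sup>2"
      using bracket_pos[of \<xi>] unfolding powr_add[symmetric] by (simp add: powr_numeral)
    finally show "(\<integral>\<^sup>+\<eta>. ?a2 \<xi> \<eta> \<partial>lborel) \<le> ennreal (3 * A) * ennreal ((bracket \<xi>)\<^sup>2 * (\<phi> \<xi>)\<^sup>2)"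
      using A by (simp add: ennreal_mult)
  qed
  also have "\<dots> = ennreal (3 * A) * ?S" by (rule nn_integral_cmult) measurable
  finally have "(\<integral>\<^sup>+\<xi>. \<integral>\<^sup>+\<eta>. ennreal (\<bar>w (\<xi> - \<eta>)\<bar> * (\<bar>\<phi> \<xi>\<bar> * \<bar>\<phi> \<eta>\<bar>)) * ?I \<xi> \<eta> \<partial>lborel \<partial>lborel)
    \<le> ennreal (6 * ball_const) * ?S + ennreal (3 * A) * ?S" by (auto simp: add_mono)
  then show ?thesis using A ball_const_nonneg by (simp add: distrib_right[symmetric])
qed

text \<open>Exchanging the variables turns the region where \<open>bracket \<eta>\<close> is the
  smaller one into the ordered region for the reflected weight. Reflection preserves the measure of
  superlevel sets, so both regions obey the same bound; hence the factor 2.\<close>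

lemma bilinear_bound:
  fixes w \<phi> :: "real^3 \<Rightarrow> real"
  assumes [measurable]: "w \<in> borel_measurable borel" "\<phi> \<in> borel_measurable borel"
    and w0: "\<And>x. 0 \<le> w x" and \<phi>0: "\<And>x. 0 \<le> \<phi> x" and M: "0 \<le> M"
    and weak: "\<And>t. t > 0 \<Longrightarrow> emeasure lborel {x. t < w x} \<le> ennreal (M / t ^ 3)"
  shows "(\<integral>\<^sup>+\<xi>. \<integral>\<^sup>+\<eta>. ennreal (w (\<xi> - \<eta>) * (\<phi> \<xi> * \<phi> \<eta>)) \<partial>lborel \<partial>lborel)
    \<le> ennreal (2 * (6 * ball_const + 3 * (ball_const + 2 * M))) * (\<integral>\<^sup>+\<xi>. ennreal ((bracket \<xi>)\<^sup>2 * (\<phi> \<xi>)\<^sup>2) \<partial>lborel)"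
proof -
  let ?A = "ball_const + 2 * M"
  let ?S = "\<integral>\<^sup>+\<xi>. ennreal ((bracket \<xi>)\<^sup>2 * (\<phi> \<xi>)\<^sup>2) \<partial>lborel"
  let ?w' = "\<lambda>x. w (- x)"
  have A: "0 \<le> ?A" using M ball_const_nonneg by simp
  have g1: "(\<integral>\<^sup>+\<eta>. ennreal ((w (\<xi> - \<eta>))\<^sup>2) * indicator {..R} (bracket \<eta>) \<partial>lborel) \<le> ennreal (?A * R)" if R: "1 \<le> R" for \<xi> R
  proof -
    have weak': "emeasure lborel {\<eta>. t < w (\<xi> - \<eta>)} \<le> ennreal (M / t ^ 3)" if "t > 0" for t
    proof -
      have "emeasure lborel {\<eta>. t < w (\<xi> - \<eta>)} = (\<integral>\<^sup>+\<eta>. indicator {\<eta>. t < w (\<xi> - \<eta>)} \<eta> \<partial>lborel)"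
        by (rule nn_integral_indicator[symmetric]) measurable
      also have "\<dots> = (\<integral>\<^sup>+\<eta>. indicator {x. t < w x} (\<xi> - \<eta>) \<partial>lborel)"
        by (rule nn_integral_cong) (simp add: indicator_def)
      also have "\<dots> = (\<integral>\<^sup>+x. indicator {x. t < w x} x \<partial>lborel)"
        by (rule nn_integral_lborel_reflect) measurable
      finally show ?thesis using weak[OF that] by simp
    qed
    have "(\<integral>\<^sup>+\<eta>. ennreal ((w (\<xi> - \<eta>))\<^sup>2) * indicator {\<eta>. bracket \<eta> \<le> R} \<eta> \<partial>lborel) \<le> ennreal (?A * R)"
      by (rule weak_L3_square_local[OF _ _ M ball_const_nonneg weak' _ emeasure_bracket_le[OF R] R]) (use w0 in auto)
    then show ?thesis by (simp add: indicator_def)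
  qed
  have g2: "(\<integral>\<^sup>+\<eta>. ennreal ((?w' (\<xi> - \<eta>))\<^sup>2) * indicator {..R} (bracket \<eta>) \<partial>lborel) \<le> ennreal (?A * R)" if R: "1 \<le> R" for \<xi> R
  proof -
    have weak': "emeasure lborel {\<eta>. t < ?w' (\<xi> - \<eta>)} \<le> ennreal (M / t ^ 3)" if "t > 0" for t
    proof -
      have "emeasure lborel {\<eta>. t < ?w' (\<xi> - \<eta>)} = (\<integral>\<^sup>+\<eta>. indicator {\<eta>. t < ?w' (\<xi> - \<eta>)} \<eta> \<partial>lborel)"
        by (rule nn_integral_indicator[symmetric]) measurable
      also have "\<dots> = (\<integral>\<^sup>+\<eta>. indicator {x. t < w x} (\<eta> + (- \<xi>)) \<partial>lborel)"
        by (rule nn_integral_cong) (simp add: indicator_def)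
      also have "\<dots> = (\<integral>\<^sup>+x. indicator {x. t < w x} x \<partial>lborel)"
        by (rule nn_integral_lborel_shift) measurable
      finally show ?thesis using weak[OF that] by simp
    qed
    have "(\<integral>\<^sup>+\<eta>. ennreal ((?w' (\<xi> - \<eta>))\<^sup>2) * indicator {\<eta>. bracket \<eta> \<le> R} \<eta> \<partial>lborel) \<le> ennreal (?A * R)"
      by (rule weak_L3_square_local[OF _ _ M ball_const_nonneg weak' _ emeasure_bracket_le[OF R] R]) (use w0 in auto)
    then show ?thesis by (simp add: indicator_def)
  qed
  let ?F = "\<lambda>\<xi> \<eta>. ennreal (w (\<xi> - \<eta>) * (\<phi> \<xi> * \<phi> \<eta>))"
  let ?I = "\<lambda>\<xi> \<eta>. indicator {bracket \<xi>..} (bracket \<eta>) :: ennreal"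
  have "(\<integral>\<^sup>+\<xi>. \<integral>\<^sup>+\<eta>. ?F \<xi> \<eta> \<partial>lborel \<partial>lborel) \<le> (\<integral>\<^sup>+\<xi>. \<integral>\<^sup>+\<eta>. ?F \<xi> \<eta> * ?I \<xi> \<eta> + ?F \<xi> \<eta> * ?I \<eta> \<xi> \<partial>lborel \<partial>lborel)"
    by (intro nn_integral_mono) (auto simp: indicator_def)
  also have "\<dots> = (\<integral>\<^sup>+\<xi>. (\<integral>\<^sup>+\<eta>. ?F \<xi> \<eta> * ?I \<xi> \<eta> \<partial>lborel) + (\<integral>\<^sup>+\<eta>. ?F \<xi> \<eta> * ?I \<eta> \<xi> \<partial>lborel) \<partial>lborel)"
    by (intro nn_integral_cong nn_integral_add) measurable
  also have "\<dots> = (\<integral>\<^sup>+\<xi>. \<integral>\<^sup>+\<eta>. ?F \<xi> \<eta> * ?I \<xi> \<eta> \<partial>lborel \<partial>lborel) + (\<integral>\<^sup>+\<xi>. \<integral>\<^sup>+\<eta>. ?F \<xi> \<eta> * ?I \<eta> \<xi> \<partial>lborel \<partial>lborel)"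
    by (rule nn_integral_add) measurable
  also have "(\<integral>\<^sup>+\<xi>. \<integral>\<^sup>+\<eta>. ?F \<xi> \<eta> * ?I \<xi> \<eta> \<partial>lborel \<partial>lborel) \<le> ennreal (6 * ball_const + 3 * ?A) * ?S"
    using ordered_bilinear_bound[OF _ _ A g1, where \<phi>=\<phi>] w0 \<phi>0 by simp
  also have "(\<integral>\<^sup>+\<xi>. \<integral>\<^sup>+\<eta>. ?F \<xi> \<eta> * ?I \<eta> \<xi> \<partial>lborel \<partial>lborel) = (\<integral>\<^sup>+\<eta>. \<integral>\<^sup>+\<xi>. ?F \<xi> \<eta> * ?I \<eta> \<xi> \<partial>lborel \<partial>lborel)"
    by (rule lborel_pair.Fubini'[symmetric]) measurable
  also have "\<dots> = (\<integral>\<^sup>+\<xi>. \<integral>\<^sup>+\<eta>. ennreal (\<bar>?w' (\<xi> - \<eta>)\<bar> * (\<bar>\<phi> \<xi>\<bar> * \<bar>\<phi> \<eta>\<bar>)) * ?I \<xi> \<eta> \<partial>lborel \<partial>lborel)"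
    using w0 \<phi>0 by (intro nn_integral_cong) (simp add: mult.commute[of "\<phi> _" "\<phi> _"])
  also have "\<dots> \<le> ennreal (6 * ball_const + 3 * ?A) * ?S"
    by (rule ordered_bilinear_bound[OF _ _ A g2]) auto
  finally have "(\<integral>\<^sup>+\<xi>. \<integral>\<^sup>+\<eta>. ?F \<xi> \<eta> \<partial>lborel \<partial>lborel) \<le> ennreal (6 * ball_const + 3 * ?A) * ?S + ennreal (6 * ball_const + 3 * ?A) * ?S"
    by (simp add: add_mono)
  also have "\<dots> = ennreal (2 * (6 * ball_const + 3 * ?A)) * ?S"
  proof -
    have "ennreal (2 * (6 * ball_const + 3 * ?A)) = ennreal (6 * ball_const + 3 * ?A) + ennreal (6 * ball_const + 3 * ?A)"
      using A ball_const_nonneg by (subst ennreal_plus[symmetric]) auto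
    then show ?thesis by (simp only: distrib_right)
  qed
  finally show ?thesis .
qed

text \<open>The substitution \<open>\<eta> = \<xi> - k\<close> turns the integral of
  \<open>w\<close> against the autocorrelation of \<open>|ft u|\<close> into the bilinear form of
  \<open>bilinear_bound\<close>. The power of \<open>2 * pi\<close> from
  \<open>ft_square_le_convolution\<close> equals that from \<open>ft_weighted_bound\<close> and
  cancels.\<close>

lemma weak_L3_fourier_bound_integrable:
  fixes u :: "real^3 \<Rightarrow> complex" and w :: "real^3 \<Rightarrow> real" and K :: real
  assumes u: "integrable lborel u" and u2: "integrable lborel (\<lambda>x. (cmod (u x))\<^sup>2)"
    and K: "0 \<le> K"
    and lip: "\<And>h. (\<integral>\<^sup>+x. ennreal ((cmod (u (x + h) - u x))\<^sup>2) \<partial>lborel) \<le> ennreal (K * (norm h)\<^sup>2)"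
    and [measurable]: "w \<in> borel_measurable borel" and w0: "\<And>x. 0 \<le> w x" and M: "0 \<le> M"
    and weak: "\<And>t. t > 0 \<Longrightarrow> emeasure lborel {x. t < w x} \<le> ennreal (M / t ^ 3)"
  shows "(\<integral>\<^sup>+k. ennreal (w k * cmod (ft (\<lambda>x. of_real ((cmod (u x))\<^sup>2)) k)) \<partial>lborel)
    \<le> ennreal (2 * (6 * ball_const + 3 * (ball_const + 2 * M)) * ((\<integral>x. (cmod (u x))\<^sup>2 \<partial>lborel) + 3 * K))"
proof -
  have [measurable]: "u \<in> borel_measurable borel" using borel_measurable_integrable[OF u] by simp
  let ?c = "(sqrt (2 * pi) ^ 3)\<^sup>2"
  let ?C = "2 * (6 * ball_const + 3 * (ball_const + 2 * M))"
  let ?\<phi> = "\<lambda>\<xi>. cmod (ft u \<xi>)"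
  let ?X = "\<integral>\<^sup>+k. ennreal (w k * cmod (ft (\<lambda>x. of_real ((cmod (u x))\<^sup>2)) k)) \<partial>lborel"
  have C0: "0 \<le> ?C" using M ball_const_nonneg by simp
  have "ennreal ?c * ?X = (\<integral>\<^sup>+k. ennreal ?c * ennreal (w k * cmod (ft (\<lambda>x. of_real ((cmod (u x))\<^sup>2)) k)) \<partial>lborel)"
    by (rule nn_integral_cmult[symmetric]) measurable
  also have "\<dots> \<le> (\<integral>\<^sup>+k. (\<integral>\<^sup>+\<xi>. ennreal (w k * (?\<phi> \<xi> * ?\<phi> (\<xi> - k))) \<partial>lborel) \<partial>lborel)"
  proof (intro nn_integral_mono)
    fix k :: "real^3"
    have "ennreal ?c * ennreal (w k * cmod (ft (\<lambda>x. of_real ((cmod (u x))\<^sup>2)) k))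
        = ennreal (w k) * ennreal (?c * cmod (ft (\<lambda>x. of_real ((cmod (u x))\<^sup>2)) k))"
      using w0[of k] by (subst (1 2) ennreal_mult[symmetric]) (auto simp: mult_ac)
    also have "\<dots> \<le> ennreal (w k) * (\<integral>\<^sup>+\<xi>. ennreal (?\<phi> \<xi> * ?\<phi> (\<xi> - k)) \<partial>lborel)"
      using ft_square_le_convolution[OF u u2 lip K, of k] by (intro mult_left_mono) auto
    also have "\<dots> = (\<integral>\<^sup>+\<xi>. ennreal (w k) * ennreal (?\<phi> \<xi> * ?\<phi> (\<xi> - k)) \<partial>lborel)"
      by (rule nn_integral_cmult[symmetric]) measurable
    also have "\<dots> = (\<integral>\<^sup>+\<xi>. ennreal (w k * (?\<phi> \<xi> * ?\<phi> (\<xi> - k))) \<partial>lborel)"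
      using w0[of k] by (intro nn_integral_cong) (simp add: ennreal_mult)
    finally show "ennreal ?c * ennreal (w k * cmod (ft (\<lambda>x. of_real ((cmod (u x))\<^sup>2)) k))
      \<le> (\<integral>\<^sup>+\<xi>. ennreal (w k * (?\<phi> \<xi> * ?\<phi> (\<xi> - k))) \<partial>lborel)" .
  qed
  also have "\<dots> = (\<integral>\<^sup>+\<xi>. (\<integral>\<^sup>+k. ennreal (w k * (?\<phi> \<xi> * ?\<phi> (\<xi> - k))) \<partial>lborel) \<partial>lborel)"
    by (rule lborel_pair.Fubini'[symmetric]) measurable
  also have "\<dots> = (\<integral>\<^sup>+\<xi>. (\<integral>\<^sup>+\<eta>. ennreal (w (\<xi> - \<eta>) * (?\<phi> \<xi> * ?\<phi> \<eta>)) \<partial>lborel) \<partial>lborel)"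
  proof (rule nn_integral_cong)
    fix \<xi> :: "real^3"
    show "(\<integral>\<^sup>+k. ennreal (w k * (?\<phi> \<xi> * ?\<phi> (\<xi> - k))) \<partial>lborel) = (\<integral>\<^sup>+\<eta>. ennreal (w (\<xi> - \<eta>) * (?\<phi> \<xi> * ?\<phi> \<eta>)) \<partial>lborel)"
      using nn_integral_lborel_reflect[of "\<lambda>k. ennreal (w k * (?\<phi> \<xi> * ?\<phi> (\<xi> - k)))" \<xi>] by simp
  qed
  also have "\<dots> \<le> ennreal ?C * (\<integral>\<^sup>+\<xi>. ennreal ((bracket \<xi>)\<^sup>2 * (?\<phi> \<xi>)\<^sup>2) \<partial>lborel)"
    by (rule bilinear_bound[OF _ _ w0 _ M weak]) auto
  also have "\<dots> \<le> ennreal ?C * (\<integral>\<^sup>+\<xi>. ennreal ((1 + \<xi> \<bullet> \<xi>) * (?\<phi> \<xi>)\<^sup>2) \<partial>lborel)"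
    by (intro mult_left_mono nn_integral_mono ennreal_leI mult_right_mono bracket_sq_le) auto
  also have "\<dots> \<le> ennreal ?C * ennreal (?c * ((\<integral>x. (cmod (u x))\<^sup>2 \<partial>lborel) + 3 * K))"
    using ft_weighted_bound[OF u u2 K lip] by (intro mult_left_mono) auto
  also have "\<dots> = ennreal ?c * ennreal (?C * ((\<integral>x. (cmod (u x))\<^sup>2 \<partial>lborel) + 3 * K))"
    using C0 K by (subst (1 2) ennreal_mult[symmetric]) (auto simp: mult_ac)
  finally have le: "ennreal ?c * ?X \<le> ennreal ?c * ennreal (?C * ((\<integral>x. (cmod (u x))\<^sup>2 \<partial>lborel) + 3 * K))" .
  have cp: "ennreal ?c \<noteq> 0" "ennreal ?c \<noteq> \<top>" by auto
  from le cp show ?thesis by (simp add: ennreal_mult_le_mult_iff)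
qed

text \<open>Multiplication by the cutoffs \<open>max 0 (1 - |x| / n)\<close> makes \<open>u\<close> integrable and keeps the
  translation modulus of continuity under control.\<close>
lemma weak_L3_fourier_bound:
  fixes u :: "real^3 \<Rightarrow> complex" and w :: "real^3 \<Rightarrow> real" and K :: real
  assumes [measurable]: "u \<in> borel_measurable borel" and u2: "integrable lborel (\<lambda>x. (cmod (u x))\<^sup>2)"
    and K: "0 \<le> K"
    and lip: "\<And>h. (\<integral>\<^sup>+x. ennreal ((cmod (u (x + h) - u x))\<^sup>2) \<partial>lborel) \<le> ennreal (K * (norm h)\<^sup>2)"
    and [measurable]: "w \<in> borel_measurable borel" and w0: "\<And>x. 0 \<le> w x" and M: "0 \<le> M"
    and weak: "\<And>t. t > 0 \<Longrightarrow> emeasure lborel {x. t < w x} \<le> ennreal (M / t ^ 3)"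
  shows "(\<integral>\<^sup>+k. ennreal (w k * cmod (ft (\<lambda>x. of_real ((cmod (u x))\<^sup>2)) k)) \<partial>lborel)
    \<le> ennreal (2 * (6 * ball_const + 3 * (ball_const + 2 * M)) * (7 * (\<integral>x. (cmod (u x))\<^sup>2 \<partial>lborel) + 6 * K))"
proof -
  let ?U = "\<integral>x. (cmod (u x))\<^sup>2 \<partial>lborel"
  let ?C = "2 * (6 * ball_const + 3 * (ball_const + 2 * M))"
  have C0: "0 \<le> ?C" using M ball_const_nonneg by simp
  define cut where "cut n x = max 0 (1 - norm x / real (Suc n))" for n and x :: "real^3"
  have cut: "0 \<le> cut n x" "cut n x \<le> 1" for n x by (auto simp: cut_def)
  have [measurable]: "cut n \<in> borel_measurable borel" for n unfolding cut_def[abs_def] by measurable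
  have cut_lip: "\<bar>cut n (x + h) - cut n x\<bar> \<le> norm h" for n x h
  proof -
    have "\<bar>cut n (x + h) - cut n x\<bar> \<le> \<bar>norm (x + h) / real (Suc n) - norm x / real (Suc n)\<bar>"
      unfolding cut_def by linarith
    also have "\<dots> = \<bar>norm (x + h) - norm x\<bar> / real (Suc n)" by (simp add: diff_divide_distrib[symmetric] del: of_nat_Suc)
    also have "\<dots> \<le> norm h / real (Suc n)"
      using norm_triangle_ineq3[of "x + h" x] by (intro divide_right_mono) auto
    also have "\<dots> \<le> norm h / 1" by (intro divide_left_mono) auto
    finally show ?thesis by simp
  qed
  have cut_lim: "(\<lambda>n. cut n x) \<longlonglongrightarrow> 1" for x
  proof -
    have "(\<lambda>n. max 0 (1 - norm x * inverse (real (Suc n)))) \<longlonglongrightarrow> max 0 (1 - norm x * 0)"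
      by (intro tendsto_intros LIMSEQ_inverse_real_of_nat)
    then show ?thesis by (simp add: cut_def divide_inverse)
  qed
  define un where "un n x = of_real (cut n x) * u x" for n x
  have [measurable]: "un n \<in> borel_measurable borel" for n unfolding un_def[abs_def] by measurable
  have un_le: "cmod (un n x) \<le> cmod (u x)" for n x
    using mult_right_mono[OF cut(2)[of n x] norm_ge_zero[of "u x"]] cut(1)[of n x] by (simp add: un_def norm_mult)
  have un_sq_le: "(cmod (un n x))\<^sup>2 \<le> (cmod (u x))\<^sup>2" for n x by (intro power_mono un_le) auto
  have un2: "integrable lborel (\<lambda>x. (cmod (un n x))\<^sup>2)" for n
    by (rule Bochner_Integration.integrable_bound[OF u2]) (use un_sq_le in auto)
  have un2_le: "(\<integral>x. (cmod (un n x))\<^sup>2 \<partial>lborel) \<le> ?U" for n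
    by (rule integral_mono[OF un2 u2 un_sq_le])
  have un1: "integrable lborel (un n)" for n
  proof (rule Bochner_Integration.integrable_bound)
    let ?B = "cball (0::real^3) (real (Suc n))"
    have "integrable lborel (indicat_real ?B)"
      by (rule integrable_real_indicator) (simp, rule emeasure_bounded_finite, rule bounded_cball)
    then show "integrable lborel (\<lambda>x. (cmod (u x))\<^sup>2 + indicat_real ?B x)" using u2 by simp
    show "AE x in lborel. norm (un n x) \<le> norm ((cmod (u x))\<^sup>2 + indicat_real ?B x)"
    proof (intro AE_I2)
      fix x :: "real^3"
      show "norm (un n x) \<le> norm ((cmod (u x))\<^sup>2 + indicat_real ?B x)"
      proof (cases "norm x \<le> real (Suc n)")
        case True
        have "norm (un n x) \<le> cmod (u x)" by (rule un_le)
        also have "\<dots> \<le> (cmod (u x))\<^sup>2 + 1" using zero_le_power2[of "cmod (u x) - 1/2"] by (simp add: power2_eq_square algebra_simps)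
        finally show ?thesis using True by simp
      next
        case False
        then have "norm x / real (Suc n) \<ge> 1" by (simp add: pos_le_divide_eq)
        then have "cut n x = 0" by (simp add: cut_def max_def)
        then show ?thesis by (simp add: un_def)
      qed
    qed
  qed simp
  have un_lip: "(\<integral>\<^sup>+x. ennreal ((cmod (un n (x + h) - un n x))\<^sup>2) \<partial>lborel) \<le> ennreal ((2 * K + 2 * ?U) * (norm h)\<^sup>2)" for n h
  proof -
    have pt: "(cmod (un n (x + h) - un n x))\<^sup>2 \<le> 2 * (cmod (u (x + h) - u x))\<^sup>2 + 2 * (norm h)\<^sup>2 * (cmod (u x))\<^sup>2" for x
    proof -
      have "un n (x + h) - un n x = of_real (cut n (x + h)) * (u (x + h) - u x) + of_real (cut n (x + h) - cut n x) * u x"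
        by (simp add: un_def algebra_simps)
      then have "cmod (un n (x + h) - un n x) \<le> cut n (x + h) * cmod (u (x + h) - u x) + \<bar>cut n (x + h) - cut n x\<bar> * cmod (u x)"
        using cut(1)[of n "x + h"]
        by (metis abs_of_nonneg norm_mult norm_of_real norm_triangle_ineq)
      also have "\<dots> \<le> 1 * cmod (u (x + h) - u x) + norm h * cmod (u x)"
        using cut cut_lip by (intro add_mono mult_right_mono) auto
      finally have "(cmod (un n (x + h) - un n x))\<^sup>2 \<le> (cmod (u (x + h) - u x) + norm h * cmod (u x))\<^sup>2"
        by (intro power_mono) auto
      also have "\<dots> \<le> 2 * (cmod (u (x + h) - u x))\<^sup>2 + 2 * (norm h)\<^sup>2 * (cmod (u x))\<^sup>2"
        using zero_le_power2[of "cmod (u (x + h) - u x) - norm h * cmod (u x)"]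
        by (simp add: power2_eq_square algebra_simps)
      finally show ?thesis .
    qed
    have "(\<integral>\<^sup>+x. ennreal ((cmod (un n (x + h) - un n x))\<^sup>2) \<partial>lborel)
       \<le> (\<integral>\<^sup>+x. ennreal 2 * ennreal ((cmod (u (x + h) - u x))\<^sup>2) + ennreal (2 * (norm h)\<^sup>2) * ennreal ((cmod (u x))\<^sup>2) \<partial>lborel)"
    proof (intro nn_integral_mono)
      fix x
      show "ennreal ((cmod (un n (x + h) - un n x))\<^sup>2) \<le> ennreal 2 * ennreal ((cmod (u (x + h) - u x))\<^sup>2) + ennreal (2 * (norm h)\<^sup>2) * ennreal ((cmod (u x))\<^sup>2)"
        using pt[of x] by (subst (1 2) ennreal_mult[symmetric]) (auto simp: ennreal_plus[symmetric] simp del: ennreal_plus intro!: ennreal_leI)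
    qed
    also have "\<dots> = (\<integral>\<^sup>+x. ennreal 2 * ennreal ((cmod (u (x + h) - u x))\<^sup>2) \<partial>lborel) + (\<integral>\<^sup>+x. ennreal (2 * (norm h)\<^sup>2) * ennreal ((cmod (u x))\<^sup>2) \<partial>lborel)"
      by (rule nn_integral_add) measurable
    also have "(\<integral>\<^sup>+x. ennreal 2 * ennreal ((cmod (u (x + h) - u x))\<^sup>2) \<partial>lborel) = ennreal 2 * (\<integral>\<^sup>+x. ennreal ((cmod (u (x + h) - u x))\<^sup>2) \<partial>lborel)"
      by (rule nn_integral_cmult) measurable
    also have "(\<integral>\<^sup>+x. ennreal (2 * (norm h)\<^sup>2) * ennreal ((cmod (u x))\<^sup>2) \<partial>lborel) = ennreal (2 * (norm h)\<^sup>2) * (\<integral>\<^sup>+x. ennreal ((cmod (u x))\<^sup>2) \<partial>lborel)"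
      by (rule nn_integral_cmult) measurable
    also have "(\<integral>\<^sup>+x. ennreal ((cmod (u x))\<^sup>2) \<partial>lborel) = ennreal ?U"
      by (rule nn_integral_eq_integral[OF u2]) simp
    also have "ennreal 2 * (\<integral>\<^sup>+x. ennreal ((cmod (u (x + h) - u x))\<^sup>2) \<partial>lborel) + ennreal (2 * (norm h)\<^sup>2) * ennreal ?U
       \<le> ennreal 2 * ennreal (K * (norm h)\<^sup>2) + ennreal (2 * (norm h)\<^sup>2) * ennreal ?U"
      by (intro add_right_mono mult_left_mono lip) simp
    also have "\<dots> = ennreal ((2 * K + 2 * ?U) * (norm h)\<^sup>2)"
      using K by (subst (1 2) ennreal_mult[symmetric]) (auto simp: ennreal_plus[symmetric] algebra_simps simp del: ennreal_plus)
    finally show ?thesis .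
  qed
  show ?thesis
  proof (rule nn_integral_le_of_tendsto)
    let ?r = "\<lambda>n x. complex_of_real ((cmod (un n x))\<^sup>2)"
    show "(\<lambda>k. ennreal (w k * cmod (ft (?r n) k))) \<in> borel_measurable lborel" for n by measurable
    show "(\<lambda>n. ennreal (w k * cmod (ft (?r n) k))) \<longlonglongrightarrow> ennreal (w k * cmod (ft (\<lambda>x. of_real ((cmod (u x))\<^sup>2)) k))" for k
    proof (intro tendsto_ennrealI tendsto_mult tendsto_const tendsto_norm)
      show "(\<lambda>n. ft (?r n) k) \<longlonglongrightarrow> ft (\<lambda>x. of_real ((cmod (u x))\<^sup>2)) k"
        unfolding ft_def
      proof (rule integral_dominated_convergence)
        show "integrable lborel (\<lambda>x. (cmod (u x))\<^sup>2)" by (rule u2)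
        show "AE x in lborel. (\<lambda>n. exp (- \<i> * of_real (k \<bullet> x)) * ?r n x) \<longlonglongrightarrow> exp (- \<i> * of_real (k \<bullet> x)) * of_real ((cmod (u x))\<^sup>2)"
        proof (intro AE_I2 tendsto_mult tendsto_const tendsto_of_real tendsto_power tendsto_norm)
          fix x
          have "(\<lambda>n. of_real (cut n x) * u x) \<longlonglongrightarrow> of_real 1 * u x" by (intro tendsto_intros cut_lim)
          then show "(\<lambda>n. un n x) \<longlonglongrightarrow> u x" by (simp add: un_def)
        qed
        show "AE x in lborel. norm (exp (- \<i> * of_real (k \<bullet> x)) * ?r n x) \<le> (cmod (u x))\<^sup>2" for n
          using un_sq_le by (simp add: norm_mult norm_power)
      qed measurable
    qed
    \<comment> \<open>Uniformly in \<open>n\<close>, the cut functions have translation constant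
      \<open>2 * K + 2 * ?U\<close>, since all cutoffs have Lipschitz constant at most 1. Inserted
      for the constant \<open>K\<close> in \<open>?U + 3 * K\<close>, it gives
      \<open>7 * ?U + 6 * K\<close>.\<close>
    show "(\<integral>\<^sup>+k. ennreal (w k * cmod (ft (?r n) k)) \<partial>lborel) \<le> ennreal (?C * (7 * ?U + 6 * K))" for n
    proof -
      have U0: "0 \<le> ?U" by simp
      have K': "0 \<le> 2 * K + 2 * ?U" using K U0 by simp
      have "(\<integral>\<^sup>+k. ennreal (w k * cmod (ft (?r n) k)) \<partial>lborel)
          \<le> ennreal (?C * ((\<integral>x. (cmod (un n x))\<^sup>2 \<partial>lborel) + 3 * (2 * K + 2 * ?U)))"
        by (rule weak_L3_fourier_bound_integrable[OF un1 un2 K' un_lip _ w0 M weak]) auto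
      also have "\<dots> \<le> ennreal (?C * (7 * ?U + 6 * K))"
        using un2_le[of n] C0 by (intro ennreal_leI mult_left_mono) auto
      finally show ?thesis .
    qed
  qed
qed

section \<open>Test functions and weak derivatives\<close>

primrec smooth_line :: "nat \<Rightarrow> (real \<Rightarrow> real) \<Rightarrow> bool" where
  "smooth_line 0 f \<longleftrightarrow> continuous_on UNIV f"
| "smooth_line (Suc k) f \<longleftrightarrow> (\<exists>f'. (\<forall>x. (f has_real_derivative f' x) (at x)) \<and> smooth_line k f')"

lemma smooth_line_SucI:
  "(\<And>x. (f has_real_derivative f' x) (at x)) \<Longrightarrow> smooth_line k f' \<Longrightarrow> smooth_line (Suc k) f"
  unfolding smooth_line.simps by blast

lemma smooth_line_SucE:
  assumes "smooth_line (Suc k) f"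
  obtains f' where "\<And>x. (f has_real_derivative f' x) (at x)" "smooth_line k f'"
  using assms unfolding smooth_line.simps by blast

lemma smooth_line_add: "smooth_line k f \<Longrightarrow> smooth_line k g \<Longrightarrow> smooth_line k (\<lambda>x. f x + g x)"
proof (induction k arbitrary: f g)
  case 0
  then show ?case by (simp add: continuous_on_add)
next
  case (Suc k)
  from Suc.prems(1) obtain f' where f': "\<And>x. (f has_real_derivative f' x) (at x)" "smooth_line k f'"
    by (rule smooth_line_SucE) blast
  from Suc.prems(2) obtain g' where g': "\<And>x. (g has_real_derivative g' x) (at x)" "smooth_line k g'"
    by (rule smooth_line_SucE) blast
  show ?case by (rule smooth_line_SucI[OF DERIV_add[OF f'(1) g'(1)] Suc.IH[OF f'(2) g'(2)]])
qed

lemma smooth_line_cmult: "smooth_line k f \<Longrightarrow> smooth_line k (\<lambda>x. c * f x)"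
proof (induction k arbitrary: f)
  case 0
  then show ?case by (simp add: continuous_on_mult_left)
next
  case (Suc k)
  from Suc.prems obtain f' where f': "\<And>x. (f has_real_derivative f' x) (at x)" "smooth_line k f'"
    by (rule smooth_line_SucE) blast
  show ?case by (rule smooth_line_SucI[OF DERIV_cmult[OF f'(1)] Suc.IH[OF f'(2)]])
qed

lemma smooth_line_Suc_imp: "smooth_line (Suc k) f \<Longrightarrow> smooth_line k f"
proof (induction k arbitrary: f)
  case 0
  then obtain f' where f': "\<And>x. (f has_real_derivative f' x) (at x)" "smooth_line 0 f'"
    by (rule smooth_line_SucE) blast
  have "continuous_on UNIV f"
    by (intro continuous_at_imp_continuous_on ballI DERIV_isCont[OF f'(1)])
  then show ?case by simp
next
  case (Suc k)
  from Suc.prems obtain f' where f': "\<And>x. (f has_real_derivative f' x) (at x)" "smooth_line (Suc k) f'"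
    by (rule smooth_line_SucE) blast
  show ?case by (rule smooth_line_SucI[OF f'(1) Suc.IH[OF f'(2)]])
qed

lemma smooth_line_mult: "smooth_line k f \<Longrightarrow> smooth_line k g \<Longrightarrow> smooth_line k (\<lambda>x. f x * g x)"
proof (induction k arbitrary: f g)
  case 0
  then show ?case by (simp add: continuous_on_mult)
next
  case (Suc k)
  from Suc.prems(1) obtain f' where f': "\<And>x. (f has_real_derivative f' x) (at x)" "smooth_line k f'"
    by (rule smooth_line_SucE) blast
  from Suc.prems(2) obtain g' where g': "\<And>x. (g has_real_derivative g' x) (at x)" "smooth_line k g'"
    by (rule smooth_line_SucE) blast
  show ?case
    by (rule smooth_line_SucI[OF DERIV_mult[OF f'(1) g'(1)] smooth_line_add[OF
        Suc.IH[OF f'(2) smooth_line_Suc_imp[OF Suc.prems(2)]] Suc.IH[OF g'(2) smooth_line_Suc_imp[OF Suc.prems(1)]]]])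
qed

lemma smooth_line_affine: "smooth_line k f \<Longrightarrow> smooth_line k (\<lambda>x. f (a + c * x))"
proof (induction k arbitrary: f)
  case 0
  then have "continuous_on UNIV f" by simp
  then have "continuous_on UNIV (\<lambda>x. f (a + c * x))"
    by (rule continuous_on_compose2) (intro continuous_intros, simp)
  then show ?case by simp
next
  case (Suc k)
  from Suc.prems obtain f' where f': "\<And>x. (f has_real_derivative f' x) (at x)" "smooth_line k f'"
    by (rule smooth_line_SucE) blast
  have "((\<lambda>x. f (a + c * x)) has_real_derivative c * f' (a + c * x)) (at x)" for x
  proof -
    have "((\<lambda>x. a + c * x) has_real_derivative c) (at x)" by (auto intro!: derivative_eq_intros)
    from DERIV_chain2[OF f'(1) this] show ?thesis by (simp add: mult.commute)
  qed
  then show ?case by (rule smooth_line_SucI[OF _ smooth_line_cmult[OF Suc.IH[OF f'(2)]]])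
qed

text \<open>The powers of \<open>1 / t\<close> make the family closed under differentiation up to
  linear combinations, which reduces smoothness at the origin to an induction. The parameter
  \<open>c\<close> is later sent to 0, where the exponential tends to 1.\<close>

definition flat :: "real \<Rightarrow> nat \<Rightarrow> real \<Rightarrow> real" where
  "flat c n t = (if t > 0 then (1 / t) ^ n * exp (- c / t) else 0)"

lemma flat_tendsto_0:
  assumes "c > 0"
  shows "(flat c n \<longlongrightarrow> 0) (at 0)"
proof -
  have "filterlim (\<lambda>t. c / t) at_top (at_right 0)"
    using filterlim_tendsto_pos_mult_at_top[OF tendsto_const \<open>c > 0\<close> filterlim_inverse_at_top_right]
    by (simp add: divide_inverse)
  then have "((\<lambda>t. (1 / c) ^ n * ((c / t) ^ n / exp (c / t))) \<longlongrightarrow> (1 / c) ^ n * 0) (at_right 0)"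
    by (intro tendsto_intros filterlim_compose[OF tendsto_power_div_exp_0])
  then have "((\<lambda>t. (1 / c) ^ n * ((c / t) ^ n / exp (c / t))) \<longlongrightarrow> 0) (at_right 0)" by simp
  moreover have "\<forall>\<^sub>F t in at_right 0. (1 / c) ^ n * ((c / t) ^ n / exp (c / t)) = flat c n t"
    using \<open>c > 0\<close> by (auto simp: eventually_at_right_field flat_def exp_minus field_simps intro!: exI[of _ 1])
  ultimately have r: "(flat c n \<longlongrightarrow> 0) (at_right 0)" by (rule Lim_transform_eventually)
  have "\<forall>\<^sub>F t in at_left 0. 0 = flat c n t"
    by (auto simp: eventually_at_left_field flat_def intro!: exI[of _ "-1"])
  then have l: "(flat c n \<longlongrightarrow> 0) (at_left 0)" by (rule Lim_transform_eventually[OF tendsto_const])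
  show ?thesis using l r by (simp add: filterlim_at_split)
qed

lemma flat_derivative:
  assumes "c > 0"
  shows "(flat c n has_real_derivative c * flat c (n + 2) t + (- real n) * flat c (n + 1) t) (at t)"
proof -
  consider "t > 0" | "t = 0" | "t < 0" by linarith
  then show ?thesis
  proof cases
    case 1
    have "((\<lambda>t. (1 / t) ^ n * exp (- c / t)) has_real_derivative c * flat c (n + 2) t + (- real n) * flat c (n + 1) t) (at t)"
      using 1 by (auto intro!: derivative_eq_intros simp: flat_def)
        (cases n; simp add: field_simps power2_eq_square)
    then show ?thesis
    proof (rule has_field_derivative_transform_within_open[where S = "{0<..}"])
      show "(1 / x) ^ n * exp (- c / x) = flat c n x" if "x \<in> {0<..}" for x using that by (simp add: flat_def)
    qed (use 1 in auto)
  next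
    case 2
    \<comment> \<open>At the origin the difference quotient of \<open>flat c n\<close> is
      \<open>flat c (n + 1)\<close>, which tends to 0.\<close>
    have "((\<lambda>y. (flat c n y - flat c n 0) / (y - 0)) \<longlongrightarrow> 0) (at 0)"
    proof (rule Lim_transform_eventually[OF flat_tendsto_0[OF assms, of "n + 1"]])
      show "\<forall>\<^sub>F y in at 0. flat c (n + 1) y = (flat c n y - flat c n 0) / (y - 0)"
        by (auto simp: eventually_at_filter flat_def field_simps)
    qed
    then have "(flat c n has_real_derivative 0) (at 0)" by (simp add: has_field_derivative_iff)
    then show ?thesis using 2 by (simp add: flat_def)
  next
    case 3
    have "((\<lambda>t. 0::real) has_real_derivative c * flat c (n + 2) t + (- real n) * flat c (n + 1) t) (at t)"
      using 3 by (simp add: flat_def)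
    then show ?thesis
    proof (rule has_field_derivative_transform_within_open[where S = "{..<0}"])
      show "0 = flat c n x" if "x \<in> {..<0}" for x using that by (simp add: flat_def)
    qed (use 3 in auto)
  qed
qed

lemma smooth_line_flat: "c > 0 \<Longrightarrow> smooth_line k (flat c n)"
proof (induction k arbitrary: n)
  case 0
  have "continuous_on UNIV (flat c n)"
    by (intro continuous_at_imp_continuous_on ballI DERIV_isCont[OF flat_derivative[OF 0]])
  then show ?case by simp
next
  case (Suc k)
  have "smooth_line k (\<lambda>t. c * flat c (n + 2) t + (- real n) * flat c (n + 1) t)"
    by (intro smooth_line_add smooth_line_cmult Suc)
  then show ?case by (rule smooth_line_SucI[OF flat_derivative[OF Suc.prems]])
qed

lemma product_has_derivative:
  fixes F F' :: "3 \<Rightarrow> real \<Rightarrow> real"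
  assumes d: "\<And>i t. (F i has_real_derivative F' i t) (at t)"
  shows "((\<lambda>x::R3. \<Prod>i\<in>UNIV. F i (x $ i)) has_derivative
    (\<lambda>y. \<Sum>i\<in>UNIV. (F' i (x $ i) * (y $ i)) * (\<Prod>j\<in>UNIV - {i}. F j (x $ j)))) (at x)"
proof (rule has_derivative_prod)
  fix i :: 3
  have "((\<lambda>x::R3. x $ i) has_derivative (\<lambda>y. y $ i)) (at x)"
    by (rule bounded_linear_imp_has_derivative) (rule bounded_linear_vec_nth)
  moreover have "(F i has_derivative (\<lambda>y. F' i (x $ i) * y)) (at (x $ i))"
    using d[of i "x $ i"] by (simp add: has_field_derivative_def)
  ultimately show "((\<lambda>x::R3. F i (x $ i)) has_derivative (\<lambda>y. F' i (x $ i) * y $ i)) (at x)"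
    using has_derivative_compose[of "\<lambda>x. x $ i" "\<lambda>y. y $ i" x UNIV "F i" "\<lambda>y. F' i (x $ i) * y"] by simp
qed

text \<open>Differentiating in one coordinate replaces one factor by its derivative, so products
  over coordinates are closed under \<open>partial_deriv\<close> and the induction goes through for
  arbitrary factors.\<close>

lemma C_k_product:
  fixes F :: "3 \<Rightarrow> real \<Rightarrow> real"
  shows "(\<And>i. smooth_line k (F i)) \<Longrightarrow> C_k k (\<lambda>x. \<Prod>i\<in>UNIV. F i (x $ i))"
proof (induction k arbitrary: F)
  case 0
  have "continuous_on UNIV (\<lambda>x::R3. F i (x $ i))" for i
  proof -
    have "continuous_on UNIV (F i)" using 0[of i] by simp
    then show ?thesis by (rule continuous_on_compose2) (intro continuous_intros, simp)
  qed
  then have "continuous_on UNIV (\<lambda>x::R3. \<Prod>i\<in>UNIV. F i (x $ i))" by (intro continuous_on_prod)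
  then show ?case by simp
next
  case (Suc k)
  have "\<forall>i. \<exists>f'. (\<forall>t. (F i has_real_derivative f' t) (at t)) \<and> smooth_line k f'"
    using Suc.prems by (meson smooth_line_SucE)
  then obtain F' where F': "\<And>i t. (F i has_real_derivative F' i t) (at t)" "\<And>i. smooth_line k (F' i)" by metis
  note D = product_has_derivative[of F F', OF F'(1)]
  have "partial_deriv j (\<lambda>x. \<Prod>i\<in>UNIV. F i (x $ i)) = (\<lambda>x. \<Prod>i\<in>UNIV. (F(j := F' j)) i (x $ i))" for j
  proof
    fix x :: R3
    have "partial_deriv j (\<lambda>x. \<Prod>i\<in>UNIV. F i (x $ i)) x
      = (\<Sum>i\<in>UNIV. (F' i (x $ i) * (axis j 1 $ i)) * (\<Prod>j\<in>UNIV - {i}. F j (x $ j)))"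
      unfolding partial_deriv_def frechet_derivative_at[OF D, symmetric] ..
    also have "\<dots> = (\<Sum>i\<in>UNIV. if i = j then F' j (x $ j) * (\<Prod>j\<in>UNIV - {j}. F j (x $ j)) else 0)"
      by (intro sum.cong refl) (auto simp: axis_def)
    also have "\<dots> = F' j (x $ j) * (\<Prod>i\<in>UNIV - {j}. F i (x $ i))" by simp
    also have "\<dots> = (\<Prod>i\<in>UNIV. (F(j := F' j)) i (x $ i))"
      by (subst prod.remove[of UNIV j]) (auto intro!: prod.cong)
    finally show "partial_deriv j (\<lambda>x. \<Prod>i\<in>UNIV. F i (x $ i)) x = (\<Prod>i\<in>UNIV. (F(j := F' j)) i (x $ i))" .
  qed
  moreover have "C_k k (\<lambda>x. \<Prod>i\<in>UNIV. (F(j := F' j)) i (x $ i))" for j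
    using smooth_line_Suc_imp[OF Suc.prems] F'(2) by (intro Suc.IH) auto
  moreover have "\<forall>x. (\<lambda>x::R3. \<Prod>i\<in>UNIV. F i (x $ i)) differentiable (at x)"
    unfolding differentiable_def using D by blast
  ultimately show ?case by (simp only: C_k.simps) simp
qed

text \<open>A smooth function supported in the closed box. As \<open>c\<close> tends to 0 every
  factor tends to 1 inside, so indicators of open boxes are bounded limits of test
  functions.\<close>

definition bump :: "real \<Rightarrow> R3 \<Rightarrow> R3 \<Rightarrow> R3 \<Rightarrow> real" where
  "bump c a b x = (\<Prod>i\<in>UNIV. flat c 0 (x $ i - a $ i) * flat c 0 (b $ i - x $ i))"

lemma bump_outside: "x \<notin> box a b \<Longrightarrow> bump c a b x = 0"
  by (auto simp: bump_def flat_def mem_box_cart)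

lemma bump_test_function:
  assumes "c > 0"
  shows "bump c a b \<in> test_functions"
proof -
  have "C_k k (bump c a b)" for k
    unfolding bump_def[abs_def]
  proof (rule C_k_product)
    fix i :: 3
    have "smooth_line k (\<lambda>t. flat c 0 (- (a $ i) + 1 * t) * flat c 0 (b $ i + (- 1) * t))"
      by (intro smooth_line_mult smooth_line_affine smooth_line_flat assms)
    then show "smooth_line k (\<lambda>t. flat c 0 (t - a $ i) * flat c 0 (b $ i - t))" by simp
  qed
  moreover have "{x. bump c a b x \<noteq> 0} \<subseteq> cbox a b"
    using bump_outside[of _ a b c] box_subset_cbox[of a b] by blast
  then have "compact (closure {x. bump c a b x \<noteq> 0})"
    using bounded_subset[OF bounded_cbox] by (simp add: compact_closure)
  ultimately show ?thesis by (simp add: test_functions_def)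
qed

lemma bump_bounds: "c > 0 \<Longrightarrow> 0 \<le> bump c a b x \<and> bump c a b x \<le> 1"
  unfolding bump_def by (intro conjI prod_nonneg prod_le_1 ballI) (auto simp: flat_def intro!: mult_le_one)

lemma bump_tendsto: "(\<lambda>n. bump (1 / real (Suc n)) a b x) \<longlonglongrightarrow> indicat_real (box a b) x"
proof (cases "x \<in> box a b")
  case True
  have fl: "(\<lambda>n. flat (1 / real (Suc n)) 0 t) \<longlonglongrightarrow> 1" if "t > 0" for t
  proof -
    have "(\<lambda>n. exp (- (1 / real (Suc n)) / t)) \<longlonglongrightarrow> exp (- 0 / t)"
      by (intro tendsto_intros LIMSEQ_inverse_real_of_nat[unfolded inverse_eq_divide]) (use that in auto)
    then show ?thesis using that by (simp add: flat_def)
  qed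
  have "(\<lambda>n. bump (1 / real (Suc n)) a b x) \<longlonglongrightarrow> (\<Prod>i\<in>(UNIV::3 set). 1 * 1)"
    unfolding bump_def using True by (intro tendsto_prod tendsto_mult fl) (auto simp: mem_box_cart)
  then show ?thesis using True by simp
next
  case False
  then show ?thesis by (simp add: bump_outside)
qed

section \<open>Calculus of test functions\<close>

lemma test_function_C_k: "\<phi> \<in> test_functions \<Longrightarrow> C_k k \<phi>"
  by (simp add: test_functions_def)

lemma test_function_continuous: "\<phi> \<in> test_functions \<Longrightarrow> continuous_on UNIV \<phi>"
  using test_function_C_k[of \<phi> 0] by simp

lemma test_function_measurable: "\<phi> \<in> test_functions \<Longrightarrow> \<phi> \<in> borel_measurable borel"
  using test_function_continuous borel_measurable_continuous_onI by blast

lemma test_function_differentiable: "\<phi> \<in> test_functions \<Longrightarrow> \<phi> differentiable (at x)"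
  using test_function_C_k[of \<phi> "Suc 0"] by simp

lemma partial_deriv_test_function:
  assumes \<phi>: "\<phi> \<in> test_functions"
  shows "partial_deriv i \<phi> \<in> test_functions"
proof -
  have "C_k k (partial_deriv i \<phi>)" for k using test_function_C_k[OF \<phi>, of "Suc k"] by simp
  moreover
  have cl: "compact (closure {x. \<phi> x \<noteq> 0})" using \<phi> by (simp add: test_functions_def)
  have "partial_deriv i \<phi> x = 0" if x: "x \<notin> closure {x. \<phi> x \<noteq> 0}" for x
  proof -
    have "((\<lambda>x. 0::real) has_derivative (\<lambda>y. 0)) (at x)" by simp
    then have "(\<phi> has_derivative (\<lambda>y. 0)) (at x)"
    proof (rule has_derivative_transform_within_open[of _ _ _ _ "- closure {x. \<phi> x \<noteq> 0}"])
      show "0 = \<phi> y" if "y \<in> - closure {x. \<phi> x \<noteq> 0}" for y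
        using that closure_subset[of "{x. \<phi> x \<noteq> 0}"] by force
    qed (use x in auto)
    then show ?thesis by (simp add: partial_deriv_def frechet_derivative_at[symmetric])
  qed
  then have "{x. partial_deriv i \<phi> x \<noteq> 0} \<subseteq> closure {x. \<phi> x \<noteq> 0}" by blast
  then have "compact (closure {x. partial_deriv i \<phi> x \<noteq> 0})"
    using bounded_subset[OF compact_imp_bounded[OF cl]] by (simp add: compact_closure)
  ultimately show ?thesis by (simp add: test_functions_def)
qed

lemma test_function_bounded:
  assumes \<phi>: "\<phi> \<in> test_functions"
  obtains B R where "0 \<le> B" "\<And>x. \<bar>\<phi> x\<bar> \<le> B * indicator (cball 0 R) x"
proof -
  let ?K = "closure {x. \<phi> x \<noteq> 0}"
  have K: "compact ?K" using \<phi> by (simp add: test_functions_def)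
  have "bounded (\<phi> ` ?K)"
    by (intro compact_imp_bounded compact_continuous_image K continuous_on_subset[OF test_function_continuous[OF \<phi>]]) auto
  then obtain B where B: "\<And>x. x \<in> ?K \<Longrightarrow> \<bar>\<phi> x\<bar> \<le> B" by (auto simp: bounded_iff)
  obtain R where R: "?K \<subseteq> cball 0 R"
    using compact_imp_bounded[OF K] bounded_subset_ballD[of ?K 0] ball_subset_cball by blast
  show thesis
  proof (rule that[of "max B 0" R])
    fix x
    show "\<bar>\<phi> x\<bar> \<le> max B 0 * indicator (cball 0 R) x"
    proof (cases "\<phi> x = 0")
      case False
      then have "x \<in> ?K" using closure_subset[of "{x. \<phi> x \<noteq> 0}"] by blast
      then show ?thesis using B[of x] R by (auto simp: indicator_def)
    qed (auto simp: indicator_def)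
  qed simp
qed

lemma test_function_square_integrable:
  assumes \<phi>: "\<phi> \<in> test_functions"
  shows "integrable lborel (\<lambda>x. (\<phi> x)\<^sup>2)"
proof -
  obtain B R where B: "0 \<le> B" "\<And>x. \<bar>\<phi> x\<bar> \<le> B * indicator (cball 0 R) x"
    using test_function_bounded[OF \<phi>] by blast
  have [measurable]: "\<phi> \<in> borel_measurable borel" by (rule test_function_measurable[OF \<phi>])
  show ?thesis
  proof (rule Bochner_Integration.integrable_bound)
    have "integrable lborel (indicat_real (cball (0::R3) R))"
      by (rule integrable_real_indicator) (simp, rule emeasure_bounded_finite, rule bounded_cball)
    then show "integrable lborel (\<lambda>x. B\<^sup>2 * indicator (cball (0::R3) R) x)" by simp
    show "AE x in lborel. norm ((\<phi> x)\<^sup>2) \<le> norm (B\<^sup>2 * indicator (cball 0 R) x)"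
    proof (intro AE_I2)
      fix x
      have "\<bar>\<phi> x\<bar>\<^sup>2 \<le> (B * indicator (cball 0 R) x)\<^sup>2" using B by (intro power_mono) auto
      then show "norm ((\<phi> x)\<^sup>2) \<le> norm (B\<^sup>2 * indicator (cball 0 R) x)"
        by (auto simp: indicator_def power_mult_distrib split: if_splits)
    qed
  qed measurable
qed

lemma partial_deriv_shift:
  assumes d: "\<And>x. \<phi> differentiable (at x)"
  shows "partial_deriv i (\<lambda>x. \<phi> (x + h)) x = partial_deriv i \<phi> (x + h)"
    and "(\<lambda>x. \<phi> (x + h)) differentiable (at x)"
proof -
  have "(\<phi> has_derivative frechet_derivative \<phi> (at (x + h))) (at (x + h))"
    using d frechet_derivative_works by blast
  moreover have "((\<lambda>x. x + h) has_derivative (\<lambda>y. y)) (at x)" by (auto intro!: derivative_eq_intros)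
  ultimately have D: "((\<lambda>x. \<phi> (x + h)) has_derivative frechet_derivative \<phi> (at (x + h))) (at x)"
    using has_derivative_compose[of "\<lambda>x. x + h" "\<lambda>y. y" x UNIV \<phi>] by simp
  show "partial_deriv i (\<lambda>x. \<phi> (x + h)) x = partial_deriv i \<phi> (x + h)"
    unfolding partial_deriv_def frechet_derivative_at[OF D, symmetric] ..
  show "(\<lambda>x. \<phi> (x + h)) differentiable (at x)" using D unfolding differentiable_def by blast
qed

lemma C_k_shift: "C_k k \<phi> \<Longrightarrow> C_k k (\<lambda>x. \<phi> (x + h))"
proof (induction k arbitrary: \<phi>)
  case 0
  then have "continuous_on UNIV \<phi>" by simp
  then have "continuous_on UNIV (\<lambda>x. \<phi> (x + h))"
    by (rule continuous_on_compose2) (intro continuous_intros, simp)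
  then show ?case by simp
next
  case (Suc k)
  then have d: "\<And>x. \<phi> differentiable (at x)" and c: "\<And>i. C_k k (partial_deriv i \<phi>)" by auto
  have "partial_deriv i (\<lambda>x. \<phi> (x + h)) = (\<lambda>x. partial_deriv i \<phi> (x + h))" for i
    using partial_deriv_shift(1)[OF d] by blast
  then show ?case using partial_deriv_shift(2)[OF d] Suc.IH[OF c] by simp
qed

lemma test_function_shift:
  assumes \<phi>: "\<phi> \<in> test_functions"
  shows "(\<lambda>x. \<phi> (x + h)) \<in> test_functions"
proof -
  have "bounded {x. \<phi> x \<noteq> 0}"
    using \<phi> bounded_subset[OF compact_imp_bounded closure_subset] by (auto simp: test_functions_def)
  then have "bounded ((\<lambda>x. - h + x) ` {x. \<phi> x \<noteq> 0})" by (rule bounded_translation)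
  moreover have "{x. \<phi> (x + h) \<noteq> 0} \<subseteq> (\<lambda>x. - h + x) ` {x. \<phi> x \<noteq> 0}"
    by (auto simp: image_iff intro!: exI[of _ "_ + h"])
  ultimately have "compact (closure {x. \<phi> (x + h) \<noteq> 0})" using bounded_subset by (auto simp: compact_closure)
  then show ?thesis using \<phi> C_k_shift by (auto simp: test_functions_def)
qed

lemma test_function_line_integral:
  assumes \<phi>: "\<phi> \<in> test_functions" and t: "0 \<le> t"
  shows "\<phi> x - \<phi> (x - t *\<^sub>R axis i 1) = (\<integral>s. indicator {0..t} s * partial_deriv i \<phi> (x - s *\<^sub>R axis i 1) \<partial>lborel)"
proof -
  let ?e = "axis i 1 :: R3"
  let ?p = "\<lambda>s. x - s *\<^sub>R ?e"
  have der: "((\<lambda>s. - \<phi> (?p s)) has_real_derivative partial_deriv i \<phi> (?p s)) (at s)" for s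
  proof -
    let ?D = "frechet_derivative \<phi> (at (?p s))"
    have D: "(\<phi> has_derivative ?D) (at (?p s))"
      using test_function_differentiable[OF \<phi>] frechet_derivative_works by blast
    have lin: "linear ?D" by (rule has_derivative_linear[OF D])
    have "(?p has_derivative (\<lambda>y. - (y *\<^sub>R ?e))) (at s)"
      by (auto intro!: derivative_eq_intros)
    then have "((\<lambda>s. \<phi> (?p s)) has_derivative (\<lambda>y. ?D (- (y *\<^sub>R ?e)))) (at s)"
      using has_derivative_compose[of ?p _ s UNIV \<phi> ?D] D by simp
    then have "((\<lambda>s. - \<phi> (?p s)) has_derivative (\<lambda>y. - ?D (- (y *\<^sub>R ?e)))) (at s)"
      by (rule has_derivative_minus)
    moreover have "- ?D (- (y *\<^sub>R ?e)) = partial_deriv i \<phi> (?p s) * y" for y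
      using lin by (simp add: linear_neg linear_scale partial_deriv_def)
    ultimately show ?thesis by (simp add: has_field_derivative_def)
  qed
  have cont: "continuous_on UNIV (partial_deriv i \<phi>)"
    by (rule test_function_continuous[OF partial_deriv_test_function[OF \<phi>]])
  have "continuous_on {0..t} (\<lambda>s. partial_deriv i \<phi> (?p s))"
    by (rule continuous_on_compose2[OF cont]) (intro continuous_intros, simp)
  then have "(\<integral>s. indicator {0..t} s *\<^sub>R partial_deriv i \<phi> (?p s) \<partial>lborel) = - \<phi> (?p t) - - \<phi> (?p 0)"
    using t by (intro integral_FTC_Icc) (auto simp: has_real_derivative_iff_has_vector_derivative[symmetric]
      intro!: has_field_derivative_at_within[OF der])
  then show ?thesis by simp
qed

section \<open>Weak derivatives and translations\<close>

lemma integrable_mult_square_integrable: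
  fixes f g :: "'a \<Rightarrow> complex"
  assumes [measurable]: "f \<in> borel_measurable M" "g \<in> borel_measurable M"
    and f2: "integrable M (\<lambda>x. (cmod (f x))\<^sup>2)" and g2: "integrable M (\<lambda>x. (cmod (g x))\<^sup>2)"
  shows "integrable M (\<lambda>x. f x * g x)"
proof (rule Bochner_Integration.integrable_bound)
  show "integrable M (\<lambda>x. (cmod (f x))\<^sup>2 + (cmod (g x))\<^sup>2)" using f2 g2 by simp
  show "AE x in M. norm (f x * g x) \<le> norm ((cmod (f x))\<^sup>2 + (cmod (g x))\<^sup>2)"
  proof (intro AE_I2)
    fix x
    have "cmod (f x) * cmod (g x) \<le> (cmod (f x))\<^sup>2 + (cmod (g x))\<^sup>2"
      by (rule cmod_mult_le_sum_squares)
    then show "norm (f x * g x) \<le> norm ((cmod (f x))\<^sup>2 + (cmod (g x))\<^sup>2)" by (simp add: norm_mult)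
  qed
qed measurable

text \<open>Testing against the bumps \<open>bump c a b\<close> and letting \<open>c\<close> tend to \<open>0\<close> shows that the
  positive and negative parts have the same mass on every box.\<close>
lemma zero_if_orthogonal_to_tests_real:
  fixes g :: "R3 \<Rightarrow> real"
  assumes [measurable]: "g \<in> borel_measurable borel" and g2: "integrable lborel (\<lambda>x. (g x)\<^sup>2)"
    and orth: "\<And>\<phi>. \<phi> \<in> test_functions \<Longrightarrow> (\<integral>x. g x * \<phi> x \<partial>lborel) = 0"
  shows "AE x in lborel. g x = 0"
proof -
  have loc: "integrable lborel (\<lambda>x. g x * indicator (box a b) x)" for a b :: R3
  proof (rule Bochner_Integration.integrable_bound)
    have "integrable lborel (indicat_real (box a b))"
      by (rule integrable_real_indicator) (simp, rule emeasure_bounded_finite, rule bounded_box)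
    then show "integrable lborel (\<lambda>x. (g x)\<^sup>2 + indicat_real (box a b) x)" using g2 by simp
    show "AE x in lborel. norm (g x * indicator (box a b) x) \<le> norm ((g x)\<^sup>2 + indicat_real (box a b) x)"
    proof (intro AE_I2)
      fix x
      have "\<bar>g x\<bar> \<le> (g x)\<^sup>2 + 1" using zero_le_power2[of "\<bar>g x\<bar> - 1/2"] by (simp add: power2_eq_square algebra_simps)
      then show "norm (g x * indicator (box a b) x) \<le> norm ((g x)\<^sup>2 + indicat_real (box a b) x)"
        by (auto simp: indicator_def)
    qed
  qed measurable
  have box0: "(\<integral>x. g x * indicator (box a b) x \<partial>lborel) = 0" for a b :: R3
  proof -
    have "(\<lambda>n. \<integral>x. g x * bump (1 / real (Suc n)) a b x \<partial>lborel) \<longlonglongrightarrow> (\<integral>x. g x * indicator (box a b) x \<partial>lborel)"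
    proof (rule integral_dominated_convergence)
      show "integrable lborel (\<lambda>x. norm (g x * indicator (box a b) x))" using loc by (rule integrable_norm)
      show "AE x in lborel. (\<lambda>n. g x * bump (1 / real (Suc n)) a b x) \<longlonglongrightarrow> g x * indicator (box a b) x"
        by (intro AE_I2 tendsto_mult tendsto_const bump_tendsto)
      have [measurable]: "bump (1 / real (Suc n)) a b \<in> borel_measurable borel" for n
        by (intro test_function_measurable bump_test_function) simp
      show "(\<lambda>x. g x * bump (1 / real (Suc n)) a b x) \<in> borel_measurable lborel" for n by measurable
      show "AE x in lborel. norm (g x * bump (1 / real (Suc n)) a b x) \<le> norm (g x * indicator (box a b) x)" for n
      proof (intro AE_I2)
        fix x
        have "\<bar>bump (1 / real (Suc n)) a b x\<bar> \<le> indicator (box a b) x"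
          using bump_bounds[of "1 / real (Suc n)" a b x] bump_outside[of x a b "1 / real (Suc n)"]
          by (cases "x \<in> box a b") auto
        then show "norm (g x * bump (1 / real (Suc n)) a b x) \<le> norm (g x * indicator (box a b) x)"
          by (simp add: abs_mult mult_left_mono)
      qed
    qed measurable
    moreover have "(\<integral>x. g x * bump (1 / real (Suc n)) a b x \<partial>lborel) = 0" for n
      by (intro orth bump_test_function) simp
    ultimately show ?thesis by (simp add: LIMSEQ_const_iff)
  qed
  have em: "emeasure (density lborel (\<lambda>x. ennreal (h x))) (box a b) = (\<integral>\<^sup>+x. ennreal (h x * indicator (box a b) x) \<partial>lborel)"
    if [measurable]: "h \<in> borel_measurable borel" for h and a b :: R3
    by (subst emeasure_density) (auto intro!: nn_integral_cong simp: indicator_def)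
  have fin: "(\<integral>\<^sup>+x. ennreal (g x * indicator (box a b) x) \<partial>lborel) < \<infinity>"
    "(\<integral>\<^sup>+x. ennreal (- g x * indicator (box a b) x) \<partial>lborel) < \<infinity>" for a b :: R3
    using loc[of a b] unfolding real_integrable_def by (auto simp: less_top)
  have eq: "(\<integral>\<^sup>+x. ennreal (g x * indicator (box a b) x) \<partial>lborel) = (\<integral>\<^sup>+x. ennreal (- g x * indicator (box a b) x) \<partial>lborel)" for a b :: R3
  proof -
    have "enn2real (\<integral>\<^sup>+x. ennreal (g x * indicator (box a b) x) \<partial>lborel) = enn2real (\<integral>\<^sup>+x. ennreal (- g x * indicator (box a b) x) \<partial>lborel)"
      using box0[of a b] unfolding real_lebesgue_integral_def[OF loc] by simp
    then show ?thesis using fin[of a b] by (metis ennreal_enn2real infinity_ennreal_def)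
  qed
  \<comment> \<open>Open boxes generate the Borel sets and are closed under intersection; equality
    and finiteness on them give equality of the measures with densities the positive and negative
    parts of \<open>g\<close>.\<close>
  have "density lborel (\<lambda>x. ennreal (g x)) = density lborel (\<lambda>x. ennreal (- g x))"
  proof (rule measure_eqI_generator_eq)
    let ?E = "range (\<lambda>(a, b). box a b :: R3 set)"
    show "Int_stable ?E" by (auto simp: Int_stable_def box_Int_box)
    show "?E \<subseteq> Pow UNIV" "sets (density lborel (\<lambda>x. ennreal (g x))) = sigma_sets UNIV ?E"
      "sets (density lborel (\<lambda>x. ennreal (- g x))) = sigma_sets UNIV ?E"
      by (simp_all add: borel_eq_box)
    let ?A = "\<lambda>n::nat. box (- (real n *\<^sub>R One)) (real n *\<^sub>R One) :: R3 set"
    show "range ?A \<subseteq> ?E" "(\<Union>i. ?A i) = UNIV" unfolding UN_box_eq_UNIV by auto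
    show "emeasure (density lborel (\<lambda>x. ennreal (g x))) (?A i) \<noteq> \<infinity>" for i
      using fin(1) by (subst em) (auto simp: less_top)
    show "emeasure (density lborel (\<lambda>x. ennreal (g x))) X = emeasure (density lborel (\<lambda>x. ennreal (- g x))) X" if "X \<in> ?E" for X
      using that eq em[of g] em[of "\<lambda>x. - g x"] by auto
  qed
  then have "AE x in lborel. ennreal (g x) = ennreal (- g x)"
    by (intro sigma_finite_measure.density_unique[OF sigma_finite_lborel]) auto
  then show ?thesis
  proof eventually_elim
    case (elim x)
    then show ?case by (cases "g x \<ge> 0") (auto simp: ennreal_neg ennreal_eq_0_iff)
  qed
qed

lemma zero_if_orthogonal_to_tests:
  fixes f :: "R3 \<Rightarrow> complex"
  assumes [measurable]: "f \<in> borel_measurable borel" and f2: "integrable lborel (\<lambda>x. (cmod (f x))\<^sup>2)"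
    and orth: "\<And>\<phi>. \<phi> \<in> test_functions \<Longrightarrow> (\<integral>x. f x * of_real (\<phi> x) \<partial>lborel) = 0"
  shows "AE x in lborel. f x = 0"
proof -
  have part: "AE x in lborel. T (f x) = 0"
    if T: "bounded_linear T" "\<And>z. \<bar>T z\<bar> \<le> cmod z" "\<And>z r. T (z * of_real r) = T z * r" for T :: "complex \<Rightarrow> real"
  proof (rule zero_if_orthogonal_to_tests_real)
    have [measurable]: "T \<in> borel_measurable borel"
      by (intro borel_measurable_continuous_onI linear_continuous_on T)
    show "(\<lambda>x. T (f x)) \<in> borel_measurable borel" by measurable
    show "integrable lborel (\<lambda>x. (T (f x))\<^sup>2)"
    proof (rule Bochner_Integration.integrable_bound[OF f2])
      show "AE x in lborel. norm ((T (f x))\<^sup>2) \<le> norm ((cmod (f x))\<^sup>2)"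
      proof (intro AE_I2)
        fix x
        have "\<bar>T (f x)\<bar>\<^sup>2 \<le> (cmod (f x))\<^sup>2" by (intro power_mono T) simp
        then show "norm ((T (f x))\<^sup>2) \<le> norm ((cmod (f x))\<^sup>2)" by simp
      qed
    qed measurable
    fix \<phi> assume \<phi>: "\<phi> \<in> test_functions"
    have [measurable]: "\<phi> \<in> borel_measurable borel" by (rule test_function_measurable[OF \<phi>])
    have i: "integrable lborel (\<lambda>x. f x * of_real (\<phi> x))"
      by (rule integrable_mult_square_integrable) (use f2 test_function_square_integrable[OF \<phi>] in auto)
    have "(\<integral>x. T (f x) * \<phi> x \<partial>lborel) = T (\<integral>x. f x * of_real (\<phi> x) \<partial>lborel)"
      using integral_bounded_linear[OF T(1) i] by (simp add: T(3))
    then show "(\<integral>x. T (f x) * \<phi> x \<partial>lborel) = 0"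
      using orth[OF \<phi>] T(1) by (simp add: linear_simps)
  qed
  have "AE x in lborel. Re (f x) = 0" by (rule part) (auto intro: bounded_linear_Re abs_Re_le_cmod)
  moreover have "AE x in lborel. Im (f x) = 0" by (rule part) (auto intro: bounded_linear_Im abs_Im_le_cmod)
  ultimately show ?thesis by eventually_elim (simp add: complex_eq_iff)
qed

text \<open>This allows the integral along a segment to be exchanged with the integral over space.
  Integrating over space first, translation invariance removes \<open>s\<close>, which runs over a
  bounded interval.\<close>

lemma integrable_shear_product:
  fixes A B :: "R3 \<Rightarrow> complex"
  assumes [measurable]: "A \<in> borel_measurable borel" "B \<in> borel_measurable borel"
    and A2: "integrable lborel (\<lambda>x. (cmod (A x))\<^sup>2)" and B2: "integrable lborel (\<lambda>x. (cmod (B x))\<^sup>2)"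
  shows "integrable (lborel \<Otimes>\<^sub>M lborel)
    (\<lambda>(s::real, x). of_real (indicator {0..t} s) * (A x * B (x + s *\<^sub>R v)))"
proof (rule integrableI_bounded)
  let ?f = "\<lambda>(s::real, x). of_real (indicator {0..t} s) * (A x * B (x + s *\<^sub>R v)) :: complex"
  show "?f \<in> borel_measurable (lborel \<Otimes>\<^sub>M lborel)" by measurable
  define a where "a = (\<integral>\<^sup>+x. ennreal ((cmod (A x))\<^sup>2) \<partial>lborel)"
  define b where "b = (\<integral>\<^sup>+x. ennreal ((cmod (B x))\<^sup>2) \<partial>lborel)"
  have ab: "a < \<infinity>" "b < \<infinity>" using A2 B2 unfolding a_def b_def real_integrable_def by (auto simp: less_top)
  have inner: "(\<integral>\<^sup>+x. ennreal (norm (?f (s, x))) \<partial>lborel) \<le> indicator {0..t} s * (a + b)" for s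
  proof -
    have "(\<integral>\<^sup>+x. ennreal (norm (?f (s, x))) \<partial>lborel)
        \<le> (\<integral>\<^sup>+x. indicator {0..t} s * (ennreal ((cmod (A x))\<^sup>2) + ennreal ((cmod (B (x + s *\<^sub>R v)))\<^sup>2)) \<partial>lborel)"
    proof (rule nn_integral_mono)
      fix x
      have "cmod (A x) * cmod (B (x + s *\<^sub>R v)) \<le> (cmod (A x))\<^sup>2 + (cmod (B (x + s *\<^sub>R v)))\<^sup>2"
        by (rule cmod_mult_le_sum_squares)
      then show "ennreal (norm (?f (s, x))) \<le> indicator {0..t} s * (ennreal ((cmod (A x))\<^sup>2) + ennreal ((cmod (B (x + s *\<^sub>R v)))\<^sup>2))"
        by (auto simp: indicator_def norm_mult ennreal_plus[symmetric] simp del: ennreal_plus intro!: ennreal_leI)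
    qed
    also have "\<dots> = indicator {0..t} s * (\<integral>\<^sup>+x. ennreal ((cmod (A x))\<^sup>2) + ennreal ((cmod (B (x + s *\<^sub>R v)))\<^sup>2) \<partial>lborel)"
      by (rule nn_integral_cmult) measurable
    also have "(\<integral>\<^sup>+x. ennreal ((cmod (A x))\<^sup>2) + ennreal ((cmod (B (x + s *\<^sub>R v)))\<^sup>2) \<partial>lborel)
        = a + (\<integral>\<^sup>+x. ennreal ((cmod (B (x + s *\<^sub>R v)))\<^sup>2) \<partial>lborel)"
      unfolding a_def by (rule nn_integral_add) measurable
    also have "(\<integral>\<^sup>+x. ennreal ((cmod (B (x + s *\<^sub>R v)))\<^sup>2) \<partial>lborel) = b"
      unfolding b_def by (rule nn_integral_lborel_shift) measurable
    finally show ?thesis .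
  qed
  have "(\<integral>\<^sup>+p. ennreal (norm (?f p)) \<partial>(lborel \<Otimes>\<^sub>M lborel)) = (\<integral>\<^sup>+s. \<integral>\<^sup>+x. ennreal (norm (?f (s, x))) \<partial>lborel \<partial>lborel)"
    by (rule sigma_finite_measure.nn_integral_fst[OF sigma_finite_lborel, symmetric]) measurable
  also have "\<dots> \<le> (\<integral>\<^sup>+s. indicator {0..t} s * (a + b) \<partial>lborel)"
    by (intro nn_integral_mono inner)
  also have "\<dots> = (\<integral>\<^sup>+s. indicator {0..t} s \<partial>lborel) * (a + b)"
    by (rule nn_integral_multc) measurable
  also have "(\<integral>\<^sup>+s. indicator {0..t} s \<partial>lborel) = emeasure lborel {0..t}" by simp
  also have "emeasure lborel {0..t} * (a + b) < \<infinity>"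
    using ab emeasure_lborel_Icc_eq[of 0 t] by (auto simp: ennreal_mult_eq_top_iff less_top[symmetric] split: if_splits)
  finally show "(\<integral>\<^sup>+p. ennreal (norm (?f p)) \<partial>(lborel \<Otimes>\<^sub>M lborel)) < \<infinity>" .
qed

text \<open>One factor \<open>t\<close> comes from the Cauchy-Schwarz inequality on the interval,
  the other from integrating over it after Fubini, when translation invariance has made the inner
  integral independent of \<open>s\<close>.\<close>

lemma nn_integral_shift_average:
  fixes G :: "R3 \<Rightarrow> complex"
  assumes [measurable]: "G \<in> borel_measurable borel" and t: "0 \<le> t"
  shows "(\<integral>\<^sup>+x. ennreal ((cmod (\<integral>s. of_real (indicator {0..t} s) * G (x + s *\<^sub>R v) \<partial>lborel))\<^sup>2) \<partial>lborel)
    \<le> ennreal (t\<^sup>2) * (\<integral>\<^sup>+x. ennreal ((cmod (G x))\<^sup>2) \<partial>lborel)"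
proof -
  have pt: "ennreal ((cmod (\<integral>s. of_real (indicator {0..t} s) * G (x + s *\<^sub>R v) \<partial>lborel))\<^sup>2)
      \<le> ennreal t * (\<integral>\<^sup>+s. indicator {0..t} s * ennreal ((cmod (G (x + s *\<^sub>R v)))\<^sup>2) \<partial>lborel)" for x
  proof -
    let ?g = "\<lambda>s::real. of_real (indicator {0..t} s) * G (x + s *\<^sub>R v) :: complex"
    \<comment> \<open>If the integrand is not integrable, its Bochner integral is 0 and the bound is
      trivial.\<close>
    have "ennreal (norm (integral\<^sup>L lborel ?g)) \<le> (\<integral>\<^sup>+s. ennreal (norm (?g s)) \<partial>lborel)"
      by (cases "integrable lborel ?g") (auto simp: integral_norm_bound_ennreal not_integrable_integral_eq)
    then have "(ennreal (norm (integral\<^sup>L lborel ?g)))\<^sup>2 \<le> (\<integral>\<^sup>+s. ennreal (norm (?g s)) \<partial>lborel)\<^sup>2"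
      by (rule power_mono) simp
    also have "(\<integral>\<^sup>+s. ennreal (norm (?g s)) \<partial>lborel)
        = (\<integral>\<^sup>+s. indicator {0..t} s * (indicator {0..t} s * ennreal (cmod (G (x + s *\<^sub>R v)))) \<partial>lborel)"
      by (intro nn_integral_cong) (auto simp: indicator_def norm_mult)
    also have "\<dots>\<^sup>2 \<le> (\<integral>\<^sup>+s. (indicator {0..t} s)\<^sup>2 \<partial>lborel) * (\<integral>\<^sup>+s. (indicator {0..t} s * ennreal (cmod (G (x + s *\<^sub>R v))))\<^sup>2 \<partial>lborel)"
      by (rule Cauchy_Schwarz_nn_integral) measurable
    also have "(\<integral>\<^sup>+s. (indicator {0..t} s)\<^sup>2 \<partial>lborel) = (\<integral>\<^sup>+s. indicator {0..t} (s::real) \<partial>lborel)"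
      by (intro nn_integral_cong) (auto simp: indicator_def)
    also have "\<dots> = ennreal t" using t by (simp add: emeasure_lborel_Icc_eq)
    also have "(\<integral>\<^sup>+s. (indicator {0..t} s * ennreal (cmod (G (x + s *\<^sub>R v))))\<^sup>2 \<partial>lborel)
        = (\<integral>\<^sup>+s. indicator {0..t} s * ennreal ((cmod (G (x + s *\<^sub>R v)))\<^sup>2) \<partial>lborel)"
      by (intro nn_integral_cong) (auto simp: indicator_def ennreal_power)
    finally show ?thesis by (simp add: ennreal_power)
  qed
  have "(\<integral>\<^sup>+x. ennreal ((cmod (\<integral>s. of_real (indicator {0..t} s) * G (x + s *\<^sub>R v) \<partial>lborel))\<^sup>2) \<partial>lborel)
      \<le> (\<integral>\<^sup>+x. ennreal t * (\<integral>\<^sup>+s. indicator {0..t} s * ennreal ((cmod (G (x + s *\<^sub>R v)))\<^sup>2) \<partial>lborel) \<partial>lborel)"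
    by (intro nn_integral_mono pt)
  also have "\<dots> = ennreal t * (\<integral>\<^sup>+x. \<integral>\<^sup>+s. indicator {0..t} s * ennreal ((cmod (G (x + s *\<^sub>R v)))\<^sup>2) \<partial>lborel \<partial>lborel)"
    by (rule nn_integral_cmult) measurable
  also have "(\<integral>\<^sup>+x. \<integral>\<^sup>+s. indicator {0..t} s * ennreal ((cmod (G (x + s *\<^sub>R v)))\<^sup>2) \<partial>lborel \<partial>lborel)
      = (\<integral>\<^sup>+s. \<integral>\<^sup>+x. indicator {0..t} s * ennreal ((cmod (G (x + s *\<^sub>R v)))\<^sup>2) \<partial>lborel \<partial>lborel)"
    by (rule lborel_pair.Fubini'[symmetric]) measurable
  also have "\<dots> = (\<integral>\<^sup>+s. indicator {0..t} (s::real) * (\<integral>\<^sup>+x. ennreal ((cmod (G x))\<^sup>2) \<partial>lborel) \<partial>lborel)"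
  proof (rule nn_integral_cong)
    fix s :: real
    have "(\<integral>\<^sup>+x. indicator {0..t} s * ennreal ((cmod (G (x + s *\<^sub>R v)))\<^sup>2) \<partial>lborel)
        = indicator {0..t} s * (\<integral>\<^sup>+x. ennreal ((cmod (G (x + s *\<^sub>R v)))\<^sup>2) \<partial>lborel)"
      by (rule nn_integral_cmult) measurable
    also have "(\<integral>\<^sup>+x. ennreal ((cmod (G (x + s *\<^sub>R v)))\<^sup>2) \<partial>lborel) = (\<integral>\<^sup>+x. ennreal ((cmod (G x))\<^sup>2) \<partial>lborel)"
      by (rule nn_integral_lborel_shift) measurable
    finally show "(\<integral>\<^sup>+x. indicator {0..t} s * ennreal ((cmod (G (x + s *\<^sub>R v)))\<^sup>2) \<partial>lborel)
        = indicator {0..t} s * (\<integral>\<^sup>+x. ennreal ((cmod (G x))\<^sup>2) \<partial>lborel)" .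
  qed
  also have "\<dots> = (\<integral>\<^sup>+s. indicator {0..t} (s::real) \<partial>lborel) * (\<integral>\<^sup>+x. ennreal ((cmod (G x))\<^sup>2) \<partial>lborel)"
    by (rule nn_integral_multc) measurable
  also have "(\<integral>\<^sup>+s. indicator {0..t} (s::real) \<partial>lborel) = ennreal t" using t by (simp add: emeasure_lborel_Icc_eq)
  also have "ennreal t * (ennreal t * (\<integral>\<^sup>+x. ennreal ((cmod (G x))\<^sup>2) \<partial>lborel)) = ennreal (t\<^sup>2) * (\<integral>\<^sup>+x. ennreal ((cmod (G x))\<^sup>2) \<partial>lborel)"
    using t by (simp add: power2_eq_square ennreal_mult mult.assoc)
  finally show ?thesis .
qed

lemma integrable_square_add:
  fixes f g :: "'a \<Rightarrow> complex"
  assumes [measurable]: "f \<in> borel_measurable M" "g \<in> borel_measurable M"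
    and f2: "integrable M (\<lambda>x. (cmod (f x))\<^sup>2)" and g2: "integrable M (\<lambda>x. (cmod (g x))\<^sup>2)"
  shows "integrable M (\<lambda>x. (cmod (f x + g x))\<^sup>2)"
proof (rule Bochner_Integration.integrable_bound)
  show "integrable M (\<lambda>x. 2 * ((cmod (f x))\<^sup>2 + (cmod (g x))\<^sup>2))" using f2 g2 by simp
  show "AE x in M. norm ((cmod (f x + g x))\<^sup>2) \<le> norm (2 * ((cmod (f x))\<^sup>2 + (cmod (g x))\<^sup>2))"
  proof (intro AE_I2)
    fix x
    have "(cmod (f x + g x))\<^sup>2 \<le> (cmod (f x) + cmod (g x))\<^sup>2" by (intro power_mono norm_triangle_ineq) simp
    also have "\<dots> \<le> 2 * ((cmod (f x))\<^sup>2 + (cmod (g x))\<^sup>2)"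
      using sum_squares_bound[of "cmod (f x)" "cmod (g x)"] by (simp add: power2_sum)
    finally show "norm ((cmod (f x + g x))\<^sup>2) \<le> norm (2 * ((cmod (f x))\<^sup>2 + (cmod (g x))\<^sup>2))" by simp
  qed
qed measurable

text \<open>The difference quotient is the average of the weak derivative over a segment: both sides
  have the same integral against every test function.\<close>
lemma weak_derivative_shift_nonneg:
  fixes u G :: "R3 \<Rightarrow> complex"
  assumes [measurable]: "u \<in> borel_measurable borel" "G \<in> borel_measurable borel"
    and u2: "integrable lborel (\<lambda>x. (cmod (u x))\<^sup>2)" and G2: "integrable lborel (\<lambda>x. (cmod (G x))\<^sup>2)"
    and weak: "\<And>\<phi>. \<phi> \<in> test_functions \<Longrightarrow>
      (\<integral>x. u x * of_real (partial_deriv i \<phi> x) \<partial>lborel) = - (\<integral>x. G x * of_real (\<phi> x) \<partial>lborel)"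
    and t: "0 \<le> t"
  shows "(\<integral>\<^sup>+x. ennreal ((cmod (u (x + t *\<^sub>R axis i 1) - u x))\<^sup>2) \<partial>lborel)
    \<le> ennreal (t\<^sup>2) * (\<integral>\<^sup>+x. ennreal ((cmod (G x))\<^sup>2) \<partial>lborel)"
proof -
  let ?e = "axis i 1 :: R3"
  define H where "H x = (\<integral>s. of_real (indicator {0..t} s) * G (x + s *\<^sub>R ?e) \<partial>lborel)" for x
  have [measurable]: "H \<in> borel_measurable borel" unfolding H_def by measurable
  have Hb: "(\<integral>\<^sup>+x. ennreal ((cmod (H x))\<^sup>2) \<partial>lborel) \<le> ennreal (t\<^sup>2) * (\<integral>\<^sup>+x. ennreal ((cmod (G x))\<^sup>2) \<partial>lborel)"
    unfolding H_def by (rule nn_integral_shift_average) (use t in auto)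
  have Gfin: "(\<integral>\<^sup>+x. ennreal ((cmod (G x))\<^sup>2) \<partial>lborel) < \<infinity>"
    using G2 unfolding real_integrable_def by (auto simp: less_top)
  have H2: "integrable lborel (\<lambda>x. (cmod (H x))\<^sup>2)"
  proof (rule integrableI_bounded)
    show "(\<integral>\<^sup>+x. ennreal (norm ((cmod (H x))\<^sup>2)) \<partial>lborel) < \<infinity>"
      using le_less_trans[OF Hb] Gfin by (simp add: ennreal_mult_less_top)
  qed measurable
  have us2: "integrable lborel (\<lambda>x. (cmod (u (x + t *\<^sub>R ?e)))\<^sup>2)" by (rule integrable_lborel_shift[OF u2])
  have "AE x in lborel. (u (x + t *\<^sub>R ?e) + - u x) + - H x = 0"
  proof (rule zero_if_orthogonal_to_tests)
    show "(\<lambda>x. (u (x + t *\<^sub>R ?e) + - u x) + - H x) \<in> borel_measurable borel" by measurable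
    show "integrable lborel (\<lambda>x. (cmod ((u (x + t *\<^sub>R ?e) + - u x) + - H x))\<^sup>2)"
      by (intro integrable_square_add) (use us2 u2 H2 in auto)
    fix \<phi> assume \<phi>: "\<phi> \<in> test_functions"
    have p: "partial_deriv i \<phi> \<in> test_functions" by (rule partial_deriv_test_function[OF \<phi>])
    have [measurable]: "\<phi> \<in> borel_measurable borel" "partial_deriv i \<phi> \<in> borel_measurable borel"
      using test_function_measurable \<phi> p by blast+
    have f2: "integrable lborel (\<lambda>x. (cmod (of_real (\<phi> x)))\<^sup>2)"
      "integrable lborel (\<lambda>x. (cmod (of_real (partial_deriv i \<phi> x)))\<^sup>2)"
      using test_function_square_integrable[OF \<phi>] test_function_square_integrable[OF p] by auto
    have fs2: "integrable lborel (\<lambda>x. (cmod (of_real (\<phi> (x - t *\<^sub>R ?e))))\<^sup>2)"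
      using integrable_lborel_shift[OF f2(1), of "- (t *\<^sub>R ?e)"] by simp
    have i1: "integrable lborel (\<lambda>x. u (x + t *\<^sub>R ?e) * of_real (\<phi> x))"
      by (rule integrable_mult_square_integrable) (use us2 f2 in auto)
    have i2: "integrable lborel (\<lambda>x. u x * of_real (\<phi> x))"
      by (rule integrable_mult_square_integrable) (use u2 f2 in auto)
    have i3: "integrable lborel (\<lambda>x. H x * of_real (\<phi> x))"
      by (rule integrable_mult_square_integrable) (use H2 f2 in auto)
    have i4: "integrable lborel (\<lambda>x. u x * of_real (\<phi> (x - t *\<^sub>R ?e)))"
      by (rule integrable_mult_square_integrable) (use u2 fs2 in auto)
    have F1: "integrable (lborel \<Otimes>\<^sub>M lborel) (\<lambda>(s::real, x). of_real (indicator {0..t} s) * (u x * of_real (partial_deriv i \<phi> (x + s *\<^sub>R (- ?e)))))"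
      by (rule integrable_shear_product) (use u2 f2 in auto)
    have F2: "integrable (lborel \<Otimes>\<^sub>M lborel) (\<lambda>(s::real, x). of_real (indicator {0..t} s) * (of_real (\<phi> x) * G (x + s *\<^sub>R ?e)))"
      by (rule integrable_shear_product) (use G2 f2 in auto)
    have inner: "(\<integral>x. u x * of_real (partial_deriv i \<phi> (x + s *\<^sub>R (- ?e))) \<partial>lborel) = - (\<integral>x. of_real (\<phi> x) * G (x + s *\<^sub>R ?e) \<partial>lborel)" for s
    proof -
      have "(\<integral>x. u x * of_real (partial_deriv i \<phi> (x + s *\<^sub>R (- ?e))) \<partial>lborel)
          = (\<integral>x. u x * of_real (partial_deriv i (\<lambda>x. \<phi> (x + s *\<^sub>R (- ?e))) x) \<partial>lborel)"
        by (subst partial_deriv_shift(1)) (auto intro: test_function_differentiable[OF \<phi>])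
      also have "\<dots> = - (\<integral>x. G x * of_real (\<phi> (x + s *\<^sub>R (- ?e))) \<partial>lborel)"
        by (rule weak[OF test_function_shift[OF \<phi>]])
      also have "(\<integral>x. G x * of_real (\<phi> (x + s *\<^sub>R (- ?e))) \<partial>lborel) = (\<integral>x. G (x + s *\<^sub>R ?e) * of_real (\<phi> (x + s *\<^sub>R ?e + s *\<^sub>R (- ?e))) \<partial>lborel)"
        by (rule integral_lborel_shift[symmetric]) measurable
      also have "\<dots> = (\<integral>x. of_real (\<phi> x) * G (x + s *\<^sub>R ?e) \<partial>lborel)" by (simp add: mult.commute)
      finally show ?thesis .
    qed
    have diff: "u x * of_real (\<phi> (x - t *\<^sub>R ?e)) - u x * of_real (\<phi> x)
        = - (\<integral>s. of_real (indicator {0..t} s) * (u x * of_real (partial_deriv i \<phi> (x + s *\<^sub>R (- ?e)))) \<partial>lborel)" for x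
    proof -
      have "(\<integral>s. of_real (indicator {0..t} s) * (u x * of_real (partial_deriv i \<phi> (x + s *\<^sub>R (- ?e)))) \<partial>lborel)
          = (\<integral>s. u x * of_real (indicator {0..t} s * partial_deriv i \<phi> (x - s *\<^sub>R ?e)) \<partial>lborel)"
        by (intro Bochner_Integration.integral_cong) (auto simp: indicator_def)
      also have "\<dots> = u x * of_real (\<integral>s. indicator {0..t} s * partial_deriv i \<phi> (x - s *\<^sub>R ?e) \<partial>lborel)"
        by (simp only: integral_mult_right_zero integral_complex_of_real)
      also have "(\<integral>s. indicator {0..t} s * partial_deriv i \<phi> (x - s *\<^sub>R ?e) \<partial>lborel) = \<phi> x - \<phi> (x - t *\<^sub>R ?e)"
        by (rule test_function_line_integral[OF \<phi> t, symmetric])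
      finally show ?thesis by (simp add: algebra_simps)
    qed
    have "(\<integral>x. u (x + t *\<^sub>R ?e) * of_real (\<phi> x) \<partial>lborel) = (\<integral>x. u (x + t *\<^sub>R ?e) * of_real (\<phi> (x + t *\<^sub>R ?e - t *\<^sub>R ?e)) \<partial>lborel)" by simp
    also have "\<dots> = (\<integral>x. u x * of_real (\<phi> (x - t *\<^sub>R ?e)) \<partial>lborel)"
      by (rule integral_lborel_shift) measurable
    finally have sh: "(\<integral>x. u (x + t *\<^sub>R ?e) * of_real (\<phi> x) \<partial>lborel) = (\<integral>x. u x * of_real (\<phi> (x - t *\<^sub>R ?e)) \<partial>lborel)" .
    have "(\<integral>x. u (x + t *\<^sub>R ?e) * of_real (\<phi> x) \<partial>lborel) - (\<integral>x. u x * of_real (\<phi> x) \<partial>lborel)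
        = (\<integral>x. u x * of_real (\<phi> (x - t *\<^sub>R ?e)) - u x * of_real (\<phi> x) \<partial>lborel)"
      unfolding sh by (rule Bochner_Integration.integral_diff[symmetric]) (rule i4, rule i2)
    also have "\<dots> = - (\<integral>x. \<integral>s. of_real (indicator {0..t} s) * (u x * of_real (partial_deriv i \<phi> (x + s *\<^sub>R (- ?e)))) \<partial>lborel \<partial>lborel)"
      unfolding diff by simp
    also have "(\<integral>x. \<integral>s. of_real (indicator {0..t} s) * (u x * of_real (partial_deriv i \<phi> (x + s *\<^sub>R (- ?e)))) \<partial>lborel \<partial>lborel)
        = (\<integral>s. \<integral>x. of_real (indicator {0..t} s) * (u x * of_real (partial_deriv i \<phi> (x + s *\<^sub>R (- ?e)))) \<partial>lborel \<partial>lborel)"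
      by (rule lborel_pair.Fubini_integral[OF F1])
    also have "\<dots> = (\<integral>s. - (\<integral>x. of_real (indicator {0..t} s) * (of_real (\<phi> x) * G (x + s *\<^sub>R ?e)) \<partial>lborel) \<partial>lborel)"
      by (simp only: integral_mult_right_zero inner mult_minus_right)
    also have "\<dots> = - (\<integral>s. \<integral>x. of_real (indicator {0..t} s) * (of_real (\<phi> x) * G (x + s *\<^sub>R ?e)) \<partial>lborel \<partial>lborel)" by simp
    also have "(\<integral>s. \<integral>x. of_real (indicator {0..t} s) * (of_real (\<phi> x) * G (x + s *\<^sub>R ?e)) \<partial>lborel \<partial>lborel)
        = (\<integral>x. \<integral>s. of_real (indicator {0..t} s) * (of_real (\<phi> x) * G (x + s *\<^sub>R ?e)) \<partial>lborel \<partial>lborel)"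
      by (rule lborel_pair.Fubini_integral[OF F2, symmetric])
    also have "\<dots> = (\<integral>x. H x * of_real (\<phi> x) \<partial>lborel)"
    proof (rule Bochner_Integration.integral_cong[OF refl])
      fix x
      have "(\<integral>s. of_real (indicator {0..t} s) * (of_real (\<phi> x) * G (x + s *\<^sub>R ?e)) \<partial>lborel)
          = (\<integral>s. of_real (\<phi> x) * (of_real (indicator {0..t} s) * G (x + s *\<^sub>R ?e)) \<partial>lborel)"
        by (simp only: mult.left_commute)
      also have "\<dots> = H x * of_real (\<phi> x)" unfolding H_def by (simp only: integral_mult_right_zero mult.commute)
      finally show "(\<integral>s. of_real (indicator {0..t} s) * (of_real (\<phi> x) * G (x + s *\<^sub>R ?e)) \<partial>lborel) = H x * of_real (\<phi> x)" .
    qed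
    finally have key: "(\<integral>x. u (x + t *\<^sub>R ?e) * of_real (\<phi> x) \<partial>lborel) - (\<integral>x. u x * of_real (\<phi> x) \<partial>lborel) - (\<integral>x. H x * of_real (\<phi> x) \<partial>lborel) = 0"
      by simp
    have "(\<integral>x. ((u (x + t *\<^sub>R ?e) + - u x) + - H x) * of_real (\<phi> x) \<partial>lborel)
        = (\<integral>x. (u (x + t *\<^sub>R ?e) * of_real (\<phi> x) - u x * of_real (\<phi> x)) - H x * of_real (\<phi> x) \<partial>lborel)"
      by (simp add: algebra_simps)
    also have "\<dots> = 0" using i1 i2 i3 key by simp
    finally show "(\<integral>x. ((u (x + t *\<^sub>R ?e) + - u x) + - H x) * of_real (\<phi> x) \<partial>lborel) = 0" .
  qed
  then have "AE x in lborel. ennreal ((cmod (u (x + t *\<^sub>R ?e) - u x))\<^sup>2) = ennreal ((cmod (H x))\<^sup>2)"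
    by eventually_elim (simp add: algebra_simps)
  then have "(\<integral>\<^sup>+x. ennreal ((cmod (u (x + t *\<^sub>R ?e) - u x))\<^sup>2) \<partial>lborel) = (\<integral>\<^sup>+x. ennreal ((cmod (H x))\<^sup>2) \<partial>lborel)"
    by (rule nn_integral_cong_AE)
  then show ?thesis using Hb by (simp only:)
qed

lemma weak_derivative_shift:
  fixes u G :: "R3 \<Rightarrow> complex"
  assumes [measurable]: "u \<in> borel_measurable borel" "G \<in> borel_measurable borel"
    and u2: "integrable lborel (\<lambda>x. (cmod (u x))\<^sup>2)" and G2: "integrable lborel (\<lambda>x. (cmod (G x))\<^sup>2)"
    and weak: "\<And>\<phi>. \<phi> \<in> test_functions \<Longrightarrow>
      (\<integral>x. u x * of_real (partial_deriv i \<phi> x) \<partial>lborel) = - (\<integral>x. G x * of_real (\<phi> x) \<partial>lborel)"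
  shows "(\<integral>\<^sup>+x. ennreal ((cmod (u (x + t *\<^sub>R axis i 1) - u x))\<^sup>2) \<partial>lborel)
    \<le> ennreal (t\<^sup>2) * (\<integral>\<^sup>+x. ennreal ((cmod (G x))\<^sup>2) \<partial>lborel)"
proof (cases "0 \<le> t")
  case True
  then show ?thesis by (intro weak_derivative_shift_nonneg assms)
next
  case False
  let ?e = "axis i 1 :: R3"
  have "(\<integral>\<^sup>+x. ennreal ((cmod (u (x + t *\<^sub>R ?e) - u x))\<^sup>2) \<partial>lborel)
      = (\<integral>\<^sup>+x. ennreal ((cmod (u (x + (- t) *\<^sub>R ?e + t *\<^sub>R ?e) - u (x + (- t) *\<^sub>R ?e)))\<^sup>2) \<partial>lborel)"
    by (rule nn_integral_lborel_shift[symmetric]) measurable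
  also have "\<dots> = (\<integral>\<^sup>+x. ennreal ((cmod (u (x + (- t) *\<^sub>R ?e) - u x))\<^sup>2) \<partial>lborel)"
    by (simp add: norm_minus_commute)
  also have "\<dots> \<le> ennreal ((- t)\<^sup>2) * (\<integral>\<^sup>+x. ennreal ((cmod (G x))\<^sup>2) \<partial>lborel)"
    using False by (intro weak_derivative_shift_nonneg assms) auto
  finally show ?thesis by simp
qed

text \<open>The shift by \<open>h\<close> is a succession of three coordinate shifts, each bounded
  by one component of the gradient; the factor 3 comes from
  \<open>(p + q + r)^2 \<le> 3 * (p^2 + q^2 + r^2)\<close>.\<close>

lemma weak_gradient_shift:
  fixes u :: "R3 \<Rightarrow> complex" and G :: "R3 \<Rightarrow> complex ^ 3"
  assumes [measurable]: "u \<in> borel_measurable borel" "G \<in> borel_measurable borel"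
    and u2: "integrable lborel (\<lambda>x. (cmod (u x))\<^sup>2)" and G2: "integrable lborel (\<lambda>x. (norm (G x))\<^sup>2)"
    and weak: "\<And>\<phi> i. \<phi> \<in> test_functions \<Longrightarrow>
      (\<integral>x. u x * of_real (partial_deriv i \<phi> x) \<partial>lborel) = - (\<integral>x. G x $ i * of_real (\<phi> x) \<partial>lborel)"
  shows "(\<integral>\<^sup>+x. ennreal ((cmod (u (x + h) - u x))\<^sup>2) \<partial>lborel)
    \<le> ennreal (3 * (\<integral>x. (norm (G x))\<^sup>2 \<partial>lborel) * (norm h)\<^sup>2)"
proof -
  have [measurable]: "(\<lambda>x. G x $ i) \<in> borel_measurable borel" for i
    by (rule measurable_compose[OF assms(2) borel_measurable_continuous_onI[OF linear_continuous_on[OF bounded_linear_vec_nth]]])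
  have nG: "(norm (G x))\<^sup>2 = (cmod (G x $ 1))\<^sup>2 + (cmod (G x $ 2))\<^sup>2 + (cmod (G x $ 3))\<^sup>2" for x
    by (simp add: norm_vec_def L2_set_def sum_3)
  have Gi: "integrable lborel (\<lambda>x. (cmod (G x $ i))\<^sup>2)" for i
  proof (rule Bochner_Integration.integrable_bound[OF G2])
    have "(cmod (G x $ i))\<^sup>2 \<le> (norm (G x))\<^sup>2" for x
      by (intro power_mono Finite_Cartesian_Product.norm_nth_le) simp
    then show "AE x in lborel. norm ((cmod (G x $ i))\<^sup>2) \<le> norm ((norm (G x))\<^sup>2)" by simp
  qed measurable
  define T where "T i = (\<integral>\<^sup>+x. ennreal ((cmod (G x $ i))\<^sup>2) \<partial>lborel)" for i
  have shift: "(\<integral>\<^sup>+x. ennreal ((cmod (u (x + y + (h $ i) *\<^sub>R axis i 1) - u (x + y)))\<^sup>2) \<partial>lborel) \<le> ennreal ((norm h)\<^sup>2) * T i" for y i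
  proof -
    have "(\<integral>\<^sup>+x. ennreal ((cmod (u (x + y + (h $ i) *\<^sub>R axis i 1) - u (x + y)))\<^sup>2) \<partial>lborel)
        = (\<integral>\<^sup>+x. ennreal ((cmod (u (x + (h $ i) *\<^sub>R axis i 1) - u x))\<^sup>2) \<partial>lborel)"
      by (rule nn_integral_lborel_shift) measurable
    also have "\<dots> \<le> ennreal ((h $ i)\<^sup>2) * T i"
      unfolding T_def by (rule weak_derivative_shift) (use u2 Gi weak in auto)
    also have "\<dots> \<le> ennreal ((norm h)\<^sup>2) * T i"
    proof (intro mult_right_mono ennreal_leI)
      have "\<bar>h $ i\<bar>\<^sup>2 \<le> (norm h)\<^sup>2" by (intro power_mono component_le_norm_cart) simp
      then show "(h $ i)\<^sup>2 \<le> (norm h)\<^sup>2" by simp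
    qed simp
    finally show ?thesis .
  qed
  let ?a = "\<lambda>i::3. (h $ i) *\<^sub>R (axis i 1 :: R3)"
  have h: "h = ?a 1 + ?a 2 + ?a 3"
    by (simp add: vec_eq_iff axis_def forall_3)
  let ?D = "\<lambda>y i x. ennreal ((cmod (u (x + y + ?a i) - u (x + y)))\<^sup>2)"
  have "(\<integral>\<^sup>+x. ennreal ((cmod (u (x + h) - u x))\<^sup>2) \<partial>lborel)
      \<le> (\<integral>\<^sup>+x. ennreal 3 * (?D 0 1 x + ?D (?a 1) 2 x + ?D (?a 1 + ?a 2) 3 x) \<partial>lborel)"
  proof (rule nn_integral_mono)
    fix x
    define p q r where "p = cmod (u (x + ?a 1) - u x)" and "q = cmod (u (x + ?a 1 + ?a 2) - u (x + ?a 1))"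
      and "r = cmod (u (x + (?a 1 + ?a 2) + ?a 3) - u (x + (?a 1 + ?a 2)))"
    have "cmod (u (x + h) - u x) = cmod ((u (x + ?a 1) - u x) + (u (x + ?a 1 + ?a 2) - u (x + ?a 1))
        + (u (x + (?a 1 + ?a 2) + ?a 3) - u (x + (?a 1 + ?a 2))))"
      by (subst h) (simp add: add.assoc)
    also have "\<dots> \<le> p + q + r" unfolding p_def q_def r_def
      by (intro order_trans[OF norm_triangle_ineq] add_mono norm_triangle_ineq order_refl)
    finally have "(cmod (u (x + h) - u x))\<^sup>2 \<le> (p + q + r)\<^sup>2" by (intro power_mono) simp_all
    also have "\<dots> \<le> 3 * (p\<^sup>2 + q\<^sup>2 + r\<^sup>2)"
      using sum_squares_bound[of p q] sum_squares_bound[of p r] sum_squares_bound[of q r]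
      by (simp add: power2_eq_square algebra_simps)
    finally have "ennreal ((cmod (u (x + h) - u x))\<^sup>2) \<le> ennreal (3 * (p\<^sup>2 + q\<^sup>2 + r\<^sup>2))" by (rule ennreal_leI)
    also have "\<dots> = ennreal 3 * ennreal (p\<^sup>2 + q\<^sup>2 + r\<^sup>2)" by (rule ennreal_mult) auto
    also have "ennreal (p\<^sup>2 + q\<^sup>2 + r\<^sup>2) = ennreal (p\<^sup>2) + ennreal (q\<^sup>2) + ennreal (r\<^sup>2)"
      by (simp add: ennreal_plus[symmetric] del: ennreal_plus)
    finally show "ennreal ((cmod (u (x + h) - u x))\<^sup>2) \<le> ennreal 3 * (?D 0 1 x + ?D (?a 1) 2 x + ?D (?a 1 + ?a 2) 3 x)"
      unfolding p_def q_def r_def by simp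
  qed
  also have "\<dots> = ennreal 3 * (\<integral>\<^sup>+x. (?D 0 1 x + ?D (?a 1) 2 x) + ?D (?a 1 + ?a 2) 3 x \<partial>lborel)"
    by (rule nn_integral_cmult) measurable
  also have "(\<integral>\<^sup>+x. (?D 0 1 x + ?D (?a 1) 2 x) + ?D (?a 1 + ?a 2) 3 x \<partial>lborel)
      = (\<integral>\<^sup>+x. ?D 0 1 x + ?D (?a 1) 2 x \<partial>lborel) + (\<integral>\<^sup>+x. ?D (?a 1 + ?a 2) 3 x \<partial>lborel)"
    by (rule nn_integral_add) measurable
  also have "(\<integral>\<^sup>+x. ?D 0 1 x + ?D (?a 1) 2 x \<partial>lborel) = (\<integral>\<^sup>+x. ?D 0 1 x \<partial>lborel) + (\<integral>\<^sup>+x. ?D (?a 1) 2 x \<partial>lborel)"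
    by (rule nn_integral_add) measurable
  also have "ennreal 3 * ((\<integral>\<^sup>+x. ?D 0 1 x \<partial>lborel) + (\<integral>\<^sup>+x. ?D (?a 1) 2 x \<partial>lborel) + (\<integral>\<^sup>+x. ?D (?a 1 + ?a 2) 3 x \<partial>lborel))
      \<le> ennreal 3 * (ennreal ((norm h)\<^sup>2) * T 1 + ennreal ((norm h)\<^sup>2) * T 2 + ennreal ((norm h)\<^sup>2) * T 3)"
    by (intro mult_left_mono add_mono shift) simp
  also have "\<dots> = ennreal 3 * (ennreal ((norm h)\<^sup>2) * (T 1 + T 2 + T 3))" by (simp add: distrib_left)
  also have "T 1 + T 2 + T 3 = ennreal (\<integral>x. (norm (G x))\<^sup>2 \<partial>lborel)"
  proof -
    have Ti: "T i = ennreal (\<integral>x. (cmod (G x $ i))\<^sup>2 \<partial>lborel)" for i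
      unfolding T_def by (rule nn_integral_eq_integral[OF Gi]) simp
    show ?thesis unfolding Ti nG using Gi by (simp add: ennreal_plus[symmetric] del: ennreal_plus)
  qed
  also have "ennreal 3 * (ennreal ((norm h)\<^sup>2) * ennreal (\<integral>x. (norm (G x))\<^sup>2 \<partial>lborel)) = ennreal (3 * (\<integral>x. (norm (G x))\<^sup>2 \<partial>lborel) * (norm h)\<^sup>2)"
    by (simp add: ennreal_mult'[symmetric] mult.commute mult.left_commute del: ennreal_numeral)
  finally show ?thesis .
qed

section \<open>The Hilbert space of square-integrable classes\<close>

lemma L2_iff: "f \<in> L2 \<longleftrightarrow> f \<in> borel_measurable lebesgue \<and> integrable lebesgue (\<lambda>x. (norm (f x))\<^sup>2)"
  by (simp add: L2_def)

lemma L2_measurable: "f \<in> L2 \<Longrightarrow> f \<in> borel_measurable lebesgue"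
  and L2_integrable: "f \<in> L2 \<Longrightarrow> integrable lebesgue (\<lambda>x. (norm (f x))\<^sup>2)"
  by (simp_all add: L2_def)

lemma L2_cong_AE:
  assumes "f \<in> L2" "g \<in> borel_measurable lebesgue" "AE x in lebesgue. f x = g x"
  shows "g \<in> L2"
proof -
  have [measurable]: "f \<in> borel_measurable lebesgue" "g \<in> borel_measurable lebesgue"
    using assms L2_measurable by auto
  have "integrable lebesgue (\<lambda>x. (norm (g x))\<^sup>2) \<longleftrightarrow> integrable lebesgue (\<lambda>x. (norm (f x))\<^sup>2)"
    by (rule integrable_cong_AE) (measurable, use assms(3) in eventually_elim, simp)
  then show ?thesis using assms by (simp add: L2_iff)
qed

lemma L2_dominated:
  assumes f: "f \<in> L2" and [measurable]: "g \<in> borel_measurable lebesgue"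
    and le: "AE x in lebesgue. norm (g x) \<le> c * norm (f x)"
  shows "g \<in> L2"
proof -
  have "integrable lebesgue (\<lambda>x. (norm (g x))\<^sup>2)"
  proof (rule Bochner_Integration.integrable_bound)
    show "integrable lebesgue (\<lambda>x. c\<^sup>2 * (norm (f x))\<^sup>2)" using L2_integrable[OF f] by simp
    show "AE x in lebesgue. norm ((norm (g x))\<^sup>2) \<le> norm (c\<^sup>2 * (norm (f x))\<^sup>2)"
      using le
    proof eventually_elim
      case (elim x)
      then have "(norm (g x))\<^sup>2 \<le> (c * norm (f x))\<^sup>2" by (intro power_mono) auto
      then show ?case by (simp add: power_mult_distrib)
    qed
  qed measurable
  then show ?thesis by (simp add: L2_iff)
qed

lemma L2_zero: "(\<lambda>x. 0) \<in> (L2 :: (R3 \<Rightarrow> complex) set)"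
  by (simp add: L2_iff)

lemma L2_add:
  fixes f g :: "R3 \<Rightarrow> complex"
  assumes "f \<in> L2" "g \<in> L2"
  shows "(\<lambda>x. f x + g x) \<in> L2"
  using assms integrable_square_add[of f lebesgue g] by (auto simp: L2_iff)

lemma L2_cmult:
  fixes f :: "R3 \<Rightarrow> complex"
  assumes "f \<in> L2"
  shows "(\<lambda>x. c * f x) \<in> L2"
  using assms by (auto simp: L2_iff norm_mult power_mult_distrib)

lemma L2_uminus: "(f :: R3 \<Rightarrow> complex) \<in> L2 \<Longrightarrow> (\<lambda>x. - f x) \<in> L2"
  using L2_cmult[of f "-1"] by simp

lemma L2_diff: "(f :: R3 \<Rightarrow> complex) \<in> L2 \<Longrightarrow> g \<in> L2 \<Longrightarrow> (\<lambda>x. f x - g x) \<in> L2"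
  using L2_add[of f "\<lambda>x. - g x"] L2_uminus[of g] by simp

lemma L2_cnj: "f \<in> L2 \<Longrightarrow> (\<lambda>x. cnj (f x)) \<in> L2"
  by (auto simp: L2_iff)

lemma L2_mult_integrable:
  fixes f g :: "R3 \<Rightarrow> complex"
  shows "f \<in> L2 \<Longrightarrow> g \<in> L2 \<Longrightarrow> integrable lebesgue (\<lambda>x. f x * g x)"
  using integrable_mult_square_integrable[of f lebesgue g] by (simp add: L2_iff)

lemma L2_inner_integrable: "f \<in> L2 \<Longrightarrow> g \<in> L2 \<Longrightarrow> integrable lebesgue (\<lambda>x. cnj (f x) * g x)"
  using L2_mult_integrable[OF L2_cnj] .

lemma L2_inner_cong:
  assumes "f \<in> L2" "f' \<in> L2" "g \<in> L2" "g' \<in> L2"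
    and "AE x in lebesgue. f x = f' x" "AE x in lebesgue. g x = g' x"
  shows "L2_inner f g = L2_inner f' g'"
proof -
  have [measurable]: "f \<in> borel_measurable lebesgue" "g \<in> borel_measurable lebesgue"
    "f' \<in> borel_measurable lebesgue" "g' \<in> borel_measurable lebesgue"
    using assms L2_measurable by auto
  show ?thesis unfolding L2_inner_def
  proof (rule integral_cong_AE)
    show "AE x in lebesgue. cnj (f x) * g x = cnj (f' x) * g' x" using assms(5,6) by eventually_elim simp
  qed measurable
qed

lemma L2_inner_add_left:
  "f \<in> L2 \<Longrightarrow> g \<in> L2 \<Longrightarrow> h \<in> L2 \<Longrightarrow> L2_inner (\<lambda>x. f x + g x) h = L2_inner f h + L2_inner g h"
  by (simp add: L2_inner_def distrib_right L2_inner_integrable)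

lemma L2_inner_cmult_left: "L2_inner (\<lambda>x. c * f x) g = cnj c * L2_inner f g"
  by (simp add: L2_inner_def mult.assoc)

lemma L2_inner_cmult_right: "L2_inner f (\<lambda>x. c * g x) = c * L2_inner f g"
  by (simp add: L2_inner_def mult.left_commute)

lemma L2_inner_commute: "L2_inner f g = cnj (L2_inner g f)"
  unfolding L2_inner_def Bochner_Integration.integral_cnj[symmetric] by (simp add: mult.commute)

lemma L2_norm_nonneg: "0 \<le> L2_norm f"
  by (simp add: L2_norm_def)

lemma L2_norm_square: "(L2_norm f)\<^sup>2 = (\<integral>x. (norm (f x))\<^sup>2 \<partial>lebesgue)"
  by (simp add: L2_norm_def)

lemma L2_inner_self: "L2_inner f f = of_real ((L2_norm f)\<^sup>2)"
proof -
  have "L2_inner f f = (\<integral>x. of_real ((norm (f x))\<^sup>2) \<partial>lebesgue)"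
    unfolding L2_inner_def complex_norm_square by (simp add: mult.commute)
  then show ?thesis by (simp only: integral_complex_of_real L2_norm_square)
qed

lemma L2_norm_eq_0:
  assumes "f \<in> L2"
  shows "L2_norm f = 0 \<longleftrightarrow> (AE x in lebesgue. f x = 0)"
  using integral_nonneg_eq_0_iff_AE[OF L2_integrable[OF assms]] by (simp add: L2_norm_def)

text \<open>The choice depends only on the almost-everywhere class, as
  \<open>borel_version_cong\<close> shows, so it can name classes. Borel representatives give access
  to integrals over \<open>lborel\<close> and to Fubini's theorem.\<close>

definition borel_version :: "(R3 \<Rightarrow> complex) \<Rightarrow> R3 \<Rightarrow> complex" where
  "borel_version f = (SOME g. g \<in> borel_measurable borel \<and> (AE x in lebesgue. g x = f x))"

lemma
  assumes f: "f \<in> borel_measurable lebesgue"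
  shows borel_version_measurable: "borel_version f \<in> borel_measurable borel"
    and AE_borel_version: "AE x in lebesgue. borel_version f x = f x"
proof -
  have m: "(\<lambda>x. Re (f x)) \<in> borel_measurable lebesgue" "(\<lambda>x. Im (f x)) \<in> borel_measurable lebesgue"
    using f by measurable
  obtain r where r: "r \<in> borel_measurable lborel" "AE x in lborel. Re (f x) = r x"
    using completion_ex_borel_measurable_real[OF m(1)] by blast
  obtain i where i: "i \<in> borel_measurable lborel" "AE x in lborel. Im (f x) = i x"
    using completion_ex_borel_measurable_real[OF m(2)] by blast
  have ae: "AE x in lebesgue. Complex (r x) (i x) = f x"
    using AE_completion[OF r(2)] AE_completion[OF i(2)] by eventually_elim (simp add: complex_eq_iff)
  have me: "(\<lambda>x. Complex (r x) (i x)) \<in> borel_measurable borel"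
  proof -
    have [measurable]: "r \<in> borel_measurable borel" "i \<in> borel_measurable borel" using r i by auto
    have "(\<lambda>x. of_real (r x) + \<i> * of_real (i x) :: complex) \<in> borel_measurable borel" by measurable
    then show ?thesis by (simp add: Complex_eq)
  qed
  have "\<exists>g. g \<in> borel_measurable borel \<and> (AE x in lebesgue. g x = f x)"
    by (intro exI conjI) (rule me, rule ae)
  from someI_ex[OF this] show "borel_version f \<in> borel_measurable borel" "AE x in lebesgue. borel_version f x = f x"
    unfolding borel_version_def by auto
qed

lemma borel_version_cong:
  assumes "AE x in lebesgue. f x = g x"
  shows "borel_version f = borel_version g"
proof -
  have "(AE x in lebesgue. h x = f x) \<longleftrightarrow> (AE x in lebesgue. h x = g x)" for h
    using assms by (auto elim: eventually_elim2)
  then show ?thesis unfolding borel_version_def by simp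
qed

lemma borel_version_L2: "f \<in> L2 \<Longrightarrow> borel_version f \<in> L2"
  using L2_cong_AE[of f "borel_version f"] AE_borel_version[of f] borel_version_measurable[of f]
  by (auto simp: L2_measurable eq_commute measurable_completion)

text \<open>Almost-everywhere classes in \<open>L2\<close>, each named by a fixed Borel representative.\<close>
typedef l2 = "borel_version ` L2"
  morphisms rep l2_of_rep using L2_zero by blast

section \<open>The real inner product space of classes\<close>

definition cls :: "(R3 \<Rightarrow> complex) \<Rightarrow> l2" where
  "cls f = l2_of_rep (borel_version f)"

lemma rep_L2: "rep x \<in> L2"
  using rep[of x] borel_version_L2 by auto

lemma rep_borel [measurable]: "rep x \<in> borel_measurable borel"
  using rep[of x] by (auto simp del: measurable_lborel1 measurable_completion intro!: borel_version_measurable L2_measurable)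

lemma AE_rep_cls: "f \<in> L2 \<Longrightarrow> AE x in lebesgue. rep (cls f) x = f x"
  unfolding cls_def by (subst l2_of_rep_inverse) (auto simp: AE_borel_version L2_measurable)

lemma cls_rep [simp]: "cls (rep x) = x"
proof -
  obtain f where f: "f \<in> L2" "rep x = borel_version f" using rep[of x] by auto
  then have "borel_version (rep x) = rep x" using borel_version_cong[OF AE_borel_version[OF L2_measurable]] by simp
  then show ?thesis unfolding cls_def by (simp add: rep_inverse)
qed

lemma cls_eqI: "AE x in lebesgue. f x = g x \<Longrightarrow> cls f = cls g"
  unfolding cls_def using borel_version_cong by metis

lemma cls_eq_iff:
  assumes "f \<in> L2" "g \<in> L2"
  shows "cls f = cls g \<longleftrightarrow> (AE x in lebesgue. f x = g x)"
proof
  assume "cls f = cls g"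
  then have "AE x in lebesgue. rep (cls f) x = g x" using AE_rep_cls[OF assms(2)] by simp
  with AE_rep_cls[OF assms(1)] show "AE x in lebesgue. f x = g x" by eventually_elim simp
qed (rule cls_eqI)

lemma l2_cases [cases type: l2]:
  obtains f where "f \<in> L2" "x = cls f"
  using rep_L2[of x] cls_rep[of x, symmetric] by (rule that)

instantiation l2 :: real_vector
begin

definition "0 = cls (\<lambda>t. 0)"
definition "x + y = cls (\<lambda>t. rep x t + rep y t)"
definition "x - y = cls (\<lambda>t. rep x t - rep y t)"
definition "- x = cls (\<lambda>t. - rep x t)"
definition "r *\<^sub>R x = cls (\<lambda>t. of_real r * rep x t)"

lemma cls_add: "f \<in> L2 \<Longrightarrow> g \<in> L2 \<Longrightarrow> cls f + cls g = cls (\<lambda>t. f t + g t)"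
  unfolding plus_l2_def by (rule cls_eqI) (use AE_rep_cls[of f] AE_rep_cls[of g] in auto)

lemma cls_diff: "f \<in> L2 \<Longrightarrow> g \<in> L2 \<Longrightarrow> cls f - cls g = cls (\<lambda>t. f t - g t)"
  unfolding minus_l2_def by (rule cls_eqI) (use AE_rep_cls[of f] AE_rep_cls[of g] in auto)

lemma cls_uminus: "f \<in> L2 \<Longrightarrow> - cls f = cls (\<lambda>t. - f t)"
  unfolding uminus_l2_def by (rule cls_eqI) (use AE_rep_cls[of f] in auto)

lemma cls_scaleR: "f \<in> L2 \<Longrightarrow> r *\<^sub>R cls f = cls (\<lambda>t. of_real r * f t)"
  unfolding scaleR_l2_def by (rule cls_eqI) (use AE_rep_cls[of f] in auto)

lemma cls_0: "cls (\<lambda>t. 0) = 0"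
  by (simp add: zero_l2_def)

instance
proof
  fix a b c :: l2 and r s :: real
  obtain f where f: "f \<in> L2" "a = cls f" by (rule l2_cases)
  obtain g where g: "g \<in> L2" "b = cls g" by (rule l2_cases)
  obtain h where h: "h \<in> L2" "c = cls h" by (rule l2_cases)
  show "a + b + c = a + (b + c)" using f g h by (simp add: cls_add L2_add add.assoc)
  show "a + b = b + a" using f g by (simp add: cls_add add.commute)
  show "0 + a = a" using f by (simp add: cls_0[symmetric] cls_add L2_zero)
  show "- a + a = 0" using f by (simp add: cls_0[symmetric] cls_add cls_uminus L2_uminus)
  show "a - b = a + - b" using f g by (simp add: cls_add cls_uminus cls_diff L2_uminus)
  show "r *\<^sub>R (a + b) = r *\<^sub>R a + r *\<^sub>R b" using f g by (simp add: cls_add cls_scaleR L2_cmult L2_add distrib_left)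
  show "(r + s) *\<^sub>R a = r *\<^sub>R a + s *\<^sub>R a" using f by (simp add: cls_add cls_scaleR L2_cmult distrib_right)
  show "r *\<^sub>R s *\<^sub>R a = (r * s) *\<^sub>R a" using f by (simp add: cls_scaleR L2_cmult mult.assoc)
  show "1 *\<^sub>R a = a" using f by (simp add: cls_scaleR)
qed

end

instantiation l2 :: real_inner
begin

definition "x \<bullet> y = Re (L2_inner (rep x) (rep y))"
definition "norm x = L2_norm (rep x)"
definition "dist x y = norm (x - y :: l2)"
definition "sgn x = x /\<^sub>R norm (x :: l2)"
definition [code del]: "(uniformity :: (l2 \<times> l2) filter) = (INF e\<in>{0<..}. principal {(x, y). dist x y < e})"
definition [code del]: "open (U :: l2 set) \<longleftrightarrow> (\<forall>x\<in>U. eventually (\<lambda>(x', y). x' = x \<longrightarrow> y \<in> U) uniformity)"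

lemma inner_cls: "f \<in> L2 \<Longrightarrow> g \<in> L2 \<Longrightarrow> cls f \<bullet> cls g = Re (L2_inner f g)"
  unfolding inner_l2_def using L2_inner_cong[of "rep (cls f)" f "rep (cls g)" g] rep_L2 AE_rep_cls by simp

instance
proof
  fix x y z :: l2 and r :: real
  obtain f where f: "f \<in> L2" "x = cls f" by (rule l2_cases)
  obtain g where g: "g \<in> L2" "y = cls g" by (rule l2_cases)
  obtain h where h: "h \<in> L2" "z = cls h" by (rule l2_cases)
  show "dist x y = norm (x - y)" by (simp add: dist_l2_def)
  show "sgn x = x /\<^sub>R norm x" by (simp add: sgn_l2_def)
  show "(uniformity :: (l2 \<times> l2) filter) = (INF e\<in>{0<..}. principal {(x, y). dist x y < e})"
    by (simp add: uniformity_l2_def)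
  show "open U \<longleftrightarrow> (\<forall>x\<in>U. eventually (\<lambda>(x', y). x' = x \<longrightarrow> y \<in> U) uniformity)" for U :: "l2 set"
    by (simp add: open_l2_def)
  show "x \<bullet> y = y \<bullet> x" unfolding inner_l2_def by (subst L2_inner_commute) simp
  show "(x + y) \<bullet> z = x \<bullet> z + y \<bullet> z" using f g h by (simp add: cls_add inner_cls L2_add L2_inner_add_left)
  show "r *\<^sub>R x \<bullet> y = r * (x \<bullet> y)" using f g by (simp add: cls_scaleR inner_cls L2_cmult L2_inner_cmult_left)
  show "0 \<le> x \<bullet> x" unfolding inner_l2_def L2_inner_self by simp
  show "x \<bullet> x = 0 \<longleftrightarrow> x = 0"
    using f by (simp add: inner_cls L2_inner_self L2_norm_eq_0 cls_0[symmetric] cls_eq_iff L2_zero)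
  show "norm x = sqrt (x \<bullet> x)" unfolding inner_l2_def norm_l2_def L2_inner_self by (simp add: L2_norm_nonneg)
qed

end

section \<open>Completeness\<close>

lemma norm_cls: "f \<in> L2 \<Longrightarrow> norm (cls f) = L2_norm f"
  by (simp add: norm_eq_sqrt_inner inner_cls L2_inner_self L2_norm_nonneg)

lemma nn_integral_L2: "f \<in> L2 \<Longrightarrow> (\<integral>\<^sup>+x. ennreal ((norm (f x))\<^sup>2) \<partial>lebesgue) = ennreal ((L2_norm f)\<^sup>2)"
  unfolding L2_norm_square by (intro nn_integral_eq_integral L2_integrable) auto

lemma L2_if_nn_integral_le:
  fixes f :: "R3 \<Rightarrow> complex"
  assumes [measurable]: "f \<in> borel_measurable lebesgue"
    and le: "(\<integral>\<^sup>+x. ennreal ((norm (f x))\<^sup>2) \<partial>lebesgue) \<le> ennreal (c\<^sup>2)" and c: "0 \<le> c"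
  shows "f \<in> L2" "L2_norm f \<le> c"
proof -
  have "integrable lebesgue (\<lambda>x. (norm (f x))\<^sup>2)"
  proof (rule integrableI_bounded)
    show "(\<integral>\<^sup>+x. ennreal (norm ((norm (f x))\<^sup>2)) \<partial>lebesgue) < \<infinity>"
      using le by (simp add: le_less_trans)
  qed measurable
  then show f: "f \<in> L2" by (simp add: L2_iff)
  have "(L2_norm f)\<^sup>2 \<le> c\<^sup>2" using le nn_integral_L2[OF f] by simp
  then show "L2_norm f \<le> c" using c power2_le_imp_le by blast
qed

text \<open>Weighted by \<open>2^k\<close>, the squared increments have a summable sequence of
  integrals, hence a finite sum almost everywhere. AM-GM bounds an increment \<open>a\<close> by
  \<open>(1/2)^k + 2^k * a^2\<close>, so the increments are absolutely summable there.\<close>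

lemma l2_fast_Cauchy_limit:
  fixes F :: "nat \<Rightarrow> R3 \<Rightarrow> complex"
  assumes F: "\<And>k. F k \<in> L2" and d: "\<And>k. L2_norm (\<lambda>x. F (Suc k) x - F k x) \<le> (1/2) ^ k"
  shows "AE x in lebesgue. convergent (\<lambda>k. F k x)"
proof -
  have [measurable]: "F k \<in> borel_measurable lebesgue" for k by (rule L2_measurable[OF F])
  have "(\<integral>\<^sup>+x. (\<Sum>k. ennreal (2 ^ k * (cmod (F (Suc k) x - F k x))\<^sup>2)) \<partial>lebesgue)
      = (\<Sum>k. \<integral>\<^sup>+x. ennreal (2 ^ k * (cmod (F (Suc k) x - F k x))\<^sup>2) \<partial>lebesgue)"
    by (rule nn_integral_suminf) measurable
  also have "\<dots> \<le> (\<Sum>k. ennreal ((1/2) ^ k))"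
  proof (rule suminf_le)
    fix k
    have "(\<integral>\<^sup>+x. ennreal (2 ^ k * (cmod (F (Suc k) x - F k x))\<^sup>2) \<partial>lebesgue)
        = (\<integral>\<^sup>+x. ennreal (2 ^ k) * ennreal ((cmod (F (Suc k) x - F k x))\<^sup>2) \<partial>lebesgue)"
      by (simp add: ennreal_mult')
    also have "\<dots> = ennreal (2 ^ k) * (\<integral>\<^sup>+x. ennreal ((cmod (F (Suc k) x - F k x))\<^sup>2) \<partial>lebesgue)"
      by (rule nn_integral_cmult) measurable
    also have "(\<integral>\<^sup>+x. ennreal ((cmod (F (Suc k) x - F k x))\<^sup>2) \<partial>lebesgue) = ennreal ((L2_norm (\<lambda>x. F (Suc k) x - F k x))\<^sup>2)"
      by (rule nn_integral_L2[OF L2_diff[OF F F]])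
    also have "ennreal (2 ^ k) * \<dots> = ennreal (2 ^ k * (L2_norm (\<lambda>x. F (Suc k) x - F k x))\<^sup>2)"
      by (rule ennreal_mult'[symmetric]) simp
    also have "\<dots> \<le> ennreal ((1/2) ^ k)"
    proof (rule ennreal_leI)
      have "(L2_norm (\<lambda>x. F (Suc k) x - F k x))\<^sup>2 \<le> ((1/2) ^ k)\<^sup>2"
        by (intro power_mono d L2_norm_nonneg)
      then have "2 ^ k * (L2_norm (\<lambda>x. F (Suc k) x - F k x))\<^sup>2 \<le> 2 ^ k * ((1/2) ^ k)\<^sup>2"
        by (intro mult_left_mono) auto
      also have "\<dots> = (1/2) ^ k" by (simp add: power2_eq_square power_divide)
      finally show "2 ^ k * (L2_norm (\<lambda>x. F (Suc k) x - F k x))\<^sup>2 \<le> (1/2) ^ k" .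
    qed
    finally show "(\<integral>\<^sup>+x. ennreal (2 ^ k * (cmod (F (Suc k) x - F k x))\<^sup>2) \<partial>lebesgue) \<le> ennreal ((1/2) ^ k)" .
  qed auto
  also have "\<dots> < \<infinity>"
    by (subst suminf_ennreal2) auto
  finally have fin: "(\<integral>\<^sup>+x. (\<Sum>k. ennreal (2 ^ k * (cmod (F (Suc k) x - F k x))\<^sup>2)) \<partial>lebesgue) \<noteq> \<infinity>" by simp
  have "AE x in lebesgue. (\<Sum>k. ennreal (2 ^ k * (cmod (F (Suc k) x - F k x))\<^sup>2)) \<noteq> \<infinity>"
    by (rule nn_integral_PInf_AE[OF _ fin]) measurable
  then show ?thesis
  proof eventually_elim
    case (elim x)
    let ?a = "\<lambda>k. cmod (F (Suc k) x - F k x)"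
    have "summable (\<lambda>k. 2 ^ k * (?a k)\<^sup>2)"
      by (rule summable_suminf_not_top) (use elim in auto)
    then have s: "summable (\<lambda>k. (1/2) ^ k + 2 ^ k * (?a k)\<^sup>2)" by (intro summable_add) (auto intro: summable_geometric)
    have le: "?a k \<le> (1/2) ^ k + 2 ^ k * (?a k)\<^sup>2" for k
    proof -
      have p: "(2::real) ^ k > 0" by simp
      have "2 * (2 ^ k * ?a k) * 1 \<le> (2 ^ k * ?a k)\<^sup>2 + 1\<^sup>2" by (rule sum_squares_bound)
      moreover have "0 \<le> 2 ^ k * ?a k" by simp
      ultimately have "2 ^ k * ?a k \<le> (2 ^ k * ?a k)\<^sup>2 + 1\<^sup>2" by linarith
      then have "2 ^ k * ?a k \<le> 1 + (2 ^ k)\<^sup>2 * (?a k)\<^sup>2" by (simp add: power_mult_distrib add.commute)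
      also have "\<dots> = 2 ^ k * ((1/2) ^ k + 2 ^ k * (?a k)\<^sup>2)"
        by (simp add: power2_eq_square distrib_left power_divide)
      finally show ?thesis using p by simp
    qed
    have "summable (\<lambda>k. F (Suc k) x - F k x)"
      by (rule summable_comparison_test'[OF s]) (use le in auto)
    then have "convergent (\<lambda>n. \<Sum>k<n. F (Suc k) x - F k x)" by (simp add: summable_iff_convergent)
    then have "convergent (\<lambda>n. F n x - F 0 x)"
      unfolding sum_lessThan_telescope[of "\<lambda>k. F k x"] .
    then have "convergent (\<lambda>n. F n x - F 0 x + F 0 x)" by (intro convergent_add convergent_const)
    then show ?case by simp
  qed
qed

text \<open>The Riesz-Fischer argument: a rapidly Cauchy subsequence converges almost everywhere,
  and Fatou's lemma identifies its pointwise limit as the limit of the whole sequence in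
  norm.\<close>

instance l2 :: complete_space
proof
  fix X :: "nat \<Rightarrow> l2" assume X: "Cauchy X"
  have "\<exists>N. \<forall>m\<ge>N. \<forall>n\<ge>N. dist (X m) (X n) < (1/2) ^ k" for k
    using X by (intro metric_CauchyD) auto
  then obtain N where N: "\<And>k m n. m \<ge> N k \<Longrightarrow> n \<ge> N k \<Longrightarrow> dist (X m) (X n) < (1/2) ^ k" by metis
  \<comment> \<open>The sum dominates each of its terms, so \<open>r m\<close> is beyond
    \<open>N k\<close> for every \<open>k \<le> m\<close>.\<close>
  define r where "r k = (\<Sum>i\<le>k. N i)" for k
  have rN: "N k \<le> r m" if "k \<le> m" for k m
    unfolding r_def using that by (intro member_le_sum) auto
  define F where "F k = rep (X (r k))" for k
  have F: "F k \<in> L2" for k unfolding F_def by (rule rep_L2)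
  have [measurable]: "F k \<in> borel_measurable lebesgue" for k by (rule L2_measurable[OF F])
  have FX: "L2_norm (\<lambda>x. F m x - rep (X n) x) = dist (X (r m)) (X n)" for m n
    unfolding dist_norm F_def minus_l2_def by (rule norm_cls[OF L2_diff[OF rep_L2 rep_L2], symmetric])
  have conv: "AE x in lebesgue. convergent (\<lambda>k. F k x)"
  proof (rule l2_fast_Cauchy_limit[OF F])
    fix k
    have "L2_norm (\<lambda>x. F (Suc k) x - F k x) = dist (X (r (Suc k))) (X (r k))"
      using FX[of "Suc k" "r k"] by (simp add: F_def)
    also have "\<dots> < (1/2) ^ k" by (intro N rN) auto
    finally show "L2_norm (\<lambda>x. F (Suc k) x - F k x) \<le> (1/2) ^ k" by simp
  qed
  define f where "f x = lim (\<lambda>k. F k x)" for x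
  have [measurable]: "f \<in> borel_measurable lebesgue" unfolding f_def by measurable
  have close: "(\<lambda>x. f x - rep (X n) x) \<in> L2 \<and> L2_norm (\<lambda>x. f x - rep (X n) x) \<le> (1/2) ^ k" if n: "n \<ge> N k" for n k
  proof -
    have [measurable]: "rep (X n) \<in> borel_measurable lebesgue" by (rule L2_measurable[OF rep_L2])
    have "(\<integral>\<^sup>+x. ennreal ((cmod (f x - rep (X n) x))\<^sup>2) \<partial>lebesgue)
        = (\<integral>\<^sup>+x. liminf (\<lambda>m. ennreal ((cmod (F m x - rep (X n) x))\<^sup>2)) \<partial>lebesgue)"
    proof (rule nn_integral_cong_AE)
      show "AE x in lebesgue. ennreal ((cmod (f x - rep (X n) x))\<^sup>2) = liminf (\<lambda>m. ennreal ((cmod (F m x - rep (X n) x))\<^sup>2))"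
        using conv
      proof eventually_elim
        case (elim x)
        then have "(\<lambda>k. F k x) \<longlonglongrightarrow> f x" unfolding f_def by (simp add: convergent_LIMSEQ_iff)
        then have "(\<lambda>m. ennreal ((cmod (F m x - rep (X n) x))\<^sup>2)) \<longlonglongrightarrow> ennreal ((cmod (f x - rep (X n) x))\<^sup>2)"
          by (intro tendsto_intros tendsto_ennrealI)
        then show ?case by (intro lim_imp_Liminf[symmetric]) auto
      qed
    qed
    also have "\<dots> \<le> liminf (\<lambda>m. \<integral>\<^sup>+x. ennreal ((cmod (F m x - rep (X n) x))\<^sup>2) \<partial>lebesgue)"
      by (rule nn_integral_liminf) measurable
    also have "\<dots> = liminf (\<lambda>m. ennreal ((dist (X (r m)) (X n))\<^sup>2))"
      unfolding nn_integral_L2[OF L2_diff[OF F rep_L2]] FX ..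
    also have "\<dots> \<le> liminf (\<lambda>m::nat. ennreal (((1/2) ^ k)\<^sup>2))"
    proof (rule Liminf_mono)
      show "\<forall>\<^sub>F m in sequentially. ennreal ((dist (X (r m)) (X n))\<^sup>2) \<le> ennreal (((1/2) ^ k)\<^sup>2)"
      proof (rule eventually_sequentiallyI[of k])
        fix m assume "k \<le> m"
        then have "dist (X (r m)) (X n) < (1/2) ^ k" by (intro N rN n)
        then show "ennreal ((dist (X (r m)) (X n))\<^sup>2) \<le> ennreal (((1/2) ^ k)\<^sup>2)"
          by (intro ennreal_leI power_mono) auto
      qed
    qed
    also have "\<dots> = ennreal (((1/2) ^ k)\<^sup>2)" by (simp add: Liminf_const)
    finally have le: "(\<integral>\<^sup>+x. ennreal ((cmod (f x - rep (X n) x))\<^sup>2) \<partial>lebesgue) \<le> ennreal (((1/2) ^ k)\<^sup>2)" .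
    show ?thesis
      using L2_if_nn_integral_le[of "\<lambda>x. f x - rep (X n) x", OF _ le] by simp
  qed
  have f: "f \<in> L2"
    using L2_add[OF _ rep_L2, of "\<lambda>x. f x - rep (X (N 0)) x" "X (N 0)"] close[of 0 "N 0"] by simp
  have "X \<longlonglongrightarrow> cls f"
  proof (rule metric_LIMSEQ_I)
    fix e :: real assume "e > 0"
    then obtain k where k: "(1/2) ^ k < e" using real_arch_pow_inv[of e "1/2"] by auto
    show "\<exists>no. \<forall>n\<ge>no. dist (X n) (cls f) < e"
    proof (intro exI allI impI)
      fix n assume n: "n \<ge> N k"
      have "dist (cls f) (X n) = norm (cls f - cls (rep (X n)))" by (simp add: dist_norm)
      also have "\<dots> = L2_norm (\<lambda>x. f x - rep (X n) x)"
        by (simp add: cls_diff[OF f rep_L2] norm_cls[OF L2_diff[OF f rep_L2]] del: cls_rep)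
      also have "\<dots> \<le> (1/2) ^ k" using close[OF n] by simp
      finally show "dist (X n) (cls f) < e" using k by (simp add: dist_commute)
    qed
  qed
  then show "convergent X" by (auto simp: convergent_def)
qed

section \<open>Multiplication by the imaginary unit\<close>

definition l2_J :: "l2 \<Rightarrow> l2" where
  "l2_J x = cls (\<lambda>t. \<i> * rep x t)"

lemma l2_J_cls: "f \<in> L2 \<Longrightarrow> l2_J (cls f) = cls (\<lambda>t. \<i> * f t)"
  unfolding l2_J_def by (rule cls_eqI) (use AE_rep_cls[of f] in auto)

lemma l2_J_linear: "linear l2_J"
proof (rule linearI)
  fix x y :: l2 and c :: real
  obtain f where f: "f \<in> L2" "x = cls f" by (rule l2_cases)
  obtain g where g: "g \<in> L2" "y = cls g" by (rule l2_cases)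
  show "l2_J (x + y) = l2_J x + l2_J y"
    using f g by (simp add: cls_add l2_J_cls L2_add L2_cmult distrib_left)
  show "l2_J (c *\<^sub>R x) = c *\<^sub>R l2_J x"
    using f by (simp add: cls_scaleR l2_J_cls L2_cmult mult.left_commute)
qed

lemma l2_J_J [simp]: "l2_J (l2_J x) = - x"
  by (cases x) (simp add: l2_J_cls L2_cmult cls_uminus mult.assoc[symmetric])

lemma l2_J_inner [simp]: "l2_J x \<bullet> l2_J y = x \<bullet> y"
  by (cases x, cases y) (simp add: l2_J_cls inner_cls L2_cmult L2_inner_cmult_left L2_inner_cmult_right)

lemma l2_J_inner_left: "l2_J x \<bullet> y = - (x \<bullet> l2_J y)"
  using l2_J_inner[of x "l2_J y"] by simp

text \<open>\<open>L2_inner\<close> is conjugate linear in its first argument, so putting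
  \<open>\<i>\<close> there multiplies it by \<open>- \<i>\<close> and moves the imaginary part into
  the real part.\<close>

lemma L2_inner_eq:
  assumes "f \<in> L2" "g \<in> L2"
  shows "L2_inner f g = of_real (cls f \<bullet> cls g) + \<i> * of_real (l2_J (cls f) \<bullet> cls g)"
  using assms by (simp add: l2_J_cls inner_cls L2_cmult L2_inner_cmult_left complex_eq_iff)

section \<open>Weak derivatives of classes\<close>

lemma test_function_L2:
  assumes "\<phi> \<in> test_functions"
  shows "(\<lambda>x. complex_of_real (\<phi> x)) \<in> L2"
proof -
  have m: "\<phi> \<in> borel_measurable lborel" using test_function_measurable[OF assms] by simp
  have ml: "\<phi> \<in> borel_measurable lebesgue" by (rule measurable_completion[OF m])
  have "integrable lebesgue (\<lambda>x. (\<phi> x)\<^sup>2) \<longleftrightarrow> integrable lborel (\<lambda>x. (\<phi> x)\<^sup>2)"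
    by (rule integrable_completion) (rule borel_measurable_power[OF m])
  moreover have "(\<lambda>x. complex_of_real (\<phi> x)) \<in> borel_measurable lebesgue"
    by (rule measurable_compose[OF ml borel_measurable_of_real])
  ultimately show ?thesis unfolding L2_iff norm_of_real power2_abs using test_function_square_integrable[OF assms] by blast
qed

abbreviation tcls :: "(R3 \<Rightarrow> real) \<Rightarrow> l2" where
  "tcls \<phi> \<equiv> cls (\<lambda>x. of_real (\<phi> x))"

lemma L2_inner_test: "L2_inner (\<lambda>x. of_real (\<phi> x)) f = (\<integral>x. f x * of_real (\<phi> x) \<partial>lebesgue)"
  by (simp add: L2_inner_def mult.commute)

text \<open>The real and imaginary parts of the integration by parts formula in
  \<open>is_weak_grad\<close>. Written with inner products, both sides are continuous in
  \<open>u\<close> and \<open>g\<close>, which makes the relation closed.\<close>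

definition weak_partial :: "3 \<Rightarrow> l2 \<Rightarrow> l2 \<Rightarrow> bool" where
  "weak_partial i u g \<longleftrightarrow> (\<forall>\<phi>\<in>test_functions.
     tcls (partial_deriv i \<phi>) \<bullet> u = - (tcls \<phi> \<bullet> g) \<and>
     l2_J (tcls (partial_deriv i \<phi>)) \<bullet> u = - (l2_J (tcls \<phi>) \<bullet> g))"

lemma weak_partial_cls:
  assumes "u \<in> L2" "g \<in> L2"
  shows "weak_partial i (cls u) (cls g) \<longleftrightarrow> (\<forall>\<phi>\<in>test_functions.
    (\<integral>x. u x * of_real (partial_deriv i \<phi> x) \<partial>lebesgue) = - (\<integral>x. g x * of_real (\<phi> x) \<partial>lebesgue))"
  unfolding weak_partial_def
proof (rule ball_cong[OF refl])
  fix \<phi> assume \<phi>: "\<phi> \<in> test_functions"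
  note L = test_function_L2[OF \<phi>] test_function_L2[OF partial_deriv_test_function[OF \<phi>, of i]]
  show "(tcls (partial_deriv i \<phi>) \<bullet> cls u = - (tcls \<phi> \<bullet> cls g) \<and>
     l2_J (tcls (partial_deriv i \<phi>)) \<bullet> cls u = - (l2_J (tcls \<phi>) \<bullet> cls g)) \<longleftrightarrow>
     (\<integral>x. u x * of_real (partial_deriv i \<phi> x) \<partial>lebesgue) = - (\<integral>x. g x * of_real (\<phi> x) \<partial>lebesgue)"
    unfolding L2_inner_test[symmetric] L2_inner_eq[OF L(2) assms(1)] L2_inner_eq[OF L(1) assms(2)]
    by (simp add: complex_eq_iff)
qed

lemma weak_partial_add: "weak_partial i u g \<Longrightarrow> weak_partial i u' g' \<Longrightarrow> weak_partial i (u + u') (g + g')"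
  by (auto simp: weak_partial_def inner_right_distrib)

lemma weak_partial_scale: "weak_partial i u g \<Longrightarrow> weak_partial i (c *\<^sub>R u) (c *\<^sub>R g)"
  by (auto simp: weak_partial_def)

lemma l2_J_inner_right: "x \<bullet> l2_J y = - (l2_J x \<bullet> y)"
  by (simp add: l2_J_inner_left)

lemma weak_partial_J: "weak_partial i u g \<Longrightarrow> weak_partial i (l2_J u) (l2_J g)"
  by (simp add: weak_partial_def l2_J_inner_right)

lemma weak_partial_closed:
  assumes w: "\<And>n. weak_partial i (U n) (G n)" and "U \<longlonglongrightarrow> u" "G \<longlonglongrightarrow> g"
  shows "weak_partial i u g"
proof -
  have lim: "x \<bullet> u = - (y \<bullet> g)" if "\<And>n. x \<bullet> U n = - (y \<bullet> G n)" for x y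
  proof (rule LIMSEQ_unique)
    show "(\<lambda>n. x \<bullet> U n) \<longlonglongrightarrow> x \<bullet> u" by (intro tendsto_intros assms)
    show "(\<lambda>n. x \<bullet> U n) \<longlonglongrightarrow> - (y \<bullet> g)" unfolding that by (intro tendsto_intros assms)
  qed
  show ?thesis unfolding weak_partial_def
    by (intro ballI conjI lim) (use w in \<open>auto simp: weak_partial_def\<close>)
qed

lemma weak_partial_unique:
  assumes g: "weak_partial i u g" and g': "weak_partial i u g'"
  shows "g = g'"
proof -
  define d where "d = g - g'"
  have "AE x in lborel. rep d x = 0"
  proof (rule zero_if_orthogonal_to_tests)
    show "integrable lborel (\<lambda>x. (cmod (rep d x))\<^sup>2)"
      using L2_integrable[OF rep_L2[of d]] by (subst (asm) integrable_completion) auto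
    fix \<phi> assume \<phi>: "\<phi> \<in> test_functions"
    have [measurable]: "\<phi> \<in> borel_measurable borel" by (rule test_function_measurable[OF \<phi>])
    have "tcls \<phi> \<bullet> d = 0" "l2_J (tcls \<phi>) \<bullet> d = 0"
      using g g' \<phi> by (auto simp: weak_partial_def d_def inner_diff_right)
    then have "L2_inner (\<lambda>x. of_real (\<phi> x)) (rep d) = 0"
      by (simp add: L2_inner_eq[OF test_function_L2[OF \<phi>] rep_L2])
    then have "(\<integral>x. rep d x * of_real (\<phi> x) \<partial>lebesgue) = 0" by (simp add: L2_inner_test)
    then show "(\<integral>x. rep d x * of_real (\<phi> x) \<partial>lborel) = 0"
      by (subst (asm) integral_completion) auto
  qed simp
  then have "cls (rep d) = cls (\<lambda>x. 0)" by (intro cls_eqI AE_completion)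
  then show ?thesis by (simp add: cls_0 d_def)
qed

definition h1 :: "l2 set" where
  "h1 = {u. \<forall>i. \<exists>g. weak_partial i u g}"

definition wderiv :: "3 \<Rightarrow> l2 \<Rightarrow> l2" where
  "wderiv i u = (THE g. weak_partial i u g)"

lemma wderiv_eqI: "weak_partial i u g \<Longrightarrow> wderiv i u = g"
  unfolding wderiv_def by (rule the_equality) (auto intro: weak_partial_unique)

lemma weak_partial_wderiv: "u \<in> h1 \<Longrightarrow> weak_partial i u (wderiv i u)"
proof -
  assume "u \<in> h1"
  then obtain g where "weak_partial i u g" by (auto simp: h1_def)
  with wderiv_eqI[OF this] show ?thesis by simp
qed

lemma h1I: "(\<And>i. weak_partial i u (g i)) \<Longrightarrow> u \<in> h1"
  by (auto simp: h1_def)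

lemma h1_add: "u \<in> h1 \<Longrightarrow> v \<in> h1 \<Longrightarrow> u + v \<in> h1"
  by (rule h1I) (rule weak_partial_add[OF weak_partial_wderiv weak_partial_wderiv])

lemma wderiv_add: "u \<in> h1 \<Longrightarrow> v \<in> h1 \<Longrightarrow> wderiv i (u + v) = wderiv i u + wderiv i v"
  by (rule wderiv_eqI) (rule weak_partial_add[OF weak_partial_wderiv weak_partial_wderiv])

lemma h1_scale: "u \<in> h1 \<Longrightarrow> c *\<^sub>R u \<in> h1"
  by (rule h1I) (rule weak_partial_scale[OF weak_partial_wderiv])

lemma wderiv_scale: "u \<in> h1 \<Longrightarrow> wderiv i (c *\<^sub>R u) = c *\<^sub>R wderiv i u"
  by (rule wderiv_eqI) (rule weak_partial_scale[OF weak_partial_wderiv])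

lemma h1_J: "u \<in> h1 \<Longrightarrow> l2_J u \<in> h1"
  by (rule h1I) (rule weak_partial_J[OF weak_partial_wderiv])

lemma wderiv_J: "u \<in> h1 \<Longrightarrow> wderiv i (l2_J u) = l2_J (wderiv i u)"
  by (rule wderiv_eqI) (rule weak_partial_J[OF weak_partial_wderiv])

lemma h1_0: "0 \<in> h1"
  by (rule h1I[of _ "\<lambda>i. 0"]) (simp add: weak_partial_def)

lemma wderiv_diff: "u \<in> h1 \<Longrightarrow> v \<in> h1 \<Longrightarrow> wderiv i (u - v) = wderiv i u - wderiv i v"
  using wderiv_add[of u "- 1 *\<^sub>R v"] h1_scale[of v "- 1"] wderiv_scale[of v i "- 1"] by simp

section \<open>Comparison with \<open>H1\<close>, \<open>weak_grad\<close> and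
  \<open>dirichlet\<close>\<close>

lemma vec_nth_measurable: "G \<in> borel_measurable M \<Longrightarrow> (\<lambda>x. (G x :: complex ^ 3) $ i) \<in> borel_measurable M"
  by (rule measurable_compose[OF _ borel_measurable_continuous_onI[OF linear_continuous_on[OF bounded_linear_vec_nth]]])

lemma vec_component_L2:
  fixes G :: "R3 \<Rightarrow> complex ^ 3"
  assumes "G \<in> L2"
  shows "(\<lambda>x. G x $ i) \<in> L2"
proof (rule L2_dominated[OF assms])
  show "(\<lambda>x. G x $ i) \<in> borel_measurable lebesgue" by (rule vec_nth_measurable[OF L2_measurable[OF assms]])
  show "AE x in lebesgue. norm (G x $ i) \<le> 1 * norm (G x)" by (simp add: Finite_Cartesian_Product.norm_nth_le)
qed

lemma norm_vec_square: "(norm (z :: complex ^ 3))\<^sup>2 = (\<Sum>i\<in>UNIV. (cmod (z $ i))\<^sup>2)"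
  by (simp add: norm_vec_def L2_set_def sum_nonneg)

lemma vec_measurable:
  fixes G :: "'a \<Rightarrow> complex ^ 3"
  assumes [measurable]: "\<And>i. (\<lambda>x. G x $ i) \<in> borel_measurable M"
  shows "G \<in> borel_measurable M"
proof -
  have "(\<lambda>x. G x \<bullet> b) \<in> borel_measurable M" if bB: "b \<in> Basis" for b
  proof -
    obtain i c where b: "b = axis i c" using bB by (auto simp: Basis_vec_def)
    show ?thesis unfolding b inner_axis by measurable
  qed
  then show ?thesis by (simp add: borel_measurable_euclidean_space[of G])
qed

lemma vec_L2I:
  fixes G :: "R3 \<Rightarrow> complex ^ 3"
  assumes G: "\<And>i. (\<lambda>x. G x $ i) \<in> L2"
  shows "G \<in> L2"
proof -
  have "G \<in> borel_measurable lebesgue" by (rule vec_measurable) (rule L2_measurable[OF G])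
  moreover have "integrable lebesgue (\<lambda>x. (norm (G x))\<^sup>2)"
    unfolding norm_vec_square using L2_integrable[OF G] by simp
  ultimately show ?thesis by (simp add: L2_iff)
qed

lemma is_weak_grad_iff:
  assumes "u \<in> L2" "G \<in> L2"
  shows "is_weak_grad u G \<longleftrightarrow> (\<forall>i. weak_partial i (cls u) (cls (\<lambda>x. G x $ i)))"
  unfolding is_weak_grad_def weak_partial_cls[OF assms(1) vec_component_L2[OF assms(2)]] by blast

lemma H1_iff: "u \<in> H1 \<longleftrightarrow> u \<in> L2 \<and> cls u \<in> h1"
proof
  assume "u \<in> H1"
  then obtain G where "u \<in> L2" "G \<in> L2" "is_weak_grad u G" by (auto simp: H1_def)
  moreover from this have "\<And>i. weak_partial i (cls u) (cls (\<lambda>x. G x $ i))" by (simp add: is_weak_grad_iff)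
  ultimately show "u \<in> L2 \<and> cls u \<in> h1" using h1I[of "cls u" "\<lambda>i. cls (\<lambda>x. G x $ i)"] by blast
next
  assume u: "u \<in> L2 \<and> cls u \<in> h1"
  let ?G = "\<lambda>x. \<chi> i. rep (wderiv i (cls u)) x"
  have G: "?G \<in> L2" by (rule vec_L2I) (simp only: vec_lambda_beta rep_L2)
  have "is_weak_grad u ?G" unfolding is_weak_grad_iff[OF conjunct1[OF u] G] vec_lambda_beta cls_rep
    using weak_partial_wderiv[OF conjunct2[OF u]] by blast
  then show "u \<in> H1" unfolding H1_def using u G by blast
qed

lemma weak_grad:
  assumes "u \<in> H1"
  shows "weak_grad u \<in> L2" "is_weak_grad u (weak_grad u)"
proof -
  have "\<exists>G. G \<in> L2 \<and> is_weak_grad u G" using assms by (auto simp: H1_def)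
  from someI_ex[OF this] show "weak_grad u \<in> L2" "is_weak_grad u (weak_grad u)"
    unfolding weak_grad_def by auto
qed

lemma cls_weak_grad:
  assumes "u \<in> H1"
  shows "cls (\<lambda>x. weak_grad u x $ i) = wderiv i (cls u)"
  using weak_grad[OF assms] assms by (intro wderiv_eqI[symmetric]) (simp add: H1_iff is_weak_grad_iff)

lemma dirichlet_eq:
  assumes "u \<in> H1"
  shows "dirichlet u = (\<Sum>i\<in>UNIV. (norm (wderiv i (cls u)))\<^sup>2)"
proof -
  have G: "(\<lambda>x. weak_grad u x $ i) \<in> L2" for i by (rule vec_component_L2[OF weak_grad(1)[OF assms]])
  have "dirichlet u = (\<Sum>i\<in>UNIV. \<integral>x. (cmod (weak_grad u x $ i))\<^sup>2 \<partial>lebesgue)"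
    unfolding dirichlet_def norm_vec_square by (rule Bochner_Integration.integral_sum) (rule L2_integrable[OF G])
  also have "\<dots> = (\<Sum>i\<in>UNIV. (norm (wderiv i (cls u)))\<^sup>2)"
    unfolding cls_weak_grad[OF assms, symmetric] norm_cls[OF G] L2_norm_square ..
  finally show ?thesis .
qed

section \<open>Multiplication operators on their maximal domains\<close>

definition mdom :: "(R3 \<Rightarrow> real) \<Rightarrow> l2 set" where
  "mdom m = {u. (\<lambda>x. of_real (m x) * rep u x) \<in> L2}"

text \<open>To be applied with the square roots of the positive and negative parts of
  \<open>V\<close>, for which potential energies become squared norms of images. Outside
  \<open>mdom m\<close> the value is the class of a function that is not square integrable.\<close>

definition mop :: "(R3 \<Rightarrow> real) \<Rightarrow> l2 \<Rightarrow> l2" where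
  "mop m u = cls (\<lambda>x. of_real (m x) * rep u x)"

lemma mop_cls: "f \<in> L2 \<Longrightarrow> mop m (cls f) = cls (\<lambda>x. of_real (m x) * f x)"
  unfolding mop_def by (rule cls_eqI) (use AE_rep_cls[of f] in auto)

context
  fixes m :: "R3 \<Rightarrow> real"
  assumes m [measurable]: "m \<in> borel_measurable lebesgue"
begin

lemma mdom_cls:
  assumes f: "f \<in> L2"
  shows "cls f \<in> mdom m \<longleftrightarrow> (\<lambda>x. of_real (m x) * f x) \<in> L2"
proof -
  have [measurable]: "f \<in> borel_measurable lebesgue" "rep (cls f) \<in> borel_measurable lebesgue"
    using f rep_L2 L2_measurable by auto
  have m1: "(\<lambda>x. of_real (m x) * f x) \<in> borel_measurable lebesgue"
    "(\<lambda>x. of_real (m x) * rep (cls f) x) \<in> borel_measurable lebesgue" by measurable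
  have ae: "AE x in lebesgue. of_real (m x) * f x = of_real (m x) * rep (cls f) x"
    "AE x in lebesgue. of_real (m x) * rep (cls f) x = of_real (m x) * f x"
    using AE_rep_cls[OF f] by (auto elim: eventually_mono)
  show ?thesis unfolding mdom_def using L2_cong_AE[OF _ m1(1) ae(2)] L2_cong_AE[OF _ m1(2) ae(1)] by blast
qed

lemma mdom_add: "u \<in> mdom m \<Longrightarrow> v \<in> mdom m \<Longrightarrow> u + v \<in> mdom m"
  by (cases u, cases v) (simp add: cls_add mdom_cls L2_add distrib_left)

lemma mop_add: "u \<in> mdom m \<Longrightarrow> v \<in> mdom m \<Longrightarrow> mop m (u + v) = mop m u + mop m v"
  by (cases u, cases v) (simp add: cls_add mdom_cls mop_cls L2_add distrib_left)

lemma mdom_scale: "u \<in> mdom m \<Longrightarrow> r *\<^sub>R u \<in> mdom m"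
  by (cases u) (simp add: cls_scaleR mdom_cls L2_cmult mult.left_commute[of _ "of_real r"])

lemma mop_scale: "u \<in> mdom m \<Longrightarrow> mop m (r *\<^sub>R u) = r *\<^sub>R mop m u"
  by (cases u) (simp add: cls_scaleR mdom_cls mop_cls L2_cmult mult.left_commute[of _ "of_real r"])

lemma mdom_J: "u \<in> mdom m \<Longrightarrow> l2_J u \<in> mdom m"
  by (cases u) (simp add: l2_J_cls mdom_cls L2_cmult mult.left_commute[of _ "\<i>"])

lemma mop_J: "u \<in> mdom m \<Longrightarrow> mop m (l2_J u) = l2_J (mop m u)"
  by (cases u) (simp add: l2_J_cls mdom_cls mop_cls L2_cmult mult.left_commute[of _ "\<i>"])

lemma mdom_0: "0 \<in> mdom m"
  unfolding cls_0[symmetric] by (simp add: mdom_cls L2_zero)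

lemma mop_diff: "u \<in> mdom m \<Longrightarrow> v \<in> mdom m \<Longrightarrow> mop m (u - v) = mop m u - mop m v"
  using mop_add[of u "- 1 *\<^sub>R v"] mdom_scale[of v "- 1"] mop_scale[of v "- 1"] by simp

lemma mop_bounded:
  assumes c: "\<And>x. \<bar>m x\<bar> \<le> c"
  shows "bounded_linear (mop m)" and "mdom m = UNIV"
proof -
  have L: "(\<lambda>x. of_real (m x) * f x) \<in> L2" if f: "f \<in> L2" for f :: "R3 \<Rightarrow> complex"
  proof (rule L2_dominated[OF f])
    have [measurable]: "f \<in> borel_measurable lebesgue" by (rule L2_measurable[OF f])
    show "(\<lambda>x. of_real (m x) * f x) \<in> borel_measurable lebesgue" by measurable
    show "AE x in lebesgue. norm (of_real (m x) * f x) \<le> c * norm (f x)"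
      using c by (auto simp: norm_mult intro!: mult_right_mono)
  qed
  then show dom: "mdom m = UNIV" using rep_L2 by (auto simp: mdom_def)
  show "bounded_linear (mop m)"
  proof (rule bounded_linear_intro)
    show "mop m (u + v) = mop m u + mop m v" "mop m (r *\<^sub>R u) = r *\<^sub>R mop m u" for u v r
      by (rule mop_add mop_scale; simp add: dom)+
    fix u
    have c0: "0 \<le> c" using c[of 0] by simp
    have "(norm (mop m u))\<^sup>2 = (\<integral>x. (norm (of_real (m x) * rep u x))\<^sup>2 \<partial>lebesgue)"
      unfolding mop_def norm_cls[OF L[OF rep_L2]] L2_norm_square ..
    also have "\<dots> \<le> (\<integral>x. c\<^sup>2 * (norm (rep u x))\<^sup>2 \<partial>lebesgue)"
    proof (rule integral_mono)
      show "integrable lebesgue (\<lambda>x. (norm (of_real (m x) * rep u x))\<^sup>2)" by (rule L2_integrable[OF L[OF rep_L2]])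
      show "integrable lebesgue (\<lambda>x. c\<^sup>2 * (norm (rep u x))\<^sup>2)" using L2_integrable[OF rep_L2] by simp
      show "(norm (of_real (m x) * rep u x))\<^sup>2 \<le> c\<^sup>2 * (norm (rep u x))\<^sup>2" for x
        unfolding norm_mult power_mult_distrib norm_of_real using c[of x] by (intro mult_right_mono power_mono) auto
    qed
    also have "\<dots> = (norm u * c)\<^sup>2"
      by (simp add: norm_l2_def L2_norm_square power_mult_distrib mult.commute)
    finally show "norm (mop m u) \<le> norm u * c" by (rule power2_le_imp_le) (simp add: c0)
  qed
qed

end

text \<open>Cutting the multiplier off at height \<open>N\<close> makes both sides continuous.\<close>
lemma mop_closed:
  assumes [measurable]: "m \<in> borel_measurable lebesgue"
    and U: "\<And>n. U n \<in> mdom m" and u: "U \<longlonglongrightarrow> u" and y: "(\<lambda>n. mop m (U n)) \<longlonglongrightarrow> y"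
  shows "u \<in> mdom m \<and> mop m u = y"
proof -
  define c where "c N x = (if \<bar>m x\<bar> \<le> real N then 1 else 0 :: real)" for N x
  have [measurable]: "c N \<in> borel_measurable lebesgue" for N unfolding c_def by measurable
  have cb: "\<bar>c N x\<bar> \<le> 1" "\<bar>c N x * m x\<bar> \<le> real N" for N x by (auto simp: c_def)
  have cm: "(\<lambda>x. c N x * m x) \<in> borel_measurable lebesgue" for N by measurable
  have "mop (c N) y = mop (\<lambda>x. c N x * m x) u" for N
  proof (rule LIMSEQ_unique)
    have "bounded_linear (mop (c N))"
      by (rule mop_bounded(1)[of "c N" 1]) (use cb in auto)
    then show "(\<lambda>n. mop (c N) (mop m (U n))) \<longlonglongrightarrow> mop (c N) y" using y by (rule bounded_linear.tendsto)
    have "bounded_linear (mop (\<lambda>x. c N x * m x))"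
      by (rule mop_bounded(1)[OF cm]) (rule cb)
    moreover have "mop (c N) (mop m (U n)) = mop (\<lambda>x. c N x * m x) (U n)" for n
      using U[of n] mop_cls[of "\<lambda>x. of_real (m x) * rep (U n) x" "c N"]
      by (simp add: mdom_def mop_def mult.assoc)
    ultimately show "(\<lambda>n. mop (c N) (mop m (U n))) \<longlonglongrightarrow> mop (\<lambda>x. c N x * m x) u"
      using u by (simp add: bounded_linear.tendsto)
  qed
  then have "AE x in lebesgue. of_real (c N x) * rep y x = of_real (c N x * m x) * rep u x" for N
  proof -
    have L: "(\<lambda>x. of_real (c N x) * rep y x) \<in> L2" "(\<lambda>x. of_real (c N x * m x) * rep u x) \<in> L2"
      using mop_bounded(2)[of "c N" 1] mop_bounded(2)[OF cm cb(2)] cb by (auto simp: mdom_def)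
    show ?thesis using \<open>mop (c N) y = mop (\<lambda>x. c N x * m x) u\<close> unfolding mop_def cls_eq_iff[OF L] .
  qed
  then have "AE x in lebesgue. \<forall>N. of_real (c N x) * rep y x = of_real (c N x * m x) * rep u x"
    unfolding AE_all_countable by blast
  then have ae: "AE x in lebesgue. rep y x = of_real (m x) * rep u x"
  proof eventually_elim
    case (elim x)
    obtain N where "\<bar>m x\<bar> \<le> real N" using real_arch_simple by blast
    then show ?case using elim[rule_format, of N] by (simp add: c_def)
  qed
  have [measurable]: "rep u \<in> borel_measurable lebesgue" by (rule L2_measurable[OF rep_L2])
  have "(\<lambda>x. of_real (m x) * rep u x) \<in> L2"
    by (rule L2_cong_AE[OF rep_L2 _ ae]) measurable
  moreover have "mop m u = cls (rep y)" unfolding mop_def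
    by (rule cls_eqI) (use ae in eventually_elim, simp)
  ultimately show ?thesis by (simp add: mdom_def)
qed

section \<open>The Schroedinger form\<close>

lemma sqrt_weight_L2:
  fixes f :: "R3 \<Rightarrow> complex"
  assumes [measurable]: "W \<in> borel_measurable lebesgue" "f \<in> borel_measurable lebesgue"
    and W: "\<And>x. 0 \<le> W x"
  shows "(\<lambda>x. of_real (sqrt (W x)) * f x) \<in> L2 \<longleftrightarrow> integrable lebesgue (\<lambda>x. W x * (cmod (f x))\<^sup>2)"
    and "(L2_norm (\<lambda>x. of_real (sqrt (W x)) * f x))\<^sup>2 = (\<integral>x. W x * (cmod (f x))\<^sup>2 \<partial>lebesgue)"
  using W by (simp_all add: L2_iff L2_norm_square norm_mult power_mult_distrib)

definition vpos :: "(R3 \<Rightarrow> real) \<Rightarrow> R3 \<Rightarrow> real" where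
  "vpos V x = sqrt (max (V x) 0)"

definition vneg :: "(R3 \<Rightarrow> real) \<Rightarrow> R3 \<Rightarrow> real" where
  "vneg V x = sqrt (max (- V x) 0)"

text \<open>The real part of \<open>form\<close>, with \<open>V\<close> split as a difference of two
  squares so that every term is an inner product of images under a linear operator. Completeness
  then follows from closedness of these operators.\<close>

definition qform :: "(R3 \<Rightarrow> real) \<Rightarrow> l2 \<Rightarrow> l2 \<Rightarrow> real" where
  "qform V x u = (\<Sum>i\<in>UNIV. wderiv i x \<bullet> wderiv i u) + mop (vpos V) x \<bullet> mop (vpos V) u - mop (vneg V) x \<bullet> mop (vneg V) u"

definition qdom :: "(R3 \<Rightarrow> real) \<Rightarrow> l2 set" where
  "qdom V = h1 \<inter> mdom (vpos V)"

locale relatively_bounded =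
  fixes V :: "R3 \<Rightarrow> real" and a b :: real
  assumes V [measurable]: "V \<in> borel_measurable lebesgue"
    and a: "0 \<le> a" "a < 1"
    and rel: "\<And>u. u \<in> H1 \<Longrightarrow> integrable lebesgue (\<lambda>x. max (- V x) 0 * (cmod (u x))\<^sup>2) \<and>
        (\<integral>x. max (- V x) 0 * (cmod (u x))\<^sup>2 \<partial>lebesgue) \<le> a * dirichlet u + b * (L2_norm u)\<^sup>2"
begin

lemma vpos_measurable [measurable]: "vpos V \<in> borel_measurable lebesgue"
  and vneg_measurable [measurable]: "vneg V \<in> borel_measurable lebesgue"
  unfolding vpos_def vneg_def by measurable

lemma form_domain_iff: "u \<in> form_domain V \<longleftrightarrow> u \<in> L2 \<and> cls u \<in> qdom V"
proof (cases "u \<in> L2")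
  case True
  have m: "u \<in> borel_measurable lebesgue" "(\<lambda>x. max (V x) 0) \<in> borel_measurable lebesgue"
    using L2_measurable[OF True] by auto
  show ?thesis using True sqrt_weight_L2(1)[OF m(2,1)]
    by (simp add: form_domain_def H1_iff qdom_def mdom_cls[OF vpos_measurable] vpos_def)
qed (auto simp: form_domain_def H1_def)

lemma rep_form_domain: "x \<in> qdom V \<Longrightarrow> rep x \<in> form_domain V"
  by (simp add: form_domain_iff rep_L2)

lemma rel_h1:
  assumes "u \<in> h1"
  shows "u \<in> mdom (vneg V)" "(norm (mop (vneg V) u))\<^sup>2 \<le> a * (\<Sum>i\<in>UNIV. (norm (wderiv i u))\<^sup>2) + b * (norm u)\<^sup>2"
proof -
  have H: "rep u \<in> H1" using assms by (simp add: H1_iff rep_L2)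
  have m: "(\<lambda>x. max (- V x) 0) \<in> borel_measurable lebesgue" "rep u \<in> borel_measurable lebesgue"
    using L2_measurable[OF rep_L2] by auto
  note w = sqrt_weight_L2[OF m]
  have L: "(\<lambda>x. of_real (vneg V x) * rep u x) \<in> L2"
    using rel[OF H] w(1) by (simp add: vneg_def)
  then show "u \<in> mdom (vneg V)" by (simp add: mdom_def)
  show "(norm (mop (vneg V) u))\<^sup>2 \<le> a * (\<Sum>i\<in>UNIV. (norm (wderiv i u))\<^sup>2) + b * (norm u)\<^sup>2"
    using rel[OF H] w(2) unfolding mop_def norm_cls[OF L] by (simp add: vneg_def dirichlet_eq[OF H] norm_l2_def)
qed

lemma qdomD: "u \<in> qdom V \<Longrightarrow> u \<in> h1" "u \<in> qdom V \<Longrightarrow> u \<in> mdom (vpos V)" "u \<in> qdom V \<Longrightarrow> u \<in> mdom (vneg V)"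
  using rel_h1 by (auto simp: qdom_def)

text \<open>The negative part of \<open>V\<close> consumes at most the fraction \<open>a\<close> of
  the kinetic energy and a multiple of the squared norm, so the fraction \<open>1 - a\<close> of the
  kinetic energy survives. The other terms are scaled by the same fraction for uniformity.\<close>

lemma qform_lower:
  assumes u: "u \<in> qdom V"
  shows "(1 - a) * ((\<Sum>i\<in>UNIV. (norm (wderiv i u))\<^sup>2) + (norm (mop (vpos V) u))\<^sup>2 + (norm u)\<^sup>2)
    \<le> qform V u u + \<bar>b\<bar> * (norm u)\<^sup>2 + (1 - a) * (norm u)\<^sup>2"
proof -
  have "b * (norm u)\<^sup>2 \<le> \<bar>b\<bar> * (norm u)\<^sup>2" by (intro mult_right_mono) auto
  moreover have "a * (norm (mop (vpos V) u))\<^sup>2 \<ge> 0" using a by simp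
  ultimately show ?thesis
    using rel_h1(2)[OF qdomD(1)[OF u]] by (simp add: qform_def power2_norm_eq_inner[symmetric] algebra_simps)
qed

lemma qform_sym: "qform V x y = qform V y x"
  by (simp add: qform_def inner_commute)

lemma qform_J: "x \<in> qdom V \<Longrightarrow> y \<in> qdom V \<Longrightarrow> qform V (l2_J x) (l2_J y) = qform V x y"
  by (simp add: qform_def wderiv_J mop_J qdomD)

lemma qform_sym_form: "sym_form (qdom V) (qform V)"
proof
  show "subspace (qdom V)"
    unfolding subspace_def qdom_def
    by (auto intro: h1_0 h1_add h1_scale mdom_0 mdom_add mdom_scale)
  fix x y z r assume "x \<in> qdom V" "y \<in> qdom V"
  then show "qform V x (r *\<^sub>R y) = r * qform V x y"
    by (simp add: qform_def wderiv_scale mop_scale qdomD sum_distrib_left algebra_simps)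
  show "qform V x y = qform V y x" by (rule qform_sym)
  assume "z \<in> qdom V"
  with \<open>x \<in> qdom V\<close> \<open>y \<in> qdom V\<close> show "qform V x (y + z) = qform V x y + qform V x z"
    by (simp add: qform_def wderiv_add mop_add qdomD inner_right_distrib sum.distrib)
qed

text \<open>The summand \<open>\<bar>b\<bar>\<close> makes the shifted form nonnegative, and the
  additional 1 makes it dominate the squared norm, as \<open>coercive\<close> in
  \<open>closed_form\<close> requires.\<close>

abbreviation \<kappa> :: real where "\<kappa> \<equiv> \<bar>b\<bar> + 1"

lemma qform_components:
  assumes u: "u \<in> qdom V"
  shows "(1 - a) * (norm (wderiv i u))\<^sup>2 \<le> qform V u u + \<kappa> * (u \<bullet> u)"
    and "(1 - a) * (norm (mop (vpos V) u))\<^sup>2 \<le> qform V u u + \<kappa> * (u \<bullet> u)"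
    and "(1 - a) * (norm u)\<^sup>2 \<le> qform V u u + \<kappa> * (u \<bullet> u)"
    and "u \<bullet> u \<le> qform V u u + \<kappa> * (u \<bullet> u)"
    and "(1 - a) * (\<Sum>i\<in>UNIV. (norm (wderiv i u))\<^sup>2) \<le> qform V u u + \<kappa> * (u \<bullet> u)"
proof -
  have S: "(norm (wderiv i u))\<^sup>2 \<le> (\<Sum>i\<in>UNIV. (norm (wderiv i u))\<^sup>2)" for i
    by (rule member_le_sum) auto
  have S0: "0 \<le> (1 - a) * (\<Sum>i\<in>UNIV. (norm (wderiv i u))\<^sup>2)" using a by (simp add: sum_nonneg)
  have P0: "0 \<le> (1 - a) * (norm (mop (vpos V) u))\<^sup>2" using a by simp
  have n0: "0 \<le> a * (norm u)\<^sup>2" "0 \<le> (1 - a) * (norm u)\<^sup>2" using a by auto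
  have Si: "(1 - a) * (norm (wderiv i u))\<^sup>2 \<le> (1 - a) * (\<Sum>i\<in>UNIV. (norm (wderiv i u))\<^sup>2)"
    using a S by (intro mult_left_mono) auto
  have L: "(1 - a) * (\<Sum>i\<in>UNIV. (norm (wderiv i u))\<^sup>2) + (1 - a) * (norm (mop (vpos V) u))\<^sup>2
      \<le> qform V u u + \<bar>b\<bar> * (norm u)\<^sup>2"
    using qform_lower[OF u] by (simp add: distrib_left)
  have k: "\<kappa> * (u \<bullet> u) = \<bar>b\<bar> * (norm u)\<^sup>2 + (norm u)\<^sup>2" "u \<bullet> u = (norm u)\<^sup>2" "(1 - a) * (norm u)\<^sup>2 = (norm u)\<^sup>2 - a * (norm u)\<^sup>2"
    by (simp_all add: power2_norm_eq_inner algebra_simps)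
  have n1: "0 \<le> (norm u)\<^sup>2" by simp
  show "(1 - a) * (norm (wderiv i u))\<^sup>2 \<le> qform V u u + \<kappa> * (u \<bullet> u)"
    unfolding k(1) using L Si P0 n1 by linarith
  show "(1 - a) * (norm (mop (vpos V) u))\<^sup>2 \<le> qform V u u + \<kappa> * (u \<bullet> u)"
    unfolding k(1) using L S0 n1 by linarith
  show "(1 - a) * (norm u)\<^sup>2 \<le> qform V u u + \<kappa> * (u \<bullet> u)"
    unfolding k(1) using L S0 P0 k(3) n0 by linarith
  show "u \<bullet> u \<le> qform V u u + \<kappa> * (u \<bullet> u)"
    unfolding k(1) using L S0 P0 k(2) n0 by linarith
  show "(1 - a) * (\<Sum>i\<in>UNIV. (norm (wderiv i u))\<^sup>2) \<le> qform V u u + \<kappa> * (u \<bullet> u)"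
    unfolding k(1) using L P0 n1 by linarith
qed

lemma Cauchy_if_dominated:
  fixes Y :: "nat \<Rightarrow> l2"
  assumes c: "c > 0" and le: "\<And>m n. c * (norm (Y m - Y n))\<^sup>2 \<le> t m n"
    and C: "\<And>e::real. e > 0 \<Longrightarrow> \<exists>N. \<forall>m\<ge>N. \<forall>n\<ge>N. t m n < e"
  shows "\<exists>y. Y \<longlonglongrightarrow> y"
proof -
  have "Cauchy Y"
  proof (rule metric_CauchyI)
    fix e :: real assume e: "e > 0"
    then have "c * e\<^sup>2 > 0" using c by simp
    from C[OF this] obtain N where N: "\<And>m n. m \<ge> N \<Longrightarrow> n \<ge> N \<Longrightarrow> t m n < c * e\<^sup>2" by blast
    have "dist (Y m) (Y n) < e" if "m \<ge> N" "n \<ge> N" for m n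
    proof -
      have "c * (norm (Y m - Y n))\<^sup>2 < c * e\<^sup>2" using le[of m n] N[OF that] by linarith
      then have "(norm (Y m - Y n))\<^sup>2 < e\<^sup>2" using c by simp
      then show ?thesis using e power_less_imp_less_base[of "norm (Y m - Y n)" 2 e] by (simp add: dist_norm)
    qed
    then show "\<exists>M. \<forall>m\<ge>M. \<forall>n\<ge>M. dist (Y m) (Y n) < e" by blast
  qed
  then show ?thesis using Cauchy_convergent convergent_def by blast
qed

text \<open>The form norm dominates the weak derivatives, the image under
  \<open>mop (vpos V)\<close> and the vector itself, so all of these converge in norm; closedness of
  weak derivatives and of multiplication identifies their limits.\<close>

lemma qform_complete: "complete_form (qdom V) (\<lambda>x y. qform V x y + \<kappa> * (x \<bullet> y))"
proof -
  interpret q: sym_form "qdom V" "qform V" by (rule qform_sym_form)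
  show ?thesis
  proof
    show "subspace (qdom V)" by (rule q.sub)
    fix x y z r assume xy: "x \<in> qdom V" "y \<in> qdom V"
    then show "qform V x (r *\<^sub>R y) + \<kappa> * (x \<bullet> r *\<^sub>R y) = r * (qform V x y + \<kappa> * (x \<bullet> y))"
      by (simp add: q.scale_right algebra_simps)
    show "qform V x y + \<kappa> * (x \<bullet> y) = qform V y x + \<kappa> * (y \<bullet> x)"
      by (simp add: qform_sym[of x] inner_commute)
    show "0 \<le> qform V x x + \<kappa> * (x \<bullet> x)"
      using qform_components(4)[OF xy(1)] inner_ge_zero[of x] by linarith
    assume "z \<in> qdom V"
    with xy show "qform V x (y + z) + \<kappa> * (x \<bullet> (y + z)) = qform V x y + \<kappa> * (x \<bullet> y) + (qform V x z + \<kappa> * (x \<bullet> z))"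
      by (simp add: q.add_right inner_right_distrib algebra_simps)
  next
    fix X :: "nat \<Rightarrow> l2"
    let ?t = "\<lambda>x. qform V x x + \<kappa> * (x \<bullet> x)"
    assume X: "\<And>n. X n \<in> qdom V"
      and C: "\<And>e. e > 0 \<Longrightarrow> \<exists>N. \<forall>m\<ge>N. \<forall>n\<ge>N. ?t (X m - X n) < e"
    have XX: "X m - X n \<in> qdom V" for m n using X q.sub subspace_diff by blast
    have a1: "1 - a > 0" using a by simp
    have "\<exists>y. (\<lambda>n. wderiv i (X n)) \<longlonglongrightarrow> y" for i
      by (rule Cauchy_if_dominated[OF a1 _ C])
        (use qform_components(1)[OF XX] X in \<open>simp_all add: wderiv_diff qdomD\<close>)
    then obtain g where g: "\<And>i. (\<lambda>n. wderiv i (X n)) \<longlonglongrightarrow> g i" by metis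
    have "\<exists>y. (\<lambda>n. mop (vpos V) (X n)) \<longlonglongrightarrow> y"
      by (rule Cauchy_if_dominated[OF a1 _ C])
        (use qform_components(2)[OF XX] X in \<open>simp_all add: mop_diff qdomD\<close>)
    then obtain p where p: "(\<lambda>n. mop (vpos V) (X n)) \<longlonglongrightarrow> p" by blast
    have "\<exists>y. X \<longlonglongrightarrow> y"
      by (rule Cauchy_if_dominated[OF a1 _ C]) (rule qform_components(3)[OF XX])
    then obtain x where x: "X \<longlonglongrightarrow> x" by blast
    have w: "weak_partial i x (g i)" for i
      by (rule weak_partial_closed[OF _ x g]) (rule weak_partial_wderiv[OF qdomD(1)[OF X]])
    have h: "x \<in> h1" by (rule h1I[OF w])
    have m: "x \<in> mdom (vpos V)" "mop (vpos V) x = p"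
      using mop_closed[OF vpos_measurable qdomD(2)[OF X] x p] by auto
    have xq: "x \<in> qdom V" using h m by (simp add: qdom_def)
    have Xx: "X n - x \<in> qdom V" for n using X xq q.sub subspace_diff by blast
    have "(\<lambda>n. ?t (X n - x)) \<longlonglongrightarrow> 0"
    proof (rule tendsto_sandwich[of "\<lambda>n. 0"])
      show "\<forall>\<^sub>F n in sequentially. 0 \<le> ?t (X n - x)"
        using order_trans[OF inner_ge_zero qform_components(4)[OF Xx]] by simp
      \<comment> \<open>The term with \<open>vneg V\<close> enters with a minus sign and is dropped
        from the upper bound.\<close>
      show "\<forall>\<^sub>F n in sequentially. ?t (X n - x) \<le> (\<Sum>i\<in>UNIV. (norm (wderiv i (X n) - g i))\<^sup>2)
          + (norm (mop (vpos V) (X n) - p))\<^sup>2 + \<kappa> * (norm (X n - x))\<^sup>2"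
      proof (rule always_eventually, rule allI)
        fix n
        have "wderiv i (X n - x) = wderiv i (X n) - g i" for i
          using wderiv_diff[OF qdomD(1)[OF X] h] wderiv_eqI[OF w] by simp
        moreover have "mop (vpos V) (X n - x) = mop (vpos V) (X n) - p"
          using mop_diff[OF vpos_measurable qdomD(2)[OF X] m(1)] m(2) by simp
        ultimately show "?t (X n - x) \<le> (\<Sum>i\<in>UNIV. (norm (wderiv i (X n) - g i))\<^sup>2)
          + (norm (mop (vpos V) (X n) - p))\<^sup>2 + \<kappa> * (norm (X n - x))\<^sup>2"
          by (simp add: qform_def power2_norm_eq_inner)
      qed
      have "(\<lambda>n. (\<Sum>i\<in>UNIV. (norm (wderiv i (X n) - g i))\<^sup>2)
          + (norm (mop (vpos V) (X n) - p))\<^sup>2 + \<kappa> * (norm (X n - x))\<^sup>2)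
        \<longlonglongrightarrow> (\<Sum>i\<in>(UNIV::3 set). (norm (g i - g i))\<^sup>2) + (norm (p - p))\<^sup>2 + \<kappa> * (norm (x - x))\<^sup>2"
        by (intro tendsto_intros g p x)
      then show "(\<lambda>n. (\<Sum>i\<in>UNIV. (norm (wderiv i (X n) - g i))\<^sup>2)
          + (norm (mop (vpos V) (X n) - p))\<^sup>2 + \<kappa> * (norm (X n - x))\<^sup>2) \<longlonglongrightarrow> 0" by simp
    qed simp
    then show "\<exists>x\<in>qdom V. (\<lambda>n. ?t (X n - x)) \<longlonglongrightarrow> 0" using xq by blast
  qed
qed

lemma qdom_J: "x \<in> qdom V \<Longrightarrow> l2_J x \<in> qdom V"
  by (simp add: qdom_def h1_J mdom_J)

sublocale closed_form "qdom V" "qform V" \<kappa> l2_J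
  by (intro closed_form.intro closed_form_axioms.intro qform_sym_form qform_components(4)
      qform_complete l2_J_linear l2_J_J l2_J_inner qdom_J qform_J)

section \<open>Identification with the operator, its spectrum and its ground state\<close>

lemma weight_split:
  assumes f: "f \<in> form_domain V" and h: "h \<in> form_domain V"
  shows "(\<integral>x. of_real (V x) * cnj (f x) * h x \<partial>lebesgue) =
    L2_inner (\<lambda>x. of_real (vpos V x) * f x) (\<lambda>x. of_real (vpos V x) * h x) -
    L2_inner (\<lambda>x. of_real (vneg V x) * f x) (\<lambda>x. of_real (vneg V x) * h x)"
proof -
  have L: "u \<in> L2" "(\<lambda>x. of_real (vpos V x) * u x) \<in> L2" "(\<lambda>x. of_real (vneg V x) * u x) \<in> L2"
    if "u \<in> form_domain V" for u
    using that qdomD[of "cls u"]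
    by (auto simp: form_domain_iff mdom_cls[OF vpos_measurable] mdom_cls[OF vneg_measurable])
  have V: "complex_of_real (V x) = of_real (vpos V x) * of_real (vpos V x) - of_real (vneg V x) * of_real (vneg V x)" for x
    unfolding of_real_mult[symmetric] of_real_diff[symmetric] by (simp add: vpos_def vneg_def max_def)
  note i = L2_inner_integrable[OF L(2)[OF f] L(2)[OF h]] L2_inner_integrable[OF L(3)[OF f] L(3)[OF h]]
  show ?thesis
    unfolding L2_inner_def Bochner_Integration.integral_diff[OF i, symmetric]
    by (rule Bochner_Integration.integral_cong) (auto simp: V algebra_simps)
qed

lemma form_eq:
  assumes f: "f \<in> form_domain V" and h: "h \<in> form_domain V"
  shows "form V f h = of_real (qform V (cls f) (cls h)) + \<i> * of_real (qform V (l2_J (cls f)) (cls h))"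
proof -
  have H: "f \<in> H1" "h \<in> H1" using f h by (auto simp: form_domain_def)
  have fq: "f \<in> L2" "h \<in> L2" "cls f \<in> qdom V" "cls h \<in> qdom V" using f h by (auto simp: form_domain_iff)
  note G = vec_component_L2[OF weak_grad(1)]
  have "(\<integral>x. (\<Sum>i\<in>UNIV. cnj (weak_grad f x $ i) * weak_grad h x $ i) \<partial>lebesgue)
      = (\<Sum>i\<in>UNIV. L2_inner (\<lambda>x. weak_grad f x $ i) (\<lambda>x. weak_grad h x $ i))"
    unfolding L2_inner_def by (rule Bochner_Integration.integral_sum) (rule L2_inner_integrable[OF G[OF H(1)] G[OF H(2)]])
  also have "\<dots> = (\<Sum>i\<in>UNIV. of_real (wderiv i (cls f) \<bullet> wderiv i (cls h)) + \<i> * of_real (l2_J (wderiv i (cls f)) \<bullet> wderiv i (cls h)))"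
    unfolding L2_inner_eq[OF G[OF H(1)] G[OF H(2)]] cls_weak_grad[OF H(1)] cls_weak_grad[OF H(2)] ..
  finally have 1: "(\<integral>x. (\<Sum>i\<in>UNIV. cnj (weak_grad f x $ i) * weak_grad h x $ i) \<partial>lebesgue)
      = (\<Sum>i\<in>UNIV. of_real (wderiv i (cls f) \<bullet> wderiv i (cls h)) + \<i> * of_real (l2_J (wderiv i (cls f)) \<bullet> wderiv i (cls h)))" .
  have L: "(\<lambda>x. of_real (vpos V x) * f x) \<in> L2" "(\<lambda>x. of_real (vneg V x) * f x) \<in> L2"
    "(\<lambda>x. of_real (vpos V x) * h x) \<in> L2" "(\<lambda>x. of_real (vneg V x) * h x) \<in> L2"
    using qdomD[OF fq(3)] qdomD[OF fq(4)] fq by (simp_all add: mdom_cls)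
  have 2: "(\<integral>x. of_real (V x) * cnj (f x) * h x \<partial>lebesgue)
      = of_real (mop (vpos V) (cls f) \<bullet> mop (vpos V) (cls h)) + \<i> * of_real (l2_J (mop (vpos V) (cls f)) \<bullet> mop (vpos V) (cls h))
      - (of_real (mop (vneg V) (cls f) \<bullet> mop (vneg V) (cls h)) + \<i> * of_real (l2_J (mop (vneg V) (cls f)) \<bullet> mop (vneg V) (cls h)))"
    unfolding weight_split[OF f h] L2_inner_eq[OF L(1,3)] L2_inner_eq[OF L(2,4)] mop_cls[OF fq(1)] mop_cls[OF fq(2)] ..
  show ?thesis unfolding form_def 1 2 qform_def
    by (simp add: wderiv_J mop_J qdomD fq(3) sum.distrib sum_distrib_left[symmetric] algebra_simps)
qed

lemma qform_eq_energy:
  assumes u: "u \<in> form_domain V"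
  shows "qform V (cls u) (cls u) = dirichlet u + (\<integral>x. V x * (cmod (u x))\<^sup>2 \<partial>lebesgue)"
proof -
  have H: "u \<in> H1" using u by (auto simp: form_domain_def)
  have uq: "u \<in> L2" "cls u \<in> qdom V" using u by (auto simp: form_domain_iff)
  have L: "(\<lambda>x. of_real (vpos V x) * u x) \<in> L2" "(\<lambda>x. of_real (vneg V x) * u x) \<in> L2"
    using qdomD[OF uq(2)] uq by (simp_all add: mdom_cls)
  have "complex_of_real (\<integral>x. V x * (cmod (u x))\<^sup>2 \<partial>lebesgue) = (\<integral>x. of_real (V x * (cmod (u x))\<^sup>2) \<partial>lebesgue)"
    by (rule integral_complex_of_real[symmetric])
  also have "\<dots> = (\<integral>x. of_real (V x) * cnj (u x) * u x \<partial>lebesgue)"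
    unfolding of_real_mult complex_norm_square by (simp add: mult_ac)
  also have "\<dots> = of_real ((norm (mop (vpos V) (cls u)))\<^sup>2 - (norm (mop (vneg V) (cls u)))\<^sup>2)"
    unfolding weight_split[OF u u] L2_inner_self mop_cls[OF uq(1)] norm_cls[OF L(1)] norm_cls[OF L(2)] by simp
  finally have "(\<integral>x. V x * (cmod (u x))\<^sup>2 \<partial>lebesgue) = (norm (mop (vpos V) (cls u)))\<^sup>2 - (norm (mop (vneg V) (cls u)))\<^sup>2"
    by (simp only: of_real_eq_iff)
  then show ?thesis by (simp add: qform_def dirichlet_eq[OF H] power2_norm_eq_inner)
qed

text \<open>\<open>form_eq\<close> and \<open>L2_inner_eq\<close> have the same shape, so the
  complex weak equation for \<open>f\<close> is the pair of real equations tested with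
  \<open>cls f\<close> and with \<open>l2_J (cls f)\<close>, and both belong to
  \<open>qdom V\<close>.\<close>

lemma H_op_iff: "(u, w) \<in> H_op V \<longleftrightarrow> u \<in> L2 \<and> w \<in> L2 \<and> (cls u, cls w) \<in> oper"
proof
  assume uw: "(u, w) \<in> H_op V"
  then have u: "u \<in> form_domain V" and w: "w \<in> L2"
    and eq: "\<And>f. f \<in> form_domain V \<Longrightarrow> form V f u = L2_inner f w" by (auto simp: H_op_def)
  have "qform V x (cls u) = x \<bullet> cls w" if x: "x \<in> qdom V" for x
    using eq[OF rep_form_domain[OF x]]
    unfolding form_eq[OF rep_form_domain[OF x] u] L2_inner_eq[OF rep_L2 w] cls_rep by (simp add: complex_eq_iff)
  then show "u \<in> L2 \<and> w \<in> L2 \<and> (cls u, cls w) \<in> oper" using u w by (auto simp: oper_def form_domain_iff)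
next
  assume uw: "u \<in> L2 \<and> w \<in> L2 \<and> (cls u, cls w) \<in> oper"
  then have u: "u \<in> form_domain V" using operD(1) by (auto simp: form_domain_iff)
  have "form V f u = L2_inner f w" if f: "f \<in> form_domain V" for f
  proof -
    have fq: "f \<in> L2" "cls f \<in> qdom V" using f by (auto simp: form_domain_iff)
    show ?thesis unfolding form_eq[OF f u] L2_inner_eq[OF fq(1) conjunct1[OF conjunct2[OF uw]]]
      
      using operD(2)[of "cls u" "cls w" "cls f"] operD(2)[of "cls u" "cls w" "l2_J (cls f)"] uw fq(2) qdom_J[OF fq(2)] by simp
  qed
  then show "(u, w) \<in> H_op V" using u uw by (auto simp: H_op_def)
qed

lemma cls_cmult: "u \<in> L2 \<Longrightarrow> cls (\<lambda>x. z * u x) = Re z *\<^sub>R cls u + Im z *\<^sub>R l2_J (cls u)"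
proof -
  assume u: "u \<in> L2"
  have "cls (\<lambda>x. z * u x) = cls (\<lambda>x. of_real (Re z) * u x + of_real (Im z) * (\<i> * u x))"
    by (rule arg_cong[where f = cls]) (auto simp: fun_eq_iff algebra_simps complex_eq_iff)
  then show ?thesis using u by (simp add: cls_scaleR l2_J_cls L2_cmult cls_add)
qed

text \<open>A complex \<open>z\<close> acts on classes as \<open>Re z\<close> plus
  \<open>Im z\<close> times \<open>l2_J\<close>, and every class has its representative
  \<open>rep\<close>, which lets quantifiers over functions and over classes be exchanged.\<close>

lemma resolvent_set_iff:
  "z \<in> resolvent_set (H_op V) \<longleftrightarrow>
    (\<forall>u w. (u, w) \<in> oper \<longrightarrow> w = Re z *\<^sub>R u + Im z *\<^sub>R l2_J u \<longrightarrow> u = 0) \<and>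
    (\<exists>C. \<forall>h. \<exists>u w. (u, w) \<in> oper \<and> w - (Re z *\<^sub>R u + Im z *\<^sub>R l2_J u) = h \<and> norm u \<le> C * norm h)"
    (is "_ \<longleftrightarrow> ?I \<and> ?S")
proof -
  have ker: "((AE x in lebesgue. w x = z * u x) \<longrightarrow> (AE x in lebesgue. u x = 0)) \<longleftrightarrow>
      (cls w = Re z *\<^sub>R cls u + Im z *\<^sub>R l2_J (cls u) \<longrightarrow> cls u = 0)" if "u \<in> L2" "w \<in> L2" for u w
    using that cls_eq_iff[OF that(2) L2_cmult[OF that(1), of z]] cls_eq_iff[OF that(1) L2_zero]
    by (simp add: cls_cmult cls_0)
  have I: "(\<forall>(u, w)\<in>H_op V. (AE x in lebesgue. w x = z * u x) \<longrightarrow> (AE x in lebesgue. u x = 0)) \<longleftrightarrow> ?I" (is "?L \<longleftrightarrow> _")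
  proof
    assume L: ?L
    show ?I
    proof (intro allI impI)
      fix u w assume uw: "(u, w) \<in> oper" "w = Re z *\<^sub>R u + Im z *\<^sub>R l2_J u"
      have H: "(rep u, rep w) \<in> H_op V" using uw by (simp add: H_op_iff rep_L2)
      from bspec[OF L H] show "u = 0" using uw(2) unfolding prod.case ker[OF rep_L2 rep_L2] cls_rep by blast
    qed
  next
    assume R: ?I
    show ?L
    proof (rule ballI)
      fix p assume p: "p \<in> H_op V"
      obtain u w where uw': "p = (u, w)" by (cases p)
      with p have uw: "(u, w) \<in> H_op V" by simp
      have H: "u \<in> L2" "w \<in> L2" "(cls u, cls w) \<in> oper" using uw by (auto simp: H_op_iff)
      have "cls w = Re z *\<^sub>R cls u + Im z *\<^sub>R l2_J (cls u) \<longrightarrow> cls u = 0" using R H(3) by blast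
      then show "case p of (u, w) \<Rightarrow> (AE x in lebesgue. w x = z * u x) \<longrightarrow> (AE x in lebesgue. u x = 0)"
        unfolding uw' prod.case ker[OF H(1,2)] .
    qed
  qed
  have eqn: "(AE x in lebesgue. w x - z * u x = h x) \<longleftrightarrow> cls w - (Re z *\<^sub>R cls u + Im z *\<^sub>R l2_J (cls u)) = cls h"
    if "u \<in> L2" "w \<in> L2" "h \<in> L2" for u w h
    unfolding cls_cmult[OF that(1), symmetric] cls_diff[OF that(2) L2_cmult[OF that(1)]]
    by (rule cls_eq_iff[OF L2_diff[OF that(2) L2_cmult[OF that(1)]] that(3), symmetric])
  have S: "(\<exists>C. \<forall>h\<in>L2. \<exists>(u, w)\<in>H_op V. (AE x in lebesgue. w x - z * u x = h x) \<and> L2_norm u \<le> C * L2_norm h) \<longleftrightarrow> ?S"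
  proof (rule ex_cong1)
    fix C
    show "(\<forall>h\<in>L2. \<exists>(u, w)\<in>H_op V. (AE x in lebesgue. w x - z * u x = h x) \<and> L2_norm u \<le> C * L2_norm h) \<longleftrightarrow>
      (\<forall>h. \<exists>u w. (u, w) \<in> oper \<and> w - (Re z *\<^sub>R u + Im z *\<^sub>R l2_J u) = h \<and> norm u \<le> C * norm h)" (is "?L \<longleftrightarrow> ?R")
    proof
      assume L: ?L
      show ?R
      proof
        fix h
        obtain u w where uw: "(u, w) \<in> H_op V" "AE x in lebesgue. w x - z * u x = rep h x" "L2_norm u \<le> C * L2_norm (rep h)"
          using bspec[OF L rep_L2[of h]] by blast
        have H: "u \<in> L2" "w \<in> L2" "(cls u, cls w) \<in> oper" using uw(1) by (auto simp: H_op_iff)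
        have "cls w - (Re z *\<^sub>R cls u + Im z *\<^sub>R l2_J (cls u)) = h"
          using uw(2) unfolding eqn[OF H(1,2) rep_L2] cls_rep .
        moreover have "norm (cls u) \<le> C * norm h" using uw(3) by (simp add: norm_cls[OF H(1)] norm_l2_def[of h])
        ultimately show "\<exists>u w. (u, w) \<in> oper \<and> w - (Re z *\<^sub>R u + Im z *\<^sub>R l2_J u) = h \<and> norm u \<le> C * norm h"
          using H(3) by blast
      qed
    next
      assume R: ?R
      show ?L
      proof
        fix h :: "R3 \<Rightarrow> complex" assume h: "h \<in> L2"
        obtain u w where uw: "(u, w) \<in> oper" "w - (Re z *\<^sub>R u + Im z *\<^sub>R l2_J u) = cls h" "norm u \<le> C * norm (cls h)"
          using R by blast
        have "(rep u, rep w) \<in> H_op V" using uw(1) by (simp add: H_op_iff rep_L2)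
        moreover have "AE x in lebesgue. rep w x - z * rep u x = h x" unfolding eqn[OF rep_L2 rep_L2 h] using uw(2) by simp
        moreover have "L2_norm (rep u) \<le> C * L2_norm h" using uw(3) by (simp add: norm_cls[OF h] norm_l2_def[symmetric])
        ultimately show "\<exists>(u, w)\<in>H_op V. (AE x in lebesgue. w x - z * u x = h x) \<and> L2_norm u \<le> C * L2_norm h"
          by blast
      qed
    qed
  qed
  show ?thesis unfolding resolvent_set_def mem_Collect_eq I S ..
qed

lemma regular_iff: "regular r \<longleftrightarrow> of_real r \<in> resolvent_set (H_op V)"
  unfolding resolvent_set_iff regular_def by simp

text \<open>Every complex \<open>z\<close> with real part below the infimum is in the resolvent set,
  by \<open>half_plane_solvable\<close> and \<open>oper_lower\<close>; the infimum itself is in the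
  spectrum, by \<open>bottom_not_regular\<close>. The vector \<open>x0\<close> ensures that the
  infimum is over a nonempty set.\<close>

lemma mu_eq_bottom:
  assumes x0: "x0 \<in> qdom V" "norm x0 = 1"
  shows "mu V = (INF x\<in>{x \<in> qdom V. norm x = 1}. qform V x x)"
    and "lower_bound (mu V)"
proof -
  let ?S = "{x \<in> qdom V. norm x = 1}"
  define l where "l = (INF x\<in>?S. qform V x x)"
  have ne: "(\<lambda>x. qform V x x) ` ?S \<noteq> {}" using x0 by blast
  have bdd: "bdd_below ((\<lambda>x. qform V x x) ` ?S)"
  proof (rule bdd_belowI2)
    fix x assume "x \<in> ?S"
    then show "- \<bar>b\<bar> \<le> qform V x x" using qform_components(4)[of x] by (simp add: norm_eq_1)
  qed
  have lb: "lower_bound l"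
    unfolding lower_bound_def
  proof
    fix u assume u: "u \<in> qdom V"
    show "l * (u \<bullet> u) \<le> qform V u u"
    proof (cases "u = 0")
      case True
      then show ?thesis using qform_components(4)[OF u] by simp
    next
      case False
      let ?v = "(1 / norm u) *\<^sub>R u"
      have "?v \<in> ?S" using u False by (simp add: s.Q_scale)
      then have "l \<le> qform V ?v ?v" unfolding l_def by (rule cINF_lower[OF bdd])
      also have "\<dots> = qform V u u / (u \<bullet> u)"
        using u False by (simp add: s.bilinear_simps s.Q_scale power2_norm_eq_inner[symmetric] power2_eq_square)
      finally show ?thesis using False by (simp add: pos_le_divide_eq)
    qed
  qed
  have low: "l \<le> Re z" if z: "z \<in> spectrum (H_op V)" for z
  proof (rule ccontr)
    assume "\<not> l \<le> Re z"
    then have lt: "Re z < l" by simp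
    have le: "(l - Re z) * norm u \<le> norm (w - (Re z *\<^sub>R u + Im z *\<^sub>R l2_J u))" if "(u, w) \<in> oper" for u w
      using oper_lower[OF lb that, of "Re z" "Im z"] by (simp add: diff_diff_eq)
    have "z \<in> resolvent_set (H_op V)"
      unfolding resolvent_set_iff
    proof (intro conjI allI impI exI[of _ "1 / (l - Re z)"])
      fix u w assume uw: "(u, w) \<in> oper" "w = Re z *\<^sub>R u + Im z *\<^sub>R l2_J u"
      have "(l - Re z) * norm u \<le> 0" using le[OF uw(1)] uw(2) by simp
      then show "u = 0" using lt by (simp add: mult_le_0_iff)
    next
      fix h
      obtain u w where uw: "(u, w) \<in> oper" "w - Re z *\<^sub>R u - Im z *\<^sub>R l2_J u = h"
        using half_plane_solvable[OF lb lt] by blast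
      then have h: "w - (Re z *\<^sub>R u + Im z *\<^sub>R l2_J u) = h" by (simp add: diff_diff_eq)
      have "norm u \<le> 1 / (l - Re z) * norm h"
        using le[OF uw(1)] lt unfolding h by (simp add: field_simps)
      then show "\<exists>u w. (u, w) \<in> oper \<and> w - (Re z *\<^sub>R u + Im z *\<^sub>R l2_J u) = h \<and> norm u \<le> 1 / (l - Re z) * norm h"
        using uw(1) h by blast
    qed
    then show False using z by (simp add: spectrum_def)
  qed
  have "\<not> regular l"
  proof (rule bottom_not_regular[OF lb])
    fix e :: real assume "e > 0"
    then have "l < l + e" by simp
    then have "(INF x\<in>?S. qform V x x) < l + e" by (simp add: l_def)
    then obtain y where "y \<in> (\<lambda>x. qform V x x) ` ?S" "y < l + e"
      using cInf_less_iff[OF ne bdd] by blast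
    then show "\<exists>u\<in>qdom V. norm u = 1 \<and> qform V u u < l + e" by auto
  qed
  then have "complex_of_real l \<in> spectrum (H_op V)" by (simp add: regular_iff spectrum_def)
  then have "l \<in> Re ` spectrum (H_op V)" by force
  then have "mu V = l" unfolding mu_def using low by (intro cInf_eq_minimum) auto
  then show "mu V = (INF x\<in>?S. qform V x x)" "lower_bound (mu V)" using lb by (auto simp: l_def)
qed

text \<open>An isolated point has a disc free of other spectrum, whose real points to the right of
  \<open>mu V\<close> are regular; simplicity makes the kernel of \<open>H - mu V\<close> the real
  span of \<open>e\<close> and \<open>l2_J e\<close>. These are the hypotheses of
  \<open>spectral_gap\<close>.\<close>

lemma ground_state:
  assumes B: "hypothesis_B V u\<^sub>V"
  defines "e \<equiv> cls (\<lambda>x. of_real (u\<^sub>V x))"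
  shows "(\<lambda>x. complex_of_real (u\<^sub>V x)) \<in> form_domain V" "(e, mu V *\<^sub>R e) \<in> oper" "norm e = 1"
    and "\<exists>d>0. \<forall>z\<in>qdom V. e \<bullet> z = 0 \<longrightarrow> l2_J e \<bullet> z = 0 \<longrightarrow> (mu V + d) * (z \<bullet> z) \<le> qform V z z"
proof -
  let ?u = "\<lambda>x. complex_of_real (u\<^sub>V x)"
  have eig: "eigenfunction (H_op V) (of_real (mu V)) ?u" and n: "L2_norm u\<^sub>V = 1"
    and simple: "simple_eigenvalue (H_op V) (of_real (mu V))"
    and iso: "complex_of_real (mu V) isolated_in spectrum (H_op V)"
    using B by (auto simp: hypothesis_B_def positive_ground_state_def)
  have H: "(?u, \<lambda>x. of_real (mu V) * ?u x) \<in> H_op V" using eig by (simp add: eigenfunction_def)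
  then have uL: "?u \<in> L2" by (simp add: H_op_iff)
  show uf: "?u \<in> form_domain V" using H by (simp add: H_op_def)
  show eo: "(e, mu V *\<^sub>R e) \<in> oper" using H uL by (simp add: H_op_iff e_def cls_scaleR)
  show ne: "norm e = 1" using n uL by (simp add: e_def norm_cls L2_norm_def)
  have eq: "e \<in> qdom V" using operD(1)[OF eo] .
  have e0: "\<not> (AE x in lebesgue. ?u x = 0)" using eig by (simp add: eigenfunction_def)
  have lb: "lower_bound (mu V)" by (rule mu_eq_bottom(2)[OF eq ne])
  have ker: "\<exists>p q. u = p *\<^sub>R e + q *\<^sub>R l2_J e" if u: "(u, mu V *\<^sub>R u) \<in> oper" for u
  proof (cases "u = 0")
    case True
    then show ?thesis by (intro exI[of _ 0]) simp
  next
    case False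
    have "cls (\<lambda>x. of_real (mu V) * rep u x) = mu V *\<^sub>R u" using cls_scaleR[OF rep_L2, of "mu V" u] by simp
    then have "(rep u, \<lambda>x. of_real (mu V) * rep u x) \<in> H_op V"
      using u by (simp add: H_op_iff rep_L2 L2_cmult)
    moreover have "\<not> (AE x in lebesgue. rep u x = 0)"
      using False cls_eq_iff[OF rep_L2 L2_zero, of u] by (simp add: cls_0)
    ultimately have "eigenfunction (H_op V) (of_real (mu V)) (rep u)" by (simp add: eigenfunction_def)
    then obtain c where "AE x in lebesgue. rep u x = c * ?u x"
      using simple eig unfolding simple_eigenvalue_def by blast
    then have "cls (rep u) = cls (\<lambda>x. c * ?u x)" by (rule cls_eqI)
    also have "\<dots> = Re c *\<^sub>R e + Im c *\<^sub>R l2_J e" unfolding e_def by (rule cls_cmult[OF uL])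
    finally show ?thesis by auto
  qed
  obtain T where T: "open T" "T \<inter> spectrum (H_op V) = {complex_of_real (mu V)}"
    using iso by (auto simp: isolated_in_def)
  then obtain d where d: "d > 0" "ball (complex_of_real (mu V)) d \<subseteq> T"
    using open_contains_ball by blast
  have reg: "regular r" if "mu V < r" "r < mu V + d" for r
  proof -
    have "complex_of_real r \<in> ball (complex_of_real (mu V)) d" using that by (simp add: dist_of_real dist_real_def)
    then have "complex_of_real r \<in> T" using d by auto
    moreover have "complex_of_real r \<notin> T \<inter> spectrum (H_op V)" unfolding T(2) using that by simp
    ultimately show ?thesis by (simp add: regular_iff spectrum_def)
  qed
  have "(mu V + d / 2) * (z \<bullet> z) \<le> qform V z z" if "z \<in> qdom V" "e \<bullet> z = 0" "l2_J e \<bullet> z = 0" for z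
    by (rule spectral_gap[OF lb eo ker d(1) reg that])
  then show "\<exists>d>0. \<forall>z\<in>qdom V. e \<bullet> z = 0 \<longrightarrow> l2_J e \<bullet> z = 0 \<longrightarrow> (mu V + d) * (z \<bullet> z) \<le> qform V z z"
    using d(1) by (intro exI[of _ "d/2"]) auto
qed

end

section \<open>The coupling to the field\<close>

lemma borel_imp_lebesgue: "f \<in> borel_measurable borel \<Longrightarrow> f \<in> borel_measurable lebesgue"
  by (rule measurable_completion) simp

lemma fourier_bar_cong:
  assumes [measurable]: "f \<in> borel_measurable lebesgue" "h \<in> borel_measurable lebesgue"
    and ae: "AE x in lebesgue. f x = h x"
  shows "fourier_bar f k = fourier_bar h k"
proof -
  have [measurable]: "(\<lambda>x. exp (\<i> * of_real (k \<bullet> x))) \<in> borel_measurable lebesgue"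
    by (intro borel_imp_lebesgue borel_measurable_continuous_onI continuous_intros)
  show ?thesis unfolding fourier_bar_def
  proof (rule integral_cong_AE)
    show "AE x in lebesgue. exp (\<i> * of_real (k \<bullet> x)) * f x = exp (\<i> * of_real (k \<bullet> x)) * h x"
      using ae by eventually_elim simp
  qed measurable
qed

lemma fourier_bar_integrable:
  assumes f: "integrable lebesgue f"
  shows "integrable lebesgue (\<lambda>x. exp (\<i> * of_real (k \<bullet> x)) * f x)"
proof (rule Bochner_Integration.integrable_bound[OF f])
  have [measurable]: "(\<lambda>x. exp (\<i> * of_real (k \<bullet> x))) \<in> borel_measurable lebesgue"
    by (intro borel_imp_lebesgue borel_measurable_continuous_onI continuous_intros)
  have [measurable]: "f \<in> borel_measurable lebesgue" using f by (rule borel_measurable_integrable)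
  show "(\<lambda>x. exp (\<i> * of_real (k \<bullet> x)) * f x) \<in> borel_measurable lebesgue" by measurable
qed (simp add: norm_mult)

lemma fourier_bar_add:
  assumes "integrable lebesgue f" "integrable lebesgue h"
  shows "fourier_bar (\<lambda>x. f x + h x) k = fourier_bar f k + fourier_bar h k"
  using assms[THEN fourier_bar_integrable] by (simp add: fourier_bar_def distrib_left)

lemma fourier_bar_cmult: "fourier_bar (\<lambda>x. c * f x) k = c * fourier_bar f k"
  by (simp add: fourier_bar_def mult.left_commute[of _ c])

text \<open>The polarization of \<open>|u|^2\<close> over the reals. The real part makes it
  symmetric and makes \<open>dens x (l2_J x)\<close> vanish almost everywhere, which yields the
  phase invariance of the coupling.\<close>

definition dens :: "l2 \<Rightarrow> l2 \<Rightarrow> R3 \<Rightarrow> real" where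
  "dens x y t = Re (rep x t * cnj (rep y t))"

definition pair_ft :: "l2 \<Rightarrow> l2 \<Rightarrow> R3 \<Rightarrow> complex" where
  "pair_ft x y = fourier_bar (\<lambda>t. of_real (dens x y t))"

lemma dens_measurable [measurable]: "dens x y \<in> borel_measurable borel"
  unfolding dens_def by measurable

lemma dens_lebesgue: "(\<lambda>t. complex_of_real (dens x y t)) \<in> borel_measurable lebesgue"
  by (rule borel_imp_lebesgue) measurable

lemma dens_integrable: "integrable lebesgue (dens x y)"
  unfolding dens_def by (intro integrable_Re L2_mult_integrable L2_cnj rep_L2)

lemma dens_integrable_complex: "integrable lebesgue (\<lambda>t. complex_of_real (dens x y t))"
  by (intro integrable_of_real dens_integrable)

lemma dens_self: "dens x x t = (cmod (rep x t))\<^sup>2"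
  unfolding dens_def complex_norm_square[symmetric] by simp

lemma pair_ft_cong:
  assumes "AE t in lebesgue. h t = dens x y t" "h \<in> borel_measurable lebesgue"
  shows "fourier_bar (\<lambda>t. of_real (h t)) k = pair_ft x y k"
  unfolding pair_ft_def
proof (rule fourier_bar_cong[OF _ dens_lebesgue])
  show "(\<lambda>t. complex_of_real (h t)) \<in> borel_measurable lebesgue"
    by (rule measurable_compose[OF assms(2) borel_measurable_of_real])
  show "AE t in lebesgue. complex_of_real (h t) = of_real (dens x y t)" using assms(1) by eventually_elim simp
qed

lemma pair_ft_cls:
  assumes u: "u \<in> L2"
  shows "fourier_bar (\<lambda>t. of_real ((cmod (u t))\<^sup>2)) k = pair_ft (cls u) (cls u) k"
proof (rule pair_ft_cong)
  have [measurable]: "u \<in> borel_measurable lebesgue" by (rule L2_measurable[OF u])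
  show "(\<lambda>t. (cmod (u t))\<^sup>2) \<in> borel_measurable lebesgue" by measurable
  show "AE t in lebesgue. (cmod (u t))\<^sup>2 = dens (cls u) (cls u) t"
    using AE_rep_cls[OF u] by eventually_elim (simp add: dens_self)
qed

lemma dens_lebesgue_real: "dens x y \<in> borel_measurable lebesgue"
  by (rule borel_imp_lebesgue) measurable

lemma AE_rep_add: "AE t in lebesgue. rep (x + y) t = rep x t + rep y t"
  unfolding plus_l2_def by (rule AE_rep_cls[OF L2_add[OF rep_L2 rep_L2]])

lemma AE_rep_scale: "AE t in lebesgue. rep (c *\<^sub>R x) t = of_real c * rep x t"
  unfolding scaleR_l2_def by (rule AE_rep_cls[OF L2_cmult[OF rep_L2]])

lemma AE_rep_J: "AE t in lebesgue. rep (l2_J x) t = \<i> * rep x t"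
  unfolding l2_J_def by (rule AE_rep_cls[OF L2_cmult[OF rep_L2]])

lemma pair_ft_add: "pair_ft x (y + z) k = pair_ft x y k + pair_ft x z k"
proof -
  have "pair_ft x (y + z) k = fourier_bar (\<lambda>t. of_real (dens x y t + dens x z t)) k"
  proof (rule pair_ft_cong[symmetric])
    show "AE t in lebesgue. dens x y t + dens x z t = dens x (y + z) t"
      using AE_rep_add[of y z] by eventually_elim (simp add: dens_def distrib_left)
    show "(\<lambda>t. dens x y t + dens x z t) \<in> borel_measurable lebesgue"
      by (rule borel_imp_lebesgue) measurable
  qed
  also have "\<dots> = pair_ft x y k + pair_ft x z k"
    unfolding of_real_add pair_ft_def by (rule fourier_bar_add[OF dens_integrable_complex dens_integrable_complex])
  finally show ?thesis .
qed

lemma pair_ft_scale: "pair_ft x (c *\<^sub>R y) k = of_real c * pair_ft x y k"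
proof -
  have "pair_ft x (c *\<^sub>R y) k = fourier_bar (\<lambda>t. of_real (c * dens x y t)) k"
  proof (rule pair_ft_cong[symmetric])
    show "AE t in lebesgue. c * dens x y t = dens x (c *\<^sub>R y) t"
      using AE_rep_scale[of c y] by eventually_elim (simp add: dens_def algebra_simps)
    show "(\<lambda>t. c * dens x y t) \<in> borel_measurable lebesgue"
      by (rule borel_imp_lebesgue) measurable
  qed
  also have "\<dots> = of_real c * pair_ft x y k" unfolding of_real_mult pair_ft_def by (rule fourier_bar_cmult)
  finally show ?thesis .
qed

lemma pair_ft_sym: "pair_ft x y k = pair_ft y x k"
  unfolding pair_ft_def dens_def by (simp add: mult.commute)

lemma pair_ft_J: "pair_ft (l2_J x) (l2_J y) k = pair_ft x y k"
proof (unfold pair_ft_def[of "l2_J x"], rule pair_ft_cong)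
  show "AE t in lebesgue. dens (l2_J x) (l2_J y) t = dens x y t"
    using AE_rep_J[of x] AE_rep_J[of y] by eventually_elim (simp add: dens_def)
qed (rule dens_lebesgue_real)

lemma pair_ft_J0: "pair_ft x (l2_J x) k = 0"
proof -
  have "pair_ft x (l2_J x) k = fourier_bar (\<lambda>t. of_real 0) k"
  proof (rule pair_ft_cong[symmetric])
    show "AE t in lebesgue. 0 = dens x (l2_J x) t"
      using AE_rep_J[of x] by eventually_elim (simp add: dens_def algebra_simps)
  qed simp
  then show ?thesis by (simp add: fourier_bar_def)
qed

lemma pair_ft_diff: "pair_ft x (y - z) k = pair_ft x y k - pair_ft x z k"
  using pair_ft_add[of x y "- 1 *\<^sub>R z" k] pair_ft_scale[of x "- 1" z k] by simp

lemma pair_ft_polarization: "4 * pair_ft x y k = pair_ft (x + y) (x + y) k - pair_ft (x - y) (x - y) k"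
  using pair_ft_sym[of y x k] pair_ft_sym[of "x + y" x k] pair_ft_sym[of "x + y" y k] pair_ft_sym[of "x - y" x k] pair_ft_sym[of "x - y" y k]
  by (simp add: pair_ft_add pair_ft_diff)

lemma pair_ft_lborel: "pair_ft x y k = (\<integral>t. exp (\<i> * of_real (k \<bullet> t)) * of_real (dens x y t) \<partial>lborel)"
  unfolding pair_ft_def fourier_bar_def by (rule integral_completion) measurable

lemma pair_ft_measurable [measurable]: "pair_ft x y \<in> borel_measurable borel"
  unfolding pair_ft_lborel[abs_def] by measurable

lemma cmod_pair_ft_le: "cmod (pair_ft x x k) \<le> (norm x)\<^sup>2"
proof -
  have "cmod (pair_ft x x k) \<le> (\<integral>t. cmod (exp (\<i> * of_real (k \<bullet> t)) * of_real (dens x x t)) \<partial>lebesgue)"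
    unfolding pair_ft_def fourier_bar_def by (rule integral_norm_bound)
  also have "\<dots> = (norm x)\<^sup>2"
    by (simp add: norm_mult norm_power dens_self norm_l2_def L2_norm_square)
  finally show ?thesis .
qed

lemma cmod_ft_eq_pair_ft: "cmod (ft (\<lambda>t. of_real ((cmod (rep x t))\<^sup>2)) k) = cmod (pair_ft x x k)"
proof -
  have "ft (\<lambda>t. of_real ((cmod (rep x t))\<^sup>2)) k = (\<integral>t. cnj (exp (\<i> * of_real (k \<bullet> t)) * of_real (dens x x t)) \<partial>lborel)"
    unfolding ft_def by (simp add: dens_self exp_cnj)
  also have "\<dots> = cnj (pair_ft x x k)" unfolding pair_ft_lborel by (rule Bochner_Integration.integral_cnj)
  finally show ?thesis by simp
qed

lemma fourier_eq_cnj_pair_ft: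
  assumes "AE t in lebesgue. h t = dens x x t" "h \<in> borel_measurable lebesgue"
  shows "fourier (\<lambda>t. of_real (h t)) k = cnj (pair_ft x x k)"
proof -
  have "fourier (\<lambda>t. of_real (h t)) k = (\<integral>t. cnj (exp (\<i> * of_real (k \<bullet> t)) * of_real (h t)) \<partial>lebesgue)"
    unfolding fourier_def by (simp add: exp_cnj)
  also have "\<dots> = cnj (fourier_bar (\<lambda>t. of_real (h t)) k)" unfolding fourier_bar_def by (rule Bochner_Integration.integral_cnj)
  finally show ?thesis by (simp only: pair_ft_cong[OF assms])
qed

lemma h1_translation:
  assumes x: "x \<in> h1"
  shows "(\<integral>\<^sup>+t. ennreal ((cmod (rep x (t + h) - rep x t))\<^sup>2) \<partial>lborel)
    \<le> ennreal (3 * (\<Sum>i\<in>UNIV. (norm (wderiv i x))\<^sup>2) * (norm h)\<^sup>2)"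
proof -
  let ?G = "\<lambda>t. \<chi> i. rep (wderiv i x) t"
  have sq: "integrable lborel (\<lambda>t. (cmod (rep y t))\<^sup>2)" for y
    using L2_integrable[OF rep_L2[of y]] by (subst (asm) integrable_completion) auto
  have Gm: "?G \<in> borel_measurable borel" by (rule vec_measurable) simp
  have nG: "(norm (?G t))\<^sup>2 = (\<Sum>i\<in>UNIV. (cmod (rep (wderiv i x) t))\<^sup>2)" for t
    unfolding norm_vec_square by simp
  have G2: "integrable lborel (\<lambda>t. (norm (?G t))\<^sup>2)" unfolding nG using sq by simp
  have "(\<integral>t. (norm (?G t))\<^sup>2 \<partial>lborel) = (\<Sum>i\<in>UNIV. \<integral>t. (cmod (rep (wderiv i x) t))\<^sup>2 \<partial>lborel)"
    unfolding nG by (rule Bochner_Integration.integral_sum) (rule sq)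
  also have "\<dots> = (\<Sum>i\<in>UNIV. (norm (wderiv i x))\<^sup>2)"
  proof (rule sum.cong[OF refl])
    fix i
    have "(norm (wderiv i x))\<^sup>2 = (\<integral>t. (cmod (rep (wderiv i x) t))\<^sup>2 \<partial>lebesgue)" by (simp add: norm_l2_def L2_norm_square)
    also have "\<dots> = (\<integral>t. (cmod (rep (wderiv i x) t))\<^sup>2 \<partial>lborel)" by (rule integral_completion) measurable
    finally show "(\<integral>t. (cmod (rep (wderiv i x) t))\<^sup>2 \<partial>lborel) = (norm (wderiv i x))\<^sup>2" by simp
  qed
  finally have int: "(\<integral>t. (norm (?G t))\<^sup>2 \<partial>lborel) = (\<Sum>i\<in>UNIV. (norm (wderiv i x))\<^sup>2)" .
  have weak: "(\<integral>t. rep x t * of_real (partial_deriv i \<phi> t) \<partial>lborel) = - (\<integral>t. ?G t $ i * of_real (\<phi> t) \<partial>lborel)"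
    if \<phi>: "\<phi> \<in> test_functions" for \<phi> i
  proof -
    have [measurable]: "\<phi> \<in> borel_measurable borel" "partial_deriv i \<phi> \<in> borel_measurable borel"
      using \<phi> partial_deriv_test_function test_function_measurable by blast+
    have "weak_partial i (cls (rep x)) (cls (rep (wderiv i x)))" using weak_partial_wderiv[OF x] by simp
    then have eq: "(\<integral>t. rep x t * of_real (partial_deriv i \<phi> t) \<partial>lebesgue) = - (\<integral>t. rep (wderiv i x) t * of_real (\<phi> t) \<partial>lebesgue)"
      using \<phi> unfolding weak_partial_cls[OF rep_L2 rep_L2] by blast
    have "(\<integral>t. rep x t * of_real (partial_deriv i \<phi> t) \<partial>lebesgue) = (\<integral>t. rep x t * of_real (partial_deriv i \<phi> t) \<partial>lborel)"
      by (rule integral_completion) measurable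
    moreover have "(\<integral>t. rep (wderiv i x) t * of_real (\<phi> t) \<partial>lebesgue) = (\<integral>t. rep (wderiv i x) t * of_real (\<phi> t) \<partial>lborel)"
      by (rule integral_completion) measurable
    ultimately show ?thesis using eq by simp
  qed
  show ?thesis using weak_gradient_shift[OF rep_borel Gm sq G2 weak, of h] unfolding int .
qed

lemma weak_L3_tail:
  assumes f: "f \<in> weak_L3"
  shows "\<exists>M\<ge>0. \<forall>t>0. emeasure lebesgue {x. t < \<bar>f x\<bar>} \<le> ennreal (M / t ^ 3)"
proof -
  have "bdd_above ((\<lambda>t. t * measure lebesgue {x. t < \<bar>f x\<bar>} powr (1/3)) ` {0<..})"
    using f by (simp add: weak_L3_def)
  then obtain S where S': "\<And>y. y \<in> (\<lambda>t. t * measure lebesgue {x. t < \<bar>f x\<bar>} powr (1/3)) ` {0<..} \<Longrightarrow> y \<le> S"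
    unfolding bdd_above_def by blast
  have S: "t * measure lebesgue {x. t < \<bar>f x\<bar>} powr (1/3) \<le> S" if "t > 0" for t
    by (rule S', rule imageI) (simp add: that)
  have "0 \<le> 1 * measure lebesgue {x. 1 < \<bar>f x\<bar>} powr (1/3)" by simp
  also have "\<dots> \<le> S" by (rule S) simp
  finally have S0: "0 \<le> S" .
  have "emeasure lebesgue {x. t < \<bar>f x\<bar>} \<le> ennreal (S ^ 3 / t ^ 3)" if t: "t > 0" for t
  proof -
    let ?m = "measure lebesgue {x. t < \<bar>f x\<bar>}"
    \<comment> \<open>On a set of infinite measure \<open>measure\<close> is 0 and its bound would
      carry no information, so finiteness is brought in first.\<close>
    have "emeasure lebesgue {x. t < \<bar>f x\<bar>} < \<infinity>" using f t by (simp add: weak_L3_def)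
    then have "emeasure lebesgue {x. t < \<bar>f x\<bar>} = ennreal ?m" by (intro emeasure_eq_ennreal_measure) (simp add: less_top)
    moreover have "?m = (?m powr (1/3)) ^ 3"
      by (cases "?m = 0") (auto simp: powr_realpow[symmetric] powr_powr less_le)
    moreover have "(?m powr (1/3)) ^ 3 \<le> (S / t) ^ 3"
      using S[OF t] t by (intro power_mono) (auto simp: field_simps)
    ultimately show ?thesis by (simp add: power_divide ennreal_leI)
  qed
  then show ?thesis using S0 by (intro exI[of _ "S ^ 3"]) auto
qed

section \<open>The weighted coupling as a bilinear map\<close>

locale coupling_weight =
  fixes w :: "R3 \<Rightarrow> real"
  assumes w [measurable]: "w \<in> borel_measurable lebesgue" and w0: "\<And>k. 0 \<le> w k"
    and hyp_C: "hypothesis_C w"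
begin

text \<open>Against the integrable part of the weight the transform is bounded pointwise by the
  squared norm. Against the weak part \<open>weak_L3_fourier_bound\<close> applies to a Borel
  version of \<open>W2\<close>, with the translation constant provided by
  \<open>h1_translation\<close>.\<close>

lemma coupling_bound:
  "\<exists>C\<ge>0. \<forall>x\<in>h1. (\<integral>\<^sup>+k. ennreal (w k * cmod (pair_ft x x k)) \<partial>lebesgue)
    \<le> ennreal (C * ((norm x)\<^sup>2 + (\<Sum>i\<in>UNIV. (norm (wderiv i x))\<^sup>2)))"
proof -
  obtain W1 W2 where W: "AE k in lebesgue. w k = W1 k + W2 k" "integrable lebesgue W1" "W2 \<in> weak_L3"
    using hyp_C unfolding hypothesis_C_def by blast
  have [measurable]: "W1 \<in> borel_measurable lebesgue" "W2 \<in> borel_measurable lebesgue"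
    using W(2,3) by (auto simp: weak_L3_def)
  obtain M where M: "M \<ge> 0" "\<And>t. t > 0 \<Longrightarrow> emeasure lebesgue {x. t < \<bar>W2 x\<bar>} \<le> ennreal (M / t ^ 3)"
    using weak_L3_tail[OF W(3)] by blast
  obtain W' where W': "W' \<in> borel_measurable lborel" "AE k in lborel. W2 k = W' k"
    using completion_ex_borel_measurable_real[of W2 lborel] by auto
  then have [measurable]: "W' \<in> borel_measurable borel" by simp
  have tail: "emeasure lborel {k. t < \<bar>W' k\<bar>} \<le> ennreal (M / t ^ 3)" if "t > 0" for t
  proof -
    have "emeasure lborel {k. t < \<bar>W' k\<bar>} = emeasure lebesgue {k. t < \<bar>W' k\<bar>}" by simp
    also have "\<dots> = emeasure lebesgue {k. t < \<bar>W2 k\<bar>}"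
    proof (rule emeasure_eq_AE)
      show "AE k in lebesgue. k \<in> {k. t < \<bar>W' k\<bar>} \<longleftrightarrow> k \<in> {k. t < \<bar>W2 k\<bar>}"
        using AE_completion[OF W'(2)] by eventually_elim simp
      have "{k \<in> space lebesgue. t < \<bar>W2 k\<bar>} \<in> sets lebesgue" by measurable
      then show "{k. t < \<bar>W2 k\<bar>} \<in> sets lebesgue" by simp
      have "{k \<in> space borel. t < \<bar>W' k\<bar>} \<in> sets borel" by measurable
      then show "{k. t < \<bar>W' k\<bar>} \<in> sets lebesgue" by simp
    qed
    also have "\<dots> \<le> ennreal (M / t ^ 3)" by (rule M(2)[OF that])
    finally show ?thesis .
  qed
  define N where "N = (\<integral>k. \<bar>W1 k\<bar> \<partial>lebesgue)"
  define c where "c = 2 * (6 * ball_const + 3 * (ball_const + 2 * M))"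
  have c0: "0 \<le> c" "0 \<le> N" using M ball_const_nonneg by (auto simp: c_def N_def)
  show ?thesis
  \<comment> \<open>The factor 18 is 6 from \<open>weak_L3_fourier_bound\<close> times 3 from
    \<open>h1_translation\<close>; it also exceeds the 7 in front of the squared norm.\<close>
  proof (intro exI[of _ "N + 18 * c"] conjI ballI)
    show "0 \<le> N + 18 * c" using c0 by simp
    fix x assume x: "x \<in> h1"
    let ?S = "\<Sum>i\<in>(UNIV::3 set). (norm (wderiv i x))\<^sup>2"
    have S0: "0 \<le> ?S" by (simp add: sum_nonneg)
    have Bm: "pair_ft x x \<in> borel_measurable lebesgue" by (rule borel_imp_lebesgue) measurable
    note [measurable] = Bm
    have "(\<integral>\<^sup>+k. ennreal (w k * cmod (pair_ft x x k)) \<partial>lebesgue)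
        \<le> (\<integral>\<^sup>+k. ennreal (norm x ^ 2) * ennreal \<bar>W1 k\<bar> + ennreal (\<bar>W' k\<bar> * cmod (pair_ft x x k)) \<partial>lebesgue)"
    proof (rule nn_integral_mono_AE)
      show "AE k in lebesgue. ennreal (w k * cmod (pair_ft x x k)) \<le> ennreal (norm x ^ 2) * ennreal \<bar>W1 k\<bar> + ennreal (\<bar>W' k\<bar> * cmod (pair_ft x x k))"
        using W(1) AE_completion[OF W'(2)]
      proof eventually_elim
        case (elim k)
        have "w k * cmod (pair_ft x x k) \<le> (\<bar>W1 k\<bar> + \<bar>W' k\<bar>) * cmod (pair_ft x x k)"
          using elim by (intro mult_right_mono) auto
        also have "\<dots> \<le> (norm x)\<^sup>2 * \<bar>W1 k\<bar> + \<bar>W' k\<bar> * cmod (pair_ft x x k)"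
          using mult_left_mono[OF cmod_pair_ft_le, of "\<bar>W1 k\<bar>" x k] by (simp add: algebra_simps)
        finally show ?case
          by (simp add: ennreal_mult'[symmetric] ennreal_plus[symmetric] ennreal_leI del: ennreal_plus)
      qed
    qed
    also have "\<dots> = (\<integral>\<^sup>+k. ennreal (norm x ^ 2) * ennreal \<bar>W1 k\<bar> \<partial>lebesgue) + (\<integral>\<^sup>+k. ennreal (\<bar>W' k\<bar> * cmod (pair_ft x x k)) \<partial>lebesgue)"
    proof (rule nn_integral_add)
      show "(\<lambda>k. ennreal (\<bar>W' k\<bar> * cmod (pair_ft x x k))) \<in> borel_measurable lebesgue"
        by (rule borel_imp_lebesgue) measurable
    qed measurable
    also have "(\<integral>\<^sup>+k. ennreal (norm x ^ 2) * ennreal \<bar>W1 k\<bar> \<partial>lebesgue) = ennreal (norm x ^ 2) * (\<integral>\<^sup>+k. ennreal \<bar>W1 k\<bar> \<partial>lebesgue)"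
      by (rule nn_integral_cmult) measurable
    also have "(\<integral>\<^sup>+k. ennreal \<bar>W1 k\<bar> \<partial>lebesgue) = ennreal N"
      unfolding N_def by (rule nn_integral_eq_integral) (use W(2) in auto)
    also have "(\<integral>\<^sup>+k. ennreal (\<bar>W' k\<bar> * cmod (pair_ft x x k)) \<partial>lebesgue)
        = (\<integral>\<^sup>+k. ennreal (\<bar>W' k\<bar> * cmod (ft (\<lambda>t. of_real ((cmod (rep x t))\<^sup>2)) k)) \<partial>lborel)"
      unfolding nn_integral_completion cmod_ft_eq_pair_ft ..
    also have "\<dots> \<le> ennreal (c * (7 * (\<integral>t. (cmod (rep x t))\<^sup>2 \<partial>lborel) + 6 * (3 * ?S)))"
      unfolding c_def
    proof (rule weak_L3_fourier_bound)
      show "integrable lborel (\<lambda>t. (cmod (rep x t))\<^sup>2)"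
        using L2_integrable[OF rep_L2[of x]] by (subst (asm) integrable_completion) auto
      show "0 \<le> 3 * ?S" using S0 by simp
      show "(\<integral>\<^sup>+t. ennreal ((cmod (rep x (t + h) - rep x t))\<^sup>2) \<partial>lborel) \<le> ennreal (3 * ?S * (norm h)\<^sup>2)" for h
        by (rule h1_translation[OF x])
      show "emeasure lborel {k. t < \<bar>W' k\<bar>} \<le> ennreal (M / t ^ 3)" if "t > 0" for t by (rule tail[OF that])
    qed (use M in auto)
    also have "(\<integral>t. (cmod (rep x t))\<^sup>2 \<partial>lborel) = (norm x)\<^sup>2"
      unfolding norm_l2_def L2_norm_square by (rule integral_completion[symmetric]) measurable
    also have "ennreal (norm x ^ 2) * ennreal N + ennreal (c * (7 * (norm x)\<^sup>2 + 6 * (3 * ?S)))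
        = ennreal ((norm x)\<^sup>2 * N + c * (7 * (norm x)\<^sup>2 + 6 * (3 * ?S)))"
      using c0 S0 by (simp add: ennreal_mult'[symmetric] ennreal_plus[symmetric] del: ennreal_plus)
    also have "\<dots> \<le> ennreal ((N + 18 * c) * ((norm x)\<^sup>2 + ?S))"
    proof (rule ennreal_leI)
      have "0 \<le> N * ?S" "0 \<le> c * (norm x)\<^sup>2" using c0 S0 by auto
      then show "(norm x)\<^sup>2 * N + c * (7 * (norm x)\<^sup>2 + 6 * (3 * ?S)) \<le> (N + 18 * c) * ((norm x)\<^sup>2 + ?S)"
        by (simp add: algebra_simps)
    qed
    finally show "(\<integral>\<^sup>+k. ennreal (w k * cmod (pair_ft x x k)) \<partial>lebesgue) \<le> ennreal ((N + 18 * c) * ((norm x)\<^sup>2 + ?S))"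
      by (simp add: add_mono)
  qed
qed

definition wpair_ft :: "l2 \<Rightarrow> l2 \<Rightarrow> R3 \<Rightarrow> complex" where
  "wpair_ft x y k = of_real (sqrt (w k)) * pair_ft x y k"

lemma pair_ft_lebesgue [measurable]: "pair_ft x y \<in> borel_measurable lebesgue"
  by (rule borel_imp_lebesgue) measurable

lemma wpair_ft_measurable [measurable]: "wpair_ft x y \<in> borel_measurable lebesgue"
  unfolding wpair_ft_def[abs_def] by measurable

text \<open>Of the two factors in \<open>|pair_ft x x|^2\<close> one is bounded pointwise by the
  squared norm and the other is integrated against the weight. This is the origin of the mixed bound
  \<open>norm x * fnorm x\<close> in \<open>quartic_perturbation\<close>.\<close>

lemma wpair_ft_bound:
  assumes C: "0 \<le> C" and le: "(\<integral>\<^sup>+k. ennreal (w k * cmod (pair_ft x x k)) \<partial>lebesgue) \<le> ennreal C"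
  shows "wpair_ft x x \<in> L2" "(L2_norm (wpair_ft x x))\<^sup>2 \<le> (norm x)\<^sup>2 * C"
proof -
  have c0: "0 \<le> norm x * sqrt C" using C by simp
  have sq: "(norm x * sqrt C)\<^sup>2 = (norm x)\<^sup>2 * C" using C by (simp add: power_mult_distrib)
  have "(\<integral>\<^sup>+k. ennreal ((norm (wpair_ft x x k))\<^sup>2) \<partial>lebesgue)
      \<le> (\<integral>\<^sup>+k. ennreal ((norm x)\<^sup>2) * ennreal (w k * cmod (pair_ft x x k)) \<partial>lebesgue)"
  proof (rule nn_integral_mono)
    fix k
    have "(norm (wpair_ft x x k))\<^sup>2 = (w k * cmod (pair_ft x x k)) * cmod (pair_ft x x k)"
      using w0[of k] by (simp add: wpair_ft_def norm_mult power_mult_distrib power2_eq_square)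
    also have "\<dots> \<le> (w k * cmod (pair_ft x x k)) * (norm x)\<^sup>2"
      using w0[of k] cmod_pair_ft_le by (intro mult_left_mono) auto
    finally show "ennreal ((norm (wpair_ft x x k))\<^sup>2) \<le> ennreal ((norm x)\<^sup>2) * ennreal (w k * cmod (pair_ft x x k))"
      by (simp add: ennreal_mult'[symmetric] ennreal_leI mult.commute)
  qed
  also have "\<dots> = ennreal ((norm x)\<^sup>2) * (\<integral>\<^sup>+k. ennreal (w k * cmod (pair_ft x x k)) \<partial>lebesgue)"
    by (rule nn_integral_cmult) measurable
  also have "\<dots> \<le> ennreal ((norm x)\<^sup>2) * ennreal C" by (intro mult_left_mono le) simp
  also have "\<dots> = ennreal ((norm x * sqrt C)\<^sup>2)" unfolding sq by (simp add: ennreal_mult')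
  finally have b: "(\<integral>\<^sup>+k. ennreal ((norm (wpair_ft x x k))\<^sup>2) \<partial>lebesgue) \<le> ennreal ((norm x * sqrt C)\<^sup>2)" .
  note L = L2_if_nn_integral_le[OF wpair_ft_measurable b c0]
  show "wpair_ft x x \<in> L2" by (rule L(1))
  show "(L2_norm (wpair_ft x x))\<^sup>2 \<le> (norm x)\<^sup>2 * C"
    using power_mono[OF L(2) L2_norm_nonneg, of 2] unfolding sq .
qed

text \<open>The estimates hold on the diagonal only; polarization extends square integrability to
  all pairs.\<close>

lemma wpair_ft_L2:
  assumes x: "x \<in> h1" and y: "y \<in> h1"
  shows "wpair_ft x y \<in> L2"
proof -
  obtain C where C: "C \<ge> 0" "\<And>x. x \<in> h1 \<Longrightarrow> (\<integral>\<^sup>+k. ennreal (w k * cmod (pair_ft x x k)) \<partial>lebesgue)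
    \<le> ennreal (C * ((norm x)\<^sup>2 + (\<Sum>i\<in>UNIV. (norm (wderiv i x))\<^sup>2)))"
    using coupling_bound by blast
  have diag: "wpair_ft z z \<in> L2" if z: "z \<in> h1" for z
    by (rule wpair_ft_bound(1)[OF _ C(2)[OF z]]) (use C(1) in \<open>simp add: sum_nonneg\<close>)
  have "x - y \<in> h1" using h1_add[OF x h1_scale[OF y, of "- 1"]] by simp
  then have "(\<lambda>k. (1/4) * (wpair_ft (x + y) (x + y) k - wpair_ft (x - y) (x - y) k)) \<in> L2"
    by (intro L2_cmult L2_diff diag h1_add x y)
  also have "(\<lambda>k. (1/4) * (wpair_ft (x + y) (x + y) k - wpair_ft (x - y) (x - y) k)) = wpair_ft x y"
  proof
    fix k
    have "(1/4) * (wpair_ft (x + y) (x + y) k - wpair_ft (x - y) (x - y) k) = of_real (sqrt (w k)) * ((1/4) * (4 * pair_ft x y k))"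
      unfolding pair_ft_polarization wpair_ft_def by (simp add: algebra_simps)
    then show "(1/4) * (wpair_ft (x + y) (x + y) k - wpair_ft (x - y) (x - y) k) = wpair_ft x y k" by (simp add: wpair_ft_def)
  qed
  finally show ?thesis .
qed

definition coupling :: "l2 \<Rightarrow> l2 \<Rightarrow> l2" where
  "coupling x y = cls (wpair_ft x y)"

lemma coupling_add: "x \<in> h1 \<Longrightarrow> y \<in> h1 \<Longrightarrow> z \<in> h1 \<Longrightarrow> coupling x (y + z) = coupling x y + coupling x z"
  by (simp add: coupling_def cls_add wpair_ft_L2 wpair_ft_def[of x "y + z", abs_def] pair_ft_add distrib_left)
    (simp add: wpair_ft_def)

lemma coupling_scale: "x \<in> h1 \<Longrightarrow> y \<in> h1 \<Longrightarrow> coupling x (c *\<^sub>R y) = c *\<^sub>R coupling x y"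
  by (simp add: coupling_def cls_scaleR wpair_ft_L2 wpair_ft_def[of x "c *\<^sub>R y", abs_def] pair_ft_scale mult.left_commute)
    (simp add: wpair_ft_def)

lemma coupling_sym: "coupling x y = coupling y x"
  by (simp add: coupling_def wpair_ft_def[abs_def] pair_ft_sym[of x])

lemma coupling_J: "coupling (l2_J x) (l2_J x) = coupling x x"
  by (simp add: coupling_def wpair_ft_def[abs_def] pair_ft_J)

lemma coupling_J0: "coupling x (l2_J x) = 0"
  by (simp add: coupling_def wpair_ft_def[abs_def] pair_ft_J0 cls_0)

lemma coupling_norm_bound:
  "\<exists>C\<ge>0. \<forall>x\<in>h1. (norm (coupling x x))\<^sup>2 \<le> (norm x)\<^sup>2 * (C * ((norm x)\<^sup>2 + (\<Sum>i\<in>UNIV. (norm (wderiv i x))\<^sup>2)))"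
proof -
  obtain C where C: "C \<ge> 0" "\<And>x. x \<in> h1 \<Longrightarrow> (\<integral>\<^sup>+k. ennreal (w k * cmod (pair_ft x x k)) \<partial>lebesgue)
    \<le> ennreal (C * ((norm x)\<^sup>2 + (\<Sum>i\<in>UNIV. (norm (wderiv i x))\<^sup>2)))"
    using coupling_bound by blast
  have "(norm (coupling x x))\<^sup>2 \<le> (norm x)\<^sup>2 * (C * ((norm x)\<^sup>2 + (\<Sum>i\<in>UNIV. (norm (wderiv i x))\<^sup>2)))" if x: "x \<in> h1" for x
    unfolding coupling_def norm_cls[OF wpair_ft_L2[OF x x]]
    by (rule wpair_ft_bound(2)[OF _ C(2)[OF x]]) (use C(1) in \<open>simp add: sum_nonneg\<close>)
  then show ?thesis using C(1) by blast
qed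

lemma wpair_ft_self_integrable:
  assumes x: "x \<in> h1"
  shows "integrable lebesgue (\<lambda>k. w k * cmod (pair_ft x x k))"
proof (rule integrableI_bounded)
  obtain C where C: "(\<integral>\<^sup>+k. ennreal (w k * cmod (pair_ft x x k)) \<partial>lebesgue)
    \<le> ennreal (C * ((norm x)\<^sup>2 + (\<Sum>i\<in>UNIV. (norm (wderiv i x))\<^sup>2)))"
    using coupling_bound x by blast
  show "(\<integral>\<^sup>+k. ennreal (norm (w k * cmod (pair_ft x x k))) \<partial>lebesgue) < \<infinity>"
    using w0 le_less_trans[OF C] by simp
qed measurable

lemma norm_coupling_square:
  assumes x: "x \<in> h1"
  shows "(norm (coupling x x))\<^sup>2 = (\<integral>k. w k * (cmod (pair_ft x x k))\<^sup>2 \<partial>lebesgue)"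
  unfolding coupling_def norm_cls[OF wpair_ft_L2[OF x x]] L2_norm_square using w0
  by (simp add: wpair_ft_def norm_mult power_mult_distrib)

lemma weighted_square_integrable:
  assumes x: "x \<in> h1"
  shows "integrable lebesgue (\<lambda>k. w k * (cmod (pair_ft x x k))\<^sup>2)"
  using L2_integrable[OF wpair_ft_L2[OF x x]] w0 by (simp add: wpair_ft_def norm_mult power_mult_distrib)

text \<open>The density is real, so \<open>fourier\<close> of it is the conjugate of
  \<open>pair_ft\<close>. Since the weight times the modulus of \<open>pair_ft\<close> is
  integrable, Fubini moves the outer integral inside, where it reproduces \<open>pair_ft\<close>;
  what remains is the weighted integral of its squared modulus.\<close>

lemma interaction_integral:
  assumes x: "x \<in> h1" and r: "AE t in lebesgue. r t = dens x x t" "r \<in> borel_measurable lebesgue"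
  shows "(\<integral>t. fourier_bar_conv w r t * of_real (r t) \<partial>lebesgue) = of_real ((norm (coupling x x))\<^sup>2)"
proof -
  obtain w' where w': "w' \<in> borel_measurable lborel" "AE k in lborel. w k = w' k"
    using completion_ex_borel_measurable_real[of w lborel] w by blast
  then have [measurable]: "w' \<in> borel_measurable borel" by simp
  have ae: "AE k in lebesgue. w k = w' k" by (rule AE_completion[OF w'(2)])
  define h where "h k = of_real (w' k) * cnj (pair_ft x x k)" for k
  have [measurable]: "h \<in> borel_measurable borel" unfolding h_def by measurable
  have wi: "integrable lborel (\<lambda>k. w' k * cmod (pair_ft x x k))"
  proof -
    have "integrable lebesgue (\<lambda>k. w' k * cmod (pair_ft x x k))"
    proof (subst integrable_cong_AE)
      show "integrable lebesgue (\<lambda>k. w k * cmod (pair_ft x x k))" by (rule wpair_ft_self_integrable[OF x])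
      show "AE k in lebesgue. w' k * cmod (pair_ft x x k) = w k * cmod (pair_ft x x k)" using ae by eventually_elim simp
      show "(\<lambda>k. w' k * cmod (pair_ft x x k)) \<in> borel_measurable lebesgue" by (rule borel_imp_lebesgue) measurable
    qed measurable
    then show ?thesis by (subst (asm) integrable_completion) auto
  qed
  have hi: "integrable lborel h"
    by (rule Bochner_Integration.integrable_bound[OF wi]) (auto simp: h_def norm_mult)
  have conv: "fourier_bar_conv w r t = (\<integral>k. exp (\<i> * of_real (t \<bullet> k)) * h k \<partial>lborel)" for t
  proof -
    have "fourier_bar_conv w r t = fourier_bar h t"
      unfolding fourier_bar_conv_def fourier_eq_cnj_pair_ft[OF r]
    proof (rule fourier_bar_cong)
      show "h \<in> borel_measurable lebesgue" by (rule borel_imp_lebesgue) measurable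
      show "AE k in lebesgue. of_real (w k) * cnj (pair_ft x x k) = h k" using ae by eventually_elim (simp add: h_def)
    qed measurable
    also have "\<dots> = (\<integral>k. exp (\<i> * of_real (t \<bullet> k)) * h k \<partial>lborel)"
      unfolding fourier_bar_def by (rule integral_completion) measurable
    finally show ?thesis .
  qed
  have di: "integrable lborel (dens x x)"
    using dens_integrable by (subst (asm) integrable_completion) auto
  let ?g = "\<lambda>(k, t). exp (\<i> * of_real (t \<bullet> k)) * h k * of_real (dens x x t)"
  have gi: "integrable (lborel \<Otimes>\<^sub>M lborel) ?g"
  proof (rule integrableI_bounded)
    have "(\<integral>\<^sup>+p. ennreal (norm (?g p)) \<partial>(lborel \<Otimes>\<^sub>M lborel)) = (\<integral>\<^sup>+k. \<integral>\<^sup>+t. ennreal (norm (?g (k, t))) \<partial>lborel \<partial>lborel)"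
      by (rule sigma_finite_measure.nn_integral_fst[OF sigma_finite_lborel, symmetric]) measurable
    also have "\<dots> = (\<integral>\<^sup>+k. ennreal (norm (h k)) * (\<integral>\<^sup>+t. ennreal (norm (dens x x t)) \<partial>lborel) \<partial>lborel)"
    proof (rule nn_integral_cong)
      fix k
      have "(\<integral>\<^sup>+t. ennreal (norm (?g (k, t))) \<partial>lborel) = (\<integral>\<^sup>+t. ennreal (norm (h k)) * ennreal (norm (dens x x t)) \<partial>lborel)"
        by (intro nn_integral_cong) (simp add: norm_mult ennreal_mult)
      also have "\<dots> = ennreal (norm (h k)) * (\<integral>\<^sup>+t. ennreal (norm (dens x x t)) \<partial>lborel)"
        by (rule nn_integral_cmult) measurable
      finally show "(\<integral>\<^sup>+t. ennreal (norm (?g (k, t))) \<partial>lborel) = ennreal (norm (h k)) * (\<integral>\<^sup>+t. ennreal (norm (dens x x t)) \<partial>lborel)" .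
    qed
    also have "\<dots> = (\<integral>\<^sup>+k. ennreal (norm (h k)) \<partial>lborel) * (\<integral>\<^sup>+t. ennreal (norm (dens x x t)) \<partial>lborel)"
      by (rule nn_integral_multc) measurable
    also have "\<dots> < \<infinity>"
    proof -
      have "(\<integral>\<^sup>+k. ennreal (norm (h k)) \<partial>lborel) < \<infinity>" "(\<integral>\<^sup>+t. ennreal (norm (dens x x t)) \<partial>lborel) < \<infinity>"
        using hi di unfolding integrable_iff_bounded by blast+
      then show ?thesis by (simp only: infinity_ennreal_def ennreal_mult_less_top simp_thms)
    qed
    finally show "(\<integral>\<^sup>+p. ennreal (norm (?g p)) \<partial>(lborel \<Otimes>\<^sub>M lborel)) < \<infinity>" .
  qed measurable
  have inner: "(\<integral>t. exp (\<i> * of_real (t \<bullet> k)) * h k * of_real (dens x x t) \<partial>lborel) = of_real (w' k * (cmod (pair_ft x x k))\<^sup>2)" for k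
  proof -
    have "(\<integral>t. exp (\<i> * of_real (t \<bullet> k)) * h k * of_real (dens x x t) \<partial>lborel)
        = (\<integral>t. h k * (exp (\<i> * of_real (k \<bullet> t)) * of_real (dens x x t)) \<partial>lborel)"
      by (intro Bochner_Integration.integral_cong refl) (simp only: inner_commute mult_ac)
    also have "\<dots> = h k * pair_ft x x k" unfolding pair_ft_lborel by (rule integral_mult_right_zero)
    also have "\<dots> = of_real (w' k * (cmod (pair_ft x x k))\<^sup>2)" unfolding h_def of_real_mult complex_norm_square by (simp add: mult_ac)
    finally show ?thesis .
  qed
  have F: "(\<lambda>t. \<integral>k. exp (\<i> * of_real (t \<bullet> k)) * h k \<partial>lborel) \<in> borel_measurable borel" by measurable
  have "(\<integral>t. fourier_bar_conv w r t * of_real (r t) \<partial>lebesgue)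
      = (\<integral>t. (\<integral>k. exp (\<i> * of_real (t \<bullet> k)) * h k \<partial>lborel) * of_real (dens x x t) \<partial>lebesgue)"
    unfolding conv
  proof (rule integral_cong_AE)
    note [measurable] = r(2) borel_imp_lebesgue[OF F] dens_lebesgue
    show "AE t in lebesgue. (\<integral>k. exp (\<i> * of_real (t \<bullet> k)) * h k \<partial>lborel) * of_real (r t)
        = (\<integral>k. exp (\<i> * of_real (t \<bullet> k)) * h k \<partial>lborel) * of_real (dens x x t)"
      using r(1) by eventually_elim simp
    show "(\<lambda>t. (\<integral>k. exp (\<i> * of_real (t \<bullet> k)) * h k \<partial>lborel) * of_real (r t)) \<in> borel_measurable lebesgue"
      by (rule borel_measurable_times[OF borel_imp_lebesgue[OF F] measurable_compose[OF r(2) borel_measurable_of_real]])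
    show "(\<lambda>t. (\<integral>k. exp (\<i> * of_real (t \<bullet> k)) * h k \<partial>lborel) * of_real (dens x x t)) \<in> borel_measurable lebesgue"
      by (rule borel_measurable_times[OF borel_imp_lebesgue[OF F] dens_lebesgue])
  qed
  also have "\<dots> = (\<integral>t. (\<integral>k. exp (\<i> * of_real (t \<bullet> k)) * h k \<partial>lborel) * of_real (dens x x t) \<partial>lborel)"
    by (rule integral_completion) measurable
  also have "\<dots> = (\<integral>t. \<integral>k. exp (\<i> * of_real (t \<bullet> k)) * h k * of_real (dens x x t) \<partial>lborel \<partial>lborel)"
    by (simp only: integral_mult_left_zero)
  also have "\<dots> = (\<integral>k. \<integral>t. exp (\<i> * of_real (t \<bullet> k)) * h k * of_real (dens x x t) \<partial>lborel \<partial>lborel)"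
    by (rule lborel_pair.Fubini_integral[OF gi])
  also have "\<dots> = of_real (\<integral>k. w' k * (cmod (pair_ft x x k))\<^sup>2 \<partial>lborel)"
    unfolding inner by (rule integral_complex_of_real)
  also have "(\<integral>k. w' k * (cmod (pair_ft x x k))\<^sup>2 \<partial>lborel) = (\<integral>k. w' k * (cmod (pair_ft x x k))\<^sup>2 \<partial>lebesgue)"
    by (rule integral_completion[symmetric]) measurable
  also have "\<dots> = (\<integral>k. w k * (cmod (pair_ft x x k))\<^sup>2 \<partial>lebesgue)"
  proof (rule integral_cong_AE)
    show "(\<lambda>k. w' k * (cmod (pair_ft x x k))\<^sup>2) \<in> borel_measurable lebesgue" by (rule borel_imp_lebesgue) measurable
    show "AE k in lebesgue. w' k * (cmod (pair_ft x x k))\<^sup>2 = w k * (cmod (pair_ft x x k))\<^sup>2" using ae by eventually_elim simp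
  qed measurable
  also have "\<dots> = (norm (coupling x x))\<^sup>2" by (rule norm_coupling_square[OF x, symmetric])
  finally show ?thesis .
qed

end

section \<open>Elimination of the field\<close>

lemma cmod_add_cnj_square:
  "(cmod (p + of_real g * cnj q))\<^sup>2 = (cmod p)\<^sup>2 + 2 * g * Re (p * q) + g\<^sup>2 * (cmod q)\<^sup>2"
  unfolding cmod_power2 by (simp add: power2_eq_square algebra_simps)

locale field_weight =
  fixes \<omega> v :: "R3 \<Rightarrow> real"
  assumes om [measurable]: "\<omega> \<in> borel_measurable lebesgue" and om0: "\<And>k. 0 \<le> \<omega> k"
    and om_pos: "AE k in lebesgue. 0 < \<omega> k"
    and v [measurable]: "v \<in> borel_measurable lebesgue"
    and hyp: "hypothesis_C (\<lambda>k. inverse (\<omega> k) * (v k)\<^sup>2)"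
begin

sublocale coupling_weight "\<lambda>k. inverse (\<omega> k) * (v k)\<^sup>2"
  by unfold_locales (measurable, simp_all add: om0 hyp)

text \<open>Where \<open>\<omega>\<close> vanishes, a null set, \<open>source\<close> is zero.\<close>
definition source :: "l2 \<Rightarrow> R3 \<Rightarrow> complex" where
  "source x k = of_real (v k / sqrt (\<omega> k)) * pair_ft x x k"

lemma cmod_source: "(cmod (source x k))\<^sup>2 = inverse (\<omega> k) * (v k)\<^sup>2 * (cmod (pair_ft x x k))\<^sup>2"
  using om0[of k] unfolding source_def norm_mult norm_of_real power_mult_distrib
  by (simp add: power_mult_distrib power_inverse divide_inverse mult_ac)

lemma source_L2:
  assumes "x \<in> h1"
  shows "source x \<in> L2"
proof -
  have "source x \<in> borel_measurable lebesgue" unfolding source_def[abs_def] by measurable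
  then show ?thesis using weighted_square_integrable[OF assms] by (simp add: L2_iff cmod_source)
qed

text \<open>Pointwise completion of the square in the variable
  \<open>sqrt (\<omega> k) * f k\<close>. The factor \<open>v\<close> is recovered from
  \<open>sqrt (\<omega> k) * (v k / sqrt (\<omega> k))\<close> where \<open>\<omega>\<close> is
  positive, that is, almost everywhere.\<close>

lemma field_energy_eq:
  assumes x: "x \<in> h1" and f: "f \<in> Z_space \<omega>"
  shows "(\<integral>k. \<omega> k * (cmod (f k))\<^sup>2 \<partial>lebesgue) + 2 * g * Re (\<integral>k. of_real (v k) * f k * pair_ft x x k \<partial>lebesgue)
    = (\<integral>k. (cmod (of_real (sqrt (\<omega> k)) * f k + of_real g * cnj (source x k)))\<^sup>2 \<partial>lebesgue) - g\<^sup>2 * (norm (coupling x x))\<^sup>2"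
proof -
  have fm [measurable]: "f \<in> borel_measurable lebesgue" and fL: "(\<lambda>k. of_real (sqrt (\<omega> k)) * f k) \<in> L2"
    using f by (auto simp: Z_space_def)
  have [measurable]: "source x \<in> borel_measurable lebesgue" by (rule L2_measurable[OF source_L2[OF x]])
  let ?p = "\<lambda>k. of_real (sqrt (\<omega> k)) * f k" and ?q = "source x"
  have ip: "integrable lebesgue (\<lambda>k. (cmod (?p k))\<^sup>2)" by (rule L2_integrable[OF fL])
  have iq: "integrable lebesgue (\<lambda>k. (cmod (?q k))\<^sup>2)" by (rule L2_integrable[OF source_L2[OF x]])
  have ipq: "integrable lebesgue (\<lambda>k. ?p k * ?q k)" by (rule L2_mult_integrable[OF fL source_L2[OF x]])
  have 1: "(\<integral>k. \<omega> k * (cmod (f k))\<^sup>2 \<partial>lebesgue) = (\<integral>k. (cmod (?p k))\<^sup>2 \<partial>lebesgue)"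
    using om0 by (simp add: norm_mult power_mult_distrib)
  have 2: "(\<integral>k. of_real (v k) * f k * pair_ft x x k \<partial>lebesgue) = (\<integral>k. ?p k * ?q k \<partial>lebesgue)"
  proof (rule integral_cong_AE)
    show "AE k in lebesgue. of_real (v k) * f k * pair_ft x x k = ?p k * ?q k"
      using om_pos
    proof eventually_elim
      case (elim k)
      have "?p k * ?q k = of_real (sqrt (\<omega> k) * (v k / sqrt (\<omega> k))) * (f k * pair_ft x x k)"
        by (simp add: source_def)
      also have "sqrt (\<omega> k) * (v k / sqrt (\<omega> k)) = v k" using elim by simp
      finally have eq: "?p k * ?q k = of_real (v k) * (f k * pair_ft x x k)" .
      show ?case unfolding eq by (rule mult.assoc)
    qed
  qed measurable
  have 3: "(norm (coupling x x))\<^sup>2 = (\<integral>k. (cmod (?q k))\<^sup>2 \<partial>lebesgue)"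
    unfolding norm_coupling_square[OF x] cmod_source ..
  have sq: "(cmod (?p k + of_real g * cnj (?q k)))\<^sup>2 = (cmod (?p k))\<^sup>2 + 2 * g * Re (?p k * ?q k) + g\<^sup>2 * (cmod (?q k))\<^sup>2" for k
    by (rule cmod_add_cnj_square)
  have "(\<integral>k. (cmod (?p k + of_real g * cnj (?q k)))\<^sup>2 \<partial>lebesgue)
      = (\<integral>k. (cmod (?p k))\<^sup>2 + 2 * g * Re (?p k * ?q k) \<partial>lebesgue) + (\<integral>k. g\<^sup>2 * (cmod (?q k))\<^sup>2 \<partial>lebesgue)"
    unfolding sq
    by (rule Bochner_Integration.integral_add)
      (intro Bochner_Integration.integrable_add ip iq ipq integrable_Re Bochner_Integration.integrable_mult_right)+
  also have "(\<integral>k. (cmod (?p k))\<^sup>2 + 2 * g * Re (?p k * ?q k) \<partial>lebesgue)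
      = (\<integral>k. (cmod (?p k))\<^sup>2 \<partial>lebesgue) + (\<integral>k. 2 * g * Re (?p k * ?q k) \<partial>lebesgue)"
    by (rule Bochner_Integration.integral_add)
      (intro ip ipq integrable_Re Bochner_Integration.integrable_mult_right)+
  also have "(\<integral>k. 2 * g * Re (?p k * ?q k) \<partial>lebesgue) = 2 * g * Re (\<integral>k. ?p k * ?q k \<partial>lebesgue)"
    by (simp only: integral_mult_right_zero integral_Re[OF ipq])
  also have "(\<integral>k. g\<^sup>2 * (cmod (?q k))\<^sup>2 \<partial>lebesgue) = g\<^sup>2 * (norm (coupling x x))\<^sup>2" by (simp add: 3)
  finally show ?thesis unfolding 1 2 by simp
qed

text \<open>The field at which the completed square vanishes. Because \<open>inverse 0 = 0\<close>
  and division by 0 gives 0, \<open>sqrt_best_field\<close> holds at every point, including zeros of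
  \<open>\<omega>\<close>.\<close>

definition best_field :: "real \<Rightarrow> l2 \<Rightarrow> R3 \<Rightarrow> complex" where
  "best_field g x k = - (of_real (g * (v k * inverse (\<omega> k))) * cnj (pair_ft x x k))"

lemma sqrt_best_field: "of_real (sqrt (\<omega> k)) * best_field g x k = - (of_real g * cnj (source x k))"
proof -
  have "sqrt (\<omega> k) * (v k * inverse (\<omega> k)) = v k / sqrt (\<omega> k)"
    using om0[of k] real_sqrt_mult_self[of "\<omega> k"] by (cases "\<omega> k = 0") (simp_all add: field_simps)
  then have "complex_of_real (sqrt (\<omega> k)) * of_real (g * (v k * inverse (\<omega> k))) = of_real (g * (v k / sqrt (\<omega> k)))"
    unfolding of_real_mult[symmetric] by (simp add: mult.left_commute)
  then show ?thesis unfolding best_field_def source_def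
    by (simp only: mult_minus_right mult.assoc[symmetric] complex_cnj_mult complex_cnj_complex_of_real of_real_mult)
qed

lemma best_field_Z:
  assumes x: "x \<in> h1"
  shows "best_field g x \<in> Z_space \<omega>"
proof -
  have "best_field g x \<in> borel_measurable lebesgue" unfolding best_field_def[abs_def] by measurable
  moreover have "(\<lambda>k. - (of_real g * cnj (source x k))) \<in> L2"
    by (intro L2_uminus L2_cmult L2_cnj source_L2 x)
  ultimately show ?thesis by (simp add: Z_space_def sqrt_best_field)
qed

lemma energy_eq:
  assumes u: "u \<in> L2" "cls u \<in> h1" and f: "f \<in> Z_space \<omega>"
    and q: "q = dirichlet u + (\<integral>x. V x * (cmod (u x))\<^sup>2 \<partial>lebesgue)"
  shows "energy V \<omega> v g (u, f) = q
    + (\<integral>k. (cmod (of_real (sqrt (\<omega> k)) * f k + of_real g * cnj (source (cls u) k)))\<^sup>2 \<partial>lebesgue)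
    - g\<^sup>2 * (norm (coupling (cls u) (cls u)))\<^sup>2"
proof -
  have "(\<integral>x. exp (\<i> * of_real (k \<bullet> x)) * of_real ((cmod (u x))\<^sup>2) \<partial>lebesgue) = pair_ft (cls u) (cls u) k" for k
    using pair_ft_cls[OF u(1), of k] by (simp add: fourier_bar_def)
  then show ?thesis
    using field_energy_eq[OF u(2) f, of g] unfolding q energy_def by simp
qed

end

section \<open>Assembly of the expansion\<close>

theorem proposition1p6:
  fixes V \<omega> v u\<^sub>V :: "real ^ 3 \<Rightarrow> real"
  assumes "V \<in> borel_measurable lebesgue"
    and "hypothesis_A V"
    and "hypothesis_B V u\<^sub>V"
    and "\<omega> \<in> borel_measurable lebesgue"
    and "\<And>k. 0 \<le> \<omega> k"
    and "AE k in lebesgue. 0 < \<omega> k"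
    and "v \<in> borel_measurable lebesgue"
    and "hypothesis_C (\<lambda>k. inverse (\<omega> k) * (v k)\<^sup>2)"
  shows "(\<forall>\<^sub>F g in at 0. \<exists>p. is_arg_min (energy V \<omega> v g) (\<lambda>p. p \<in> unit_sphere V \<times> Z_space \<omega>) p) \<and>
    (\<lambda>g. complex_of_real (INF p\<in>unit_sphere V \<times> Z_space \<omega>. energy V \<omega> v g p) -
       (of_real (mu V) - of_real (g\<^sup>2) *
         (\<integral>x. fourier_bar_conv (\<lambda>k. inverse (\<omega> k) * (v k)\<^sup>2) (\<lambda>x. (u\<^sub>V x)\<^sup>2) x
              * of_real ((u\<^sub>V x)\<^sup>2) \<partial>lebesgue)))
     \<in> O[at 0](\<lambda>g. of_real (g ^ 4))"
proof -
  obtain a b where ab: "0 \<le> a" "a < 1" "\<And>u. u \<in> H1 \<Longrightarrow>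
        integrable lebesgue (\<lambda>x. max (- V x) 0 * (cmod (u x))\<^sup>2) \<and>
        (\<integral>x. max (- V x) 0 * (cmod (u x))\<^sup>2 \<partial>lebesgue) \<le> a * dirichlet u + b * (L2_norm u)\<^sup>2"
    using assms(2) unfolding hypothesis_A_def by blast
  interpret V: relatively_bounded V a b by unfold_locales (rule assms(1) ab)+
  interpret F: field_weight \<omega> v by unfold_locales (rule assms)+
  define e where "e = cls (\<lambda>x. of_real (u\<^sub>V x))"
  note gs = V.ground_state[OF assms(3), folded e_def]
  obtain d where d: "d > 0" "\<And>z. z \<in> qdom V \<Longrightarrow> e \<bullet> z = 0 \<Longrightarrow> l2_J e \<bullet> z = 0 \<Longrightarrow> (mu V + d) * (z \<bullet> z) \<le> qform V z z"
    using gs(4) by blast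
  obtain C where C: "C \<ge> 0" "\<And>x. x \<in> h1 \<Longrightarrow> (norm (F.coupling x x))\<^sup>2 \<le> (norm x)\<^sup>2 * (C * ((norm x)\<^sup>2 + (\<Sum>i\<in>UNIV. (norm (wderiv i x))\<^sup>2)))"
    using F.coupling_norm_bound by blast
  \<comment> \<open>Norm and gradient each contribute at most \<open>1 / (1 - a)\<close> times the
    squared form norm; this gives the factor \<open>2 / (1 - a)\<close> under the root.\<close>
  have P_bound: "norm (F.coupling x x) \<le> sqrt (2 * C / (1 - a)) * (norm x * V.fnorm x)" if x: "x \<in> qdom V" for x
  proof -
    let ?S = "\<Sum>i\<in>(UNIV::3 set). (norm (wderiv i x))\<^sup>2"
    have a1: "1 - a > 0" using ab by simp
    have "(1 - a) * ((norm x)\<^sup>2 + ?S) \<le> 2 * (V.fnorm x)\<^sup>2"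
      using V.qform_components(3)[OF x] V.qform_components(5)[OF x] unfolding V.fnorm_sq[OF x] distrib_left by linarith
    then have S: "(norm x)\<^sup>2 + ?S \<le> 2 * (V.fnorm x)\<^sup>2 / (1 - a)" using a1 by (simp add: pos_le_divide_eq mult.commute)
    have "(norm (F.coupling x x))\<^sup>2 \<le> (norm x)\<^sup>2 * (C * ((norm x)\<^sup>2 + ?S))" by (rule C(2)[OF V.qdomD(1)[OF x]])
    also have "\<dots> \<le> (norm x)\<^sup>2 * (C * (2 * (V.fnorm x)\<^sup>2 / (1 - a)))"
      by (intro mult_left_mono S C) simp
    also have "\<dots> = (sqrt (2 * C / (1 - a)) * (norm x * V.fnorm x))\<^sup>2"
      using C a1 by (simp add: power_mult_distrib)
    finally show ?thesis
      by (rule power2_le_imp_le) (use C a1 V.fnorm_nonneg[OF x] in auto)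
  qed
  interpret q: quartic_perturbation "qdom V" "qform V" "\<bar>b\<bar> + 1" l2_J F.coupling "sqrt (2 * C / (1 - a))" "mu V" d e
  proof unfold_locales
    show "0 \<le> sqrt (2 * C / (1 - a))" using C ab by simp
    fix x y z :: l2 and c :: real
    assume x: "x \<in> qdom V"
    show "F.coupling (l2_J x) (l2_J x) = F.coupling x x" by (rule F.coupling_J)
    show "F.coupling x (l2_J x) = 0" by (rule F.coupling_J0)
    show "norm (F.coupling x x) \<le> sqrt (2 * C / (1 - a)) * (norm x * V.fnorm x)" by (rule P_bound[OF x])
    show "(mu V + d) * (x \<bullet> x) \<le> qform V x x" if "e \<bullet> x = 0" "l2_J e \<bullet> x = 0" by (rule d(2)[OF x that])
    assume y: "y \<in> qdom V"
    show "F.coupling x y = F.coupling y x" by (rule F.coupling_sym)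
    show "F.coupling x (c *\<^sub>R y) = c *\<^sub>R F.coupling x y" by (rule F.coupling_scale[OF V.qdomD(1)[OF x] V.qdomD(1)[OF y]])
    assume z: "z \<in> qdom V"
    show "F.coupling x (y + z) = F.coupling x y + F.coupling x z"
      by (rule F.coupling_add[OF V.qdomD(1)[OF x] V.qdomD(1)[OF y] V.qdomD(1)[OF z]])
  qed (rule gs(2) gs(3) d(1))+
  obtain T where T: "T > 0" "\<And>t. 0 \<le> t \<Longrightarrow> t < T \<Longrightarrow> \<exists>u\<in>qdom V. norm u = 1 \<and>
      (\<forall>x\<in>qdom V. norm x = 1 \<longrightarrow> q.E t u \<le> q.E t x) \<and> mu V - t * q.A\<^sup>2 - q.K * t\<^sup>2 \<le> q.E t u"
    using q.minimizer by blast
  have lower: "q.E (g\<^sup>2) (cls u) \<le> energy V \<omega> v g (u, f)"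
    if u: "u \<in> form_domain V" and f: "f \<in> Z_space \<omega>" for g u f
  proof -
    have uq: "u \<in> L2" "cls u \<in> h1" using u V.qdomD(1) by (auto simp: V.form_domain_iff)
    show ?thesis unfolding F.energy_eq[OF uq f V.qform_eq_energy[OF u]] q.E_def by simp
  qed
  have attained: "q.E (g\<^sup>2) x = energy V \<omega> v g (rep x, F.best_field g x)" if x: "x \<in> qdom V" for g x
  proof -
    have h: "x \<in> h1" by (rule V.qdomD(1)[OF x])
    have "energy V \<omega> v g (rep x, F.best_field g x) = qform V (cls (rep x)) (cls (rep x))
      + (\<integral>k. (cmod (of_real (sqrt (\<omega> k)) * F.best_field g x k + of_real g * cnj (F.source (cls (rep x)) k)))\<^sup>2 \<partial>lebesgue)
      - g\<^sup>2 * (norm (F.coupling (cls (rep x)) (cls (rep x))))\<^sup>2"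
      by (rule F.energy_eq) (simp_all add: rep_L2 h F.best_field_Z V.qform_eq_energy[OF V.rep_form_domain[OF x], simplified])
    then show ?thesis by (simp add: F.sqrt_best_field q.E_def)
  qed
  have min: "\<exists>p\<in>unit_sphere V \<times> Z_space \<omega>. (\<forall>p'\<in>unit_sphere V \<times> Z_space \<omega>. energy V \<omega> v g p \<le> energy V \<omega> v g p') \<and>
      \<bar>energy V \<omega> v g p - (mu V - g\<^sup>2 * q.A\<^sup>2)\<bar> \<le> q.K * g ^ 4" if g: "g\<^sup>2 < T" for g
  proof -
    obtain x where x: "x \<in> qdom V" "norm x = 1" "\<And>y. y \<in> qdom V \<Longrightarrow> norm y = 1 \<Longrightarrow> q.E (g\<^sup>2) x \<le> q.E (g\<^sup>2) y"
      "mu V - g\<^sup>2 * q.A\<^sup>2 - q.K * (g\<^sup>2)\<^sup>2 \<le> q.E (g\<^sup>2) x"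
      using T(2)[of "g\<^sup>2"] g by auto
    let ?p = "(rep x, F.best_field g x)"
    have p: "?p \<in> unit_sphere V \<times> Z_space \<omega>"
      using V.rep_form_domain[OF x(1)] x(2) F.best_field_Z[OF V.qdomD(1)[OF x(1)]]
      by (simp add: unit_sphere_def norm_l2_def)
    have "energy V \<omega> v g ?p \<le> energy V \<omega> v g p'" if p': "p' \<in> unit_sphere V \<times> Z_space \<omega>" for p'
    proof -
      obtain u f where uf: "p' = (u, f)" "u \<in> form_domain V" "L2_norm u = 1" "f \<in> Z_space \<omega>"
        using p' by (auto simp: unit_sphere_def)
      have u: "u \<in> L2" "cls u \<in> qdom V" using uf(2) by (auto simp: V.form_domain_iff)
      have "energy V \<omega> v g ?p = q.E (g\<^sup>2) x" by (rule attained[OF x(1), symmetric])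
      also have "\<dots> \<le> q.E (g\<^sup>2) (cls u)" by (rule x(3)) (simp_all add: u norm_cls uf)
      also have "\<dots> \<le> energy V \<omega> v g p'" unfolding uf(1) by (rule lower[OF uf(2,4)])
      finally show ?thesis .
    qed
    \<comment> \<open>The ground state itself is a trial vector, so the minimum never exceeds the
      second-order expansion; the error \<open>q.K * g^4\<close> occurs only from below.\<close>
    moreover have "q.E (g\<^sup>2) x \<le> mu V - g\<^sup>2 * q.A\<^sup>2"
      using x(3)[OF q.eQ gs(3)] q.s_e[OF q.eQ] q.ee by (simp add: q.E_def q.A_def)
    moreover have "(g\<^sup>2)\<^sup>2 = g ^ 4" "0 \<le> q.K * g ^ 4" using q.K0 by simp_all
    ultimately show ?thesis using p x(4) attained[OF x(1), of g] by (intro bexI[of _ ?p] conjI ballI) auto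
  qed
  have small: "\<forall>\<^sub>F g in at (0::real). g\<^sup>2 < T"
  proof -
    have "((\<lambda>g::real. g\<^sup>2) \<longlongrightarrow> 0\<^sup>2) (at 0)" by (intro tendsto_intros)
    then show ?thesis using T(1) by (intro order_tendstoD(2)[where y = "0\<^sup>2"]) auto
  qed
  \<comment> \<open>This recognizes the second-order coefficient \<open>q.A\<^sup>2\<close> of the
    abstract expansion as the interaction integral; the chosen representative of \<open>e\<close>
    agrees with \<open>u\<^sub>V\<close> almost everywhere.\<close>
  have I: "(\<integral>x. fourier_bar_conv (\<lambda>k. inverse (\<omega> k) * (v k)\<^sup>2) (\<lambda>x. (u\<^sub>V x)\<^sup>2) x
              * of_real ((u\<^sub>V x)\<^sup>2) \<partial>lebesgue) = of_real (q.A\<^sup>2)"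
    unfolding q.A_def
  proof (rule F.interaction_integral[OF V.qdomD(1)[OF q.eQ]])
    have L: "(\<lambda>x. complex_of_real (u\<^sub>V x)) \<in> L2" using gs(1) by (simp add: V.form_domain_iff)
    show "AE x in lebesgue. (u\<^sub>V x)\<^sup>2 = dens e e x"
      using AE_rep_cls[OF L] unfolding e_def[symmetric] by eventually_elim (simp add: dens_self)
    have "(\<lambda>x. Re (complex_of_real (u\<^sub>V x))) \<in> borel_measurable lebesgue"
      using L2_measurable[OF L] by measurable
    then show "(\<lambda>x. (u\<^sub>V x)\<^sup>2) \<in> borel_measurable lebesgue" by simp
  qed
  show ?thesis
    unfolding I
  proof (intro conjI bigoI[of _ q.K])
    show "\<forall>\<^sub>F g in at 0. \<exists>p. is_arg_min (energy V \<omega> v g) (\<lambda>p. p \<in> unit_sphere V \<times> Z_space \<omega>) p"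
      using small
    proof eventually_elim
      case (elim g)
      then show ?case using min[of g] unfolding is_arg_min_linorder by blast
    qed
    show "\<forall>\<^sub>F g in at 0. norm (complex_of_real (INF p\<in>unit_sphere V \<times> Z_space \<omega>. energy V \<omega> v g p) -
       (of_real (mu V) - of_real (g\<^sup>2) * of_real (q.A\<^sup>2))) \<le> q.K * norm (complex_of_real (g ^ 4))"
      using small
    proof eventually_elim
      case (elim g)
      obtain p where p: "p \<in> unit_sphere V \<times> Z_space \<omega>"
        "\<And>p'. p' \<in> unit_sphere V \<times> Z_space \<omega> \<Longrightarrow> energy V \<omega> v g p \<le> energy V \<omega> v g p'"
        "\<bar>energy V \<omega> v g p - (mu V - g\<^sup>2 * q.A\<^sup>2)\<bar> \<le> q.K * g ^ 4"
        using min[OF elim] by blast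
      have "(INF p\<in>unit_sphere V \<times> Z_space \<omega>. energy V \<omega> v g p) = energy V \<omega> v g p"
        by (rule cInf_eq_minimum) (use p in auto)
      then show ?case
        using p(3) unfolding of_real_mult[symmetric] of_real_diff[symmetric] norm_of_real by simp
    qed
  qed
qed

end
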